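(* Let $F$ be a field, $\Delta$ a finite-dimensional central division algebra over $F$ of degree $d$, $n\ge 1$ an integer, and $A={\rm Mat}_n(\Delta)$. Let $f(t)\in F[t]$ be a monic polynomial of degree $nd$ with factorization $f(t)=\prod_{i=1}^s p_i(t)^{a_i}$ into pairwise distinct monic irreducible polynomials $p_i(t)\in F[t]$ and positive integers $a_i$. Put $F_i:=F[t]/(p_i(t))$. Then $f(t)$ is the characteristic polynomial of some element $x\in A$ if and only if for all $i=1,\dots,s$: (a) $a_i\deg p_i(t)=n_i d$ for some positive integer $n_i$, and (b) $[F_i:F]$ divides $n_i\cdot {\rm c}(\Delta\otimes_F F_i)$.
   Context: For a finite-dimensional central simple algebra $B$ over a field $K$, write $B\cong {\rm Mat}_m(\Delta')$ with $\Delta'$ a division algebra (unique up to isomorphism); the capacity is ${\rm c}(B):=m$ and the degree is $\deg(B)=\sqrt{[B:K]}$. The characteristic polynomial of $x\in A$ is the characteristic polynomial of the image of $x$ under $A\to A\otimes_F\bar F\cong {\rm Mat}_{nd}(\bar F)$ (the reduced characteristic polynomial); it has coefficients in $F$ and degree $nd$. Here $\Delta\otimes_F F_i$ is a central simple algebra over the field $F_i$. *)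

theory Defs
  imports
    "HOL-Algebra.Algebraic_Closure_Type"
    "HOL-Algebra.QuotRing"
    "HOL-Library.Poly_Mapping"
    "Jordan_Normal_Form.VS_Connect"
    "Jordan_Normal_Form.Char_Poly"
begin

text \<open>
  Algebras over a field \<open>K\<close> are records of type \<^typ>\<open>('a, 'b) module\<close>, which carry both a ring
  structure and a scalar multiplication. The locale \<^locale>\<open>algebra\<close> of the library only covers
  commutative algebras.
\<close>

locale assoc_algebra = vectorspace K A + A?: ring A
  for K and A +
  assumes smult_mult_left:
      "\<lbrakk>k \<in> carrier K; x \<in> carrier A; y \<in> carrier A\<rbrakk> \<Longrightarrow>
        (k \<odot>\<^bsub>A\<^esub> x) \<otimes>\<^bsub>A\<^esub> y = k \<odot>\<^bsub>A\<^esub> (x \<otimes>\<^bsub>A\<^esub> y)"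
    and smult_mult_right:
      "\<lbrakk>k \<in> carrier K; x \<in> carrier A; y \<in> carrier A\<rbrakk> \<Longrightarrow>
        x \<otimes>\<^bsub>A\<^esub> (k \<odot>\<^bsub>A\<^esub> y) = k \<odot>\<^bsub>A\<^esub> (x \<otimes>\<^bsub>A\<^esub> y)"

locale division_algebra = assoc_algebra K D for K and D +
  assumes one_neq_zero: "\<one>\<^bsub>D\<^esub> \<noteq> \<zero>\<^bsub>D\<^esub>"
    and nonzero_Units: "carrier D - {\<zero>\<^bsub>D\<^esub>} \<subseteq> Units D"

definition algebra_center :: "('b, 'm) ring_scheme \<Rightarrow> 'b set" where
  "algebra_center A = {z \<in> carrier A. \<forall>x\<in>carrier A. z \<otimes>\<^bsub>A\<^esub> x = x \<otimes>\<^bsub>A\<^esub> z}"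

locale central_division_algebra = division_algebra K D for K and D +
  assumes center_eq: "algebra_center D = (\<lambda>k. k \<odot>\<^bsub>D\<^esub> \<one>\<^bsub>D\<^esub>) ` carrier K"

definition algebra_degree :: "('a, 'k) ring_scheme \<Rightarrow> ('a, 'b) module \<Rightarrow> real" where
  "algebra_degree K A = sqrt (real (vectorspace.dim K A))"

definition algebra_iso ::
    "('a, 'k) ring_scheme \<Rightarrow> ('a, 'b) module \<Rightarrow> ('a, 'c) module \<Rightarrow> ('b \<Rightarrow> 'c) set" where
  "algebra_iso K A B =
    {h \<in> ring_iso A B. \<forall>k\<in>carrier K. \<forall>x\<in>carrier A. h (k \<odot>\<^bsub>A\<^esub> x) = k \<odot>\<^bsub>B\<^esub> h x}"

definition mat_algebra :: "nat \<Rightarrow> ('a, 'b) module \<Rightarrow> ('a, 'b mat) module" where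
  "mat_algebra n A =
    \<lparr>carrier = {M \<in> carrier_mat n n. elements_mat M \<subseteq> carrier A},
     monoid.mult = (\<lambda>M N. mat n n (\<lambda>(i, j). \<Oplus>\<^bsub>A\<^esub>k\<in>{..<n}. M $$ (i, k) \<otimes>\<^bsub>A\<^esub> N $$ (k, j))),
     one = mat n n (\<lambda>(i, j). if i = j then \<one>\<^bsub>A\<^esub> else \<zero>\<^bsub>A\<^esub>),
     ring.zero = mat n n (\<lambda>_. \<zero>\<^bsub>A\<^esub>),
     add = (\<lambda>M N. mat n n (\<lambda>ij. M $$ ij \<oplus>\<^bsub>A\<^esub> N $$ ij)),
     module.smult = (\<lambda>k M. mat n n (\<lambda>ij. k \<odot>\<^bsub>A\<^esub> M $$ ij))\<rparr>"

text \<open>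
  If \<open>B\<close> is isomorphic to the algebra of matrices over \<open>D\<close>, then \<open>D\<close> is isomorphic to a corner
  \<open>e B e\<close> with \<open>e\<close> idempotent. So nothing is lost by letting \<open>D\<close> range over algebras whose elements
  have the same type as those of \<open>B\<close>.
\<close>

definition capacity :: "('a, 'k) ring_scheme \<Rightarrow> ('a, 'b) module \<Rightarrow> nat" where
  "capacity K B =
    (THE m. m \<ge> 1 \<and> (\<exists>D :: ('a, 'b) module.
       division_algebra K D \<and> algebra_iso K B (mat_algebra m D) \<noteq> {}))"

definition quot_algebra :: "('a, 'b) module \<Rightarrow> 'b set \<Rightarrow> ('a, 'b set) module" where
  "quot_algebra A I =
    \<lparr>carrier = carrier (A Quot I), monoid.mult = monoid.mult (A Quot I), one = one (A Quot I),
     ring.zero = ring.zero (A Quot I), add = add (A Quot I),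
     module.smult = (\<lambda>k C. \<Union>x\<in>C. I +>\<^bsub>A\<^esub> (k \<odot>\<^bsub>A\<^esub> x))\<rparr>"

text \<open>
  The tensor product \<open>A \<otimes>\<^sub>K L\<close> of a \<open>K\<close>-algebra \<open>A\<close> and a commutative \<open>K\<close>-algebra \<open>L\<close>,
  regarded as an \<open>L\<close>-algebra: the free abelian group on the pairs \<open>(a, b)\<close>, with multiplication
  \<open>(a, b) (a', b') = (a a', b b')\<close> extended bilinearly, modulo the usual relations. The additive
  subgroup spanned by these relations is stable under multiplication by pairs, so it is the
  ideal that they generate. The scalar multiplication of \<open>pre_tensor\<close> satisfies the module
  laws only after passing to the quotient.
\<close>

definition pre_tensor :: "('a, 'b) module \<Rightarrow> ('a, 'c) module \<Rightarrow> ('c, 'b \<times> 'c \<Rightarrow>\<^sub>0 int) module" where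
  "pre_tensor A L =
    \<lparr>carrier = {u. Poly_Mapping.keys u \<subseteq> carrier A \<times> carrier L},
     monoid.mult = (\<lambda>u v. frag_extend (\<lambda>(a, b).
       frag_extend (\<lambda>(a', b'). frag_of (a \<otimes>\<^bsub>A\<^esub> a', b \<otimes>\<^bsub>L\<^esub> b')) v) u),
     one = frag_of (\<one>\<^bsub>A\<^esub>, \<one>\<^bsub>L\<^esub>),
     ring.zero = 0,
     add = (+),
     module.smult = (\<lambda>l. frag_extend (\<lambda>(a, b). frag_of (a, l \<otimes>\<^bsub>L\<^esub> b)))\<rparr>"

definition tensor_relations ::
    "('a, 'k) ring_scheme \<Rightarrow> ('a, 'b) module \<Rightarrow> ('a, 'c) module \<Rightarrow> ('b \<times> 'c \<Rightarrow>\<^sub>0 int) set" where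
  "tensor_relations K A L =
    {frag_of (a \<oplus>\<^bsub>A\<^esub> a', b) - frag_of (a, b) - frag_of (a', b) | a a' b.
       a \<in> carrier A \<and> a' \<in> carrier A \<and> b \<in> carrier L} \<union>
    {frag_of (a, b \<oplus>\<^bsub>L\<^esub> b') - frag_of (a, b) - frag_of (a, b') | a b b'.
       a \<in> carrier A \<and> b \<in> carrier L \<and> b' \<in> carrier L} \<union>
    {frag_of (k \<odot>\<^bsub>A\<^esub> a, b) - frag_of (a, k \<odot>\<^bsub>L\<^esub> b) | k a b.
       k \<in> carrier K \<and> a \<in> carrier A \<and> b \<in> carrier L}"

definition tensor_ideal ::
    "('a, 'k) ring_scheme \<Rightarrow> ('a, 'b) module \<Rightarrow> ('a, 'c) module \<Rightarrow> ('b \<times> 'c \<Rightarrow>\<^sub>0 int) set" where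
  "tensor_ideal K A L = Idl\<^bsub>pre_tensor A L\<^esub> (tensor_relations K A L)"

definition base_change ::
    "('a, 'k) ring_scheme \<Rightarrow> ('a, 'b) module \<Rightarrow> ('a, 'c) module \<Rightarrow>
      ('c, ('b \<times> 'c \<Rightarrow>\<^sub>0 int) set) module" where
  "base_change K A L = quot_algebra (pre_tensor A L) (tensor_ideal K A L)"

definition pure_tensor ::
    "('a, 'k) ring_scheme \<Rightarrow> ('a, 'b) module \<Rightarrow> ('a, 'c) module \<Rightarrow> 'b \<Rightarrow> 'c \<Rightarrow>
      ('b \<times> 'c \<Rightarrow>\<^sub>0 int) set" where
  "pure_tensor K A L a b = tensor_ideal K A L +>\<^bsub>pre_tensor A L\<^esub> frag_of (a, b)"

text \<open>The base field \<open>F\<close> is a type of class \<^class>\<open>field\<close>, seen as the record \<open>class_ring\<close>.\<close>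

definition poly_algebra :: "('f :: field, 'f poly) module" where
  "poly_algebra =
    \<lparr>carrier = UNIV, monoid.mult = (*), one = 1, ring.zero = 0, add = (+),
     module.smult = Polynomial.smult\<rparr>"

definition adjoin_root :: "'f :: field poly \<Rightarrow> ('f, 'f poly set) module" where
  "adjoin_root p = quot_algebra poly_algebra (PIdl\<^bsub>poly_algebra\<^esub> p)"

definition closure_algebra :: "('f :: field, 'f alg_closure) module" where
  "closure_algebra =
    \<lparr>carrier = UNIV, monoid.mult = (*), one = 1, ring.zero = 0, add = (+),
     module.smult = (\<lambda>c x. to_ac c * x)\<rparr>"

text \<open>
  \<open>is_char_poly A N x f\<close>: \<open>f\<close> is the reduced characteristic polynomial of the element \<open>x\<close> of the
  central simple algebra \<open>A\<close> of degree \<open>N\<close>. By the Skolem--Noether theorem it does not matter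
  which isomorphism to the matrix algebra is used.
\<close>

definition is_char_poly :: "('f :: field, 'b) module \<Rightarrow> nat \<Rightarrow> 'b \<Rightarrow> 'f poly \<Rightarrow> bool" where
  "is_char_poly A N x f \<longleftrightarrow>
    (\<exists>\<phi> \<in> algebra_iso class_ring (base_change class_ring A closure_algebra)
             (module_mat TYPE('f alg_closure) N N).
       map_poly to_ac f = char_poly (\<phi> (pure_tensor class_ring A closure_algebra x 1)))"

end

theory Submission
  imports Defs "HOL-Algebra.Free_Abelian_Groups"
begin

text \<open>
  Over the algebraic closure, left multiplication by \<open>x\<close> on \<open>A\<close> becomes left multiplication on
  \<open>nd \<times> nd\<close> matrices; as \<open>A\<close> is a sum of \<open>n\<close> copies of the column space \<open>\<Delta>\<^sup>n\<close>, this shows that the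
  characteristic polynomial of \<open>x\<close>, seen as an \<open>F\<close>-linear map of \<open>\<Delta>\<^sup>n\<close>, is the \<open>d\<close>-th power of the reduced
  one. So \<open>f\<close> is a reduced characteristic polynomial if and only if \<open>f\<^sup>d\<close> is the characteristic
  polynomial of an endomorphism \<open>T\<close> of some right \<open>\<Delta>\<close>-space.

  Such pairs are modules over \<open>\<Delta> \<otimes> F[t]\<close>. Splitting off kernels of \<open>p(T)\<close> for irreducible \<open>p\<close>
  reduces to modules over the simple algebra \<open>\<Delta> \<otimes> F[t]/(p)\<close>, which has dimension \<open>d\<^sup>2 deg p\<close> and
  capacity \<open>c\<close>. By Wedderburn's theorem its simple module has dimension \<open>d\<^sup>2 deg p / c\<close>, hence \<open>p\<^sup>j\<close> is
  the characteristic polynomial of such a module if and only if \<open>d\<^sup>2\<close> divides \<open>c j\<close>. The conditions (a)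
  and (b) say exactly that \<open>d\<^sup>2\<close> divides \<open>deg p \<cdot> j\<close> and \<open>c j\<close> for \<open>j = d a\<^sub>i\<close>.
\<close>

subsection \<open>Linear algebra with indexed bases\<close>

text \<open>Modules are encoded as matrices over F acting on \<open>F^k\<close>: the submodules and
  quotients met in an induction on dimension have no types of their own, but they appear as diagonal
  blocks. Characteristic polynomials multiply and the two divisibility conditions add up along a
  filtration, so it is enough to cut off one invariant kernel at a time and to pass to the quotient.
  The field F[t]/(p) is a record and not a type. Dimension and module theory is therefore developed
  over a field given as a type, and \<Delta> \<otimes> F[t]/(p) is regarded as an algebra over F.
  Its capacity is defined over F[t]/(p) but can be read off from the ring structure alone. Working
  with f^d instead of f loses nothing, because a monic polynomial is determined by any of its
  positive powers. For the arithmetic, put e = deg p_i and let c be the capacity. That d^2 divides e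
  d a_i means e a_i = n_i d for some n_i. That d^2 divides c d a_i means that d divides c a_i;
  multiplied by e, this says that e d divides c n_i d, that is, e divides n_i c.\<close>

lemma (in abelian_monoid) finsum_lessThan_Suc:
  fixes n :: nat
  assumes "\<And>i. i \<le> n \<Longrightarrow> g i \<in> carrier G"
  shows "finsum G g {..<Suc n} = finsum G g {..<n} \<oplus> g n"
proof -
  have "finsum G g (insert n {..<n}) = g n \<oplus> finsum G g {..<n}"
    by (rule finsum_insert) (use assms in auto)
  moreover have "finsum G g {..<n} \<in> carrier G"
    by (rule finsum_closed) (use assms in auto)
  ultimately show ?thesis using assms by (simp add: lessThan_Suc a_comm)
qed

lemma (in abelian_monoid) finsum_lessThan_add:
  fixes m n :: nat
  assumes "\<And>i. i < m + n \<Longrightarrow> g i \<in> carrier G"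
  shows "finsum G g {..<m + n} = finsum G g {..<m} \<oplus> (\<Oplus>i\<in>{..<n}. g (m + i))"
  using assms
proof (induction n)
  case 0
  then have "finsum G g {..<m} \<in> carrier G" by (intro finsum_closed) auto
  then show ?case by simp
next
  case (Suc n)
  have c: "finsum G g {..<m} \<in> carrier G" "(\<Oplus>i\<in>{..<n}. g (m + i)) \<in> carrier G"
    using Suc.prems by (auto intro!: finsum_closed)
  have "finsum G g {..<Suc (m + n)} = finsum G g {..<m + n} \<oplus> g (m + n)"
    by (rule finsum_lessThan_Suc) (use Suc.prems in auto)
  moreover have "(\<Oplus>i\<in>{..<Suc n}. g (m + i)) = (\<Oplus>i\<in>{..<n}. g (m + i)) \<oplus> g (m + n)"
    by (rule finsum_lessThan_Suc) (use Suc.prems in auto)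
  ultimately show ?case using Suc c by (simp add: a_assoc)
qed

text \<open>The flat index i * n + j is the numbering of all product bases below; this lemma unfolds
  a linear combination over such a basis into a double sum.\<close>

lemma (in abelian_monoid) finsum_lessThan_mult:
  fixes m n :: nat
  assumes "\<And>i. i < m * n \<Longrightarrow> g i \<in> carrier G"
  shows "finsum G g {..<m * n} = (\<Oplus>i\<in>{..<m}. \<Oplus>j\<in>{..<n}. g (i * n + j))"
  using assms
proof (induction m)
  case 0
  then show ?case by simp
next
  case (Suc m)
  have *: "i * n + j < Suc m * n" if "i \<le> m" "j < n" for i j
  proof -
    have "i * n + j < (i + 1) * n" using that by simp
    also have "\<dots> \<le> Suc m * n" using that by (intro mult_right_mono) auto
    finally show ?thesis .
  qed
  have "finsum G g {..<m * n + n} = finsum G g {..<m * n} \<oplus> (\<Oplus>j\<in>{..<n}. g (m * n + j))"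
    by (rule finsum_lessThan_add) (use Suc.prems in \<open>auto simp: add.commute\<close>)
  moreover have "finsum G g {..<m * n} = (\<Oplus>i\<in>{..<m}. \<Oplus>j\<in>{..<n}. g (i * n + j))"
    by (rule Suc.IH) (use Suc.prems in auto)
  moreover have "(\<Oplus>i\<in>{..<Suc m}. \<Oplus>j\<in>{..<n}. g (i * n + j)) =
      (\<Oplus>i\<in>{..<m}. \<Oplus>j\<in>{..<n}. g (i * n + j)) \<oplus> (\<Oplus>j\<in>{..<n}. g (m * n + j))"
    by (rule finsum_lessThan_Suc) (use Suc.prems * in \<open>auto intro!: finsum_closed\<close>)
  ultimately show ?case by (simp add: add.commute)
qed

text \<open>With \<open>h\<close> the identity this also moves a sum between two records that share
  their addition but have different carriers, such as an algebra and one of its corners.\<close>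

lemma finsum_hom:
  fixes n :: nat
  assumes "abelian_monoid G" "abelian_monoid H"
    and "\<And>i. i < n \<Longrightarrow> g i \<in> carrier G"
    and "\<And>x. x \<in> carrier G \<Longrightarrow> h x \<in> carrier H"
    and "\<And>x y. x \<in> carrier G \<Longrightarrow> y \<in> carrier G \<Longrightarrow> h (x \<oplus>\<^bsub>G\<^esub> y) = h x \<oplus>\<^bsub>H\<^esub> h y"
    and "h \<zero>\<^bsub>G\<^esub> = \<zero>\<^bsub>H\<^esub>"
  shows "h (finsum G g {..<n}) = (\<Oplus>\<^bsub>H\<^esub>i\<in>{..<n}. h (g i))"
proof -
  interpret G: abelian_monoid G by fact
  interpret H: abelian_monoid H by fact
  show ?thesis using assms(3)
  proof (induction n)
    case 0
    then show ?case using assms(6) by simp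
  next
    case (Suc n)
    have "finsum G g {..<n} \<in> carrier G" using Suc.prems by (intro G.finsum_closed) auto
    moreover have "finsum G g {..<Suc n} = finsum G g {..<n} \<oplus>\<^bsub>G\<^esub> g n"
      by (rule G.finsum_lessThan_Suc) (use Suc.prems in auto)
    moreover have "(\<Oplus>\<^bsub>H\<^esub>i\<in>{..<Suc n}. h (g i)) = (\<Oplus>\<^bsub>H\<^esub>i\<in>{..<n}. h (g i)) \<oplus>\<^bsub>H\<^esub> h (g n)"
      by (rule H.finsum_lessThan_Suc) (use Suc.prems assms(4) in auto)
    ultimately show ?case using Suc assms(5) by simp
  qed
qed

lemma (in abelian_monoid) finsum_eq_single:
  fixes k n :: nat
  assumes "k < n" "\<And>i. i < n \<Longrightarrow> g i \<in> carrier G" "\<And>i. i < n \<Longrightarrow> i \<noteq> k \<Longrightarrow> g i = \<zero>"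
  shows "finsum G g {..<n} = g k"
proof -
  have "finsum G g {..<n} = (\<Oplus>i\<in>{..<n}. if k = i then g i else \<zero>)"
    by (rule finsum_cong') (use assms in auto)
  also have "\<dots> = g k" by (rule add.finprod_singleton) (use assms in auto)
  finally show ?thesis .
qed

lemma (in abelian_monoid) finsum_eq_zero:
  fixes n :: nat
  assumes "\<And>i. i < n \<Longrightarrow> g i = \<zero>"
  shows "finsum G g {..<n} = \<zero>"
  using add.finprod_one_eqI[of "{..<n}" g] assms by auto

lemma (in abelian_monoid) add_four:
  assumes "x \<in> carrier G" "y \<in> carrier G" "z \<in> carrier G" "w \<in> carrier G"
  shows "(x \<oplus> y) \<oplus> (z \<oplus> w) = (x \<oplus> z) \<oplus> (y \<oplus> w)"
  using assms by (simp add: a_ac)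

section \<open>Linear combinations, indexed bases, coordinates and linear maps\<close>

definition lc :: "('k :: field, 'v) module \<Rightarrow> nat \<Rightarrow> (nat \<Rightarrow> 'v) \<Rightarrow> (nat \<Rightarrow> 'k) \<Rightarrow> 'v" where
  "lc V n b c = (\<Oplus>\<^bsub>V\<^esub>i\<in>{..<n}. c i \<odot>\<^bsub>V\<^esub> b i)"

definition indep :: "('k :: field, 'v) module \<Rightarrow> nat \<Rightarrow> (nat \<Rightarrow> 'v) \<Rightarrow> bool" where
  "indep V n b \<longleftrightarrow> (\<forall>i<n. b i \<in> carrier V) \<and> (\<forall>c. lc V n b c = \<zero>\<^bsub>V\<^esub> \<longrightarrow> (\<forall>i<n. c i = 0))"

definition fbasis :: "('k :: field, 'v) module \<Rightarrow> nat \<Rightarrow> (nat \<Rightarrow> 'v) \<Rightarrow> bool" where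
  "fbasis V n b \<longleftrightarrow> indep V n b \<and> (\<forall>v\<in>carrier V. \<exists>c. v = lc V n b c)"

text \<open>For a basis \<open>b\<close> only the values at indices below \<open>n\<close> are
  determined, so every statement about coordinates carries a bound on the index.\<close>

definition coord :: "('k :: field, 'v) module \<Rightarrow> nat \<Rightarrow> (nat \<Rightarrow> 'v) \<Rightarrow> 'v \<Rightarrow> nat \<Rightarrow> 'k" where
  "coord V n b v = (SOME c. v = lc V n b c)"

definition linmap :: "('k :: field, 'v) module \<Rightarrow> ('k, 'w) module \<Rightarrow> ('v \<Rightarrow> 'w) \<Rightarrow> bool" where
  "linmap V W g \<longleftrightarrow> (\<forall>v\<in>carrier V. g v \<in> carrier W) \<and>
     (\<forall>v\<in>carrier V. \<forall>w\<in>carrier V. g (v \<oplus>\<^bsub>V\<^esub> w) = g v \<oplus>\<^bsub>W\<^esub> g w) \<and>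
     (\<forall>c. \<forall>v\<in>carrier V. g (c \<odot>\<^bsub>V\<^esub> v) = c \<odot>\<^bsub>W\<^esub> g v)"

locale fvs = vectorspace "class_ring :: 'k :: field ring" V for V :: "('k :: field, 'v) module"
begin

lemma sc [simp]: "v \<in> carrier V \<Longrightarrow> c \<odot>\<^bsub>V\<^esub> v \<in> carrier V"
  using smult_closed by simp

lemma sc_add: "v \<in> carrier V \<Longrightarrow> (c + c') \<odot>\<^bsub>V\<^esub> v = c \<odot>\<^bsub>V\<^esub> v \<oplus>\<^bsub>V\<^esub> c' \<odot>\<^bsub>V\<^esub> v"
  using smult_l_distr[of c c' v] by simp

lemma sc_distr: "v \<in> carrier V \<Longrightarrow> w \<in> carrier V \<Longrightarrow>
    c \<odot>\<^bsub>V\<^esub> (v \<oplus>\<^bsub>V\<^esub> w) = c \<odot>\<^bsub>V\<^esub> v \<oplus>\<^bsub>V\<^esub> c \<odot>\<^bsub>V\<^esub> w"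
  using smult_r_distr[of c v w] by simp

lemma sc_mult: "v \<in> carrier V \<Longrightarrow> (c * c') \<odot>\<^bsub>V\<^esub> v = c \<odot>\<^bsub>V\<^esub> (c' \<odot>\<^bsub>V\<^esub> v)"
  using smult_assoc1[of c c' v] by simp

lemma sc_1 [simp]: "v \<in> carrier V \<Longrightarrow> 1 \<odot>\<^bsub>V\<^esub> v = v"
  using smult_one[of v] by simp

lemma sc_0 [simp]: "v \<in> carrier V \<Longrightarrow> 0 \<odot>\<^bsub>V\<^esub> v = \<zero>\<^bsub>V\<^esub>"
  using lmult_0[of v] by simp

lemma sc_zero [simp]: "c \<odot>\<^bsub>V\<^esub> \<zero>\<^bsub>V\<^esub> = \<zero>\<^bsub>V\<^esub>"
  using rmult_0[of c] by simp

lemma sc_minus1: "v \<in> carrier V \<Longrightarrow> (- 1) \<odot>\<^bsub>V\<^esub> v = \<ominus>\<^bsub>V\<^esub> v"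
  using smult_minus_1[of v] by (simp add: class_ring_simps)

lemma sc_eq_zero: "v \<in> carrier V \<Longrightarrow> c \<odot>\<^bsub>V\<^esub> v = \<zero>\<^bsub>V\<^esub> \<Longrightarrow> c = 0 \<or> v = \<zero>\<^bsub>V\<^esub>"
proof -
  assume v: "v \<in> carrier V" and 0: "c \<odot>\<^bsub>V\<^esub> v = \<zero>\<^bsub>V\<^esub>"
  have "v = inverse c \<odot>\<^bsub>V\<^esub> (c \<odot>\<^bsub>V\<^esub> v)" if "c \<noteq> 0"
    using that v by (simp add: sc_mult[symmetric])
  then show ?thesis using v 0 sc_zero by metis
qed

lemma lc_closed [simp]: "(\<And>i. i < n \<Longrightarrow> b i \<in> carrier V) \<Longrightarrow> lc V n b c \<in> carrier V"
  unfolding lc_def by (intro M.finsum_closed) auto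

lemma lc_cong:
  "(\<And>i. i < n \<Longrightarrow> b i \<in> carrier V) \<Longrightarrow> (\<And>i. i < n \<Longrightarrow> c i = c' i) \<Longrightarrow> (\<And>i. i < n \<Longrightarrow> b i = b' i) \<Longrightarrow>
    lc V n b c = lc V n b' c'"
  unfolding lc_def by (intro M.finsum_cong') auto

lemma lc_0 [simp]: "lc V 0 b c = \<zero>\<^bsub>V\<^esub>"
  by (simp add: lc_def)

lemma lc_Suc: "(\<And>i. i \<le> n \<Longrightarrow> b i \<in> carrier V) \<Longrightarrow>
    lc V (Suc n) b c = lc V n b c \<oplus>\<^bsub>V\<^esub> c n \<odot>\<^bsub>V\<^esub> b n"
  unfolding lc_def by (intro M.finsum_lessThan_Suc) auto

lemma lc_add: "(\<And>i. i < n \<Longrightarrow> b i \<in> carrier V) \<Longrightarrow>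
    lc V n b (\<lambda>i. c i + c' i) = lc V n b c \<oplus>\<^bsub>V\<^esub> lc V n b c'"
proof (induction n)
  case (Suc n)
  then show ?case
    using M.add_four[of "lc V n b c" "lc V n b c'" "c n \<odot>\<^bsub>V\<^esub> b n" "c' n \<odot>\<^bsub>V\<^esub> b n"]
    by (simp add: lc_Suc sc_add)
qed simp

lemma lc_smult: "(\<And>i. i < n \<Longrightarrow> b i \<in> carrier V) \<Longrightarrow>
    lc V n b (\<lambda>i. a * c i) = a \<odot>\<^bsub>V\<^esub> lc V n b c"
proof (induction n)
  case (Suc n)
  then show ?case by (simp add: lc_Suc sc_distr sc_mult)
qed simp

lemma lc_zero [simp]: "(\<And>i. i < n \<Longrightarrow> b i \<in> carrier V) \<Longrightarrow> lc V n b (\<lambda>_. 0) = \<zero>\<^bsub>V\<^esub>"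
  unfolding lc_def by (intro M.finsum_eq_zero) auto

lemma lc_diff: "(\<And>i. i < n \<Longrightarrow> b i \<in> carrier V) \<Longrightarrow>
    lc V n b (\<lambda>i. c i - c' i) = lc V n b c \<ominus>\<^bsub>V\<^esub> lc V n b c'"
  using lc_add[of n b c "\<lambda>i. (-1) * c' i"] lc_smult[of n b "-1" c']
  by (simp add: M.minus_eq sc_minus1 del: mult_minus1)

lemma lc_delta:
  assumes "\<And>i. i < n \<Longrightarrow> b i \<in> carrier V" "i < n"
  shows "lc V n b (\<lambda>j. if j = i then 1 else 0) = b i"
  unfolding lc_def using assms by (subst M.finsum_eq_single[of i]) auto

lemma lc_lc:
  assumes "\<And>i. i < n \<Longrightarrow> b i \<in> carrier V"
  shows "lc V k (\<lambda>j. lc V n b (A j)) c = lc V n b (\<lambda>i. \<Sum>j<k. c j * A j i)"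
  using assms
  by (induction k) (simp_all add: lc_Suc lc_add lc_smult)

lemma indepD: "indep V n b \<Longrightarrow> i < n \<Longrightarrow> b i \<in> carrier V"
  "indep V n b \<Longrightarrow> lc V n b c = \<zero>\<^bsub>V\<^esub> \<Longrightarrow> i < n \<Longrightarrow> c i = 0"
  by (auto simp: indep_def)

lemma fbasisD: "fbasis V n b \<Longrightarrow> indep V n b" "fbasis V n b \<Longrightarrow> i < n \<Longrightarrow> b i \<in> carrier V"
  by (auto simp: indep_def fbasis_def)

lemma lc_inj:
  assumes "indep V n b" "lc V n b c = lc V n b c'" "i < n"
  shows "c i = c' i"
proof -
  have b: "\<And>i. i < n \<Longrightarrow> b i \<in> carrier V" using assms indepD by auto
  have "lc V n b (\<lambda>i. c i - c' i) = lc V n b c \<ominus>\<^bsub>V\<^esub> lc V n b c'" by (rule lc_diff[OF b])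
  also have "\<dots> = \<zero>\<^bsub>V\<^esub>" using assms(2) b by (simp add: M.minus_eq M.r_neg)
  finally have "lc V n b (\<lambda>i. c i - c' i) = \<zero>\<^bsub>V\<^esub>" .
  from indepD(2)[OF assms(1) this assms(3)] show ?thesis by simp
qed

lemma lc_coord: "fbasis V n b \<Longrightarrow> v \<in> carrier V \<Longrightarrow> lc V n b (coord V n b v) = v"
  unfolding fbasis_def coord_def by (metis (mono_tags, lifting) someI_ex)

lemma coord_eqI: "fbasis V n b \<Longrightarrow> v = lc V n b c \<Longrightarrow> i < n \<Longrightarrow> coord V n b v i = c i"
  by (rule lc_inj[of n b]) (auto simp: fbasisD lc_coord)

lemma coord_add: "fbasis V n b \<Longrightarrow> v \<in> carrier V \<Longrightarrow> w \<in> carrier V \<Longrightarrow> i < n \<Longrightarrow>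
    coord V n b (v \<oplus>\<^bsub>V\<^esub> w) i = coord V n b v i + coord V n b w i"
  by (rule coord_eqI) (auto simp: lc_add fbasisD lc_coord)

lemma coord_smult: "fbasis V n b \<Longrightarrow> v \<in> carrier V \<Longrightarrow> i < n \<Longrightarrow>
    coord V n b (c \<odot>\<^bsub>V\<^esub> v) i = c * coord V n b v i"
  by (rule coord_eqI) (auto simp: lc_smult fbasisD lc_coord)

lemma coord_basis: "fbasis V n b \<Longrightarrow> i < n \<Longrightarrow> j < n \<Longrightarrow>
    coord V n b (b j) i = (if i = j then 1 else 0)"
  by (rule coord_eqI) (auto simp: lc_delta fbasisD)

text \<open>Translates indexed families into the set-based notions of the library, so that its
  dimension theory applies to them; \<open>fbasis_dim\<close> and \<open>indep_le_dim\<close> are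
  obtained in this way.\<close>

lemma indep_lib:
  assumes "indep V n b"
  shows "inj_on b {..<n}" "lin_indpt (b ` {..<n})" "b ` {..<n} \<subseteq> carrier V"
proof -
  have b: "\<And>i. i < n \<Longrightarrow> b i \<in> carrier V" using assms indepD by auto
  show inj: "inj_on b {..<n}"
  proof (rule inj_onI)
    fix i j assume ij: "i \<in> {..<n}" "j \<in> {..<n}" "b i = b j"
    have "lc V n b (\<lambda>k. if k = i then 1 else 0) = lc V n b (\<lambda>k. if k = j then 1 else 0)"
      using ij b lc_delta[of n b i] lc_delta[of n b j] by simp
    from lc_inj[OF assms this, of i] ij show "i = j" by (auto split: if_splits)
  qed
  show sub: "b ` {..<n} \<subseteq> carrier V" using b by auto
  show "lin_indpt (b ` {..<n})"
  proof (rule finite_lin_indpt2[OF _ sub])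
    fix a :: "'v \<Rightarrow> 'k"
    assume "lincomb a (b ` {..<n}) = \<zero>\<^bsub>V\<^esub>"
    then have "(\<Oplus>\<^bsub>V\<^esub>v\<in>b ` {..<n}. a v \<odot>\<^bsub>V\<^esub> v) = \<zero>\<^bsub>V\<^esub>" by (simp add: lincomb_def)
    then have "lc V n b (\<lambda>i. a (b i)) = \<zero>\<^bsub>V\<^esub>"
      unfolding lc_def using b by (subst (asm) M.finsum_reindex[OF _ inj]) auto
    with assms show "\<forall>v\<in>b ` {..<n}. a v = \<zero>\<^bsub>class_ring\<^esub>" by (auto dest: indepD(2))
  qed auto
qed

lemma fbasis_dim:
  assumes "fbasis V n b"
  shows "fin_dim" "dim = n"
proof -
  have b: "\<And>i. i < n \<Longrightarrow> b i \<in> carrier V" using assms fbasisD by auto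
  note l = indep_lib[OF fbasisD(1)[OF assms]]
  have "carrier V \<subseteq> span (b ` {..<n})"
  proof
    fix v assume "v \<in> carrier V"
    then obtain c where "v = lc V n b c" using assms by (auto simp: fbasis_def)
    also have "\<dots> = lc V n b (\<lambda>i. c (the_inv_into {..<n} b (b i)))"
      by (rule lc_cong) (use b the_inv_into_f_f[OF l(1)] in auto)
    also have "\<dots> = lincomb (\<lambda>v. c (the_inv_into {..<n} b v)) (b ` {..<n})"
      unfolding lc_def lincomb_def using b by (subst M.finsum_reindex[OF _ l(1)]) auto
    finally show "v \<in> span (b ` {..<n})"
      unfolding span_def by (intro CollectI exI[of _ "b ` {..<n}"]) auto
  qed
  moreover have "span (b ` {..<n}) \<subseteq> carrier V" using l(3) by (rule span_is_subset2)
  ultimately have gen: "gen_set (b ` {..<n})" by auto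
  show "fin_dim" unfolding fin_dim_def using gen l(3) by blast
  have "basis (b ` {..<n})" unfolding basis_def using gen l by auto
  from dim_basis[OF _ this] show "dim = n" using card_image[OF l(1)] by simp
qed

lemma indep_le_dim: "fin_dim \<Longrightarrow> indep V n b \<Longrightarrow> n \<le> dim"
  using li_le_dim(2)[of "b ` {..<n}"] indep_lib[of n b] card_image[of b "{..<n}"] by simp

lemma indep_le_fbasis: "fbasis V n b \<Longrightarrow> indep V r w \<Longrightarrow> r \<le> n"
  using fbasis_dim indep_le_dim by blast

lemma fbasis_unique: "fbasis V n b \<Longrightarrow> fbasis V n' b' \<Longrightarrow> n = n'"
  using fbasis_dim by blast

lemma indep_extend:
  assumes "indep V r b" "v \<in> carrier V" "\<And>c. v \<noteq> lc V r b c"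
  shows "indep V (Suc r) (b(r := v))"
proof -
  have b: "\<And>i. i < r \<Longrightarrow> b i \<in> carrier V" using assms indepD by auto
  have "c i = 0" if c: "lc V (Suc r) (b(r := v)) c = \<zero>\<^bsub>V\<^esub>" and i: "i < Suc r" for c i
  proof -
    have "lc V r (b(r := v)) c = lc V r b c" by (rule lc_cong) (use b in auto)
    then have eq: "lc V r b c \<oplus>\<^bsub>V\<^esub> c r \<odot>\<^bsub>V\<^esub> v = \<zero>\<^bsub>V\<^esub>"
      using c b assms(2) by (subst (asm) lc_Suc) (auto simp: less_Suc_eq_le le_less)
    have "c r = 0"
    proof (rule ccontr)
      assume n0: "c r \<noteq> 0"
      have "c r \<odot>\<^bsub>V\<^esub> v = \<ominus>\<^bsub>V\<^esub> lc V r b c"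
        using eq b assms(2) by (metis M.a_comm M.minus_equality lc_closed sc)
      also have "\<dots> = (-1) \<odot>\<^bsub>V\<^esub> lc V r b c" using b by (simp add: sc_minus1)
      finally have "inverse (c r) \<odot>\<^bsub>V\<^esub> (c r \<odot>\<^bsub>V\<^esub> v) = inverse (c r) \<odot>\<^bsub>V\<^esub> ((-1) \<odot>\<^bsub>V\<^esub> lc V r b c)" by simp
      then have "v = inverse (c r) \<odot>\<^bsub>V\<^esub> ((-1) \<odot>\<^bsub>V\<^esub> lc V r b c)"
        using n0 assms(2) by (simp add: sc_mult[symmetric])
      also have "\<dots> = lc V r b (\<lambda>i. inverse (c r) * ((-1) * c i))" using b by (simp only: lc_smult)
      finally show False using assms(3) by blast
    qed
    moreover from this have "lc V r b c = \<zero>\<^bsub>V\<^esub>" using eq b assms(2) by simp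
    ultimately show ?thesis using indepD(2)[OF assms(1)] i by (auto simp: less_Suc_eq)
  qed
  then show ?thesis using b assms(2) by (auto simp: indep_def)
qed

text \<open>An independent extension of maximal length spans, for otherwise
  \<open>indep_extend\<close> would lengthen it. The bound \<open>N\<close> makes the maximum exist
  and expresses finite dimension without mentioning a basis.\<close>

lemma indep_extend_fbasis:
  assumes "indep V r b" "\<And>n w. indep V n w \<Longrightarrow> n \<le> N"
  obtains n b' where "fbasis V n b'" "r \<le> n" "n \<le> N" "\<And>i. i < r \<Longrightarrow> b' i = b i"
proof -
  define P where "P n \<longleftrightarrow> (\<exists>b'. indep V n b' \<and> r \<le> n \<and> (\<forall>i<r. b' i = b i))" for n
  have "P r" using assms(1) by (auto simp: P_def)
  moreover have "\<And>n. P n \<Longrightarrow> n \<le> N" using assms(2) by (auto simp: P_def)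
  ultimately obtain n where n: "P n" "\<And>k. P k \<Longrightarrow> k \<le> n"
    by (metis Nat.ex_has_greatest_nat)
  then obtain b' where b': "indep V n b'" "r \<le> n" "\<forall>i<r. b' i = b i" by (auto simp: P_def)
  have "\<exists>c. v = lc V n b' c" if "v \<in> carrier V" for v
  proof (rule ccontr)
    assume "\<not> ?thesis"
    then have "indep V (Suc n) (b'(n := v))" using that b' by (intro indep_extend) auto
    then have "P (Suc n)" using b' by (auto simp: P_def intro!: exI[of _ "b'(n := v)"])
    from n(2)[OF this] show False by simp
  qed
  then have "fbasis V n b'" using b' by (auto simp: fbasis_def)
  with that b' assms(2) show ?thesis by auto
qed

lemma ex_fbasis:
  assumes "\<And>n w. indep V n w \<Longrightarrow> n \<le> N"
  obtains n b where "fbasis V n b" "n \<le> N"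
  by (rule indep_extend_fbasis[of 0 "\<lambda>_. \<zero>\<^bsub>V\<^esub>" N]) (use assms in \<open>auto simp: indep_def\<close>)

lemma ex_fbasis_dim:
  assumes "fin_dim"
  obtains b where "fbasis V dim b"
  using ex_fbasis[of dim] indep_le_dim[OF assms] fbasis_dim by metis

lemma indep_full_fbasis:
  assumes "fbasis V n b" "indep V n w"
  shows "fbasis V n w"
proof -
  from indep_extend_fbasis[OF assms(2), of n] indep_le_fbasis[OF assms(1)]
  obtain m w' where w': "fbasis V m w'" "n \<le> m" "m \<le> n" "\<And>i. i < n \<Longrightarrow> w' i = w i" by metis
  then have "m = n" by simp
  have "lc V n w' c = lc V n w c" for c
    by (rule lc_cong) (use w' \<open>m = n\<close> fbasisD indepD(1)[OF assms(2)] in auto)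
  then show ?thesis using w' \<open>m = n\<close> assms(2) by (auto simp: fbasis_def)
qed

end

lemma linmapD:
  assumes "linmap V W g"
  shows "v \<in> carrier V \<Longrightarrow> g v \<in> carrier W"
    and "v \<in> carrier V \<Longrightarrow> w \<in> carrier V \<Longrightarrow> g (v \<oplus>\<^bsub>V\<^esub> w) = g v \<oplus>\<^bsub>W\<^esub> g w"
    and "v \<in> carrier V \<Longrightarrow> g (c \<odot>\<^bsub>V\<^esub> v) = c \<odot>\<^bsub>W\<^esub> g v"
  using assms by (auto simp: linmap_def)

lemma linmap_zero:
  assumes "fvs V" "fvs W" "linmap V W g"
  shows "g \<zero>\<^bsub>V\<^esub> = \<zero>\<^bsub>W\<^esub>"
proof -
  interpret V: fvs V by fact
  interpret W: fvs W by fact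
  have "g (0 \<odot>\<^bsub>V\<^esub> \<zero>\<^bsub>V\<^esub>) = 0 \<odot>\<^bsub>W\<^esub> g \<zero>\<^bsub>V\<^esub>" by (rule linmapD(3)[OF assms(3)]) simp
  then show ?thesis using linmapD(1)[OF assms(3)] by simp
qed

lemma linmap_lc:
  assumes "fvs V" "fvs W" "linmap V W g" "\<And>i. i < n \<Longrightarrow> b i \<in> carrier V"
  shows "g (lc V n b c) = lc W n (\<lambda>i. g (b i)) c"
proof -
  interpret V: fvs V by fact
  interpret W: fvs W by fact
  show ?thesis using assms(4)
    by (induction n) (simp_all add: linmap_zero[OF assms(1-3)] V.lc_Suc W.lc_Suc linmapD[OF assms(3)])
qed

text \<open>The last two hypotheses say that \<open>V\<close> is the direct sum of \<open>r\<close>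
  copies of \<open>U\<close>, embedded by the maps \<open>\<theta> i\<close>. The i-th copy occupies
  the positions i * m, ..., i * m + m - 1, whence \<open>div\<close> and \<open>mod\<close>. Matrix
  algebras, Peirce decompositions, modules over simple algebras and tensor products all obtain their
  bases from here.\<close>

lemma fbasis_prod:
  assumes "fvs V" "fvs U" "fbasis U m y" "\<And>i. i < r \<Longrightarrow> linmap U V (\<theta> i)"
    and surj: "\<And>v. v \<in> carrier V \<Longrightarrow>
      \<exists>u. (\<forall>i<r. u i \<in> carrier U) \<and> v = (\<Oplus>\<^bsub>V\<^esub>i\<in>{..<r}. \<theta> i (u i))"
    and inj: "\<And>u i. (\<And>i. i < r \<Longrightarrow> u i \<in> carrier U) \<Longrightarrow>
      (\<Oplus>\<^bsub>V\<^esub>i\<in>{..<r}. \<theta> i (u i)) = \<zero>\<^bsub>V\<^esub> \<Longrightarrow> i < r \<Longrightarrow> u i = \<zero>\<^bsub>U\<^esub>"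
  shows "fbasis V (r * m) (\<lambda>x. \<theta> (x div m) (y (x mod m)))"
proof -
  interpret V: fvs V by fact
  interpret U: fvs U by fact
  let ?b = "\<lambda>x. \<theta> (x div m) (y (x mod m))"
  note \<theta> = linmapD[OF assms(4)]
  have y: "\<And>i. i < m \<Longrightarrow> y i \<in> carrier U" using U.fbasisD(2)[OF assms(3)] .
  have b: "?b x \<in> carrier V" if "x < r * m" for x
  proof -
    have "x div m < r" using that by (simp add: less_mult_imp_div_less)
    moreover have "x mod m < m" using that by (metis mod_less_divisor mult_0_right neq0_conv not_less0)
    ultimately show ?thesis using \<theta>(1) y by blast
  qed
  have lc: "lc V (r * m) ?b c = (\<Oplus>\<^bsub>V\<^esub>i\<in>{..<r}. \<theta> i (lc U m y (\<lambda>l. c (i * m + l))))" for c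
  proof -
    have "lc V (r * m) ?b c = (\<Oplus>\<^bsub>V\<^esub>i\<in>{..<r}. \<Oplus>\<^bsub>V\<^esub>j\<in>{..<m}. c (i * m + j) \<odot>\<^bsub>V\<^esub> ?b (i * m + j))"
      unfolding lc_def by (rule V.M.finsum_lessThan_mult) (use b in auto)
    also have "\<dots> = (\<Oplus>\<^bsub>V\<^esub>i\<in>{..<r}. \<theta> i (lc U m y (\<lambda>l. c (i * m + l))))"
    proof (rule V.M.finsum_cong')
      show "(\<lambda>i. \<theta> i (lc U m y (\<lambda>l. c (i * m + l)))) \<in> {..<r} \<rightarrow> carrier V"
        using \<theta>(1) y by auto
      fix i assume "i \<in> {..<r}"
      then have i: "i < r" by simp
      have "\<theta> i (lc U m y (\<lambda>l. c (i * m + l))) = lc V m (\<lambda>l. \<theta> i (y l)) (\<lambda>l. c (i * m + l))"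
        by (rule linmap_lc[OF assms(2,1) assms(4)[OF i] y])
      also have "\<dots> = (\<Oplus>\<^bsub>V\<^esub>j\<in>{..<m}. c (i * m + j) \<odot>\<^bsub>V\<^esub> ?b (i * m + j))"
        unfolding lc_def by (rule V.M.finsum_cong') (use \<theta>(1)[OF i] y in auto)
      finally show "(\<Oplus>\<^bsub>V\<^esub>j\<in>{..<m}. c (i * m + j) \<odot>\<^bsub>V\<^esub> ?b (i * m + j)) =
        \<theta> i (lc U m y (\<lambda>l. c (i * m + l)))" by simp
    qed simp
    finally show ?thesis .
  qed
  have "\<exists>c. v = lc V (r * m) ?b c" if "v \<in> carrier V" for v
  proof -
    from surj[OF that] obtain u where u: "\<And>i. i < r \<Longrightarrow> u i \<in> carrier U"
      "v = (\<Oplus>\<^bsub>V\<^esub>i\<in>{..<r}. \<theta> i (u i))" by auto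
    define c where "c x = coord U m y (u (x div m)) (x mod m)" for x
    have eq: "lc U m y (\<lambda>l. c (i * m + l)) = u i" if "i < r" for i
    proof -
      have "lc U m y (\<lambda>l. c (i * m + l)) = lc U m y (coord U m y (u i))"
        by (rule U.lc_cong) (use y in \<open>auto simp: c_def\<close>)
      then show ?thesis using U.lc_coord[OF assms(3) u(1)[OF that]] by simp
    qed
    have "lc V (r * m) ?b c = v" unfolding lc u(2)
      by (rule V.M.finsum_cong') (use eq u(1) \<theta>(1) in auto)
    then show ?thesis by metis
  qed
  moreover have "c x = 0" if c: "lc V (r * m) ?b c = \<zero>\<^bsub>V\<^esub>" and x: "x < r * m" for c x
  proof -
    have "x div m < r" using x by (simp add: less_mult_imp_div_less)
    moreover have xm: "x mod m < m" using x by (metis mod_less_divisor mult_0_right neq0_conv not_less0)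
    ultimately have "lc U m y (\<lambda>l. c (x div m * m + l)) = \<zero>\<^bsub>U\<^esub>"
      using inj[of "\<lambda>i. lc U m y (\<lambda>l. c (i * m + l))" "x div m"] c y unfolding lc by simp
    from U.indepD(2)[OF U.fbasisD(1)[OF assms(3)] this xm] show "c x = 0" by simp
  qed
  ultimately show ?thesis using b by (auto simp: fbasis_def indep_def)
qed

section \<open>Matrices of endomorphisms and change of basis\<close>

definition mat_of :: "('k :: field, 'v) module \<Rightarrow> nat \<Rightarrow> (nat \<Rightarrow> 'v) \<Rightarrow> ('v \<Rightarrow> 'v) \<Rightarrow> 'k mat" where
  "mat_of V k b g = mat k k (\<lambda>(i, j). coord V k b (g (b j)) i)"

lemma mat_of_carrier [simp]: "mat_of V k b g \<in> carrier_mat k k"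
  "dim_row (mat_of V k b g) = k" "dim_col (mat_of V k b g) = k"
  by (auto simp: mat_of_def)

context fvs
begin

lemma mat_of_apply:
  assumes "fbasis V k b" "linmap V V g"
  shows "g (lc V k b c) = lc V k b (\<lambda>i. \<Sum>j<k. mat_of V k b g $$ (i, j) * c j)"
proof -
  have b: "\<And>i. i < k \<Longrightarrow> b i \<in> carrier V" using fbasisD(2)[OF assms(1)] .
  have "g (lc V k b c) = lc V k (\<lambda>j. g (b j)) c"
    by (rule linmap_lc) (use assms b fvs_axioms in auto)
  also have "\<dots> = lc V k (\<lambda>j. lc V k b (coord V k b (g (b j)))) c"
    by (rule lc_cong) (use assms b in \<open>auto simp: lc_coord linmapD(1)[OF assms(2)]\<close>)
  also have "\<dots> = lc V k b (\<lambda>i. \<Sum>j<k. c j * coord V k b (g (b j)) i)"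
    by (rule lc_lc) (use b in auto)
  also have "\<dots> = lc V k b (\<lambda>i. \<Sum>j<k. mat_of V k b g $$ (i, j) * c j)"
    by (rule lc_cong) (use b in \<open>auto simp: mat_of_def mult.commute\<close>)
  finally show ?thesis .
qed

lemma mat_ofI:
  assumes "fbasis V k b" "M \<in> carrier_mat k k"
    "\<And>j. j < k \<Longrightarrow> g (b j) = lc V k b (\<lambda>i. M $$ (i, j))"
  shows "mat_of V k b g = M"
  using assms by (intro eq_matI) (auto simp: mat_of_def intro!: coord_eqI)

lemma mat_of_comp:
  assumes "fbasis V k b" "linmap V V g" "linmap V V h"
  shows "mat_of V k b (\<lambda>v. g (h v)) = mat_of V k b g * mat_of V k b h"
proof (rule mat_ofI[OF assms(1)])
  have b: "\<And>i. i < k \<Longrightarrow> b i \<in> carrier V" using fbasisD(2)[OF assms(1)] .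
  fix j assume j: "j < k"
  have "h (b j) = lc V k b (coord V k b (h (b j)))"
    using lc_coord[OF assms(1)] linmapD(1)[OF assms(3) b[OF j]] by simp
  then have "g (h (b j)) = lc V k b (\<lambda>i. \<Sum>l<k. mat_of V k b g $$ (i, l) * coord V k b (h (b j)) l)"
    using mat_of_apply[OF assms(1,2)] by metis
  also have "\<dots> = lc V k b (\<lambda>i. (mat_of V k b g * mat_of V k b h) $$ (i, j))"
    by (rule lc_cong) (use j b in \<open>auto simp: scalar_prod_def mat_of_def lessThan_atLeast0\<close>)
  finally show "g (h (b j)) = lc V k b (\<lambda>i. (mat_of V k b g * mat_of V k b h) $$ (i, j))" .
qed auto

lemma mat_of_add:
  assumes "fbasis V k b" "\<And>v. v \<in> carrier V \<Longrightarrow> g v \<in> carrier V" "\<And>v. v \<in> carrier V \<Longrightarrow> h v \<in> carrier V"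
    "\<And>v. v \<in> carrier V \<Longrightarrow> gh v = g v \<oplus>\<^bsub>V\<^esub> h v"
  shows "mat_of V k b gh = mat_of V k b g + mat_of V k b h"
  using assms fbasisD(2)[OF assms(1)] by (intro eq_matI) (auto simp: mat_of_def coord_add)

lemma mat_of_smult:
  assumes "fbasis V k b" "\<And>v. v \<in> carrier V \<Longrightarrow> g v \<in> carrier V"
    "\<And>v. v \<in> carrier V \<Longrightarrow> h v = c \<odot>\<^bsub>V\<^esub> g v"
  shows "mat_of V k b h = c \<cdot>\<^sub>m mat_of V k b g"
  using assms fbasisD(2)[OF assms(1)] by (intro eq_matI) (auto simp: mat_of_def coord_smult)

lemma mat_of_id:
  assumes "fbasis V k b" "\<And>v. v \<in> carrier V \<Longrightarrow> g v = v"
  shows "mat_of V k b g = 1\<^sub>m k"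
  using assms fbasisD(2)[OF assms(1)] by (intro eq_matI) (auto simp: mat_of_def coord_basis)

lemma mat_of_zero:
  assumes "fbasis V k b" "\<And>v. v \<in> carrier V \<Longrightarrow> g v = \<zero>\<^bsub>V\<^esub>"
  shows "mat_of V k b g = 0\<^sub>m k k"
proof (rule mat_ofI[OF assms(1)])
  fix j assume "j < k"
  moreover have "lc V k b (\<lambda>i. 0\<^sub>m k k $$ (i, j)) = lc V k b (\<lambda>_. 0)"
    by (rule lc_cong) (use \<open>j < k\<close> fbasisD(2)[OF assms(1)] in auto)
  ultimately show "g (b j) = lc V k b (\<lambda>i. 0\<^sub>m k k $$ (i, j))"
    using assms fbasisD(2)[OF assms(1)] by simp
qed auto

lemma mat_of_similar:
  assumes "fbasis V k b" "fbasis V k b'" "linmap V V g"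
  shows "similar_mat (mat_of V k b g) (mat_of V k b' g)"
proof -
  have b: "\<And>i. i < k \<Longrightarrow> b i \<in> carrier V" using fbasisD(2)[OF assms(1)] .
  have b': "\<And>i. i < k \<Longrightarrow> b' i \<in> carrier V" using fbasisD(2)[OF assms(2)] .
  let ?M = "mat_of V k b g" and ?M' = "mat_of V k b' g"
  \<comment> \<open>Column j of \<open>P\<close> holds the coordinates of \<open>b' j\<close> with
    respect to \<open>b\<close>, and \<open>Q\<close> goes the other way. They are mutually inverse
    by \<open>inv\<close>, and ?M P = P ?M' because both sides describe \<open>g (b' j)\<close> in
    the basis \<open>b\<close>.\<close>
  define P where "P = mat k k (\<lambda>(i, j). coord V k b (b' j) i)"
  define Q where "Q = mat k k (\<lambda>(i, j). coord V k b' (b j) i)"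
  have PQc: "P \<in> carrier_mat k k" "Q \<in> carrier_mat k k" by (auto simp: P_def Q_def)
  have tr: "lc V k e' c = lc V k e (\<lambda>i. \<Sum>j<k. coord V k e (e' j) i * c j)"
    if e: "fbasis V k e" and e': "\<And>i. i < k \<Longrightarrow> e' i \<in> carrier V" for e e' c
  proof -
    have "lc V k e' c = lc V k (\<lambda>j. lc V k e (coord V k e (e' j))) c"
      by (rule lc_cong) (use e e' lc_coord in auto)
    also have "\<dots> = lc V k e (\<lambda>i. \<Sum>j<k. c j * coord V k e (e' j) i)"
      by (rule lc_lc) (use fbasisD(2)[OF e] in auto)
    finally show ?thesis by (simp add: mult.commute)
  qed
  have inv: "mat k k (\<lambda>(i, j). coord V k e (e' j) i) * mat k k (\<lambda>(i, j). coord V k e' (e j) i) = 1\<^sub>m k"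
    if e: "fbasis V k e" and e': "fbasis V k e'" for e e'
  proof (rule eq_matI)
    fix i j assume "i < dim_row (1\<^sub>m k :: 'k mat)" "j < dim_col (1\<^sub>m k :: 'k mat)"
    then have ij: "i < k" "j < k" by auto
    have "e j = lc V k e' (coord V k e' (e j))" using lc_coord[OF e'] fbasisD(2)[OF e] ij by simp
    also have "\<dots> = lc V k e (\<lambda>i. \<Sum>l<k. coord V k e (e' l) i * coord V k e' (e j) l)"
      by (rule tr[OF e]) (use fbasisD(2)[OF e'] in auto)
    finally have "coord V k e (e j) i = (\<Sum>l<k. coord V k e (e' l) i * coord V k e' (e j) l)"
      by (rule coord_eqI[OF e _ ij(1)])
    then show "(mat k k (\<lambda>(i, j). coord V k e (e' j) i) * mat k k (\<lambda>(i, j). coord V k e' (e j) i)) $$ (i, j) =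
      1\<^sub>m k $$ (i, j)"
      using ij coord_basis[OF e ij] by (simp add: scalar_prod_def lessThan_atLeast0)
  qed auto
  have PQ: "P * Q = 1\<^sub>m k" "Q * P = 1\<^sub>m k"
    unfolding P_def Q_def by (rule inv[OF assms(1,2)], rule inv[OF assms(2,1)])
  have "?M * P = P * ?M'"
  proof (rule eq_matI)
    fix i j assume "i < dim_row (P * ?M')" "j < dim_col (P * ?M')"
    then have ij: "i < k" "j < k" by (auto simp: P_def)
    have "g (b' j) = lc V k b' (\<lambda>i. ?M' $$ (i, j))"
    proof -
      have "lc V k b' (\<lambda>i. ?M' $$ (i, j)) = lc V k b' (coord V k b' (g (b' j)))"
        by (rule lc_cong) (use ij b' in \<open>auto simp: mat_of_def\<close>)
      then show ?thesis using ij lc_coord[OF assms(2) linmapD(1)[OF assms(3) b'[OF ij(2)]]] by simp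
    qed
    also have "\<dots> = lc V k b (\<lambda>i. \<Sum>l<k. coord V k b (b' l) i * ?M' $$ (l, j))"
      by (rule tr[OF assms(1)]) (use b' in auto)
    finally have 1: "coord V k b (g (b' j)) i = (\<Sum>l<k. coord V k b (b' l) i * ?M' $$ (l, j))"
      by (rule coord_eqI[OF assms(1) _ ij(1)])
    have "g (b' j) = lc V k b (\<lambda>i. \<Sum>l<k. ?M $$ (i, l) * coord V k b (b' j) l)"
      using mat_of_apply[OF assms(1,3), of "coord V k b (b' j)"] lc_coord[OF assms(1)] b' ij by simp
    from coord_eqI[OF assms(1) this ij(1)] 1
    show "(?M * P) $$ (i, j) = (P * ?M') $$ (i, j)"
      using ij by (simp add: P_def scalar_prod_def lessThan_atLeast0)
  qed (auto simp: P_def)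
  then have "P * ?M' * Q = ?M * (P * Q)"
    using assoc_mult_mat[OF mat_of_carrier(1) PQc, of V b g] by simp
  then have "?M = P * ?M' * Q" using PQ by simp
  with PQ PQc show ?thesis
    unfolding similar_mat_def similar_mat_wit_def by (intro exI[of _ P] exI[of _ Q]) (auto simp: Let_def)
qed

end

subsection \<open>Simple algebras and Wedderburn's theorem\<close>

text \<open>These are the maps x \<mapsto> \<Sum> p_i x q_i. Their values at x make up the two-sided
  ideal generated by x, so ideals can be handled through explicit operators.\<close>

inductive_set mult_ops :: "('a, 'm) ring_scheme \<Rightarrow> ('a \<Rightarrow> 'a) set" for B where
  mult: "p \<in> carrier B \<Longrightarrow> q \<in> carrier B \<Longrightarrow> (\<lambda>x. p \<otimes>\<^bsub>B\<^esub> x \<otimes>\<^bsub>B\<^esub> q) \<in> mult_ops B"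
| add: "E \<in> mult_ops B \<Longrightarrow> E' \<in> mult_ops B \<Longrightarrow> (\<lambda>x. E x \<oplus>\<^bsub>B\<^esub> E' x) \<in> mult_ops B"

text \<open>Simplicity in the form that the ideal generated by any nonzero element contains \<open>1\<close>.\<close>

definition simple_ring :: "('a, 'm) ring_scheme \<Rightarrow> bool" where
  "simple_ring B \<longleftrightarrow> \<one>\<^bsub>B\<^esub> \<noteq> \<zero>\<^bsub>B\<^esub> \<and>
     (\<forall>x\<in>carrier B. x \<noteq> \<zero>\<^bsub>B\<^esub> \<longrightarrow> (\<exists>E\<in>mult_ops B. E x = \<one>\<^bsub>B\<^esub>))"

context ring
begin

lemma mult_ops_closed: "E \<in> mult_ops R \<Longrightarrow> x \<in> carrier R \<Longrightarrow> E x \<in> carrier R"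
  by (induction rule: mult_ops.induct) auto

lemma mult_ops_sandwich_zero:
  assumes "E \<in> mult_ops R" "x \<in> carrier R" "u \<in> carrier R" "v \<in> carrier R"
    "\<And>p q. p \<in> carrier R \<Longrightarrow> q \<in> carrier R \<Longrightarrow> u \<otimes> (p \<otimes> x \<otimes> q) \<otimes> v = \<zero>"
  shows "u \<otimes> E x \<otimes> v = \<zero>"
  using assms(1)
proof induction
  case (mult p q)
  then show ?case using assms by simp
next
  case (add E E')
  then show ?case using assms by (simp add: r_distr l_distr mult_ops_closed)
qed

text \<open>If u p x q v were zero for all p and q, then u E(x) v would be zero for every
  multiplication operator E, and one with E(x) = 1 would give u v = 0. In this way any nonzero x can
  be used to link u with v.\<close>

lemma simple_ring_sandwich:
  assumes "simple_ring R" "x \<in> carrier R" "x \<noteq> \<zero>" "u \<in> carrier R" "v \<in> carrier R" "u \<otimes> v \<noteq> \<zero>"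
  obtains p q where "p \<in> carrier R" "q \<in> carrier R" "u \<otimes> (p \<otimes> x \<otimes> q) \<otimes> v \<noteq> \<zero>"
proof -
  obtain E where E: "E \<in> mult_ops R" "E x = \<one>" using assms by (auto simp: simple_ring_def)
  have "\<exists>p q. p \<in> carrier R \<and> q \<in> carrier R \<and> u \<otimes> (p \<otimes> x \<otimes> q) \<otimes> v \<noteq> \<zero>"
  proof (rule ccontr)
    assume "\<not> ?thesis"
    then have "u \<otimes> E x \<otimes> v = \<zero>"
      by (intro mult_ops_sandwich_zero[OF E(1) assms(2,4,5)]) blast
    then show False using E(2) assms(4-6) by simp
  qed
  with that show ?thesis by auto
qed

end

text \<open>Here \<open>f i\<close> and \<open>c j\<close> play the roles of the matrix units \<open>E\<^sub>i\<^sub>0\<close> and \<open>E\<^sub>0\<^sub>j\<close>, and the corner \<open>e B e\<close> is the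
  division algebra of which \<open>B\<close> is a matrix algebra.\<close>

locale mu_system = ring B for B (structure) +
  fixes m :: nat and e and f c :: "nat \<Rightarrow> 'a"
  assumes e_closed [simp]: "e \<in> carrier B"
    and e_idem [simp]: "e \<otimes> e = e"
    and e_nonzero: "e \<noteq> \<zero>"
    and f_closed [simp]: "i < m \<Longrightarrow> f i \<in> carrier B"
    and c_closed [simp]: "i < m \<Longrightarrow> c i \<in> carrier B"
    and f_e [simp]: "i < m \<Longrightarrow> f i \<otimes> e = f i"
    and e_c [simp]: "i < m \<Longrightarrow> e \<otimes> c i = c i"
    and c_f: "i < m \<Longrightarrow> j < m \<Longrightarrow> c i \<otimes> f j = (if i = j then e else \<zero>)"
    and sum_f_c: "(\<Oplus>i\<in>{..<m}. f i \<otimes> c i) = \<one>"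
    and corner_inverse: "x \<in> carrier B \<Longrightarrow> e \<otimes> x \<otimes> e = x \<Longrightarrow> x \<noteq> \<zero> \<Longrightarrow>
      \<exists>y\<in>carrier B. e \<otimes> y \<otimes> e = y \<and> x \<otimes> y = e \<and> y \<otimes> x = e"
begin

lemma m_pos: "0 < m"
proof (rule ccontr)
  assume "\<not> 0 < m"
  then have "\<one> = \<zero>" using sum_f_c by simp
  then have "\<one> \<otimes> e = \<zero> \<otimes> e" by simp
  then show False using e_nonzero by simp
qed

lemma corner_e:
  assumes "x \<in> carrier B" "e \<otimes> x \<otimes> e = x"
  shows "e \<otimes> x = x" "x \<otimes> e = x"
proof -
  have "e \<otimes> (e \<otimes> x \<otimes> e) = e \<otimes> e \<otimes> x \<otimes> e" using assms(1) by (simp add: m_assoc del: e_idem)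
  then show "e \<otimes> x = x" using assms by simp
  have "e \<otimes> x \<otimes> e \<otimes> e = e \<otimes> x \<otimes> (e \<otimes> e)" using assms(1) by (simp add: m_assoc del: e_idem)
  then show "x \<otimes> e = x" using assms by simp
qed

lemma corner_mult:
  assumes "x \<in> carrier B" "e \<otimes> x \<otimes> e = x" "y \<in> carrier B" "e \<otimes> y \<otimes> e = y"
  shows "e \<otimes> (x \<otimes> y) \<otimes> e = x \<otimes> y"
proof -
  have "e \<otimes> (x \<otimes> y) \<otimes> e = (e \<otimes> x) \<otimes> (y \<otimes> e)" using assms(1,3) by (simp add: m_assoc)
  then show ?thesis using corner_e(1)[OF assms(1,2)] corner_e(2)[OF assms(3,4)] by simp
qed

lemma corner_cxf:
  assumes "x \<in> carrier B" "i < m" "j < m"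
  shows "e \<otimes> (c i \<otimes> x \<otimes> f j) \<otimes> e = c i \<otimes> x \<otimes> f j"
proof -
  have "e \<otimes> (c i \<otimes> x \<otimes> f j) \<otimes> e = (e \<otimes> c i) \<otimes> x \<otimes> (f j \<otimes> e)"
    using assms by (simp add: m_assoc del: e_c f_e)
  then show ?thesis using assms by simp
qed

end

section \<open>Algebras over a field: subspaces, corners, one-sided ideals and idempotents\<close>

locale falg = assoc_algebra "class_ring :: 'k :: field ring" B for B :: "('k :: field, 'b) module"

sublocale falg \<subseteq> fvs B
  by unfold_locales

context fvs
begin

definition subsp :: "'v set \<Rightarrow> bool" where
  "subsp S \<longleftrightarrow> S \<subseteq> carrier V \<and> \<zero>\<^bsub>V\<^esub> \<in> S \<and> (\<forall>v\<in>S. \<forall>w\<in>S. v \<oplus>\<^bsub>V\<^esub> w \<in> S) \<and> (\<forall>c. \<forall>v\<in>S. c \<odot>\<^bsub>V\<^esub> v \<in> S)"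

lemma subsp_fvs: "subsp S \<Longrightarrow> fvs (V\<lparr>carrier := S\<rparr>)"
  unfolding fvs_def subsp_def
  by (intro subspace_is_vs subspace.intro submodule.intro vectorspace_axioms module_axioms) auto

lemma subsp_lc:
  assumes "subsp S" "\<And>i. i < n \<Longrightarrow> b i \<in> S"
  shows "lc (V\<lparr>carrier := S\<rparr>) n b c = lc V n b c"
proof -
  interpret S: fvs "V\<lparr>carrier := S\<rparr>" using subsp_fvs[OF assms(1)] .
  have sub: "S \<subseteq> carrier V" using assms(1) by (auto simp: subsp_def)
  show ?thesis using assms(2) sub
    by (induction n) (auto simp: S.lc_Suc lc_Suc subset_eq)
qed

lemma subsp_indep: "subsp S \<Longrightarrow> indep (V\<lparr>carrier := S\<rparr>) n b \<longleftrightarrow> indep V n b \<and> (\<forall>i<n. b i \<in> S)"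
  using subsp_lc[of S n b] by (auto simp: indep_def subsp_def)

lemma subsp_indep_mono:
  "subsp S \<Longrightarrow> subsp S' \<Longrightarrow> S \<subseteq> S' \<Longrightarrow> indep (V\<lparr>carrier := S\<rparr>) n b \<Longrightarrow> indep (V\<lparr>carrier := S'\<rparr>) n b"
  by (auto simp: subsp_indep)

lemma subsp_ex_fbasis:
  assumes "fbasis V N b" "subsp S"
  obtains n w where "fbasis (V\<lparr>carrier := S\<rparr>) n w" "n \<le> N"
  by (rule fvs.ex_fbasis[OF subsp_fvs[OF assms(2)], of N])
     (use assms indep_le_fbasis subsp_indep in blast)+

lemma lc_in_subsp: "subsp S \<Longrightarrow> (\<And>i. i < n \<Longrightarrow> b i \<in> S) \<Longrightarrow> lc V n b c \<in> S"
  using subsp_lc[of S n b c] fvs.lc_closed[OF subsp_fvs, of S n b c] by auto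

end

text \<open>For an idempotent \<open>e\<close> the carrier is e B e. Being cut out by a linear
  equation, it is a subspace at once. The unit has to change to \<open>e\<close>.\<close>

definition corner :: "('k, 'b) module \<Rightarrow> 'b \<Rightarrow> ('k, 'b) module" where
  "corner B e = B\<lparr>carrier := {x \<in> carrier B. e \<otimes>\<^bsub>B\<^esub> x \<otimes>\<^bsub>B\<^esub> e = x}, one := e\<rparr>"

text \<open>For an idempotent \<open>e\<close> the carrier is e B. The unit is simply inherited from
  \<open>B\<close> and need not lie in the carrier; the record serves as a vector space on which
  \<open>B\<close> acts from the right.\<close>

definition right_ideal :: "('k, 'b) module \<Rightarrow> 'b \<Rightarrow> ('k, 'b) module" where
  "right_ideal B e = B\<lparr>carrier := {x \<in> carrier B. e \<otimes>\<^bsub>B\<^esub> x = x}\<rparr>"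

lemma corner_simps [simp]: "carrier (corner B e) = {x \<in> carrier B. e \<otimes>\<^bsub>B\<^esub> x \<otimes>\<^bsub>B\<^esub> e = x}"
  "monoid.mult (corner B e) = monoid.mult B" "one (corner B e) = e" "ring.zero (corner B e) = ring.zero B"
  "add (corner B e) = add B" "module.smult (corner B e) = module.smult B"
  by (auto simp: corner_def)

lemma right_ideal_simps [simp]: "carrier (right_ideal B e) = {x \<in> carrier B. e \<otimes>\<^bsub>B\<^esub> x = x}"
  "monoid.mult (right_ideal B e) = monoid.mult B" "one (right_ideal B e) = one B"
  "ring.zero (right_ideal B e) = ring.zero B"
  "add (right_ideal B e) = add B" "module.smult (right_ideal B e) = module.smult B"
  by (auto simp: right_ideal_def)

lemma fvs_one_update: "fvs V \<Longrightarrow> fvs (V\<lparr>one := u\<rparr>)"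
  by (simp add: fvs_def vectorspace_def module_def module_axioms_def abelian_group_def
      abelian_monoid_def abelian_group_axioms_def)

lemma lc_one_update [simp]: "lc (V\<lparr>one := u\<rparr>) = lc V"
  by (simp add: lc_def finsum_def fun_eq_iff)

context falg
begin

lemma sc_l: "x \<in> carrier B \<Longrightarrow> y \<in> carrier B \<Longrightarrow> (k \<odot>\<^bsub>B\<^esub> x) \<otimes>\<^bsub>B\<^esub> y = k \<odot>\<^bsub>B\<^esub> (x \<otimes>\<^bsub>B\<^esub> y)"
  using smult_mult_left[of k x y] by simp

lemma sc_r: "x \<in> carrier B \<Longrightarrow> y \<in> carrier B \<Longrightarrow> x \<otimes>\<^bsub>B\<^esub> (k \<odot>\<^bsub>B\<^esub> y) = k \<odot>\<^bsub>B\<^esub> (x \<otimes>\<^bsub>B\<^esub> y)"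
  using smult_mult_right[of k x y] by simp

lemma corner_subsp: "e \<in> carrier B \<Longrightarrow> subsp {x \<in> carrier B. e \<otimes>\<^bsub>B\<^esub> x \<otimes>\<^bsub>B\<^esub> e = x}"
  by (auto simp: subsp_def A.r_distr A.l_distr sc_l sc_r)

lemma right_ideal_subsp: "e \<in> carrier B \<Longrightarrow> subsp {x \<in> carrier B. e \<otimes>\<^bsub>B\<^esub> x = x}"
  by (auto simp: subsp_def A.r_distr sc_r)

lemma corner_fvs: "e \<in> carrier B \<Longrightarrow> fvs (corner B e)"
  unfolding corner_def by (rule fvs_one_update[OF subsp_fvs[OF corner_subsp], simplified])

lemma right_ideal_fvs: "e \<in> carrier B \<Longrightarrow> fvs (right_ideal B e)"
  unfolding right_ideal_def by (rule subsp_fvs[OF right_ideal_subsp])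

lemma corner_ex_fbasis:
  assumes "fbasis B N b" "e \<in> carrier B"
  obtains n w where "fbasis (corner B e) n w"
proof -
  let ?S = "{x \<in> carrier B. e \<otimes>\<^bsub>B\<^esub> x \<otimes>\<^bsub>B\<^esub> e = x}"
  obtain n w where "fbasis (B\<lparr>carrier := ?S\<rparr>) n w"
    using subsp_ex_fbasis[OF assms(1) corner_subsp[OF assms(2)]] by blast
  then have "fbasis (B\<lparr>carrier := ?S\<rparr>\<lparr>one := e\<rparr>) n w"
    unfolding fbasis_def indep_def lc_one_update by simp
  then have "fbasis (corner B e) n w" by (simp add: corner_def)
  with that show ?thesis by blast
qed

lemma left_ideal_subsp:
  assumes a: "a \<in> carrier B"
  shows "subsp {r \<otimes>\<^bsub>B\<^esub> a | r. r \<in> carrier B}"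
  unfolding subsp_def
proof (intro conjI ballI allI)
  show "\<zero>\<^bsub>B\<^esub> \<in> {r \<otimes>\<^bsub>B\<^esub> a | r. r \<in> carrier B}" using a by (auto intro!: exI[of _ "\<zero>\<^bsub>B\<^esub>"])
next
  fix v w assume "v \<in> {r \<otimes>\<^bsub>B\<^esub> a | r. r \<in> carrier B}" "w \<in> {r \<otimes>\<^bsub>B\<^esub> a | r. r \<in> carrier B}"
  then obtain r s where "v = r \<otimes>\<^bsub>B\<^esub> a" "w = s \<otimes>\<^bsub>B\<^esub> a" "r \<in> carrier B" "s \<in> carrier B" by auto
  then show "v \<oplus>\<^bsub>B\<^esub> w \<in> {r \<otimes>\<^bsub>B\<^esub> a | r. r \<in> carrier B}"
    using a by (auto intro!: exI[of _ "r \<oplus>\<^bsub>B\<^esub> s"] simp: A.l_distr)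
next
  fix k v assume "v \<in> {r \<otimes>\<^bsub>B\<^esub> a | r. r \<in> carrier B}"
  then obtain r where "v = r \<otimes>\<^bsub>B\<^esub> a" "r \<in> carrier B" by auto
  then show "k \<odot>\<^bsub>B\<^esub> v \<in> {r \<otimes>\<^bsub>B\<^esub> a | r. r \<in> carrier B}"
    using a by (auto intro!: exI[of _ "k \<odot>\<^bsub>B\<^esub> r"] simp: sc_l)
qed (use a in auto)

text \<open>Among the left ideals B a with a \<noteq> 0, choose one of least dimension. A nonzero
  element r a of it generates a left ideal inside B a that cannot have smaller dimension; so the two
  coincide and a itself is a multiple of r a.\<close>

lemma minimal_left_ideal:
  assumes "fbasis B N b" "\<one>\<^bsub>B\<^esub> \<noteq> \<zero>\<^bsub>B\<^esub>"
  obtains a where "a \<in> carrier B" "a \<noteq> \<zero>\<^bsub>B\<^esub>"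
    "\<And>r. r \<in> carrier B \<Longrightarrow> r \<otimes>\<^bsub>B\<^esub> a \<noteq> \<zero>\<^bsub>B\<^esub> \<Longrightarrow> \<exists>s\<in>carrier B. a = s \<otimes>\<^bsub>B\<^esub> (r \<otimes>\<^bsub>B\<^esub> a)"
proof -
  let ?L = "\<lambda>a. {r \<otimes>\<^bsub>B\<^esub> a | r. r \<in> carrier B}"
  define P where "P n \<longleftrightarrow> (\<exists>a\<in>carrier B. a \<noteq> \<zero>\<^bsub>B\<^esub> \<and> (\<exists>w. fbasis (B\<lparr>carrier := ?L a\<rparr>) n w))" for n
  have ex: "\<exists>n w. fbasis (B\<lparr>carrier := ?L a\<rparr>) n w" if "a \<in> carrier B" for a
    using subsp_ex_fbasis[OF assms(1) left_ideal_subsp[OF that]] by metis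
  have "\<exists>n. P n" using ex[of "\<one>\<^bsub>B\<^esub>"] assms(2) by (fastforce simp: P_def)
  then obtain n where n: "P n" "\<And>k. P k \<Longrightarrow> n \<le> k" by (metis LeastI_ex Least_le)
  then obtain a w where a: "a \<in> carrier B" "a \<noteq> \<zero>\<^bsub>B\<^esub>" "fbasis (B\<lparr>carrier := ?L a\<rparr>) n w"
    by (auto simp: P_def)
  have "\<exists>s\<in>carrier B. a = s \<otimes>\<^bsub>B\<^esub> (r \<otimes>\<^bsub>B\<^esub> a)" if r: "r \<in> carrier B" "r \<otimes>\<^bsub>B\<^esub> a \<noteq> \<zero>\<^bsub>B\<^esub>" for r
  proof -
    let ?s = "r \<otimes>\<^bsub>B\<^esub> a"
    have s: "?s \<in> carrier B" using r a by simp
    obtain k w' where w': "fbasis (B\<lparr>carrier := ?L ?s\<rparr>) k w'" using ex[OF s] by auto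
    have sub: "?L ?s \<subseteq> ?L a"
    proof
      fix v assume "v \<in> ?L ?s"
      then obtain t where "t \<in> carrier B" "v = t \<otimes>\<^bsub>B\<^esub> ?s" by auto
      then show "v \<in> ?L a" using r a by (auto intro!: exI[of _ "t \<otimes>\<^bsub>B\<^esub> r"] simp: A.m_assoc)
    qed
    note S = left_ideal_subsp[OF s] and T = left_ideal_subsp[OF a(1)]
    have "indep (B\<lparr>carrier := ?L ?s\<rparr>) k w'" using w' by (simp add: fbasis_def)
    then have ind: "indep (B\<lparr>carrier := ?L a\<rparr>) k w'" by (rule subsp_indep_mono[OF S T sub])
    have "k \<le> n" by (rule fvs.indep_le_fbasis[OF subsp_fvs[OF T] a(3) ind])
    moreover have "n \<le> k" using n(2)[of k] s r w' by (auto simp: P_def)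
    ultimately have "k = n" by simp
    have bas: "fbasis (B\<lparr>carrier := ?L a\<rparr>) n w'"
      by (rule fvs.indep_full_fbasis[OF subsp_fvs[OF T] a(3)]) (use ind \<open>k = n\<close> in simp)
    have "a \<in> ?L a" using a by (auto intro!: exI[of _ "\<one>\<^bsub>B\<^esub>"])
    then obtain c where "a = lc (B\<lparr>carrier := ?L a\<rparr>) n w' c" using bas unfolding fbasis_def by auto
    also have w'S: "\<And>i. i < n \<Longrightarrow> w' i \<in> ?L ?s"
      using w' \<open>k = n\<close> unfolding fbasis_def indep_def by auto
    then have "lc (B\<lparr>carrier := ?L a\<rparr>) n w' c = lc B n w' c"
      by (intro subsp_lc[OF T]) (use sub in auto)
    also have "\<dots> \<in> ?L ?s" by (rule lc_in_subsp[OF S w'S])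
    finally show ?thesis by auto
  qed
  with a that show ?thesis by blast
qed

text \<open>Brauer's lemma. Let B a be minimal. Simplicity gives p with a p a \<noteq> 0, so right
  multiplication by u = p a is not zero on B a and, by minimality, injective there. An element e of
  B a with e u = u satisfies (e e - e) u = 0, hence e e = e. The final property is minimality once
  more, since s = s e lies in B a.\<close>

lemma ex_division_idempotent:
  assumes "fbasis B N b" "simple_ring B"
  obtains e where "e \<in> carrier B" "e \<noteq> \<zero>\<^bsub>B\<^esub>" "e \<otimes>\<^bsub>B\<^esub> e = e"
    "\<And>s. s \<in> carrier B \<Longrightarrow> s \<otimes>\<^bsub>B\<^esub> e = s \<Longrightarrow> s \<noteq> \<zero>\<^bsub>B\<^esub> \<Longrightarrow> \<exists>r\<in>carrier B. e = r \<otimes>\<^bsub>B\<^esub> s"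
proof -
  have 1: "\<one>\<^bsub>B\<^esub> \<noteq> \<zero>\<^bsub>B\<^esub>" using assms(2) by (simp add: simple_ring_def)
  obtain a where a: "a \<in> carrier B" "a \<noteq> \<zero>\<^bsub>B\<^esub>"
    "\<And>r. r \<in> carrier B \<Longrightarrow> r \<otimes>\<^bsub>B\<^esub> a \<noteq> \<zero>\<^bsub>B\<^esub> \<Longrightarrow> \<exists>s\<in>carrier B. a = s \<otimes>\<^bsub>B\<^esub> (r \<otimes>\<^bsub>B\<^esub> a)"
    using minimal_left_ideal[OF assms(1) 1] by blast
  obtain p q where pq: "p \<in> carrier B" "q \<in> carrier B" "a \<otimes>\<^bsub>B\<^esub> (p \<otimes>\<^bsub>B\<^esub> a \<otimes>\<^bsub>B\<^esub> q) \<otimes>\<^bsub>B\<^esub> \<one>\<^bsub>B\<^esub> \<noteq> \<zero>\<^bsub>B\<^esub>"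
    using A.simple_ring_sandwich[OF assms(2) a(1,2,1), of "\<one>\<^bsub>B\<^esub>"] a by auto
  define u where "u = p \<otimes>\<^bsub>B\<^esub> a"
  have u: "u \<in> carrier B" using pq a by (simp add: u_def)
  have "a \<otimes>\<^bsub>B\<^esub> u \<noteq> \<zero>\<^bsub>B\<^esub>"
  proof
    assume "a \<otimes>\<^bsub>B\<^esub> u = \<zero>\<^bsub>B\<^esub>"
    moreover have "a \<otimes>\<^bsub>B\<^esub> (p \<otimes>\<^bsub>B\<^esub> a \<otimes>\<^bsub>B\<^esub> q) \<otimes>\<^bsub>B\<^esub> \<one>\<^bsub>B\<^esub> = (a \<otimes>\<^bsub>B\<^esub> u) \<otimes>\<^bsub>B\<^esub> q"
      using a pq by (simp add: u_def A.m_assoc)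
    ultimately show False using pq by simp
  qed
  then have au: "a \<otimes>\<^bsub>B\<^esub> u \<noteq> \<zero>\<^bsub>B\<^esub>" .
  have "(a \<otimes>\<^bsub>B\<^esub> p) \<otimes>\<^bsub>B\<^esub> a = a \<otimes>\<^bsub>B\<^esub> u" using a pq by (simp add: u_def A.m_assoc)
  then obtain r where r: "r \<in> carrier B" "a = r \<otimes>\<^bsub>B\<^esub> (a \<otimes>\<^bsub>B\<^esub> u)"
    using a(3)[of "a \<otimes>\<^bsub>B\<^esub> p"] au a pq by auto
  \<comment> \<open>Chosen inside B a such that e u = p (r a u) = p a = u.\<close>
  define e where "e = p \<otimes>\<^bsub>B\<^esub> r \<otimes>\<^bsub>B\<^esub> a"
  have e: "e \<in> carrier B" using pq r a by (simp add: e_def)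
  have eu: "e \<otimes>\<^bsub>B\<^esub> u = u"
  proof -
    have "e \<otimes>\<^bsub>B\<^esub> u = p \<otimes>\<^bsub>B\<^esub> (r \<otimes>\<^bsub>B\<^esub> (a \<otimes>\<^bsub>B\<^esub> u))" using pq r(1) a u by (simp add: e_def A.m_assoc)
    then show ?thesis using r(2) by (simp add: u_def)
  qed
  have e0: "e \<noteq> \<zero>\<^bsub>B\<^esub>" using eu au u a by auto
  have idem: "e \<otimes>\<^bsub>B\<^esub> e = e"
  proof (rule ccontr)
    assume ne: "e \<otimes>\<^bsub>B\<^esub> e \<noteq> e"
    \<comment> \<open>The difference e e - e equals t a, so it lies in B a, and right multiplication
      by u kills it. Minimality writes a as s (t a), which would force a u = 0.\<close>
    define t where "t = (e \<ominus>\<^bsub>B\<^esub> \<one>\<^bsub>B\<^esub>) \<otimes>\<^bsub>B\<^esub> (p \<otimes>\<^bsub>B\<^esub> r)"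
    have t: "t \<in> carrier B" using e pq r by (simp add: t_def)
    have "t \<otimes>\<^bsub>B\<^esub> a = (e \<ominus>\<^bsub>B\<^esub> \<one>\<^bsub>B\<^esub>) \<otimes>\<^bsub>B\<^esub> e" using e pq r(1) a by (simp add: t_def e_def A.m_assoc)
    also have "\<dots> = e \<otimes>\<^bsub>B\<^esub> e \<ominus>\<^bsub>B\<^esub> e" using e by (simp add: M.minus_eq A.l_distr A.l_minus)
    finally have ta: "t \<otimes>\<^bsub>B\<^esub> a = e \<otimes>\<^bsub>B\<^esub> e \<ominus>\<^bsub>B\<^esub> e" .
    then have "t \<otimes>\<^bsub>B\<^esub> a \<noteq> \<zero>\<^bsub>B\<^esub>" using ne e by simp
    then obtain s where s: "s \<in> carrier B" "a = s \<otimes>\<^bsub>B\<^esub> (t \<otimes>\<^bsub>B\<^esub> a)" using a(3)[OF t] by auto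
    have "(t \<otimes>\<^bsub>B\<^esub> a) \<otimes>\<^bsub>B\<^esub> u = e \<otimes>\<^bsub>B\<^esub> (e \<otimes>\<^bsub>B\<^esub> u) \<ominus>\<^bsub>B\<^esub> e \<otimes>\<^bsub>B\<^esub> u"
      unfolding ta using e u by (simp add: M.minus_eq A.l_distr A.l_minus A.m_assoc)
    then have tau: "(t \<otimes>\<^bsub>B\<^esub> a) \<otimes>\<^bsub>B\<^esub> u = \<zero>\<^bsub>B\<^esub>" using eu u e by (simp add: M.minus_eq M.r_neg)
    have "a \<otimes>\<^bsub>B\<^esub> u = (s \<otimes>\<^bsub>B\<^esub> (t \<otimes>\<^bsub>B\<^esub> a)) \<otimes>\<^bsub>B\<^esub> u" using s(2) by simp
    also have "\<dots> = s \<otimes>\<^bsub>B\<^esub> ((t \<otimes>\<^bsub>B\<^esub> a) \<otimes>\<^bsub>B\<^esub> u)" using s(1) t a u by (simp add: A.m_assoc)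
    finally show False using au tau s(1) by simp
  qed
  have "\<exists>v\<in>carrier B. e = v \<otimes>\<^bsub>B\<^esub> s" if s: "s \<in> carrier B" "s \<otimes>\<^bsub>B\<^esub> e = s" "s \<noteq> \<zero>\<^bsub>B\<^esub>" for s
  proof -
    have "(s \<otimes>\<^bsub>B\<^esub> (p \<otimes>\<^bsub>B\<^esub> r)) \<otimes>\<^bsub>B\<^esub> a = s \<otimes>\<^bsub>B\<^esub> e" using s(1) pq r(1) a by (simp add: e_def A.m_assoc)
    then obtain v where v: "v \<in> carrier B" "a = v \<otimes>\<^bsub>B\<^esub> s"
      using a(3)[of "s \<otimes>\<^bsub>B\<^esub> (p \<otimes>\<^bsub>B\<^esub> r)"] s pq r by auto
    then have "e = (p \<otimes>\<^bsub>B\<^esub> r \<otimes>\<^bsub>B\<^esub> v) \<otimes>\<^bsub>B\<^esub> s"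
      using pq r(1) s(1) by (simp add: e_def A.m_assoc)
    then show ?thesis using pq r v by auto
  qed
  with e e0 idem that show ?thesis by blast
qed

text \<open>Hypothesis \<open>l\<close> gives left inverses r, and e r e is then a left inverse
  inside the corner. A left inverse y of x has in turn a left inverse z, and z = z (y x) = x shows
  that y is inverse to x on both sides.\<close>

lemma division_corner_inverse:
  assumes e: "e \<in> carrier B" "e \<noteq> \<zero>\<^bsub>B\<^esub>" "e \<otimes>\<^bsub>B\<^esub> e = e"
    and l: "\<And>s. s \<in> carrier B \<Longrightarrow> s \<otimes>\<^bsub>B\<^esub> e = s \<Longrightarrow> s \<noteq> \<zero>\<^bsub>B\<^esub> \<Longrightarrow> \<exists>r\<in>carrier B. e = r \<otimes>\<^bsub>B\<^esub> s"
    and x: "x \<in> carrier B" "e \<otimes>\<^bsub>B\<^esub> x \<otimes>\<^bsub>B\<^esub> e = x" "x \<noteq> \<zero>\<^bsub>B\<^esub>"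
  shows "\<exists>y\<in>carrier B. e \<otimes>\<^bsub>B\<^esub> y \<otimes>\<^bsub>B\<^esub> e = y \<and> x \<otimes>\<^bsub>B\<^esub> y = e \<and> y \<otimes>\<^bsub>B\<^esub> x = e"
proof -
  have left: "\<exists>y\<in>carrier B. e \<otimes>\<^bsub>B\<^esub> y = y \<and> y \<otimes>\<^bsub>B\<^esub> e = y \<and> y \<otimes>\<^bsub>B\<^esub> x = e"
    if x: "x \<in> carrier B" "e \<otimes>\<^bsub>B\<^esub> x = x" "x \<otimes>\<^bsub>B\<^esub> e = x" "x \<noteq> \<zero>\<^bsub>B\<^esub>" for x
  proof -
    obtain r where r: "r \<in> carrier B" "e = r \<otimes>\<^bsub>B\<^esub> x" using l[OF x(1,3,4)] by auto
    have "e \<otimes>\<^bsub>B\<^esub> (e \<otimes>\<^bsub>B\<^esub> r \<otimes>\<^bsub>B\<^esub> e) = (e \<otimes>\<^bsub>B\<^esub> e) \<otimes>\<^bsub>B\<^esub> r \<otimes>\<^bsub>B\<^esub> e"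
      "(e \<otimes>\<^bsub>B\<^esub> r \<otimes>\<^bsub>B\<^esub> e) \<otimes>\<^bsub>B\<^esub> e = e \<otimes>\<^bsub>B\<^esub> r \<otimes>\<^bsub>B\<^esub> (e \<otimes>\<^bsub>B\<^esub> e)"
      "(e \<otimes>\<^bsub>B\<^esub> r \<otimes>\<^bsub>B\<^esub> e) \<otimes>\<^bsub>B\<^esub> x = e \<otimes>\<^bsub>B\<^esub> (r \<otimes>\<^bsub>B\<^esub> (e \<otimes>\<^bsub>B\<^esub> x))"
      using e(1) r(1) x(1) by (simp_all add: A.m_assoc)
    then have "e \<otimes>\<^bsub>B\<^esub> (e \<otimes>\<^bsub>B\<^esub> r \<otimes>\<^bsub>B\<^esub> e) = e \<otimes>\<^bsub>B\<^esub> r \<otimes>\<^bsub>B\<^esub> e"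
      "(e \<otimes>\<^bsub>B\<^esub> r \<otimes>\<^bsub>B\<^esub> e) \<otimes>\<^bsub>B\<^esub> e = e \<otimes>\<^bsub>B\<^esub> r \<otimes>\<^bsub>B\<^esub> e"
      "(e \<otimes>\<^bsub>B\<^esub> r \<otimes>\<^bsub>B\<^esub> e) \<otimes>\<^bsub>B\<^esub> x = e"
      unfolding e(3) x(2) r(2)[symmetric] e(3) by simp_all
    then show ?thesis using e r(1) by (intro bexI[of _ "e \<otimes>\<^bsub>B\<^esub> r \<otimes>\<^bsub>B\<^esub> e"]) auto
  qed
  have ex: "e \<otimes>\<^bsub>B\<^esub> x = x" "x \<otimes>\<^bsub>B\<^esub> e = x"
  proof -
    have "e \<otimes>\<^bsub>B\<^esub> (e \<otimes>\<^bsub>B\<^esub> x \<otimes>\<^bsub>B\<^esub> e) = (e \<otimes>\<^bsub>B\<^esub> e) \<otimes>\<^bsub>B\<^esub> x \<otimes>\<^bsub>B\<^esub> e"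
      "(e \<otimes>\<^bsub>B\<^esub> x \<otimes>\<^bsub>B\<^esub> e) \<otimes>\<^bsub>B\<^esub> e = e \<otimes>\<^bsub>B\<^esub> x \<otimes>\<^bsub>B\<^esub> (e \<otimes>\<^bsub>B\<^esub> e)"
      using e(1) x(1) by (simp_all add: A.m_assoc)
    then show "e \<otimes>\<^bsub>B\<^esub> x = x" "x \<otimes>\<^bsub>B\<^esub> e = x" unfolding x(2) e(3) by auto
  qed
  obtain y where y: "y \<in> carrier B" "e \<otimes>\<^bsub>B\<^esub> y = y" "y \<otimes>\<^bsub>B\<^esub> e = y" "y \<otimes>\<^bsub>B\<^esub> x = e"
    using left[OF x(1) ex x(3)] by auto
  have "y \<noteq> \<zero>\<^bsub>B\<^esub>" using y(4) e(2) x(1) by auto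
  then obtain z where z: "z \<in> carrier B" "z \<otimes>\<^bsub>B\<^esub> e = z" "z \<otimes>\<^bsub>B\<^esub> y = e" using left[OF y(1-3)] by auto
  have "z = z \<otimes>\<^bsub>B\<^esub> (y \<otimes>\<^bsub>B\<^esub> x)" using z y by simp
  also have "\<dots> = (z \<otimes>\<^bsub>B\<^esub> y) \<otimes>\<^bsub>B\<^esub> x" using z(1) y(1) x(1) by (simp add: A.m_assoc)
  also have "\<dots> = x" using z(3) ex by simp
  finally have "x \<otimes>\<^bsub>B\<^esub> y = e" using z(3) by simp
  with y show ?thesis by (intro bexI[of _ y]) auto
qed

text \<open>Take a system f_i, c_i that satisfies all conditions except that \<Sum> f_i c_i = 1, and
  make it as long as possible. If the sum were some s \<noteq> 1, then g = 1 - s would be a nonzero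
  idempotent annihilated by all c_i and f_i; simplicity links e with g, and this yields one more
  pair.\<close>

theorem ex_mu_system:
  assumes "fbasis B N b" "simple_ring B"
  obtains m e f c where "mu_system B m e f c"
proof -
  obtain e where e: "e \<in> carrier B" "e \<noteq> \<zero>\<^bsub>B\<^esub>" "e \<otimes>\<^bsub>B\<^esub> e = e"
    and l: "\<And>s. s \<in> carrier B \<Longrightarrow> s \<otimes>\<^bsub>B\<^esub> e = s \<Longrightarrow> s \<noteq> \<zero>\<^bsub>B\<^esub> \<Longrightarrow> \<exists>r\<in>carrier B. e = r \<otimes>\<^bsub>B\<^esub> s"
    using ex_division_idempotent[OF assms] by blast
  have inv: "\<exists>y\<in>carrier B. e \<otimes>\<^bsub>B\<^esub> y \<otimes>\<^bsub>B\<^esub> e = y \<and> x \<otimes>\<^bsub>B\<^esub> y = e \<and> y \<otimes>\<^bsub>B\<^esub> x = e"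
    if "x \<in> carrier B" "e \<otimes>\<^bsub>B\<^esub> x \<otimes>\<^bsub>B\<^esub> e = x" "x \<noteq> \<zero>\<^bsub>B\<^esub>" for x
    by (rule division_corner_inverse[OF e _ that]) (rule l)
  define Q where "Q m f c \<longleftrightarrow> (\<forall>i<m. f i \<in> carrier B \<and> c i \<in> carrier B \<and> f i \<otimes>\<^bsub>B\<^esub> e = f i \<and>
    e \<otimes>\<^bsub>B\<^esub> c i = c i) \<and> (\<forall>i<m. \<forall>j<m. c i \<otimes>\<^bsub>B\<^esub> f j = (if i = j then e else \<zero>\<^bsub>B\<^esub>))" for m :: nat and f c
  \<comment> \<open>Multiplying a relation \<Sum> k_i c_i = 0 by f_j from the right leaves k_j e =
    0. So the c_i are linearly independent over the ground field and their number is at most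
    \<open>N\<close>.\<close>
  have bound: "m \<le> N" if "Q m f c" for m f c
  proof -
    have fc: "\<And>i. i < m \<Longrightarrow> f i \<in> carrier B" "\<And>i. i < m \<Longrightarrow> c i \<in> carrier B"
      "\<And>i j. i < m \<Longrightarrow> j < m \<Longrightarrow> c i \<otimes>\<^bsub>B\<^esub> f j = (if i = j then e else \<zero>\<^bsub>B\<^esub>)"
      using that by (auto simp: Q_def)
    have "k j = 0" if k: "lc B m c k = \<zero>\<^bsub>B\<^esub>" and j: "j < m" for k j
    proof -
      have lin: "linmap B B (\<lambda>x. x \<otimes>\<^bsub>B\<^esub> f j)" using fc(1)[OF j] by (auto simp: linmap_def A.l_distr sc_l)
      have "lc B m c k \<otimes>\<^bsub>B\<^esub> f j = lc B m (\<lambda>i. c i \<otimes>\<^bsub>B\<^esub> f j) k"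
        by (rule linmap_lc[OF fvs_axioms fvs_axioms lin]) (use fc in auto)
      also have "\<dots> = k j \<odot>\<^bsub>B\<^esub> (c j \<otimes>\<^bsub>B\<^esub> f j)"
        unfolding lc_def by (rule M.finsum_eq_single) (use fc j e in auto)
      finally have "k j \<odot>\<^bsub>B\<^esub> e = \<zero>\<^bsub>B\<^esub>" using k fc j by simp
      then show ?thesis using sc_eq_zero e by blast
    qed
    then have "indep B m c" using fc by (auto simp: indep_def)
    then show ?thesis using indep_le_fbasis[OF assms(1)] by blast
  qed
  have "\<exists>f c. Q 0 f c" by (simp add: Q_def)
  then obtain m where m: "\<exists>f c. Q m f c" "\<And>k. \<exists>f c. Q k f c \<Longrightarrow> k \<le> m"
    using bound Nat.ex_has_greatest_nat[of "\<lambda>m. \<exists>f c. Q m f c" 0 N] by blast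
  then obtain f c where Q: "Q m f c" by blast
  have fc [simp]: "\<And>i. i < m \<Longrightarrow> f i \<in> carrier B" "\<And>i. i < m \<Longrightarrow> c i \<in> carrier B"
    and fe: "\<And>i. i < m \<Longrightarrow> f i \<otimes>\<^bsub>B\<^esub> e = f i" and ec: "\<And>i. i < m \<Longrightarrow> e \<otimes>\<^bsub>B\<^esub> c i = c i"
    and cf: "\<And>i j. i < m \<Longrightarrow> j < m \<Longrightarrow> c i \<otimes>\<^bsub>B\<^esub> f j = (if i = j then e else \<zero>\<^bsub>B\<^esub>)"
    using Q by (auto simp: Q_def)
  define s where "s = (\<Oplus>\<^bsub>B\<^esub>i\<in>{..<m}. f i \<otimes>\<^bsub>B\<^esub> c i)"
  have s: "s \<in> carrier B" unfolding s_def by (rule M.finsum_closed) auto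
  have "s = \<one>\<^bsub>B\<^esub>"
  proof (rule ccontr)
    assume "s \<noteq> \<one>\<^bsub>B\<^esub>"
    define g where "g = \<one>\<^bsub>B\<^esub> \<ominus>\<^bsub>B\<^esub> s"
    have g: "g \<in> carrier B" using s by (simp add: g_def)
    have g0: "g \<noteq> \<zero>\<^bsub>B\<^esub>" using \<open>s \<noteq> \<one>\<^bsub>B\<^esub>\<close> s by (auto simp: g_def)
    have cg: "c j \<otimes>\<^bsub>B\<^esub> g = \<zero>\<^bsub>B\<^esub>" if j: "j < m" for j
    proof -
      have "c j \<otimes>\<^bsub>B\<^esub> s = (\<Oplus>\<^bsub>B\<^esub>i\<in>{..<m}. c j \<otimes>\<^bsub>B\<^esub> (f i \<otimes>\<^bsub>B\<^esub> c i))"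
        unfolding s_def using j by (intro A.finsum_rdistr) auto
      also have "\<dots> = c j \<otimes>\<^bsub>B\<^esub> (f j \<otimes>\<^bsub>B\<^esub> c j)"
        by (rule M.finsum_eq_single[OF j]) (use j cf e(1) in \<open>auto simp: A.m_assoc[symmetric]\<close>)
      also have "\<dots> = c j" using j cf ec by (simp add: A.m_assoc[symmetric])
      finally show ?thesis using j s by (simp add: g_def M.minus_eq A.r_distr A.r_minus M.r_neg)
    qed
    have gf: "g \<otimes>\<^bsub>B\<^esub> f j = \<zero>\<^bsub>B\<^esub>" if j: "j < m" for j
    proof -
      have "s \<otimes>\<^bsub>B\<^esub> f j = (\<Oplus>\<^bsub>B\<^esub>i\<in>{..<m}. (f i \<otimes>\<^bsub>B\<^esub> c i) \<otimes>\<^bsub>B\<^esub> f j)"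
        unfolding s_def using j by (intro A.finsum_ldistr) auto
      also have "\<dots> = (f j \<otimes>\<^bsub>B\<^esub> c j) \<otimes>\<^bsub>B\<^esub> f j"
        by (rule M.finsum_eq_single[OF j]) (use j cf e(1) in \<open>auto simp: A.m_assoc\<close>)
      also have "\<dots> = f j" using j cf fe by (simp add: A.m_assoc)
      finally show ?thesis using j s by (simp add: g_def M.minus_eq A.l_distr A.l_minus M.r_neg)
    qed
    have gg: "g \<otimes>\<^bsub>B\<^esub> g = g"
    proof -
      have "s \<otimes>\<^bsub>B\<^esub> g = (\<Oplus>\<^bsub>B\<^esub>i\<in>{..<m}. (f i \<otimes>\<^bsub>B\<^esub> c i) \<otimes>\<^bsub>B\<^esub> g)"
        unfolding s_def using g by (intro A.finsum_ldistr) auto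
      also have "\<dots> = \<zero>\<^bsub>B\<^esub>" by (rule M.finsum_eq_zero) (use cg g in \<open>auto simp: A.m_assoc\<close>)
      finally have "s \<otimes>\<^bsub>B\<^esub> g = \<zero>\<^bsub>B\<^esub>" .
      moreover have "(\<one>\<^bsub>B\<^esub> \<ominus>\<^bsub>B\<^esub> s) \<otimes>\<^bsub>B\<^esub> g = g \<ominus>\<^bsub>B\<^esub> s \<otimes>\<^bsub>B\<^esub> g"
        using s g by (simp add: M.minus_eq A.l_distr A.l_minus)
      ultimately have "(\<one>\<^bsub>B\<^esub> \<ominus>\<^bsub>B\<^esub> s) \<otimes>\<^bsub>B\<^esub> g = g" using g by (simp add: M.minus_eq)
      then show ?thesis by (simp only: g_def[symmetric])
    qed
    obtain p q where pq: "p \<in> carrier B" "q \<in> carrier B"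
      "e \<otimes>\<^bsub>B\<^esub> (p \<otimes>\<^bsub>B\<^esub> g \<otimes>\<^bsub>B\<^esub> q) \<otimes>\<^bsub>B\<^esub> e \<noteq> \<zero>\<^bsub>B\<^esub>"
      using A.simple_ring_sandwich[OF assms(2) g g0 e(1) e(1)] e by auto
    let ?x = "e \<otimes>\<^bsub>B\<^esub> (p \<otimes>\<^bsub>B\<^esub> g \<otimes>\<^bsub>B\<^esub> q) \<otimes>\<^bsub>B\<^esub> e"
    have x: "?x \<in> carrier B" using e(1) pq(1,2) g by simp
    have "e \<otimes>\<^bsub>B\<^esub> ?x \<otimes>\<^bsub>B\<^esub> e = (e \<otimes>\<^bsub>B\<^esub> e) \<otimes>\<^bsub>B\<^esub> (p \<otimes>\<^bsub>B\<^esub> g \<otimes>\<^bsub>B\<^esub> q) \<otimes>\<^bsub>B\<^esub> (e \<otimes>\<^bsub>B\<^esub> e)"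
      using e(1) pq(1,2) g by (simp add: A.m_assoc)
    then have "e \<otimes>\<^bsub>B\<^esub> ?x \<otimes>\<^bsub>B\<^esub> e = ?x" by (simp only: e(3))
    then obtain d where d: "d \<in> carrier B" "e \<otimes>\<^bsub>B\<^esub> d \<otimes>\<^bsub>B\<^esub> e = d" "?x \<otimes>\<^bsub>B\<^esub> d = e"
      using inv[OF x] pq(3) by blast
    have de: "d \<otimes>\<^bsub>B\<^esub> e = d"
    proof -
      have "(e \<otimes>\<^bsub>B\<^esub> d \<otimes>\<^bsub>B\<^esub> e) \<otimes>\<^bsub>B\<^esub> e = e \<otimes>\<^bsub>B\<^esub> d \<otimes>\<^bsub>B\<^esub> (e \<otimes>\<^bsub>B\<^esub> e)" using e(1) d(1) by (simp add: A.m_assoc)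
      then show ?thesis using d(2) e(3) by simp
    qed
    \<comment> \<open>The element e p g q e of the corner is nonzero and has the inverse d. The new
      pair splits it at the idempotent g, with d absorbed into f', so that c' f' = e p g g q e d =
      e. The factor g makes all products with the old pairs vanish.\<close>
    define c' where "c' = c(m := e \<otimes>\<^bsub>B\<^esub> p \<otimes>\<^bsub>B\<^esub> g)"
    define f' where "f' = f(m := g \<otimes>\<^bsub>B\<^esub> q \<otimes>\<^bsub>B\<^esub> e \<otimes>\<^bsub>B\<^esub> d)"
    have "(e \<otimes>\<^bsub>B\<^esub> p \<otimes>\<^bsub>B\<^esub> g) \<otimes>\<^bsub>B\<^esub> (g \<otimes>\<^bsub>B\<^esub> q \<otimes>\<^bsub>B\<^esub> e \<otimes>\<^bsub>B\<^esub> d) = e \<otimes>\<^bsub>B\<^esub> (p \<otimes>\<^bsub>B\<^esub> (g \<otimes>\<^bsub>B\<^esub> g) \<otimes>\<^bsub>B\<^esub> q) \<otimes>\<^bsub>B\<^esub> e \<otimes>\<^bsub>B\<^esub> d"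
      using e(1) pq(1,2) g d(1) by (simp add: A.m_assoc)
    then have 1: "c' m \<otimes>\<^bsub>B\<^esub> f' m = e" using gg d(3) by (simp add: c'_def f'_def)
    have 2: "c' i \<otimes>\<^bsub>B\<^esub> f' m = \<zero>\<^bsub>B\<^esub>" if "i < m" for i
    proof -
      have "c i \<otimes>\<^bsub>B\<^esub> (g \<otimes>\<^bsub>B\<^esub> q \<otimes>\<^bsub>B\<^esub> e \<otimes>\<^bsub>B\<^esub> d) = (c i \<otimes>\<^bsub>B\<^esub> g) \<otimes>\<^bsub>B\<^esub> (q \<otimes>\<^bsub>B\<^esub> e \<otimes>\<^bsub>B\<^esub> d)"
        using that e(1) pq(1,2) g d(1) by (simp add: A.m_assoc)
      then show ?thesis using that cg pq e d by (simp add: c'_def f'_def)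
    qed
    have 3: "c' m \<otimes>\<^bsub>B\<^esub> f' j = \<zero>\<^bsub>B\<^esub>" if "j < m" for j
    proof -
      have "(e \<otimes>\<^bsub>B\<^esub> p \<otimes>\<^bsub>B\<^esub> g) \<otimes>\<^bsub>B\<^esub> f j = (e \<otimes>\<^bsub>B\<^esub> p) \<otimes>\<^bsub>B\<^esub> (g \<otimes>\<^bsub>B\<^esub> f j)"
        using that e(1) pq(1,2) g by (simp add: A.m_assoc)
      then show ?thesis using that gf pq e by (simp add: c'_def f'_def)
    qed
    have 4: "c' m \<in> carrier B" "f' m \<in> carrier B" using e(1) pq(1,2) g d(1) by (auto simp: c'_def f'_def)
    have 5: "f' m \<otimes>\<^bsub>B\<^esub> e = f' m"
    proof -
      have "f' m \<otimes>\<^bsub>B\<^esub> e = g \<otimes>\<^bsub>B\<^esub> q \<otimes>\<^bsub>B\<^esub> e \<otimes>\<^bsub>B\<^esub> (d \<otimes>\<^bsub>B\<^esub> e)"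
        using e(1) pq(1,2) g d(1) by (simp add: f'_def A.m_assoc)
      then show ?thesis using de by (simp add: f'_def)
    qed
    have 6: "e \<otimes>\<^bsub>B\<^esub> c' m = c' m"
    proof -
      have "e \<otimes>\<^bsub>B\<^esub> c' m = (e \<otimes>\<^bsub>B\<^esub> e) \<otimes>\<^bsub>B\<^esub> p \<otimes>\<^bsub>B\<^esub> g"
        using e(1) pq(1,2) g by (simp add: c'_def A.m_assoc)
      then show ?thesis using e(3) by (simp add: c'_def)
    qed
    have old: "c' i = c i" "f' i = f i" if "i < m" for i using that by (auto simp: c'_def f'_def)
    have "Q (Suc m) f' c'"
      unfolding Q_def less_Suc_eq using 1 2 3 4 5 6 old fe ec cf by auto
    with m(2) show False by (meson Suc_n_not_le_n)
  qed
  then have "(\<Oplus>\<^bsub>B\<^esub>i\<in>{..<m}. f i \<otimes>\<^bsub>B\<^esub> c i) = \<one>\<^bsub>B\<^esub>" by (simp add: s_def)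
  then have "mu_system B m e f c"
    using e fe ec cf inv by unfold_locales auto
  with that show ?thesis by blast
qed

end

subsection \<open>Dimensions of modules over a simple algebra\<close>

locale rmod = B: falg B + V: fvs V for B :: "('k :: field, 'b) module" and V :: "('k, 'v) module" +
  fixes act :: "'v \<Rightarrow> 'b \<Rightarrow> 'v"
  assumes act_closed [simp]: "v \<in> carrier V \<Longrightarrow> x \<in> carrier B \<Longrightarrow> act v x \<in> carrier V"
    and act_add_left: "v \<in> carrier V \<Longrightarrow> w \<in> carrier V \<Longrightarrow> x \<in> carrier B \<Longrightarrow>
      act (v \<oplus>\<^bsub>V\<^esub> w) x = act v x \<oplus>\<^bsub>V\<^esub> act w x"
    and act_add_right: "v \<in> carrier V \<Longrightarrow> x \<in> carrier B \<Longrightarrow> y \<in> carrier B \<Longrightarrow>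
      act v (x \<oplus>\<^bsub>B\<^esub> y) = act v x \<oplus>\<^bsub>V\<^esub> act v y"
    and act_sc_left: "v \<in> carrier V \<Longrightarrow> x \<in> carrier B \<Longrightarrow> act (k \<odot>\<^bsub>V\<^esub> v) x = k \<odot>\<^bsub>V\<^esub> act v x"
    and act_sc_right: "v \<in> carrier V \<Longrightarrow> x \<in> carrier B \<Longrightarrow> act v (k \<odot>\<^bsub>B\<^esub> x) = k \<odot>\<^bsub>V\<^esub> act v x"
    and act_mult: "v \<in> carrier V \<Longrightarrow> x \<in> carrier B \<Longrightarrow> y \<in> carrier B \<Longrightarrow>
      act v (x \<otimes>\<^bsub>B\<^esub> y) = act (act v x) y"
    and act_one [simp]: "v \<in> carrier V \<Longrightarrow> act v \<one>\<^bsub>B\<^esub> = v"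
begin

lemma act_linmap: "x \<in> carrier B \<Longrightarrow> linmap V V (\<lambda>v. act v x)"
  by (auto simp: linmap_def act_add_left act_sc_left)

lemma act_linmap': "v \<in> carrier V \<Longrightarrow> linmap B V (act v)"
  by (auto simp: linmap_def act_add_right act_sc_right)

lemma act_zero_left [simp]: "x \<in> carrier B \<Longrightarrow> act \<zero>\<^bsub>V\<^esub> x = \<zero>\<^bsub>V\<^esub>"
  using linmap_zero[OF V.fvs_axioms V.fvs_axioms act_linmap] by simp

lemma act_zero_right [simp]: "v \<in> carrier V \<Longrightarrow> act v \<zero>\<^bsub>B\<^esub> = \<zero>\<^bsub>V\<^esub>"
  using linmap_zero[OF B.fvs_axioms V.fvs_axioms act_linmap'] by simp

lemma act_finsum_left: "(\<And>i. i < n \<Longrightarrow> v i \<in> carrier V) \<Longrightarrow> x \<in> carrier B \<Longrightarrow>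
    act (\<Oplus>\<^bsub>V\<^esub>i\<in>{..<n :: nat}. v i) x = (\<Oplus>\<^bsub>V\<^esub>i\<in>{..<n}. act (v i) x)"
  by (rule finsum_hom) (auto simp: act_add_left intro: V.M.abelian_monoid_axioms)

lemma act_finsum_right: "(\<And>i. i < n \<Longrightarrow> x i \<in> carrier B) \<Longrightarrow> v \<in> carrier V \<Longrightarrow>
    act v (\<Oplus>\<^bsub>B\<^esub>i\<in>{..<n :: nat}. x i) = (\<Oplus>\<^bsub>V\<^esub>i\<in>{..<n}. act v (x i))"
  by (rule finsum_hom) (auto simp: act_add_right intro: V.M.abelian_monoid_axioms B.M.abelian_monoid_axioms)

text \<open>Linear independence of vectors of V e over the corner e B e, which acts from the right.
  For \<open>e\<close> from a \<open>mu_system\<close> the corner is a division algebra.\<close>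

definition dindep :: "'b \<Rightarrow> nat \<Rightarrow> (nat \<Rightarrow> 'v) \<Rightarrow> bool" where
  "dindep e r w \<longleftrightarrow> (\<forall>i<r. w i \<in> carrier V \<and> act (w i) e = w i) \<and>
    (\<forall>d. (\<forall>i<r. d i \<in> carrier (corner B e)) \<longrightarrow> (\<Oplus>\<^bsub>V\<^esub>i\<in>{..<r}. act (w i) (d i)) = \<zero>\<^bsub>V\<^esub> \<longrightarrow>
      (\<forall>i<r. d i = \<zero>\<^bsub>B\<^esub>))"

lemma dindepD:
  assumes "dindep e r w" "\<And>i. i < r \<Longrightarrow> d i \<in> carrier (corner B e)"
    "(\<Oplus>\<^bsub>V\<^esub>i\<in>{..<r}. act (w i) (d i)) = \<zero>\<^bsub>V\<^esub>" "i < r"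
  shows "d i = \<zero>\<^bsub>B\<^esub>"
  using assms unfolding dindep_def by blast

text \<open>The usual basis argument over a division algebra: a \<open>dindep\<close> family of
  maximal length spans V e, because the coefficient of a further vector in a relation can be
  inverted inside the corner. Lengths are bounded by the dimension of \<open>V\<close>, as
  independence over the corner implies independence over the ground field.\<close>

lemma ex_corner_basis:
  assumes "mu_system B m e f c" "fbasis V N b"
  obtains r w where "dindep e r w"
    "\<And>v. v \<in> carrier V \<Longrightarrow> act v e = v \<Longrightarrow>
      \<exists>d. (\<forall>i<r. d i \<in> carrier (corner B e)) \<and> v = (\<Oplus>\<^bsub>V\<^esub>i\<in>{..<r}. act (w i) (d i))"
proof -
  interpret mu: mu_system B m e f c by fact
  have "dindep e 0 w" for w by (simp add: dindep_def)
  moreover have bound: "r \<le> N" if "dindep e r w" for r w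
  proof -
    have w: "\<And>i. i < r \<Longrightarrow> w i \<in> carrier V" "\<And>i. i < r \<Longrightarrow> act (w i) e = w i"
      using that by (auto simp: dindep_def)
    \<comment> \<open>A scalar k of the ground field enters the corner as k e, which acts on vectors
      of V e as k.\<close>
    have "k i = 0" if k: "lc V r w k = \<zero>\<^bsub>V\<^esub>" and i: "i < r" for k i
    proof -
      have "(\<Oplus>\<^bsub>V\<^esub>i\<in>{..<r}. act (w i) (k i \<odot>\<^bsub>B\<^esub> e)) = lc V r w k"
        unfolding lc_def by (rule V.M.finsum_cong') (use w in \<open>auto simp: act_sc_right\<close>)
      moreover have "k i \<odot>\<^bsub>B\<^esub> e \<in> carrier (corner B e)" for i by (simp add: B.sc_l B.sc_r)
      ultimately have "k i \<odot>\<^bsub>B\<^esub> e = \<zero>\<^bsub>B\<^esub>"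
        by (intro dindepD[OF \<open>dindep e r w\<close> _ _ i]) (auto simp only: k)
      then show ?thesis using B.sc_eq_zero mu.e_nonzero mu.e_closed by blast
    qed
    then have "indep V r w" using w by (auto simp: indep_def)
    then show ?thesis using V.indep_le_fbasis[OF assms(2)] by blast
  qed
  ultimately obtain r where r: "\<exists>w. dindep e r w" "\<And>k. \<exists>w. dindep e k w \<Longrightarrow> k \<le> r"
    using Nat.ex_has_greatest_nat[of "\<lambda>r. \<exists>w. dindep e r w" 0 N] by blast
  then obtain w where w: "dindep e r w" by blast
  have wc: "\<And>i. i < r \<Longrightarrow> w i \<in> carrier V" "\<And>i. i < r \<Longrightarrow> act (w i) e = w i"
    using w by (auto simp: dindep_def)
  have "\<exists>d. (\<forall>i<r. d i \<in> carrier (corner B e)) \<and> v = (\<Oplus>\<^bsub>V\<^esub>i\<in>{..<r}. act (w i) (d i))"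
    if v: "v \<in> carrier V" "act v e = v" for v
  proof (rule ccontr)
    assume no: "\<not> ?thesis"
    have "dindep e (Suc r) (w(r := v))"
      unfolding dindep_def
    proof (intro conjI allI impI)
      fix d i
      assume d: "\<forall>i<Suc r. d i \<in> carrier (corner B e)"
        and 0: "(\<Oplus>\<^bsub>V\<^esub>i\<in>{..<Suc r}. act ((w(r := v)) i) (d i)) = \<zero>\<^bsub>V\<^esub>" and i: "i < Suc r"
      have dB: "d i \<in> carrier B" if "i \<le> r" for i using d that by auto
      have "(\<Oplus>\<^bsub>V\<^esub>i\<in>{..<Suc r}. act ((w(r := v)) i) (d i)) =
        (\<Oplus>\<^bsub>V\<^esub>i\<in>{..<r}. act ((w(r := v)) i) (d i)) \<oplus>\<^bsub>V\<^esub> act v (d r)"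
        by (subst V.M.finsum_lessThan_Suc) (use wc v dB in auto)
      also have "(\<Oplus>\<^bsub>V\<^esub>i\<in>{..<r}. act ((w(r := v)) i) (d i)) = (\<Oplus>\<^bsub>V\<^esub>i\<in>{..<r}. act (w i) (d i))"
        by (rule V.M.finsum_cong') (use wc dB in auto)
      finally have eq: "(\<Oplus>\<^bsub>V\<^esub>i\<in>{..<r}. act (w i) (d i)) \<oplus>\<^bsub>V\<^esub> act v (d r) = \<zero>\<^bsub>V\<^esub>" using 0 by simp
      have sc: "(\<Oplus>\<^bsub>V\<^esub>i\<in>{..<r}. act (w i) (d i)) \<in> carrier V"
        by (rule V.M.finsum_closed) (use wc dB in auto)
      have "d r = \<zero>\<^bsub>B\<^esub>"
      proof (rule ccontr)
        assume "d r \<noteq> \<zero>\<^bsub>B\<^esub>"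
        \<comment> \<open>Acting by the inverse of the last coefficient turns the relation into an
          expression of \<open>v\<close> through the old family, contrary to the choice of
          \<open>v\<close>.\<close>
        then obtain y where y: "y \<in> carrier B" "e \<otimes>\<^bsub>B\<^esub> y \<otimes>\<^bsub>B\<^esub> e = y" "d r \<otimes>\<^bsub>B\<^esub> y = e"
          using mu.corner_inverse[of "d r"] d by auto
        have "act ((\<Oplus>\<^bsub>V\<^esub>i\<in>{..<r}. act (w i) (d i)) \<oplus>\<^bsub>V\<^esub> act v (d r)) y =
          (\<Oplus>\<^bsub>V\<^esub>i\<in>{..<r}. act (act (w i) (d i)) y) \<oplus>\<^bsub>V\<^esub> act (act v (d r)) y"
          using sc y(1) wc dB v by (simp add: act_add_left act_finsum_left)
        also have "act (act v (d r)) y = v" using v y dB by (simp add: act_mult[symmetric])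
        also have "(\<Oplus>\<^bsub>V\<^esub>i\<in>{..<r}. act (act (w i) (d i)) y) = (\<Oplus>\<^bsub>V\<^esub>i\<in>{..<r}. act (w i) (d i \<otimes>\<^bsub>B\<^esub> y))"
          by (rule V.M.finsum_cong') (use wc dB y in \<open>auto simp: act_mult\<close>)
        finally have "(\<Oplus>\<^bsub>V\<^esub>i\<in>{..<r}. act (w i) (d i \<otimes>\<^bsub>B\<^esub> y)) \<oplus>\<^bsub>V\<^esub> v = \<zero>\<^bsub>V\<^esub>"
          using eq y by simp
        then have "\<ominus>\<^bsub>V\<^esub> (\<Oplus>\<^bsub>V\<^esub>i\<in>{..<r}. act (w i) (d i \<otimes>\<^bsub>B\<^esub> y)) = v"
          by (subst (asm) V.M.a_comm) (use v wc dB y in \<open>auto intro!: V.M.minus_equality V.M.finsum_closed\<close>)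
        moreover have "\<ominus>\<^bsub>V\<^esub> (\<Oplus>\<^bsub>V\<^esub>i\<in>{..<r}. act (w i) (d i \<otimes>\<^bsub>B\<^esub> y)) =
          (\<Oplus>\<^bsub>V\<^esub>i\<in>{..<r}. \<ominus>\<^bsub>V\<^esub> act (w i) (d i \<otimes>\<^bsub>B\<^esub> y))"
          by (rule finsum_hom) (use wc dB y in \<open>auto simp: V.M.minus_add intro: V.M.abelian_monoid_axioms\<close>)
        moreover have "(\<Oplus>\<^bsub>V\<^esub>i\<in>{..<r}. \<ominus>\<^bsub>V\<^esub> act (w i) (d i \<otimes>\<^bsub>B\<^esub> y)) =
          (\<Oplus>\<^bsub>V\<^esub>i\<in>{..<r}. act (w i) ((-1) \<odot>\<^bsub>B\<^esub> (d i \<otimes>\<^bsub>B\<^esub> y)))"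
          by (rule V.M.finsum_cong') (use wc dB y in \<open>auto simp: act_sc_right V.sc_minus1\<close>)
        ultimately have "v = (\<Oplus>\<^bsub>V\<^esub>i\<in>{..<r}. act (w i) ((-1) \<odot>\<^bsub>B\<^esub> (d i \<otimes>\<^bsub>B\<^esub> y)))" by simp
        moreover have "(-1) \<odot>\<^bsub>B\<^esub> (d i \<otimes>\<^bsub>B\<^esub> y) \<in> carrier (corner B e)" if "i < r" for i
          using mu.corner_mult[of "d i" y] d y that by (auto simp: B.sc_l B.sc_r)
        ultimately have "\<exists>d. (\<forall>i<r. d i \<in> carrier (corner B e)) \<and> v = (\<Oplus>\<^bsub>V\<^esub>i\<in>{..<r}. act (w i) (d i))"
          by (intro exI[of _ "\<lambda>i. (-1) \<odot>\<^bsub>B\<^esub> (d i \<otimes>\<^bsub>B\<^esub> y)"] conjI allI impI)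
        with no show False by contradiction
      qed
      moreover from this have s0: "(\<Oplus>\<^bsub>V\<^esub>i\<in>{..<r}. act (w i) (d i)) = \<zero>\<^bsub>V\<^esub>" using eq sc v by simp
      have "d i = \<zero>\<^bsub>B\<^esub>" if "i < r" for i
        by (rule dindepD[OF w _ s0 that]) (use d in auto)
      ultimately show "d i = \<zero>\<^bsub>B\<^esub>" using i by (auto simp: less_Suc_eq)
    next
      fix i assume "i < Suc r"
      then show "(w(r := v)) i \<in> carrier V" "act ((w(r := v)) i) e = (w(r := v)) i"
        using v wc by (auto simp: less_Suc_eq)
    qed
    with r(2) show False by (meson Suc_n_not_le_n)
  qed
  with w that show ?thesis by blast
qed

text \<open>Since v = \<Sum> (v f_j) c_j with v f_j in V e, the module is the direct sum of the
  spaces V e c_j, and V e is free of some rank r over the corner. Hence dim V = m r \<delta>. From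
  the most to the least significant digit, the index x holds the number of c, the number of w and
  the corner coordinate. The spanning property of w is exported too: for a division algebra and e =
  1 it provides the entries of a matrix.\<close>

theorem rmod_basis:
  assumes "mu_system B m e f c" "fbasis V N b" "fbasis (corner B e) \<delta> y"
  obtains r w where "\<And>i. i < r \<Longrightarrow> w i \<in> carrier V" "\<And>i. i < r \<Longrightarrow> act (w i) e = w i"
    "fbasis V (m * r * \<delta>) (\<lambda>x. act (act (w (x div \<delta> mod r)) (y (x mod \<delta>))) (c (x div \<delta> div r)))"
    "\<And>v. v \<in> carrier V \<Longrightarrow> act v e = v \<Longrightarrow>
      \<exists>d. (\<forall>i<r. d i \<in> carrier (corner B e)) \<and> v = (\<Oplus>\<^bsub>V\<^esub>i\<in>{..<r}. act (w i) (d i))"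
proof -
  interpret mu: mu_system B m e f c by fact
  obtain r w where w: "dindep e r w"
    and span: "\<And>v. v \<in> carrier V \<Longrightarrow> act v e = v \<Longrightarrow>
      \<exists>d. (\<forall>i<r. d i \<in> carrier (corner B e)) \<and> v = (\<Oplus>\<^bsub>V\<^esub>i\<in>{..<r}. act (w i) (d i))"
    using ex_corner_basis[OF assms(1,2)] by blast
  have wc: "\<And>i. i < r \<Longrightarrow> w i \<in> carrier V" "\<And>i. i < r \<Longrightarrow> act (w i) e = w i"
    using w by (auto simp: dindep_def)
  \<comment> \<open>The number t = j * r + i stands for the copy w_i (e B e) c_j of the
    corner.\<close>
  define \<theta> where "\<theta> t d = act (act (w (t mod r)) d) (c (t div r))" for t d
  have t: "t mod r < r" "t div r < m" if "t < m * r" for t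
    using that by (auto simp: less_mult_imp_div_less) (metis mod_less_divisor mult_0_right neq0_conv not_less0)
  have \<theta>_cl: "\<theta> (j * r + i) d = act (act (w i) d) (c j)" if "i < r" for i j d
    using that by (simp add: \<theta>_def)
  have lt: "j * r + i < m * r" if "j < m" "i < r" for i j
  proof -
    have "j * r + i < (j + 1) * r" using that by simp
    also have "\<dots> \<le> m * r" using that by (intro mult_right_mono) auto
    finally show ?thesis .
  qed
  have sum: "(\<Oplus>\<^bsub>V\<^esub>t\<in>{..<m * r}. \<theta> t (u t)) = (\<Oplus>\<^bsub>V\<^esub>j\<in>{..<m}. act (\<Oplus>\<^bsub>V\<^esub>i\<in>{..<r}. act (w i) (u (j * r + i))) (c j))"
    if u: "\<And>t. t < m * r \<Longrightarrow> u t \<in> carrier B" for u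
  proof -
    have "(\<Oplus>\<^bsub>V\<^esub>t\<in>{..<m * r}. \<theta> t (u t)) = (\<Oplus>\<^bsub>V\<^esub>j\<in>{..<m}. \<Oplus>\<^bsub>V\<^esub>i\<in>{..<r}. \<theta> (j * r + i) (u (j * r + i)))"
      by (rule V.M.finsum_lessThan_mult) (use u t wc in \<open>auto simp: \<theta>_def\<close>)
    also have "\<dots> = (\<Oplus>\<^bsub>V\<^esub>j\<in>{..<m}. act (\<Oplus>\<^bsub>V\<^esub>i\<in>{..<r}. act (w i) (u (j * r + i))) (c j))"
    proof (rule V.M.finsum_cong')
      fix j assume "j \<in> {..<m}"
      then have j: "j < m" by simp
      show "(\<Oplus>\<^bsub>V\<^esub>i\<in>{..<r}. \<theta> (j * r + i) (u (j * r + i))) = act (\<Oplus>\<^bsub>V\<^esub>i\<in>{..<r}. act (w i) (u (j * r + i))) (c j)"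
        using j u lt wc by (subst act_finsum_left) (auto simp: \<theta>_cl intro!: V.M.finsum_cong')
    qed (use u lt wc in \<open>auto intro!: act_closed V.M.finsum_closed\<close>)
    finally show ?thesis .
  qed
  have "fbasis V (m * r * \<delta>) (\<lambda>x. \<theta> (x div \<delta>) (y (x mod \<delta>)))"
  proof (rule fbasis_prod[OF V.fvs_axioms B.corner_fvs[OF mu.e_closed] assms(3)])
    fix i assume "i < m * r"
    then show "linmap (corner B e) V (\<theta> i)"
      using t[of i] wc by (auto simp: linmap_def \<theta>_def act_add_right act_add_left act_sc_right act_sc_left)
  next
    fix v assume v: "v \<in> carrier V"
    have "\<exists>d. (\<forall>i<r. d i \<in> carrier (corner B e)) \<and> act v (f j) = (\<Oplus>\<^bsub>V\<^esub>i\<in>{..<r}. act (w i) (d i))"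
      if "j < m" for j
      using that v by (intro span) (auto simp: act_mult[symmetric])
    then obtain d where d: "\<And>i j. j < m \<Longrightarrow> i < r \<Longrightarrow> d j i \<in> carrier (corner B e)"
      "\<And>j. j < m \<Longrightarrow> act v (f j) = (\<Oplus>\<^bsub>V\<^esub>i\<in>{..<r}. act (w i) (d j i))" by metis
    define u where "u t = d (t div r) (t mod r)" for t
    have u: "\<forall>t<m * r. u t \<in> carrier (corner B e)" using d(1) t by (simp add: u_def)
    have "(\<Oplus>\<^bsub>V\<^esub>t\<in>{..<m * r}. \<theta> t (u t)) = (\<Oplus>\<^bsub>V\<^esub>j\<in>{..<m}. act (\<Oplus>\<^bsub>V\<^esub>i\<in>{..<r}. act (w i) (u (j * r + i))) (c j))"
      by (rule sum) (use u in auto)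
    also have "\<dots> = (\<Oplus>\<^bsub>V\<^esub>j\<in>{..<m}. act v (f j \<otimes>\<^bsub>B\<^esub> c j))"
    proof (rule V.M.finsum_cong')
      fix j assume "j \<in> {..<m}"
      then have j: "j < m" by simp
      have "(\<Oplus>\<^bsub>V\<^esub>i\<in>{..<r}. act (w i) (u (j * r + i))) = (\<Oplus>\<^bsub>V\<^esub>i\<in>{..<r}. act (w i) (d j i))"
        by (rule V.M.finsum_cong') (use wc d(1)[OF j] in \<open>auto simp: u_def\<close>)
      then show "act (\<Oplus>\<^bsub>V\<^esub>i\<in>{..<r}. act (w i) (u (j * r + i))) (c j) = act v (f j \<otimes>\<^bsub>B\<^esub> c j)"
        using d(2)[OF j] j v by (simp add: act_mult)
    qed (use v in auto)
    also have "\<dots> = act v (\<Oplus>\<^bsub>B\<^esub>j\<in>{..<m}. f j \<otimes>\<^bsub>B\<^esub> c j)"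
      by (rule act_finsum_right[symmetric]) (use v in auto)
    also have "\<dots> = v" using v mu.sum_f_c by simp
    finally show "\<exists>u. (\<forall>i<m * r. u i \<in> carrier (corner B e)) \<and> v = (\<Oplus>\<^bsub>V\<^esub>i\<in>{..<m * r}. \<theta> i (u i))"
      using u by metis
  next
    fix u t
    assume u: "\<And>i. i < m * r \<Longrightarrow> u i \<in> carrier (corner B e)"
      and 0: "(\<Oplus>\<^bsub>V\<^esub>i\<in>{..<m * r}. \<theta> i (u i)) = \<zero>\<^bsub>V\<^esub>" and tr: "t < m * r"
    define h where "h = t div r"
    have h: "h < m" using t[OF tr] by (simp add: h_def)
    \<comment> \<open>Acting by f_h keeps only the h-th of these sums, because c_j f_h is e for j =
      h and zero otherwise; then the independence of w applies.\<close>
    let ?s = "\<lambda>j. \<Oplus>\<^bsub>V\<^esub>i\<in>{..<r}. act (w i) (u (j * r + i))"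
    have s: "?s j \<in> carrier V" if "j < m" for j
      by (rule V.M.finsum_closed) (use that u lt wc in auto)
    have "\<zero>\<^bsub>V\<^esub> = act (\<Oplus>\<^bsub>V\<^esub>j\<in>{..<m}. act (?s j) (c j)) (f h)"
      using 0 u h by (subst (asm) sum) auto
    also have "\<dots> = (\<Oplus>\<^bsub>V\<^esub>j\<in>{..<m}. act (act (?s j) (c j)) (f h))"
      by (rule act_finsum_left) (use s h in auto)
    also have "\<dots> = act (act (?s h) (c h)) (f h)"
      by (rule V.M.finsum_eq_single) (use s h mu.c_f in \<open>auto simp: act_mult[symmetric]\<close>)
    also have "\<dots> = act (?s h) e" using s h mu.c_f by (simp add: act_mult[symmetric])
    also have "\<dots> = (\<Oplus>\<^bsub>V\<^esub>i\<in>{..<r}. act (act (w i) (u (h * r + i))) e)"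
      by (rule act_finsum_left) (use h u lt wc in auto)
    also have "\<dots> = ?s h"
    proof (rule V.M.finsum_cong')
      fix i assume "i \<in> {..<r}"
      then have i: "i < r" by simp
      then have "u (h * r + i) \<otimes>\<^bsub>B\<^esub> e = u (h * r + i)"
        using mu.corner_e(2) u[OF lt[OF h i]] by simp
      then show "act (act (w i) (u (h * r + i))) e = act (w i) (u (h * r + i))"
        using i wc u[OF lt[OF h i]] by (simp add: act_mult[symmetric])
    qed (use h u lt wc in auto)
    finally have "?s h = \<zero>\<^bsub>V\<^esub>" by simp
    then have "u (h * r + i) = \<zero>\<^bsub>B\<^esub>" if "i < r" for i
      using dindepD[OF w, of "\<lambda>i. u (h * r + i)"] u lt[OF h] that by blast
    from this[of "t mod r"] show "u t = \<zero>\<^bsub>corner B e\<^esub>" using t[OF tr] by (simp add: h_def)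
  qed
  then show ?thesis using that[of r w] wc span by (simp add: \<theta>_def)
qed

end

context falg
begin

text \<open>Because v = \<Sum> (v f_i) c_i for v in e B, this right ideal is the direct sum of the m
  spaces (e B e) c_i. Its dimension m \<delta> is the unit in which the dimensions of all modules
  are measured, by \<open>rmod_basis\<close>.\<close>

lemma mu_system_right_ideal_basis:
  assumes "mu_system B m e f c" "fbasis (corner B e) \<delta> y"
  shows "fbasis (right_ideal B e) (m * \<delta>) (\<lambda>x. y (x mod \<delta>) \<otimes>\<^bsub>B\<^esub> c (x div \<delta>))"
proof -
  interpret mu: mu_system B m e f c by fact
  interpret R: fvs "right_ideal B e" by (rule right_ideal_fvs[OF mu.e_closed])
  have cr: "d \<otimes>\<^bsub>B\<^esub> c j \<in> carrier (right_ideal B e)" if "d \<in> carrier (corner B e)" "j < m" for d j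
    using that mu.corner_e[of d] by (auto simp: A.m_assoc[symmetric])
  have fs: "(\<Oplus>\<^bsub>right_ideal B e\<^esub>i\<in>{..<m}. u i \<otimes>\<^bsub>B\<^esub> c i) = (\<Oplus>\<^bsub>B\<^esub>i\<in>{..<m}. u i \<otimes>\<^bsub>B\<^esub> c i)"
    if "\<And>i. i < m \<Longrightarrow> u i \<in> carrier (corner B e)" for u
    by (rule finsum_hom[OF R.M.abelian_monoid_axioms M.abelian_monoid_axioms cr[OF that]]) auto
  have "fbasis (right_ideal B e) (m * \<delta>) (\<lambda>x. (\<lambda>j d. d \<otimes>\<^bsub>B\<^esub> c j) (x div \<delta>) (y (x mod \<delta>)))"
  proof (rule fbasis_prod[OF R.fvs_axioms corner_fvs[OF mu.e_closed] assms(2)])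
    fix i assume "i < m"
    then show "linmap (corner B e) (right_ideal B e) (\<lambda>d. d \<otimes>\<^bsub>B\<^esub> c i)"
      unfolding linmap_def using cr by (auto simp: A.l_distr sc_l)
  next
    fix v assume "v \<in> carrier (right_ideal B e)"
    then have v: "v \<in> carrier B" "e \<otimes>\<^bsub>B\<^esub> v = v" by auto
    have u: "v \<otimes>\<^bsub>B\<^esub> f i \<in> carrier (corner B e)" if "i < m" for i
    proof -
      have "e \<otimes>\<^bsub>B\<^esub> (v \<otimes>\<^bsub>B\<^esub> f i) \<otimes>\<^bsub>B\<^esub> e = (e \<otimes>\<^bsub>B\<^esub> v) \<otimes>\<^bsub>B\<^esub> (f i \<otimes>\<^bsub>B\<^esub> e)"
        using v(1) that by (simp add: A.m_assoc del: mu.f_e)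
      then show ?thesis using v that by simp
    qed
    have "(\<Oplus>\<^bsub>right_ideal B e\<^esub>i\<in>{..<m}. (v \<otimes>\<^bsub>B\<^esub> f i) \<otimes>\<^bsub>B\<^esub> c i) = (\<Oplus>\<^bsub>B\<^esub>i\<in>{..<m}. (v \<otimes>\<^bsub>B\<^esub> f i) \<otimes>\<^bsub>B\<^esub> c i)"
      by (rule fs[OF u])
    also have "\<dots> = (\<Oplus>\<^bsub>B\<^esub>i\<in>{..<m}. v \<otimes>\<^bsub>B\<^esub> (f i \<otimes>\<^bsub>B\<^esub> c i))"
      by (rule M.finsum_cong') (use v in \<open>auto simp: A.m_assoc\<close>)
    also have "\<dots> = v \<otimes>\<^bsub>B\<^esub> (\<Oplus>\<^bsub>B\<^esub>i\<in>{..<m}. f i \<otimes>\<^bsub>B\<^esub> c i)"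
      by (rule A.finsum_rdistr[symmetric]) (use v in auto)
    also have "\<dots> = v" using v mu.sum_f_c by simp
    finally show "\<exists>u. (\<forall>i<m. u i \<in> carrier (corner B e)) \<and> v = (\<Oplus>\<^bsub>right_ideal B e\<^esub>i\<in>{..<m}. u i \<otimes>\<^bsub>B\<^esub> c i)"
      using u by (intro exI[of _ "\<lambda>i. v \<otimes>\<^bsub>B\<^esub> f i"]) auto
  next
    fix u h
    assume u: "\<And>i. i < m \<Longrightarrow> u i \<in> carrier (corner B e)" and h: "h < m"
      and 0: "(\<Oplus>\<^bsub>right_ideal B e\<^esub>i\<in>{..<m}. u i \<otimes>\<^bsub>B\<^esub> c i) = \<zero>\<^bsub>right_ideal B e\<^esub>"
    have uB: "\<And>i. i < m \<Longrightarrow> u i \<in> carrier B" using u by auto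
    have "\<zero>\<^bsub>B\<^esub> = (\<Oplus>\<^bsub>B\<^esub>i\<in>{..<m}. u i \<otimes>\<^bsub>B\<^esub> c i) \<otimes>\<^bsub>B\<^esub> f h" using 0 fs[OF u] h by simp
    also have "\<dots> = (\<Oplus>\<^bsub>B\<^esub>i\<in>{..<m}. u i \<otimes>\<^bsub>B\<^esub> c i \<otimes>\<^bsub>B\<^esub> f h)"
      by (rule A.finsum_ldistr) (use uB h in auto)
    also have "\<dots> = u h \<otimes>\<^bsub>B\<^esub> c h \<otimes>\<^bsub>B\<^esub> f h"
      by (rule M.finsum_eq_single[OF h]) (use uB h mu.c_f in \<open>auto simp: A.m_assoc\<close>)
    also have "\<dots> = u h" using uB h mu.c_f mu.corner_e(2)[of "u h"] u by (simp add: A.m_assoc)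
    finally show "u h = \<zero>\<^bsub>corner B e\<^esub>" by simp
  qed
  then show ?thesis by simp
qed

text \<open>The Peirce decomposition v = \<Sum> f_i (c_i v f_j) c_j: the algebra consists of m^2
  copies of its corner.\<close>

lemma mu_system_basis:
  assumes "mu_system B m e f c" "fbasis (corner B e) \<delta> y"
  shows "fbasis B (m * m * \<delta>) (\<lambda>x. f (x div \<delta> div m) \<otimes>\<^bsub>B\<^esub> y (x mod \<delta>) \<otimes>\<^bsub>B\<^esub> c (x div \<delta> mod m))"
proof -
  interpret mu: mu_system B m e f c by fact
  define \<theta> where "\<theta> t d = f (t div m) \<otimes>\<^bsub>B\<^esub> d \<otimes>\<^bsub>B\<^esub> c (t mod m)" for t d
  have t: "t mod m < m" "t div m < m" if "t < m * m" for t
    using that mu.m_pos by (auto simp: less_mult_imp_div_less)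
  have lt: "j * m + i < m * m" if "j < m" "i < m" for i j
  proof -
    have "j * m + i < (j + 1) * m" using that by simp
    also have "\<dots> \<le> m * m" using that by (intro mult_right_mono) auto
    finally show ?thesis .
  qed
  have sum: "(\<Oplus>\<^bsub>B\<^esub>t\<in>{..<m * m}. \<theta> t (u t)) = (\<Oplus>\<^bsub>B\<^esub>i\<in>{..<m}. \<Oplus>\<^bsub>B\<^esub>j\<in>{..<m}. f i \<otimes>\<^bsub>B\<^esub> u (i * m + j) \<otimes>\<^bsub>B\<^esub> c j)"
    if u: "\<And>t. t < m * m \<Longrightarrow> u t \<in> carrier B" for u
  proof -
    have "(\<Oplus>\<^bsub>B\<^esub>t\<in>{..<m * m}. \<theta> t (u t)) = (\<Oplus>\<^bsub>B\<^esub>i\<in>{..<m}. \<Oplus>\<^bsub>B\<^esub>j\<in>{..<m}. \<theta> (i * m + j) (u (i * m + j)))"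
      by (rule M.finsum_lessThan_mult) (use u t in \<open>auto simp: \<theta>_def\<close>)
    also have "\<dots> = (\<Oplus>\<^bsub>B\<^esub>i\<in>{..<m}. \<Oplus>\<^bsub>B\<^esub>j\<in>{..<m}. f i \<otimes>\<^bsub>B\<^esub> u (i * m + j) \<otimes>\<^bsub>B\<^esub> c j)"
      by (intro M.finsum_cong') (use u lt in \<open>auto simp: \<theta>_def intro!: M.finsum_closed\<close>)
    finally show ?thesis .
  qed
  have "fbasis B (m * m * \<delta>) (\<lambda>x. \<theta> (x div \<delta>) (y (x mod \<delta>)))"
  proof (rule fbasis_prod[OF fvs_axioms corner_fvs[OF mu.e_closed] assms(2)])
    fix i assume "i < m * m"
    then show "linmap (corner B e) B (\<theta> i)"
      using t[of i] by (auto simp: linmap_def \<theta>_def A.l_distr A.r_distr sc_l sc_r)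
  next
    fix v assume v: "v \<in> carrier B"
    define u where "u t = c (t div m) \<otimes>\<^bsub>B\<^esub> v \<otimes>\<^bsub>B\<^esub> f (t mod m)" for t
    have u: "\<forall>t<m * m. u t \<in> carrier (corner B e)" using v t mu.corner_cxf[OF v] by (simp add: u_def)
    have "(\<Oplus>\<^bsub>B\<^esub>t\<in>{..<m * m}. \<theta> t (u t)) = (\<Oplus>\<^bsub>B\<^esub>i\<in>{..<m}. \<Oplus>\<^bsub>B\<^esub>j\<in>{..<m}. f i \<otimes>\<^bsub>B\<^esub> u (i * m + j) \<otimes>\<^bsub>B\<^esub> c j)"
      by (rule sum) (use u in auto)
    also have "\<dots> = (\<Oplus>\<^bsub>B\<^esub>i\<in>{..<m}. (f i \<otimes>\<^bsub>B\<^esub> c i) \<otimes>\<^bsub>B\<^esub> v)"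
    proof (rule M.finsum_cong')
      fix i assume "i \<in> {..<m}"
      then have i: "i < m" by simp
      have "(\<Oplus>\<^bsub>B\<^esub>j\<in>{..<m}. f i \<otimes>\<^bsub>B\<^esub> u (i * m + j) \<otimes>\<^bsub>B\<^esub> c j) =
        (\<Oplus>\<^bsub>B\<^esub>j\<in>{..<m}. (f i \<otimes>\<^bsub>B\<^esub> c i \<otimes>\<^bsub>B\<^esub> v) \<otimes>\<^bsub>B\<^esub> (f j \<otimes>\<^bsub>B\<^esub> c j))"
        by (rule M.finsum_cong') (use v i in \<open>auto simp: u_def A.m_assoc\<close>)
      also have "\<dots> = (f i \<otimes>\<^bsub>B\<^esub> c i \<otimes>\<^bsub>B\<^esub> v) \<otimes>\<^bsub>B\<^esub> (\<Oplus>\<^bsub>B\<^esub>j\<in>{..<m}. f j \<otimes>\<^bsub>B\<^esub> c j)"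
        by (rule A.finsum_rdistr[symmetric]) (use v i in auto)
      finally show "(\<Oplus>\<^bsub>B\<^esub>j\<in>{..<m}. f i \<otimes>\<^bsub>B\<^esub> u (i * m + j) \<otimes>\<^bsub>B\<^esub> c j) = (f i \<otimes>\<^bsub>B\<^esub> c i) \<otimes>\<^bsub>B\<^esub> v"
        using v i mu.sum_f_c by simp
    qed (use v in auto)
    also have "\<dots> = (\<Oplus>\<^bsub>B\<^esub>j\<in>{..<m}. f j \<otimes>\<^bsub>B\<^esub> c j) \<otimes>\<^bsub>B\<^esub> v"
      by (rule A.finsum_ldistr[symmetric]) (use v in auto)
    also have "\<dots> = v" using v mu.sum_f_c by simp
    finally show "\<exists>u. (\<forall>i<m * m. u i \<in> carrier (corner B e)) \<and> v = (\<Oplus>\<^bsub>B\<^esub>i\<in>{..<m * m}. \<theta> i (u i))"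
      using u by metis
  next
    fix u t
    assume u: "\<And>i. i < m * m \<Longrightarrow> u i \<in> carrier (corner B e)"
      and 0: "(\<Oplus>\<^bsub>B\<^esub>i\<in>{..<m * m}. \<theta> i (u i)) = \<zero>\<^bsub>B\<^esub>" and tr: "t < m * m"
    have uB: "\<And>i. i < m * m \<Longrightarrow> u i \<in> carrier B" using u by auto
    \<comment> \<open>Multiplying the vanishing sum by c_h from the left and by f_k from the right
      isolates its coefficient with index h * m + k.\<close>
    define h k where "h = t div m" and "k = t mod m"
    have hk: "h < m" "k < m" "h * m + k = t" using t[OF tr] by (auto simp: h_def k_def)
    let ?s = "\<lambda>i. \<Oplus>\<^bsub>B\<^esub>j\<in>{..<m}. f i \<otimes>\<^bsub>B\<^esub> u (i * m + j) \<otimes>\<^bsub>B\<^esub> c j"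
    have s: "?s i \<in> carrier B" if "i < m" for i
      by (rule M.finsum_closed) (use that uB lt in auto)
    have cs: "c h \<otimes>\<^bsub>B\<^esub> ?s i = (\<Oplus>\<^bsub>B\<^esub>j\<in>{..<m}. (c h \<otimes>\<^bsub>B\<^esub> f i) \<otimes>\<^bsub>B\<^esub> (u (i * m + j) \<otimes>\<^bsub>B\<^esub> c j))" if "i < m" for i
      using that uB lt hk by (subst A.finsum_rdistr) (auto intro!: M.finsum_cong' simp: A.m_assoc)
    have "\<zero>\<^bsub>B\<^esub> = c h \<otimes>\<^bsub>B\<^esub> (\<Oplus>\<^bsub>B\<^esub>i\<in>{..<m}. ?s i)"
      using 0 hk uB by (subst (asm) sum) auto
    also have "\<dots> = (\<Oplus>\<^bsub>B\<^esub>i\<in>{..<m}. c h \<otimes>\<^bsub>B\<^esub> ?s i)"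
      by (rule A.finsum_rdistr) (use s hk in auto)
    also have "\<dots> = c h \<otimes>\<^bsub>B\<^esub> ?s h"
    proof (rule M.finsum_eq_single)
      fix i assume i: "i < m" "i \<noteq> h"
      show "c h \<otimes>\<^bsub>B\<^esub> ?s i = \<zero>\<^bsub>B\<^esub>" unfolding cs[OF i(1)]
        by (rule M.finsum_eq_zero) (use i hk mu.c_f uB lt in auto)
    qed (use s hk in auto)
    also have "\<dots> = (\<Oplus>\<^bsub>B\<^esub>j\<in>{..<m}. u (h * m + j) \<otimes>\<^bsub>B\<^esub> c j)"
      unfolding cs[OF hk(1)]
    proof (rule M.finsum_cong')
      fix j assume "j \<in> {..<m}"
      then have j: "j < m" by simp
      have "e \<otimes>\<^bsub>B\<^esub> (u (h * m + j) \<otimes>\<^bsub>B\<^esub> c j) = (e \<otimes>\<^bsub>B\<^esub> u (h * m + j)) \<otimes>\<^bsub>B\<^esub> c j"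
        using uB[OF lt[OF hk(1) j]] j by (simp add: A.m_assoc)
      then show "(c h \<otimes>\<^bsub>B\<^esub> f h) \<otimes>\<^bsub>B\<^esub> (u (h * m + j) \<otimes>\<^bsub>B\<^esub> c j) = u (h * m + j) \<otimes>\<^bsub>B\<^esub> c j"
        using mu.corner_e(1)[of "u (h * m + j)"] u[OF lt[OF hk(1) j]] hk mu.c_f by simp
    qed (use hk uB lt in auto)
    finally have z: "\<zero>\<^bsub>B\<^esub> = (\<Oplus>\<^bsub>B\<^esub>j\<in>{..<m}. u (h * m + j) \<otimes>\<^bsub>B\<^esub> c j)" .
    have "\<zero>\<^bsub>B\<^esub> = \<zero>\<^bsub>B\<^esub> \<otimes>\<^bsub>B\<^esub> f k" using hk by simp
    also have "\<dots> = (\<Oplus>\<^bsub>B\<^esub>j\<in>{..<m}. u (h * m + j) \<otimes>\<^bsub>B\<^esub> c j) \<otimes>\<^bsub>B\<^esub> f k"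
      by (subst z) (rule refl)
    also have "\<dots> = (\<Oplus>\<^bsub>B\<^esub>j\<in>{..<m}. u (h * m + j) \<otimes>\<^bsub>B\<^esub> c j \<otimes>\<^bsub>B\<^esub> f k)"
      by (rule A.finsum_ldistr) (use uB hk lt in auto)
    also have "\<dots> = u (h * m + k) \<otimes>\<^bsub>B\<^esub> c k \<otimes>\<^bsub>B\<^esub> f k"
      by (rule M.finsum_eq_single[OF hk(2)]) (use uB hk lt mu.c_f in \<open>auto simp: A.m_assoc\<close>)
    also have "\<dots> = u t"
      using uB[OF tr] u[OF tr] hk mu.c_f mu.corner_e(2)[of "u t"] by (simp add: A.m_assoc)
    finally show "u t = \<zero>\<^bsub>corner B e\<^esub>" by simp
  qed
  then show ?thesis by (simp add: \<theta>_def)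
qed

lemma rmod_right_ideal:
  assumes "e \<in> carrier B"
  shows "rmod B (right_ideal B e) (\<lambda>v x. v \<otimes>\<^bsub>B\<^esub> x)"
proof -
  interpret R: fvs "right_ideal B e" by (rule right_ideal_fvs[OF assms])
  show ?thesis
    by unfold_locales
      (use assms in \<open>auto simp: A.l_distr A.r_distr sc_l sc_r A.m_assoc[symmetric]\<close>)
qed

text \<open>As a module over \<open>B\<close> described by the second system, e B has a dimension m
  \<delta> = m' r \<delta>'. Compared with m^2 \<delta> = m'^2 \<delta>', the dimension of
  \<open>B\<close>, this gives m' = m r. The roles can be exchanged.\<close>

theorem mu_system_size_unique:
  assumes "fbasis B N b" "mu_system B m e f c" "mu_system B m' e' f' c'"
  shows "m = m'"
proof -
  have dvd: "m dvd m'" if mu: "mu_system B m e f c" and mu': "mu_system B m' e' f' c'" for m e f c m' e' f' c'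
  proof -
    interpret mu: mu_system B m e f c by fact
    interpret mu': mu_system B m' e' f' c' by fact
    obtain \<delta> y where y: "fbasis (corner B e) \<delta> y" using corner_ex_fbasis[OF assms(1) mu.e_closed] .
    obtain \<delta>' y' where y': "fbasis (corner B e') \<delta>' y'" using corner_ex_fbasis[OF assms(1) mu'.e_closed] .
    have N: "N = m * m * \<delta>" "N = m' * m' * \<delta>'"
      using fbasis_unique[OF assms(1)] mu_system_basis[OF mu y] mu_system_basis[OF mu' y'] by blast+
    interpret R: rmod B "right_ideal B e" "\<lambda>v x. v \<otimes>\<^bsub>B\<^esub> x" by (rule rmod_right_ideal[OF mu.e_closed])
    have bas: "fbasis (right_ideal B e) (m * \<delta>) (\<lambda>x. y (x mod \<delta>) \<otimes>\<^bsub>B\<^esub> c (x div \<delta>))"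
      by (rule mu_system_right_ideal_basis[OF mu y])
    obtain r where "m * \<delta> = m' * r * \<delta>'"
      by (rule R.rmod_basis[OF mu' bas y']) (use R.V.fbasis_unique[OF bas] in blast)
    then have "m' * \<delta>' * m' = m' * \<delta>' * (m * r)" using N by (simp add: ac_simps)
    \<comment> \<open>Needed to cancel m' \<delta>'. If \<delta>' were zero, then \<open>B\<close>
      would have dimension zero and e = 0.\<close>
    moreover have "\<delta>' > 0"
    proof (rule ccontr)
      assume "\<not> \<delta>' > 0"
      then have "N = 0" using N by simp
      then have "\<one>\<^bsub>B\<^esub> = \<zero>\<^bsub>B\<^esub>" using assms(1) unfolding fbasis_def by (metis A.one_closed lc_0)
      then have "\<one>\<^bsub>B\<^esub> \<otimes>\<^bsub>B\<^esub> e = \<zero>\<^bsub>B\<^esub> \<otimes>\<^bsub>B\<^esub> e" by simp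
      then show False using mu.e_nonzero by simp
    qed
    ultimately show ?thesis using mu'.m_pos by simp
  qed
  show ?thesis using dvd[OF assms(2,3)] dvd[OF assms(3,2)] by (rule dvd_antisym)
qed

end

subsection \<open>Scalar extension\<close>

text \<open>The two records may have different scalar multiplications and even different types of
  scalars. This is how ring facts pass from a quotient ring to the quotient algebra, and from an
  algebra over an extension field to the same ring over the base field.\<close>

lemma ring_cong:
  assumes "ring R" "carrier S = carrier R" "monoid.mult S = monoid.mult R" "one S = one R"
    "ring.zero S = ring.zero R" "add S = add R"
  shows "ring S"
proof -
  interpret R: ring R by fact
  show ?thesis
  proof (rule ringI)
    show "abelian_group S"
      by (rule abelian_groupI) (auto simp: assms(2-) R.a_ac intro: R.add.l_inv_ex)
    show "Group.monoid S"
      by (rule monoidI) (auto simp: assms(2-) R.m_assoc)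
  qed (auto simp: assms(2-) R.l_distr R.r_distr)
qed

lemma frag_extend_fun_diff:
  "frag_extend (\<lambda>x. f x - g x) u = frag_extend f u - frag_extend g u"
  using subset_UNIV
  by (induction u rule: frag_induction) (auto simp: frag_extend_diff)

lemma frag_extend_fun_add:
  "frag_extend (\<lambda>x. f x + g x) u = frag_extend f u + frag_extend g u"
  using subset_UNIV
  by (induction u rule: frag_induction) (auto simp: frag_extend_diff)

section \<open>Formal sums of pairs and the ideal of tensor relations\<close>

lemma pre_tensor_simps [simp]:
  "carrier (pre_tensor A L) = {u. Poly_Mapping.keys u \<subseteq> carrier A \<times> carrier L}"
  "one (pre_tensor A L) = frag_of (\<one>\<^bsub>A\<^esub>, \<one>\<^bsub>L\<^esub>)"
  "ring.zero (pre_tensor A L) = 0"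
  "add (pre_tensor A L) = (+)"
  by (auto simp: pre_tensor_def)

lemma pre_tensor_mult_of [simp]:
  "frag_of (a, b) \<otimes>\<^bsub>pre_tensor A L\<^esub> frag_of (a', b') = frag_of (a \<otimes>\<^bsub>A\<^esub> a', b \<otimes>\<^bsub>L\<^esub> b')"
  by (simp add: pre_tensor_def)

lemma pre_tensor_mult_zero [simp]:
  "0 \<otimes>\<^bsub>pre_tensor A L\<^esub> v = 0" "u \<otimes>\<^bsub>pre_tensor A L\<^esub> 0 = 0"
  by (auto simp: pre_tensor_def intro!: frag_extend_eq_0)

lemma pre_tensor_mult_diff:
  "(u - u') \<otimes>\<^bsub>pre_tensor A L\<^esub> v = u \<otimes>\<^bsub>pre_tensor A L\<^esub> v - u' \<otimes>\<^bsub>pre_tensor A L\<^esub> v"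
  "u \<otimes>\<^bsub>pre_tensor A L\<^esub> (v - v') = u \<otimes>\<^bsub>pre_tensor A L\<^esub> v - u \<otimes>\<^bsub>pre_tensor A L\<^esub> v'"
  "(u + u') \<otimes>\<^bsub>pre_tensor A L\<^esub> v = u \<otimes>\<^bsub>pre_tensor A L\<^esub> v + u' \<otimes>\<^bsub>pre_tensor A L\<^esub> v"
  "u \<otimes>\<^bsub>pre_tensor A L\<^esub> (v + v') = u \<otimes>\<^bsub>pre_tensor A L\<^esub> v + u \<otimes>\<^bsub>pre_tensor A L\<^esub> v'"
  by (simp_all add: pre_tensor_def frag_extend_diff frag_extend_add frag_extend_fun_diff[symmetric]
      frag_extend_fun_add[symmetric] case_prod_unfold)

lemma keys_add_closed:
  fixes u v :: "'z \<Rightarrow>\<^sub>0 int"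
  shows "Poly_Mapping.keys u \<subseteq> Z \<Longrightarrow> Poly_Mapping.keys v \<subseteq> Z \<Longrightarrow> Poly_Mapping.keys (u + v) \<subseteq> Z"
  using Poly_Mapping.keys_add[of u v] by blast

lemma keys_diff_closed:
  fixes u v :: "'z \<Rightarrow>\<^sub>0 int"
  shows "Poly_Mapping.keys u \<subseteq> Z \<Longrightarrow> Poly_Mapping.keys v \<subseteq> Z \<Longrightarrow> Poly_Mapping.keys (u - v) \<subseteq> Z"
  using keys_diff[of u v] by blast

text \<open>The additive subgroup generated by the relations. It turns out to be an ideal, so it
  contains \<open>tensor_ideal\<close>; an additive map that kills the relations therefore kills the
  whole ideal, and no products of relations have to be followed through the map.\<close>

inductive_set tensor_span ::
  "('a, 'k) ring_scheme \<Rightarrow> ('a, 'b) module \<Rightarrow> ('a, 'c) module \<Rightarrow> ('b \<times> 'c \<Rightarrow>\<^sub>0 int) set"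
  for K A L where
  zero: "0 \<in> tensor_span K A L"
| rel: "u \<in> tensor_relations K A L \<Longrightarrow> u \<in> tensor_span K A L"
| diff: "u \<in> tensor_span K A L \<Longrightarrow> v \<in> tensor_span K A L \<Longrightarrow> u - v \<in> tensor_span K A L"

locale tensor = A: falg A + L: falg L + L: cring L
  for A :: "('f :: field, 'b) module" and L :: "('f, 'c) module"
begin

abbreviation "P \<equiv> pre_tensor A L"
abbreviation "I \<equiv> tensor_ideal class_ring A L"
abbreviation "T \<equiv> base_change class_ring A L"
abbreviation pt (infix \<open>\<bowtie>\<close> 75) where "a \<bowtie> l \<equiv> pure_tensor class_ring A L a l"
abbreviation "S \<equiv> carrier A \<times> carrier L"

lemma P_closed:
  assumes "Poly_Mapping.keys u \<subseteq> S" "Poly_Mapping.keys v \<subseteq> S"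
  shows "Poly_Mapping.keys (u \<otimes>\<^bsub>P\<^esub> v) \<subseteq> S"
  using assms(1)
proof (induction rule: frag_induction)
  case (one x)
  obtain a b where x: "x = (a, b)" "a \<in> carrier A" "b \<in> carrier L" using one by auto
  show ?case unfolding x(1) using assms(2)
  proof (induction rule: frag_induction)
    case (one y)
    then show ?case using x by (cases y) auto
  next
    case (diff c d)
    then show ?case using keys_diff[of "frag_of (a, b) \<otimes>\<^bsub>P\<^esub> c" "frag_of (a, b) \<otimes>\<^bsub>P\<^esub> d"]
      by (auto simp: pre_tensor_mult_diff)
  qed auto
next
  case (diff c d)
  then show ?case using keys_diff[of "c \<otimes>\<^bsub>P\<^esub> v" "d \<otimes>\<^bsub>P\<^esub> v"] by (auto simp: pre_tensor_mult_diff)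
qed auto

lemma P_assoc:
  assumes "Poly_Mapping.keys u \<subseteq> S" "Poly_Mapping.keys v \<subseteq> S" "Poly_Mapping.keys w \<subseteq> S"
  shows "(u \<otimes>\<^bsub>P\<^esub> v) \<otimes>\<^bsub>P\<^esub> w = u \<otimes>\<^bsub>P\<^esub> (v \<otimes>\<^bsub>P\<^esub> w)"
  using assms(1)
proof (induction rule: frag_induction)
  case (one x)
  obtain a b where x: "x = (a, b)" "a \<in> carrier A" "b \<in> carrier L" using one by auto
  show ?case unfolding x(1) using assms(2)
  proof (induction rule: frag_induction)
    case (one y)
    obtain a' b' where y: "y = (a', b')" "a' \<in> carrier A" "b' \<in> carrier L" using one by auto
    show ?case unfolding y(1) using assms(3)
    proof (induction rule: frag_induction)
      case (one z)
      then show ?case using x y by (cases z) (auto simp: A.A.m_assoc L.A.m_assoc)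
    qed (auto simp: pre_tensor_mult_diff)
  qed (auto simp: pre_tensor_mult_diff)
qed (auto simp: pre_tensor_mult_diff)

lemma P_one:
  assumes "Poly_Mapping.keys u \<subseteq> S"
  shows "frag_of (\<one>\<^bsub>A\<^esub>, \<one>\<^bsub>L\<^esub>) \<otimes>\<^bsub>P\<^esub> u = u" "u \<otimes>\<^bsub>P\<^esub> frag_of (\<one>\<^bsub>A\<^esub>, \<one>\<^bsub>L\<^esub>) = u"
  using assms by (induction rule: frag_induction) (auto simp: pre_tensor_mult_diff)

text \<open>Expresses scaling as multiplication by a fixed element; this makes scaling compatible
  with the passage to cosets.\<close>

lemma P_smult:
  assumes "Poly_Mapping.keys u \<subseteq> S"
  shows "l \<odot>\<^bsub>P\<^esub> u = frag_of (\<one>\<^bsub>A\<^esub>, l) \<otimes>\<^bsub>P\<^esub> u"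
  using assms
proof (induction rule: frag_induction)
  case zero
  then show ?case by (simp add: pre_tensor_def)
next
  case (one x)
  then show ?case by (cases x) (auto simp: pre_tensor_def)
next
  case (diff a b)
  then show ?case by (simp add: pre_tensor_mult_diff) (simp add: pre_tensor_def frag_extend_diff)
qed

lemma P_ring: "ring P"
proof (rule ringI)
  show "abelian_group P"
  proof (rule abelian_groupI)
    fix x assume "x \<in> carrier P"
    then show "\<exists>y\<in>carrier P. y \<oplus>\<^bsub>P\<^esub> x = \<zero>\<^bsub>P\<^esub>"
      by (intro bexI[of _ "- x"]) (auto simp: keys_minus)
  next
    fix x y assume "x \<in> carrier P" "y \<in> carrier P"
    then show "x \<oplus>\<^bsub>P\<^esub> y \<in> carrier P" using keys_add_closed[of x S y] by simp
  qed (auto simp: add_ac)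
  show "Group.monoid P"
    by (rule monoidI) (use P_closed in \<open>auto simp: P_assoc P_one\<close>)
qed (auto simp: pre_tensor_mult_diff)

sublocale P: ring P by (rule P_ring)

lemma P_minus: "u \<in> carrier P \<Longrightarrow> v \<in> carrier P \<Longrightarrow> u \<ominus>\<^bsub>P\<^esub> v = u - v"
proof -
  assume u: "u \<in> carrier P" and v: "v \<in> carrier P"
  have "\<ominus>\<^bsub>P\<^esub> v = - v" by (rule P.minus_equality) (use v in \<open>auto simp: keys_minus\<close>)
  then show ?thesis by (simp add: P.minus_eq)
qed

lemma relations_carrier: "tensor_relations class_ring A L \<subseteq> carrier P"
  unfolding tensor_relations_def
  by (auto dest!: keys_diff_closed[THEN subsetD, rotated 2, of _ _ _ S]) 

lemma span_carrier: "u \<in> tensor_span class_ring A L \<Longrightarrow> u \<in> carrier P"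
proof (induction rule: tensor_span.induct)
  case (rel u)
  then show ?case using relations_carrier by blast
next
  case (diff u v)
  then show ?case using keys_diff_closed[of u S v] by simp
qed simp

text \<open>Each of the three kinds of relation is mapped to the same kind by multiplication with a
  pair from either side. So forming the ideal adds nothing to the additive span.\<close>

lemma relations_mult:
  assumes "r \<in> tensor_relations class_ring A L" "x \<in> carrier A" "l \<in> carrier L"
  shows "frag_of (x, l) \<otimes>\<^bsub>P\<^esub> r \<in> tensor_relations class_ring A L"
    "r \<otimes>\<^bsub>P\<^esub> frag_of (x, l) \<in> tensor_relations class_ring A L"
proof -
  consider (a) a a' b where "r = frag_of (a \<oplus>\<^bsub>A\<^esub> a', b) - frag_of (a, b) - frag_of (a', b)"
      "a \<in> carrier A" "a' \<in> carrier A" "b \<in> carrier L"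
    | (b) a b b' where "r = frag_of (a, b \<oplus>\<^bsub>L\<^esub> b') - frag_of (a, b) - frag_of (a, b')"
      "a \<in> carrier A" "b \<in> carrier L" "b' \<in> carrier L"
    | (c) k a b where "r = frag_of (k \<odot>\<^bsub>A\<^esub> a, b) - frag_of (a, k \<odot>\<^bsub>L\<^esub> b)"
      "a \<in> carrier A" "b \<in> carrier L"
    using assms(1) unfolding tensor_relations_def by auto
  then have "frag_of (x, l) \<otimes>\<^bsub>P\<^esub> r \<in> tensor_relations class_ring A L \<and>
    r \<otimes>\<^bsub>P\<^esub> frag_of (x, l) \<in> tensor_relations class_ring A L"
  proof cases
    case a
    have "frag_of (x, l) \<otimes>\<^bsub>P\<^esub> r = frag_of (x \<otimes>\<^bsub>A\<^esub> a \<oplus>\<^bsub>A\<^esub> x \<otimes>\<^bsub>A\<^esub> a', l \<otimes>\<^bsub>L\<^esub> b) - frag_of (x \<otimes>\<^bsub>A\<^esub> a, l \<otimes>\<^bsub>L\<^esub> b) - frag_of (x \<otimes>\<^bsub>A\<^esub> a', l \<otimes>\<^bsub>L\<^esub> b)"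
      "r \<otimes>\<^bsub>P\<^esub> frag_of (x, l) = frag_of (a \<otimes>\<^bsub>A\<^esub> x \<oplus>\<^bsub>A\<^esub> a' \<otimes>\<^bsub>A\<^esub> x, b \<otimes>\<^bsub>L\<^esub> l) - frag_of (a \<otimes>\<^bsub>A\<^esub> x, b \<otimes>\<^bsub>L\<^esub> l) - frag_of (a' \<otimes>\<^bsub>A\<^esub> x, b \<otimes>\<^bsub>L\<^esub> l)"
      using a assms by (simp_all add: pre_tensor_mult_diff A.A.r_distr A.A.l_distr)
    then show ?thesis unfolding tensor_relations_def using a assms by blast
  next
    case b
    have "frag_of (x, l) \<otimes>\<^bsub>P\<^esub> r = frag_of (x \<otimes>\<^bsub>A\<^esub> a, l \<otimes>\<^bsub>L\<^esub> b \<oplus>\<^bsub>L\<^esub> l \<otimes>\<^bsub>L\<^esub> b') - frag_of (x \<otimes>\<^bsub>A\<^esub> a, l \<otimes>\<^bsub>L\<^esub> b) - frag_of (x \<otimes>\<^bsub>A\<^esub> a, l \<otimes>\<^bsub>L\<^esub> b')"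
      "r \<otimes>\<^bsub>P\<^esub> frag_of (x, l) = frag_of (a \<otimes>\<^bsub>A\<^esub> x, b \<otimes>\<^bsub>L\<^esub> l \<oplus>\<^bsub>L\<^esub> b' \<otimes>\<^bsub>L\<^esub> l) - frag_of (a \<otimes>\<^bsub>A\<^esub> x, b \<otimes>\<^bsub>L\<^esub> l) - frag_of (a \<otimes>\<^bsub>A\<^esub> x, b' \<otimes>\<^bsub>L\<^esub> l)"
      using b assms by (simp_all add: pre_tensor_mult_diff L.A.r_distr L.A.l_distr)
    then show ?thesis unfolding tensor_relations_def using b assms by blast
  next
    case c
    have "frag_of (x, l) \<otimes>\<^bsub>P\<^esub> r = frag_of (k \<odot>\<^bsub>A\<^esub> (x \<otimes>\<^bsub>A\<^esub> a), l \<otimes>\<^bsub>L\<^esub> b) - frag_of (x \<otimes>\<^bsub>A\<^esub> a, k \<odot>\<^bsub>L\<^esub> (l \<otimes>\<^bsub>L\<^esub> b))"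
      "r \<otimes>\<^bsub>P\<^esub> frag_of (x, l) = frag_of (k \<odot>\<^bsub>A\<^esub> (a \<otimes>\<^bsub>A\<^esub> x), b \<otimes>\<^bsub>L\<^esub> l) - frag_of (a \<otimes>\<^bsub>A\<^esub> x, k \<odot>\<^bsub>L\<^esub> (b \<otimes>\<^bsub>L\<^esub> l))"
      using c assms by (simp_all add: pre_tensor_mult_diff A.sc_l A.sc_r L.sc_l L.sc_r)
    moreover have "x \<otimes>\<^bsub>A\<^esub> a \<in> carrier A" "a \<otimes>\<^bsub>A\<^esub> x \<in> carrier A" "l \<otimes>\<^bsub>L\<^esub> b \<in> carrier L" "b \<otimes>\<^bsub>L\<^esub> l \<in> carrier L"
      using c assms by auto
    ultimately show ?thesis unfolding tensor_relations_def by simp blast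
  qed
  then show "frag_of (x, l) \<otimes>\<^bsub>P\<^esub> r \<in> tensor_relations class_ring A L"
    "r \<otimes>\<^bsub>P\<^esub> frag_of (x, l) \<in> tensor_relations class_ring A L" by auto
qed

lemma span_mult:
  assumes "u \<in> tensor_span class_ring A L" "v \<in> carrier P"
  shows "v \<otimes>\<^bsub>P\<^esub> u \<in> tensor_span class_ring A L" "u \<otimes>\<^bsub>P\<^esub> v \<in> tensor_span class_ring A L"
proof -
  have 1: "frag_of (x, l) \<otimes>\<^bsub>P\<^esub> u \<in> tensor_span class_ring A L \<and> u \<otimes>\<^bsub>P\<^esub> frag_of (x, l) \<in> tensor_span class_ring A L"
    if "x \<in> carrier A" "l \<in> carrier L" for x l
    using assms(1)
    by (induction rule: tensor_span.induct)
      (auto simp: pre_tensor_mult_diff intro: tensor_span.intros relations_mult that)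
  have "Poly_Mapping.keys v \<subseteq> S" using assms(2) by simp
  then have "v \<otimes>\<^bsub>P\<^esub> u \<in> tensor_span class_ring A L \<and> u \<otimes>\<^bsub>P\<^esub> v \<in> tensor_span class_ring A L"
  proof (induction rule: frag_induction)
    case (one x)
    then show ?case using 1 by (cases x) auto
  qed (auto simp: pre_tensor_mult_diff intro: tensor_span.intros)
  then show "v \<otimes>\<^bsub>P\<^esub> u \<in> tensor_span class_ring A L" "u \<otimes>\<^bsub>P\<^esub> v \<in> tensor_span class_ring A L" by auto
qed

lemma span_ideal: "ideal (tensor_span class_ring A L) P"
proof (rule idealI[OF P_ring])
  show "subgroup (tensor_span class_ring A L) (add_monoid P)"
  proof (rule group.subgroupI)
    show "Group.group (add_monoid P)" by (rule P.add.group_axioms)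
    show "tensor_span class_ring A L \<subseteq> carrier (add_monoid P)" using span_carrier by auto
    show "tensor_span class_ring A L \<noteq> {}" using tensor_span.zero by blast
  next
    fix a assume a: "a \<in> tensor_span class_ring A L"
    have "a \<in> carrier P" by (rule span_carrier[OF a])
    then have "inv\<^bsub>add_monoid P\<^esub> a = 0 - a"
      using P_minus[of 0 a] P.minus_eq[of 0 a] by (simp add: a_inv_def)
    then show "inv\<^bsub>add_monoid P\<^esub> a \<in> tensor_span class_ring A L"
      using tensor_span.diff[OF tensor_span.zero a] by simp
  next
    fix a b assume a: "a \<in> tensor_span class_ring A L" and b: "b \<in> tensor_span class_ring A L"
    have "a - (0 - b) \<in> tensor_span class_ring A L"
      by (rule tensor_span.diff[OF a tensor_span.diff[OF tensor_span.zero b]])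
    then show "a \<otimes>\<^bsub>add_monoid P\<^esub> b \<in> tensor_span class_ring A L" by simp
  qed
qed (auto intro: span_mult)

lemma I_ideal: "ideal I P"
  unfolding tensor_ideal_def by (rule P.genideal_ideal[OF relations_carrier])

sublocale I: ideal I P by (rule I_ideal)

lemma I_subset_span: "I \<subseteq> tensor_span class_ring A L"
  unfolding tensor_ideal_def
  by (rule P.genideal_minimal[OF span_ideal]) (auto intro: tensor_span.rel)

lemma relations_I: "tensor_relations class_ring A L \<subseteq> I"
  unfolding tensor_ideal_def by (rule P.genideal_self[OF relations_carrier])

section \<open>Calculation in the tensor product: pure tensors, universal property, freeness over
  the second factor\<close>

lemma T_simps:
  "carrier T = a_rcosets\<^bsub>P\<^esub> I" "monoid.mult T = rcoset_mult P I" "one T = I +>\<^bsub>P\<^esub> \<one>\<^bsub>P\<^esub>"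
  "ring.zero T = I" "add T = set_add P"
  by (auto simp: base_change_def quot_algebra_def FactRing_def)

lemma T_ring: "ring T"
  by (rule ring_cong[OF I.quotient_is_ring]) (auto simp: base_change_def quot_algebra_def)

sublocale T: ring T by (rule T_ring)

lemma T_rep:
  assumes "x \<in> carrier T"
  obtains u where "u \<in> carrier P" "x = I +>\<^bsub>P\<^esub> u"
  using assms by (auto simp: T_simps A_RCOSETS_def RCOSETS_def a_r_coset_def)

lemma cls_closed: "u \<in> carrier P \<Longrightarrow> I +>\<^bsub>P\<^esub> u \<in> carrier T"
  unfolding T_simps by (rule P.a_rcosetsI[OF I.a_subset])

lemma cls_add: "u \<in> carrier P \<Longrightarrow> v \<in> carrier P \<Longrightarrow> (I +>\<^bsub>P\<^esub> u) \<oplus>\<^bsub>T\<^esub> (I +>\<^bsub>P\<^esub> v) = I +>\<^bsub>P\<^esub> (u + v)"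
  unfolding T_simps using I.a_rcos_sum[of u v] by simp

lemma cls_mult: "u \<in> carrier P \<Longrightarrow> v \<in> carrier P \<Longrightarrow> (I +>\<^bsub>P\<^esub> u) \<otimes>\<^bsub>T\<^esub> (I +>\<^bsub>P\<^esub> v) = I +>\<^bsub>P\<^esub> (u \<otimes>\<^bsub>P\<^esub> v)"
  unfolding T_simps by (rule I.rcoset_mult_add)

lemma cls_zero: "I +>\<^bsub>P\<^esub> 0 = \<zero>\<^bsub>T\<^esub>"
  unfolding T_simps using I.a_rcos_const[OF I.zero_closed] by simp

lemma cls_eq_iff: "u \<in> carrier P \<Longrightarrow> v \<in> carrier P \<Longrightarrow> I +>\<^bsub>P\<^esub> u = I +>\<^bsub>P\<^esub> v \<longleftrightarrow> u - v \<in> I"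
  using P.quotient_eq_iff_same_a_r_cos[OF I_ideal, of u v] P_minus[of u v] by simp

lemma cls_diff: "u \<in> carrier P \<Longrightarrow> v \<in> carrier P \<Longrightarrow> (I +>\<^bsub>P\<^esub> u) \<ominus>\<^bsub>T\<^esub> (I +>\<^bsub>P\<^esub> v) = I +>\<^bsub>P\<^esub> (u - v)"
proof -
  assume u: "u \<in> carrier P" and v: "v \<in> carrier P"
  have uv: "u - v \<in> carrier P" using u v keys_diff_closed[of u S v] by simp
  have "(I +>\<^bsub>P\<^esub> (u - v)) \<oplus>\<^bsub>T\<^esub> (I +>\<^bsub>P\<^esub> v) = I +>\<^bsub>P\<^esub> u" using cls_add[OF uv v] by simp
  then show ?thesis using cls_closed[OF u] cls_closed[OF v] cls_closed[OF uv]
    by (metis T.add.inv_solve_right' T.minus_eq)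
qed

lemma pure_closed [simp]: "a \<in> carrier A \<Longrightarrow> l \<in> carrier L \<Longrightarrow> a \<bowtie> l \<in> carrier T"
  unfolding pure_tensor_def by (rule cls_closed) simp

lemma pure_mult: "a \<in> carrier A \<Longrightarrow> l \<in> carrier L \<Longrightarrow> a' \<in> carrier A \<Longrightarrow> l' \<in> carrier L \<Longrightarrow>
    (a \<bowtie> l) \<otimes>\<^bsub>T\<^esub> (a' \<bowtie> l') = (a \<otimes>\<^bsub>A\<^esub> a') \<bowtie> (l \<otimes>\<^bsub>L\<^esub> l')"
  unfolding pure_tensor_def by (subst cls_mult) auto

lemma pure_one: "\<one>\<^bsub>A\<^esub> \<bowtie> \<one>\<^bsub>L\<^esub> = \<one>\<^bsub>T\<^esub>"
  unfolding pure_tensor_def T_simps by simp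

lemma pure_add_left: "a \<in> carrier A \<Longrightarrow> a' \<in> carrier A \<Longrightarrow> l \<in> carrier L \<Longrightarrow>
    (a \<oplus>\<^bsub>A\<^esub> a') \<bowtie> l = a \<bowtie> l \<oplus>\<^bsub>T\<^esub> a' \<bowtie> l"
proof -
  assume *: "a \<in> carrier A" "a' \<in> carrier A" "l \<in> carrier L"
  have "frag_of (a \<oplus>\<^bsub>A\<^esub> a', l) - frag_of (a, l) - frag_of (a', l) \<in> I"
    using relations_I * unfolding tensor_relations_def by blast
  then have "I +>\<^bsub>P\<^esub> frag_of (a \<oplus>\<^bsub>A\<^esub> a', l) = I +>\<^bsub>P\<^esub> (frag_of (a, l) + frag_of (a', l))"
    using * keys_add_closed[of "frag_of (a, l)" S "frag_of (a', l)"] by (subst cls_eq_iff) (auto simp: diff_diff_eq)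
  then show ?thesis unfolding pure_tensor_def using * by (subst cls_add) auto
qed

lemma pure_add_right: "a \<in> carrier A \<Longrightarrow> l \<in> carrier L \<Longrightarrow> l' \<in> carrier L \<Longrightarrow>
    a \<bowtie> (l \<oplus>\<^bsub>L\<^esub> l') = a \<bowtie> l \<oplus>\<^bsub>T\<^esub> a \<bowtie> l'"
proof -
  assume *: "a \<in> carrier A" "l \<in> carrier L" "l' \<in> carrier L"
  have "frag_of (a, l \<oplus>\<^bsub>L\<^esub> l') - frag_of (a, l) - frag_of (a, l') \<in> I"
    using relations_I * unfolding tensor_relations_def by blast
  then have "I +>\<^bsub>P\<^esub> frag_of (a, l \<oplus>\<^bsub>L\<^esub> l') = I +>\<^bsub>P\<^esub> (frag_of (a, l) + frag_of (a, l'))"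
    using * keys_add_closed[of "frag_of (a, l)" S "frag_of (a, l')"] by (subst cls_eq_iff) (auto simp: diff_diff_eq)
  then show ?thesis unfolding pure_tensor_def using * by (subst cls_add) auto
qed

lemma pure_sc: "a \<in> carrier A \<Longrightarrow> l \<in> carrier L \<Longrightarrow> (k \<odot>\<^bsub>A\<^esub> a) \<bowtie> l = a \<bowtie> (k \<odot>\<^bsub>L\<^esub> l)"
proof -
  assume *: "a \<in> carrier A" "l \<in> carrier L"
  have "frag_of (k \<odot>\<^bsub>A\<^esub> a, l) - frag_of (a, k \<odot>\<^bsub>L\<^esub> l) \<in> I"
    using relations_I * unfolding tensor_relations_def by simp blast
  then show ?thesis unfolding pure_tensor_def using * by (subst cls_eq_iff) auto
qed

text \<open>Differences take the place of sums because the free abelian group is generated by the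
  pairs in this form; negatives of pure tensors then come at no cost.\<close>

lemma T_induct [consumes 1, case_names pure zero diff]:
  assumes "x \<in> carrier T"
    and pure: "\<And>a l. a \<in> carrier A \<Longrightarrow> l \<in> carrier L \<Longrightarrow> Q (a \<bowtie> l)"
    and zero: "Q \<zero>\<^bsub>T\<^esub>"
    and diff: "\<And>x y. x \<in> carrier T \<Longrightarrow> y \<in> carrier T \<Longrightarrow> Q x \<Longrightarrow> Q y \<Longrightarrow> Q (x \<ominus>\<^bsub>T\<^esub> y)"
  shows "Q x"
proof -
  obtain u where u: "u \<in> carrier P" "x = I +>\<^bsub>P\<^esub> u" using T_rep[OF assms(1)] .
  have "Poly_Mapping.keys u \<subseteq> S" using u by simp
  then have "u \<in> carrier P \<and> Q (I +>\<^bsub>P\<^esub> u)"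
  proof (induction rule: frag_induction)
    case zero
    then show ?case using assms(3) by (simp add: cls_zero)
  next
    case (one z)
    then show ?case using pure by (cases z) (auto simp: pure_tensor_def)
  next
    case (diff a b)
    then show ?case using assms(4)[of "I +>\<^bsub>P\<^esub> a" "I +>\<^bsub>P\<^esub> b"] keys_diff_closed[of a S b]
      by (auto simp: cls_closed cls_diff)
  qed
  then show ?thesis using u by simp
qed

text \<open>In a quotient algebra the scalar multiple of a coset is a union over its
  representatives. Here all these cosets coincide, since scaling by l is multiplication by the class
  of (1, l).\<close>

lemma T_smult: 
  assumes "l \<in> carrier L" "x \<in> carrier T"
  shows "l \<odot>\<^bsub>T\<^esub> x = (\<one>\<^bsub>A\<^esub> \<bowtie> l) \<otimes>\<^bsub>T\<^esub> x"
proof -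
  obtain u where u: "u \<in> carrier P" "x = I +>\<^bsub>P\<^esub> u" using T_rep[OF assms(2)] .
  let ?l = "frag_of (\<one>\<^bsub>A\<^esub>, l)"
  have l: "?l \<in> carrier P" using assms(1) by simp
  have eq: "I +>\<^bsub>P\<^esub> (l \<odot>\<^bsub>P\<^esub> y) = I +>\<^bsub>P\<^esub> (?l \<otimes>\<^bsub>P\<^esub> u)" if "y \<in> I +>\<^bsub>P\<^esub> u" for y
  proof -
    have y: "y \<in> carrier P" using that u(1) I.a_subset P.a_r_coset_subset_G by blast
    have "I +>\<^bsub>P\<^esub> (l \<odot>\<^bsub>P\<^esub> y) = (I +>\<^bsub>P\<^esub> ?l) \<otimes>\<^bsub>T\<^esub> (I +>\<^bsub>P\<^esub> y)"
      using y l by (simp add: P_smult cls_mult)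
    also have "I +>\<^bsub>P\<^esub> y = I +>\<^bsub>P\<^esub> u" using I.a_repr_independence'[OF that u(1)] by simp
    finally show ?thesis using u l by (simp add: cls_mult)
  qed
  have "l \<odot>\<^bsub>T\<^esub> x = (\<Union>y\<in>I +>\<^bsub>P\<^esub> u. I +>\<^bsub>P\<^esub> (l \<odot>\<^bsub>P\<^esub> y))"
    by (simp add: base_change_def quot_algebra_def u)
  also have "\<dots> = (\<Union>y\<in>I +>\<^bsub>P\<^esub> u. I +>\<^bsub>P\<^esub> (?l \<otimes>\<^bsub>P\<^esub> u))" using eq by simp
  also have "\<dots> = I +>\<^bsub>P\<^esub> (?l \<otimes>\<^bsub>P\<^esub> u)" using I.a_rcos_self[OF u(1)] by auto
  finally show ?thesis unfolding pure_tensor_def u(2) using cls_mult[OF l u(1)] by simp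
qed

text \<open>The free abelian group on the pairs provides a homomorphism \<open>h0\<close>. It kills
  \<open>tensor_span\<close>, which contains the ideal, and so descends to cosets. The target is
  just an abelian group; where the induced map should respect products, this is checked afterwards
  by \<open>T_induct\<close>.\<close>

theorem T_universal:
  assumes "abelian_group G"
    and cl: "\<And>a l. a \<in> carrier A \<Longrightarrow> l \<in> carrier L \<Longrightarrow> \<beta> a l \<in> carrier G"
    and add_l: "\<And>a a' l. a \<in> carrier A \<Longrightarrow> a' \<in> carrier A \<Longrightarrow> l \<in> carrier L \<Longrightarrow> \<beta> (a \<oplus>\<^bsub>A\<^esub> a') l = \<beta> a l \<oplus>\<^bsub>G\<^esub> \<beta> a' l"
    and add_r: "\<And>a l l'. a \<in> carrier A \<Longrightarrow> l \<in> carrier L \<Longrightarrow> l' \<in> carrier L \<Longrightarrow> \<beta> a (l \<oplus>\<^bsub>L\<^esub> l') = \<beta> a l \<oplus>\<^bsub>G\<^esub> \<beta> a l'"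
    and bal: "\<And>k a l. a \<in> carrier A \<Longrightarrow> l \<in> carrier L \<Longrightarrow> \<beta> (k \<odot>\<^bsub>A\<^esub> a) l = \<beta> a (k \<odot>\<^bsub>L\<^esub> l)"
  obtains h where "\<And>x. x \<in> carrier T \<Longrightarrow> h x \<in> carrier G"
    "\<And>x y. x \<in> carrier T \<Longrightarrow> y \<in> carrier T \<Longrightarrow> h (x \<oplus>\<^bsub>T\<^esub> y) = h x \<oplus>\<^bsub>G\<^esub> h y"
    "\<And>a l. a \<in> carrier A \<Longrightarrow> l \<in> carrier L \<Longrightarrow> h (a \<bowtie> l) = \<beta> a l"
proof -
  interpret G: abelian_group G by fact
  obtain h0 where h0: "h0 \<in> hom (free_Abelian_group S) (add_monoid G)"
    "\<And>x. x \<in> S \<Longrightarrow> h0 (frag_of x) = (\<lambda>(a, l). \<beta> a l) x"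
  proof (rule comm_group.free_Abelian_group_universal[OF G.a_comm_group])
    show "(\<lambda>(a, l). \<beta> a l) ` S \<subseteq> carrier (add_monoid G)" using cl by auto
  qed blast
  interpret h0: group_hom "free_Abelian_group S" "add_monoid G" h0
    by (rule group_hom.intro) (use h0(1) G.a_group in \<open>auto simp: group_hom_axioms_def\<close>)
  have h0c: "h0 u \<in> carrier G" if "u \<in> carrier P" for u
    using h0.hom_closed[of u] that by (simp add: free_Abelian_group_def)
  have h0a: "h0 (u + v) = h0 u \<oplus>\<^bsub>G\<^esub> h0 v" if "u \<in> carrier P" "v \<in> carrier P" for u v
    using h0.hom_mult[of u v] that by (simp add: free_Abelian_group_def)
  have h00: "h0 0 = \<zero>\<^bsub>G\<^esub>" using h0.hom_one by (simp add: free_Abelian_group_def)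
  have h0d: "h0 (u - v) = h0 u \<ominus>\<^bsub>G\<^esub> h0 v" if uv: "u \<in> carrier P" "v \<in> carrier P" for u v
  proof -
    have d: "u - v \<in> carrier P" using that keys_diff_closed[of u S v] by simp
    have "h0 (u - v) \<oplus>\<^bsub>G\<^esub> h0 v = h0 u" using h0a[OF d uv(2)] by simp
    then show ?thesis using h0c[OF d] h0c[OF uv(1)] h0c[OF uv(2)]
      by (metis G.add.inv_solve_right' G.minus_eq)
  qed
  have of: "h0 (frag_of (a, l)) = \<beta> a l" if "a \<in> carrier A" "l \<in> carrier L" for a l
    using h0(2)[of "(a, l)"] that by simp
  have ofc: "frag_of (a, l) \<in> carrier P" if "a \<in> carrier A" "l \<in> carrier L" for a l using that by simp
  have kill: "h0 u = \<zero>\<^bsub>G\<^esub>" if "u \<in> tensor_span class_ring A L" for u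
    using that
  proof (induction rule: tensor_span.induct)
    case (rel u)
    have d3: "h0 (x - y - z) = h0 x \<ominus>\<^bsub>G\<^esub> h0 y \<ominus>\<^bsub>G\<^esub> h0 z" if "x \<in> carrier P" "y \<in> carrier P" "z \<in> carrier P" for x y z
      using that keys_diff_closed[of x S y] h0d by simp
    have g: "(x \<oplus>\<^bsub>G\<^esub> y) \<ominus>\<^bsub>G\<^esub> x \<ominus>\<^bsub>G\<^esub> y = \<zero>\<^bsub>G\<^esub>" if "x \<in> carrier G" "y \<in> carrier G" for x y
    proof -
      have "(x \<oplus>\<^bsub>G\<^esub> y) \<ominus>\<^bsub>G\<^esub> x \<ominus>\<^bsub>G\<^esub> y = (x \<oplus>\<^bsub>G\<^esub> y) \<oplus>\<^bsub>G\<^esub> (\<ominus>\<^bsub>G\<^esub> x \<oplus>\<^bsub>G\<^esub> \<ominus>\<^bsub>G\<^esub> y)"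
        using that by (simp add: G.minus_eq G.a_assoc)
      then show ?thesis
        using that G.add_four[of x y "\<ominus>\<^bsub>G\<^esub> x" "\<ominus>\<^bsub>G\<^esub> y"] by (simp add: G.r_neg)
    qed
    from rel show ?case unfolding tensor_relations_def
      using cl g by (auto simp: d3 h0d of add_l add_r bal)
  next
    case (diff u v)
    then show ?case using h0d[of u v] span_carrier by (simp add: G.minus_eq)
  qed (rule h00)
  \<comment> \<open>A coset is evaluated at a chosen representative. The choice is immaterial
    because two representatives differ by an element that \<open>h0\<close> kills.\<close>
  define h where "h x = h0 (SOME u. u \<in> carrier P \<and> x = I +>\<^bsub>P\<^esub> u)" for x
  have h: "h (I +>\<^bsub>P\<^esub> u) = h0 u" if u: "u \<in> carrier P" for u
  proof -
    let ?v = "SOME v. v \<in> carrier P \<and> I +>\<^bsub>P\<^esub> u = I +>\<^bsub>P\<^esub> v"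
    have "?v \<in> carrier P \<and> I +>\<^bsub>P\<^esub> u = I +>\<^bsub>P\<^esub> ?v" by (rule someI[of _ u]) (use u in simp)
    then have v: "?v \<in> carrier P" "I +>\<^bsub>P\<^esub> u = I +>\<^bsub>P\<^esub> ?v" by auto
    then have "u - ?v \<in> I" using cls_eq_iff[OF u v(1)] by simp
    then have "h0 (u - ?v) = \<zero>\<^bsub>G\<^esub>" using kill I_subset_span by blast
    then have "h0 u \<ominus>\<^bsub>G\<^esub> h0 ?v = \<zero>\<^bsub>G\<^esub>" by (simp only: h0d[OF u v(1)])
    then have "h0 u = h0 ?v" by (simp only: G.minus_other_side[OF h0c[OF u] h0c[OF v(1)]])
    then show ?thesis by (simp only: h_def)
  qed
  show ?thesis
  proof (rule that[of h])
    fix x assume "x \<in> carrier T"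
    then show "h x \<in> carrier G" using T_rep h h0c by metis
  next
    fix x y assume "x \<in> carrier T" "y \<in> carrier T"
    then obtain u v where uv: "u \<in> carrier P" "x = I +>\<^bsub>P\<^esub> u" "v \<in> carrier P" "y = I +>\<^bsub>P\<^esub> v" using T_rep by metis
    have "u + v \<in> carrier P" using uv keys_add_closed[of u S v] by simp
    then show "h (x \<oplus>\<^bsub>T\<^esub> y) = h x \<oplus>\<^bsub>G\<^esub> h y" using uv h h0a by (simp only: cls_add)
  next
    fix a l assume "a \<in> carrier A" "l \<in> carrier L"
    then show "h (a \<bowtie> l) = \<beta> a l" unfolding pure_tensor_def using h ofc of by simp
  qed
qed

lemma pure_zero_left [simp]: "l \<in> carrier L \<Longrightarrow> \<zero>\<^bsub>A\<^esub> \<bowtie> l = \<zero>\<^bsub>T\<^esub>"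
  using pure_add_left[of "\<zero>\<^bsub>A\<^esub>" "\<zero>\<^bsub>A\<^esub>" l] by (metis A.M.l_zero A.M.zero_closed T.add.l_cancel_one' pure_closed)

lemma pure_zero_right [simp]: "a \<in> carrier A \<Longrightarrow> a \<bowtie> \<zero>\<^bsub>L\<^esub> = \<zero>\<^bsub>T\<^esub>"
  using pure_add_right[of a "\<zero>\<^bsub>L\<^esub>" "\<zero>\<^bsub>L\<^esub>"] by (metis L.M.l_zero L.M.zero_closed T.add.l_cancel_one' pure_closed)

lemma pure_minus_right: "a \<in> carrier A \<Longrightarrow> l \<in> carrier L \<Longrightarrow> \<ominus>\<^bsub>T\<^esub> (a \<bowtie> l) = a \<bowtie> (\<ominus>\<^bsub>L\<^esub> l)"
  by (rule T.minus_equality) (auto simp: pure_add_right[symmetric] L.M.l_neg)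

lemma pure_expand:
  assumes "fbasis A N y" "a \<in> carrier A" "l \<in> carrier L"
  shows "a \<bowtie> l = (\<Oplus>\<^bsub>T\<^esub>i\<in>{..<N}. y i \<bowtie> (coord A N y a i \<odot>\<^bsub>L\<^esub> l))"
proof -
  have y: "\<And>i. i < N \<Longrightarrow> y i \<in> carrier A" using A.fbasisD(2)[OF assms(1)] .
  have "a \<bowtie> l = (\<Oplus>\<^bsub>A\<^esub>i\<in>{..<N}. coord A N y a i \<odot>\<^bsub>A\<^esub> y i) \<bowtie> l"
    using A.lc_coord[OF assms(1,2)] by (simp add: lc_def)
  also have "\<dots> = (\<Oplus>\<^bsub>T\<^esub>i\<in>{..<N}. (coord A N y a i \<odot>\<^bsub>A\<^esub> y i) \<bowtie> l)"
    by (rule finsum_hom[OF A.M.abelian_monoid_axioms T.abelian_monoid_axioms])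
      (use y assms(3) in \<open>auto simp: pure_add_left\<close>)
  also have "\<dots> = (\<Oplus>\<^bsub>T\<^esub>i\<in>{..<N}. y i \<bowtie> (coord A N y a i \<odot>\<^bsub>L\<^esub> l))"
    by (rule T.finsum_cong') (use y assms(3) in \<open>auto simp: pure_sc\<close>)
  finally show ?thesis .
qed

lemma T_expand:
  assumes "fbasis A N y" "x \<in> carrier T"
  shows "\<exists>l. (\<forall>i<N. l i \<in> carrier L) \<and> x = (\<Oplus>\<^bsub>T\<^esub>i\<in>{..<N}. y i \<bowtie> l i)"
proof -
  have y: "\<And>i. i < N \<Longrightarrow> y i \<in> carrier A" using A.fbasisD(2)[OF assms(1)] .
  show ?thesis using assms(2)
  proof (induction rule: T_induct)
    case (pure a l)
    then show ?case using pure_expand[OF assms(1) pure]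
      by (intro exI[of _ "\<lambda>i. coord A N y a i \<odot>\<^bsub>L\<^esub> l"]) simp
  next
    case zero
    have "(\<Oplus>\<^bsub>T\<^esub>i\<in>{..<N}. y i \<bowtie> \<zero>\<^bsub>L\<^esub>) = \<zero>\<^bsub>T\<^esub>" by (rule T.finsum_eq_zero) (use y in auto)
    then show ?case by (intro exI[of _ "\<lambda>_. \<zero>\<^bsub>L\<^esub>"]) simp
  next
    case (diff x x')
    then obtain l l' where l: "\<And>i. i < N \<Longrightarrow> l i \<in> carrier L" "x = (\<Oplus>\<^bsub>T\<^esub>i\<in>{..<N}. y i \<bowtie> l i)"
      and l': "\<And>i. i < N \<Longrightarrow> l' i \<in> carrier L" "x' = (\<Oplus>\<^bsub>T\<^esub>i\<in>{..<N}. y i \<bowtie> l' i)" by auto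
    have "\<ominus>\<^bsub>T\<^esub> x' = (\<Oplus>\<^bsub>T\<^esub>i\<in>{..<N}. \<ominus>\<^bsub>T\<^esub> (y i \<bowtie> l' i))" unfolding l'(2)
      by (rule finsum_hom[OF T.abelian_monoid_axioms T.abelian_monoid_axioms])
        (use y l' in \<open>auto simp: T.minus_add\<close>)
    then have "x \<ominus>\<^bsub>T\<^esub> x' = (\<Oplus>\<^bsub>T\<^esub>i\<in>{..<N}. y i \<bowtie> l i) \<oplus>\<^bsub>T\<^esub> (\<Oplus>\<^bsub>T\<^esub>i\<in>{..<N}. \<ominus>\<^bsub>T\<^esub> (y i \<bowtie> l' i))"
      unfolding T.minus_eq l(2) by simp
    also have "\<dots> = (\<Oplus>\<^bsub>T\<^esub>i\<in>{..<N}. y i \<bowtie> l i \<oplus>\<^bsub>T\<^esub> \<ominus>\<^bsub>T\<^esub> (y i \<bowtie> l' i))"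
      by (rule T.finsum_addf[symmetric]) (use y l l' in auto)
    also have "\<dots> = (\<Oplus>\<^bsub>T\<^esub>i\<in>{..<N}. y i \<bowtie> (l i \<oplus>\<^bsub>L\<^esub> \<ominus>\<^bsub>L\<^esub> l' i))"
      by (rule T.finsum_cong') (use y l l' in \<open>auto simp: pure_minus_right pure_add_right\<close>)
    finally show ?case using l l' by (intro exI[of _ "\<lambda>i. l i \<oplus>\<^bsub>L\<^esub> \<ominus>\<^bsub>L\<^esub> l' i"]) simp
  qed
qed

text \<open>The map a \<otimes> l \<mapsto> (j-th coordinate of a) l is balanced and so defined on
  the tensor product; it sends the sum to l_j. With \<open>T_expand\<close> this makes the elements
  y_i \<otimes> 1 a basis over \<open>L\<close>.\<close>

lemma T_independent:
  assumes "fbasis A N y" "\<And>i. i < N \<Longrightarrow> l i \<in> carrier L"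
    "(\<Oplus>\<^bsub>T\<^esub>i\<in>{..<N}. y i \<bowtie> l i) = \<zero>\<^bsub>T\<^esub>" "j < N"
  shows "l j = \<zero>\<^bsub>L\<^esub>"
proof -
  have y: "\<And>i. i < N \<Longrightarrow> y i \<in> carrier A" using A.fbasisD(2)[OF assms(1)] .
  obtain h where h: "\<And>x. x \<in> carrier T \<Longrightarrow> h x \<in> carrier L"
    "\<And>x y. x \<in> carrier T \<Longrightarrow> y \<in> carrier T \<Longrightarrow> h (x \<oplus>\<^bsub>T\<^esub> y) = h x \<oplus>\<^bsub>L\<^esub> h y"
    "\<And>a l. a \<in> carrier A \<Longrightarrow> l \<in> carrier L \<Longrightarrow> h (a \<bowtie> l) = coord A N y a j \<odot>\<^bsub>L\<^esub> l"
    by (rule T_universal[of L "\<lambda>a l. coord A N y a j \<odot>\<^bsub>L\<^esub> l"])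
      (use assms(1,4) in \<open>auto simp: A.coord_add A.coord_smult L.sc_add L.sc_distr
        L.sc_mult[symmetric] mult.commute intro: L.M.abelian_group_axioms\<close>)
  have h0: "h \<zero>\<^bsub>T\<^esub> = \<zero>\<^bsub>L\<^esub>"
    using h(2)[of "\<zero>\<^bsub>T\<^esub>" "\<zero>\<^bsub>T\<^esub>"] h(1)[of "\<zero>\<^bsub>T\<^esub>"] by simp
  have "\<zero>\<^bsub>L\<^esub> = h (\<Oplus>\<^bsub>T\<^esub>i\<in>{..<N}. y i \<bowtie> l i)" using assms(3) h0 by simp
  also have "\<dots> = (\<Oplus>\<^bsub>L\<^esub>i\<in>{..<N}. h (y i \<bowtie> l i))"
    by (rule finsum_hom[OF T.abelian_monoid_axioms L.M.abelian_monoid_axioms])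
      (use y assms(2) h h0 in auto)
  also have "\<dots> = h (y j \<bowtie> l j)"
    by (rule L.M.finsum_eq_single) (use y assms h in \<open>auto simp: A.coord_basis\<close>)
  also have "\<dots> = l j" using h(3) y assms by (simp add: A.coord_basis)
  finally show ?thesis by simp
qed

end

subsection \<open>Simplicity of the scalar extension\<close>

context ring
begin

text \<open>Multiplication operators up to equality on the carrier. The elements of
  \<open>mult_ops\<close> are total functions of a fixed shape, and composites or finite sums of
  them have that shape only after rewriting that is valid on the carrier.\<close>

definition is_mop :: "('a \<Rightarrow> 'a) \<Rightarrow> bool" where
  "is_mop g \<longleftrightarrow> (\<exists>E\<in>mult_ops R. \<forall>x\<in>carrier R. g x = E x)"

lemma is_mop_mult: "p \<in> carrier R \<Longrightarrow> q \<in> carrier R \<Longrightarrow> is_mop (\<lambda>x. p \<otimes> x \<otimes> q)"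
  unfolding is_mop_def by (intro bexI[of _ "\<lambda>x. p \<otimes> x \<otimes> q"] mult_ops.mult) auto

lemma is_mop_add: "is_mop g \<Longrightarrow> is_mop h \<Longrightarrow> is_mop (\<lambda>x. g x \<oplus> h x)"
  unfolding is_mop_def by (fastforce intro: mult_ops.add)

lemma is_mop_cong: "is_mop g \<Longrightarrow> (\<And>x. x \<in> carrier R \<Longrightarrow> h x = g x) \<Longrightarrow> is_mop h"
  unfolding is_mop_def by auto

lemma is_mop_id: "is_mop (\<lambda>x. x)"
  by (rule is_mop_cong[OF is_mop_mult[of \<one> \<one>]]) auto

lemma is_mop_zero: "is_mop (\<lambda>x. \<zero>)"
  by (rule is_mop_cong[OF is_mop_mult[of \<zero> \<zero>]]) auto

lemma is_mop_closed: "is_mop g \<Longrightarrow> x \<in> carrier R \<Longrightarrow> g x \<in> carrier R"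
  unfolding is_mop_def using mult_ops_closed by auto

lemma is_mop_sandwich:
  assumes "is_mop g" "p \<in> carrier R" "q \<in> carrier R"
  shows "is_mop (\<lambda>x. p \<otimes> g x \<otimes> q)"
proof -
  obtain E where E: "E \<in> mult_ops R" "\<forall>x\<in>carrier R. g x = E x" using assms(1) by (auto simp: is_mop_def)
  have "is_mop (\<lambda>x. p \<otimes> E x \<otimes> q)" using E(1)
  proof induction
    case (mult p' q')
    then have "is_mop (\<lambda>x. (p \<otimes> p') \<otimes> x \<otimes> (q' \<otimes> q))" using assms by (intro is_mop_mult) auto
    then show ?case by (rule is_mop_cong) (use assms mult in \<open>auto simp: m_assoc\<close>)
  next
    case (add E E')
    then have "is_mop (\<lambda>x. (p \<otimes> E x \<otimes> q) \<oplus> (p \<otimes> E' x \<otimes> q))" by (intro is_mop_add)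
    then show ?case by (rule is_mop_cong) (use assms add in \<open>auto simp: l_distr r_distr mult_ops_closed\<close>)
  qed
  then show ?thesis by (rule is_mop_cong) (use E in auto)
qed

lemma is_mop_lmult: "is_mop g \<Longrightarrow> p \<in> carrier R \<Longrightarrow> is_mop (\<lambda>x. p \<otimes> g x)"
  by (rule is_mop_cong[OF is_mop_sandwich[of g p \<one>]]) (auto simp: is_mop_closed)

lemma is_mop_rmult: "is_mop g \<Longrightarrow> p \<in> carrier R \<Longrightarrow> is_mop (\<lambda>x. g x \<otimes> p)"
  by (rule is_mop_cong[OF is_mop_sandwich[of g \<one> p]]) (auto simp: is_mop_closed)

lemma is_mop_comp:
  assumes "is_mop h" "is_mop g"
  shows "is_mop (\<lambda>x. h (g x))"
proof -
  obtain E where E: "E \<in> mult_ops R" "\<forall>x\<in>carrier R. h x = E x" using assms(1) by (auto simp: is_mop_def)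
  have "is_mop (\<lambda>x. E (g x))" using E(1)
    by induction (auto intro: is_mop_sandwich is_mop_add assms(2))
  then show ?thesis by (rule is_mop_cong) (use E assms(2) is_mop_closed in auto)
qed

lemma is_mop_sum:
  assumes "finite J" "\<And>j. j \<in> J \<Longrightarrow> is_mop (g j)"
  shows "is_mop (\<lambda>x. \<Oplus>j\<in>J. g j x)"
  using assms
proof (induction J)
  case empty
  then show ?case using is_mop_zero by simp
next
  case (insert k J)
  then have "is_mop (\<lambda>x. g k x \<oplus> (\<Oplus>j\<in>J. g j x))" by (intro is_mop_add) auto
  then show ?case
    by (rule is_mop_cong) (use insert is_mop_closed in \<open>auto intro!: finsum_insert\<close>)
qed

lemma is_mop_diff:
  assumes "is_mop g" "is_mop h"
  shows "is_mop (\<lambda>x. g x \<ominus> h x)"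
  by (rule is_mop_cong[OF is_mop_add[OF assms(1) is_mop_lmult[OF assms(2), of "\<ominus> \<one>"]]])
    (use is_mop_closed assms in \<open>auto simp: minus_eq l_minus\<close>)

lemma mult_ops_additive:
  assumes "E \<in> mult_ops R" "x \<in> carrier R" "y \<in> carrier R"
  shows "E (x \<oplus> y) = E x \<oplus> E y"
  using assms(1)
proof induction
  case (mult p q)
  then show ?case using assms by (simp add: l_distr r_distr)
next
  case (add E E')
  then show ?case using assms add_four[of "E x" "E y" "E' x" "E' y"] by (simp add: mult_ops_closed)
qed

lemma mult_ops_zero: "E \<in> mult_ops R \<Longrightarrow> E \<zero> = \<zero>"
  by (induction rule: mult_ops.induct) auto

end

definition central_algebra :: "('k :: field, 'b) module \<Rightarrow> bool" where
  "central_algebra B \<longleftrightarrow> (\<forall>z\<in>carrier B. (\<forall>x\<in>carrier B. z \<otimes>\<^bsub>B\<^esub> x = x \<otimes>\<^bsub>B\<^esub> z) \<longrightarrow> (\<exists>k. z = k \<odot>\<^bsub>B\<^esub> \<one>\<^bsub>B\<^esub>))"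

context falg
begin

text \<open>A form of the Artin--Whaples density theorem.\<close>

theorem mult_ops_dense:
  assumes simple: "simple_ring B" and central: "central_algebra B" and y: "indep B N y"
    and "finite J" "J \<subseteq> {..<N}"
  shows "\<forall>i\<in>J. \<exists>g. A.is_mop g \<and> g (y i) = \<one>\<^bsub>B\<^esub> \<and> (\<forall>j\<in>J - {i}. g (y j) = \<zero>\<^bsub>B\<^esub>)"
  using assms(4,5)
proof (induction J)
  case empty
  then show ?case by simp
next
  case (insert k J)
  then have J: "J \<subseteq> {..<N}" and k: "k < N" "k \<notin> J" and fin: "finite J" by auto
  have yc: "\<And>i. i < N \<Longrightarrow> y i \<in> carrier B" using y indepD(1) by auto
  then have yJ: "\<And>j. j \<in> J \<Longrightarrow> y j \<in> carrier B" using J by auto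
  have "\<forall>i\<in>J. \<exists>g. A.is_mop g \<and> g (y i) = \<one>\<^bsub>B\<^esub> \<and> (\<forall>j\<in>J - {i}. g (y j) = \<zero>\<^bsub>B\<^esub>)"
    using insert.IH J by blast
  then obtain G where G: "\<And>i. i \<in> J \<Longrightarrow> A.is_mop (G i)" "\<And>i. i \<in> J \<Longrightarrow> G i (y i) = \<one>\<^bsub>B\<^esub>"
    "\<And>i j. i \<in> J \<Longrightarrow> j \<in> J \<Longrightarrow> j \<noteq> i \<Longrightarrow> G i (y j) = \<zero>\<^bsub>B\<^esub>"
    by (metis (no_types, lifting) Diff_iff bchoice empty_iff insert_iff)
  define c where "c j = G j (y k)" for j
  have c: "c j \<in> carrier B" if "j \<in> J" for j using A.is_mop_closed G(1)[OF that] yc k by (simp add: c_def)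
  \<comment> \<open>The core of the induction: some operator kills all y_j with j in J but not y_k.
    Otherwise y_k would be a combination of the y_j with coefficients in the centre.\<close>
  have "\<exists>g. A.is_mop g \<and> g (y k) \<noteq> \<zero>\<^bsub>B\<^esub> \<and> (\<forall>j\<in>J. g (y j) = \<zero>\<^bsub>B\<^esub>)"
  proof (rule ccontr)
    assume "\<not> ?thesis"
    then have no: "g (y k) = \<zero>\<^bsub>B\<^esub>" if "A.is_mop g" "\<And>j. j \<in> J \<Longrightarrow> g (y j) = \<zero>\<^bsub>B\<^esub>" for g
      using that by blast
    \<comment> \<open>The operator x \<mapsto> g x - \<Sum> g(y_j) G_j(x) kills every y_j with j in
      J, hence also y_k.\<close>
    have star: "g (y k) = (\<Oplus>\<^bsub>B\<^esub>j\<in>J. g (y j) \<otimes>\<^bsub>B\<^esub> c j)" if g: "A.is_mop g" for g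
    proof -
      have gJ: "g (y j) \<in> carrier B" if "j \<in> J" for j using A.is_mop_closed[OF g yJ[OF that]] .
      let ?h = "\<lambda>x. \<Oplus>\<^bsub>B\<^esub>j\<in>J. g (y j) \<otimes>\<^bsub>B\<^esub> G j x"
      have h: "A.is_mop ?h"
        using fin gJ G(1) by (intro A.is_mop_sum A.is_mop_lmult) auto
      have "?h (y i) = g (y i)" if i: "i \<in> J" for i
      proof -
        have "?h (y i) = (\<Oplus>\<^bsub>B\<^esub>j\<in>J. if i = j then g (y j) else \<zero>\<^bsub>B\<^esub>)"
          by (rule M.finsum_cong') (use i gJ G in auto)
        also have "\<dots> = g (y i)" by (rule M.add.finprod_singleton[OF i fin]) (use gJ in auto)
        finally show ?thesis .
      qed
      then have "g (y k) \<ominus>\<^bsub>B\<^esub> ?h (y k) = \<zero>\<^bsub>B\<^esub>"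
        using gJ by (intro no[OF A.is_mop_diff[OF g h]]) (auto simp: M.minus_eq M.r_neg)
      moreover have "g (y k) \<in> carrier B" "?h (y k) \<in> carrier B"
        using A.is_mop_closed g h yc k by blast+
      ultimately have "g (y k) = ?h (y k)" by simp
      then show ?thesis by (simp add: c_def)
    qed
    \<comment> \<open>In \<open>star\<close> take g x = G_i(x) b. Since G_i(y_j) is 1 for j = i and
      0 otherwise, this gives c_i b = b c_i.\<close>
    have cen: "\<exists>l. c i = l \<odot>\<^bsub>B\<^esub> \<one>\<^bsub>B\<^esub>" if i: "i \<in> J" for i
    proof -
      have "c i \<otimes>\<^bsub>B\<^esub> b = b \<otimes>\<^bsub>B\<^esub> c i" if b: "b \<in> carrier B" for b
      proof -
        have "c i \<otimes>\<^bsub>B\<^esub> b = (\<Oplus>\<^bsub>B\<^esub>j\<in>J. (G i (y j) \<otimes>\<^bsub>B\<^esub> b) \<otimes>\<^bsub>B\<^esub> c j)"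
          using star[OF A.is_mop_rmult[OF G(1)[OF i] b]] by (simp add: c_def)
        also have "\<dots> = (\<Oplus>\<^bsub>B\<^esub>j\<in>J. if i = j then b \<otimes>\<^bsub>B\<^esub> c j else \<zero>\<^bsub>B\<^esub>)"
          by (rule M.finsum_cong') (use i b c G(2,3)[OF i] in auto)
        also have "\<dots> = b \<otimes>\<^bsub>B\<^esub> c i" by (rule M.add.finprod_singleton[OF i fin]) (use b c in auto)
        finally show ?thesis .
      qed
      then show ?thesis using central c[OF i] unfolding central_algebra_def by blast
    qed
    then obtain l where l: "\<And>i. i \<in> J \<Longrightarrow> c i = l i \<odot>\<^bsub>B\<^esub> \<one>\<^bsub>B\<^esub>" by metis
    \<comment> \<open>In \<open>star\<close> take the identity. As the c_j are scalars, y_k becomes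
      a linear combination of the other y_j.\<close>
    have "y k = (\<Oplus>\<^bsub>B\<^esub>j\<in>J. y j \<otimes>\<^bsub>B\<^esub> c j)" using star[OF A.is_mop_id] .
    also have "\<dots> = (\<Oplus>\<^bsub>B\<^esub>j\<in>J. (if j \<in> J then l j else 0) \<odot>\<^bsub>B\<^esub> y j)"
      by (rule M.finsum_cong') (use l yJ in \<open>auto simp: sc_r\<close>)
    also have "\<dots> = lc B N y (\<lambda>j. if j \<in> J then l j else 0)"
      unfolding lc_def
      by (rule M.add.finprod_mono_neutral_cong_left) (use J yc yJ in auto)
    finally have "lc B N y (\<lambda>j. if j = k then 1 else 0) = lc B N y (\<lambda>j. if j \<in> J then l j else 0)"
      using lc_delta[of N y k] yc k by simp
    from lc_inj[OF y this k(1)] show False using k(2) by simp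
  qed
  then obtain g where g: "A.is_mop g" "g (y k) \<noteq> \<zero>\<^bsub>B\<^esub>" "\<forall>j\<in>J. g (y j) = \<zero>\<^bsub>B\<^esub>" by blast
  have "g (y k) \<in> carrier B" using A.is_mop_closed[OF g(1)] yc k by blast
  then obtain E where E: "E \<in> mult_ops B" "E (g (y k)) = \<one>\<^bsub>B\<^esub>"
    using simple g(2) by (auto simp: simple_ring_def)
  \<comment> \<open>The nonzero value g(y_k) generates the unit ideal, so a further operator brings
    it to 1.\<close>
  define h where "h x = E (g x)" for x
  have "A.is_mop E" using E(1) unfolding A.is_mop_def by auto
  then have h: "A.is_mop h" "h (y k) = \<one>\<^bsub>B\<^esub>" "\<And>j. j \<in> J \<Longrightarrow> h (y j) = \<zero>\<^bsub>B\<^esub>"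
    using A.is_mop_comp[OF _ g(1), of E] E g(3) A.mult_ops_zero by (auto simp: h_def[abs_def])
  show ?case
  proof
    fix i assume i: "i \<in> insert k J"
    show "\<exists>g. A.is_mop g \<and> g (y i) = \<one>\<^bsub>B\<^esub> \<and> (\<forall>j\<in>insert k J - {i}. g (y j) = \<zero>\<^bsub>B\<^esub>)"
    proof (cases "i = k")
      case True
      then show ?thesis using h k by (intro exI[of _ h]) auto
    next
      case False
      then have iJ: "i \<in> J" using i by simp
      \<comment> \<open>The operator \<open>G i\<close> of the smaller family may be nonzero at y_k.
        Subtracting c_i h corrects its value there and changes nothing at the y_j with j in J, where
        \<open>h\<close> vanishes.\<close>
      show ?thesis
      proof (intro exI[of _ "\<lambda>x. G i x \<ominus>\<^bsub>B\<^esub> c i \<otimes>\<^bsub>B\<^esub> h x"] conjI ballI)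
        show "A.is_mop (\<lambda>x. G i x \<ominus>\<^bsub>B\<^esub> c i \<otimes>\<^bsub>B\<^esub> h x)"
          using G(1) iJ h(1) c by (intro A.is_mop_diff A.is_mop_lmult) auto
        show "G i (y i) \<ominus>\<^bsub>B\<^esub> c i \<otimes>\<^bsub>B\<^esub> h (y i) = \<one>\<^bsub>B\<^esub>"
          using iJ G(2) h(3) c by (simp add: M.minus_eq)
        fix j assume "j \<in> insert k J - {i}"
        then consider "j = k" | "j \<in> J" "j \<noteq> i" by auto
        then show "G i (y j) \<ominus>\<^bsub>B\<^esub> c i \<otimes>\<^bsub>B\<^esub> h (y j) = \<zero>\<^bsub>B\<^esub>"
        proof cases
          case 1
          then show ?thesis using h(2) c[OF iJ] by (simp add: c_def M.minus_eq M.r_neg)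
        next
          case 2
          then show ?thesis using h(3) G(3)[OF iJ] c[OF iJ] by (simp add: M.minus_eq)
        qed
      qed
    qed
  qed
qed

end

context tensor
begin

lemma mult_ops_extend:
  assumes "E \<in> mult_ops A"
  obtains E' where "E' \<in> mult_ops T" "\<And>a l. a \<in> carrier A \<Longrightarrow> l \<in> carrier L \<Longrightarrow> E' (a \<bowtie> l) = E a \<bowtie> l"
proof -
  have "\<exists>E'\<in>mult_ops T. \<forall>a\<in>carrier A. \<forall>l\<in>carrier L. E' (a \<bowtie> l) = E a \<bowtie> l"
    using assms
  proof induction
    case (mult p q)
    then show ?case
      by (intro bexI[of _ "\<lambda>x. (p \<bowtie> \<one>\<^bsub>L\<^esub>) \<otimes>\<^bsub>T\<^esub> x \<otimes>\<^bsub>T\<^esub> (q \<bowtie> \<one>\<^bsub>L\<^esub>)"] mult_ops.mult)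
        (auto simp: pure_mult)
  next
    case (add E E')
    then obtain F F' where F: "F \<in> mult_ops T" "\<forall>a\<in>carrier A. \<forall>l\<in>carrier L. F (a \<bowtie> l) = E a \<bowtie> l"
      and F': "F' \<in> mult_ops T" "\<forall>a\<in>carrier A. \<forall>l\<in>carrier L. F' (a \<bowtie> l) = E' a \<bowtie> l" by blast
    then show ?case using A.A.mult_ops_closed add.hyps
      by (intro bexI[of _ "\<lambda>x. F x \<oplus>\<^bsub>T\<^esub> F' x"] mult_ops.add) (auto simp: pure_add_left)
  qed
  with that show ?thesis by blast
qed

lemma T_nontrivial:
  assumes "fbasis A N y" "\<one>\<^bsub>A\<^esub> \<noteq> \<zero>\<^bsub>A\<^esub>" "\<one>\<^bsub>L\<^esub> \<noteq> \<zero>\<^bsub>L\<^esub>"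
  shows "\<one>\<^bsub>T\<^esub> \<noteq> \<zero>\<^bsub>T\<^esub>"
proof
  assume 0: "\<one>\<^bsub>T\<^esub> = \<zero>\<^bsub>T\<^esub>"
  have "\<one>\<^bsub>T\<^esub> = (\<Oplus>\<^bsub>T\<^esub>i\<in>{..<N}. y i \<bowtie> (coord A N y \<one>\<^bsub>A\<^esub> i \<odot>\<^bsub>L\<^esub> \<one>\<^bsub>L\<^esub>))"
    using pure_expand[OF assms(1), of "\<one>\<^bsub>A\<^esub>" "\<one>\<^bsub>L\<^esub>"] pure_one by simp
  then have "coord A N y \<one>\<^bsub>A\<^esub> i \<odot>\<^bsub>L\<^esub> \<one>\<^bsub>L\<^esub> = \<zero>\<^bsub>L\<^esub>" if "i < N" for i
    using T_independent[OF assms(1) _ _ that, of "\<lambda>i. coord A N y \<one>\<^bsub>A\<^esub> i \<odot>\<^bsub>L\<^esub> \<one>\<^bsub>L\<^esub>"] 0 by simp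
  then have z: "coord A N y \<one>\<^bsub>A\<^esub> i = 0" if "i < N" for i
    using L.sc_eq_zero[of "\<one>\<^bsub>L\<^esub>"] that assms(3) by auto
  have "\<one>\<^bsub>A\<^esub> = lc A N y (coord A N y \<one>\<^bsub>A\<^esub>)" using A.lc_coord[OF assms(1)] by simp
  also have "\<dots> = lc A N y (\<lambda>_. 0)" by (rule A.lc_cong) (use A.fbasisD(2)[OF assms(1)] z in auto)
  also have "\<dots> = \<zero>\<^bsub>A\<^esub>" using A.fbasisD(2)[OF assms(1)] by simp
  finally show False using assms(2) by simp
qed

text \<open>Write x = \<Sum> y_i \<otimes> l_i with some l_k \<noteq> 0. Density provides a
  multiplication operator of \<open>A\<close> that sends y_k to 1 and the other y_i to 0; applied in
  the first factor it sends x to 1 \<otimes> l_k, and l_k is invertible. This serves both for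
  F[t]/(p) and for the algebraic closure.\<close>

theorem T_simple:
  assumes "simple_ring A" "central_algebra A" "fbasis A N y"
    and L1: "\<one>\<^bsub>L\<^esub> \<noteq> \<zero>\<^bsub>L\<^esub>" and L_inv: "\<And>l. l \<in> carrier L \<Longrightarrow> l \<noteq> \<zero>\<^bsub>L\<^esub> \<Longrightarrow> \<exists>l'\<in>carrier L. l' \<otimes>\<^bsub>L\<^esub> l = \<one>\<^bsub>L\<^esub>"
  shows "simple_ring T"
  unfolding simple_ring_def
proof (intro conjI ballI impI)
  show "\<one>\<^bsub>T\<^esub> \<noteq> \<zero>\<^bsub>T\<^esub>" using T_nontrivial[OF assms(3)] assms(1) L1 by (simp add: simple_ring_def)
  fix x assume x: "x \<in> carrier T" "x \<noteq> \<zero>\<^bsub>T\<^esub>"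
  have y: "\<And>i. i < N \<Longrightarrow> y i \<in> carrier A" using A.fbasisD(2)[OF assms(3)] .
  obtain l where l: "\<And>i. i < N \<Longrightarrow> l i \<in> carrier L" "x = (\<Oplus>\<^bsub>T\<^esub>i\<in>{..<N}. y i \<bowtie> l i)"
    using T_expand[OF assms(3) x(1)] by auto
  have "\<exists>k<N. l k \<noteq> \<zero>\<^bsub>L\<^esub>"
  proof (rule ccontr)
    assume "\<not> ?thesis"
    then have "x = \<zero>\<^bsub>T\<^esub>" unfolding l(2) by (intro T.finsum_eq_zero) (use y in auto)
    with x(2) show False by simp
  qed
  then obtain k l' where k: "k < N" "l k \<noteq> \<zero>\<^bsub>L\<^esub>" and l': "l' \<in> carrier L" "l' \<otimes>\<^bsub>L\<^esub> l k = \<one>\<^bsub>L\<^esub>"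
    using L_inv l(1) by blast
  obtain g where g: "A.A.is_mop g" "g (y k) = \<one>\<^bsub>A\<^esub>" "\<forall>j\<in>{..<N} - {k}. g (y j) = \<zero>\<^bsub>A\<^esub>"
    using A.mult_ops_dense[OF assms(1,2) A.fbasisD(1)[OF assms(3)], of "{..<N}"] k by blast
  then obtain E where E: "E \<in> mult_ops A" "\<And>a. a \<in> carrier A \<Longrightarrow> g a = E a" unfolding A.A.is_mop_def by auto
  obtain E' where E': "E' \<in> mult_ops T" "\<And>a l. a \<in> carrier A \<Longrightarrow> l \<in> carrier L \<Longrightarrow> E' (a \<bowtie> l) = E a \<bowtie> l"
    using mult_ops_extend[OF E(1)] by blast
  have "E' x = (\<Oplus>\<^bsub>T\<^esub>i\<in>{..<N}. E' (y i \<bowtie> l i))" unfolding l(2)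
    by (rule finsum_hom[OF T.abelian_monoid_axioms T.abelian_monoid_axioms])
      (use y l T.mult_ops_closed[OF E'(1)] T.mult_ops_additive[OF E'(1)] T.mult_ops_zero[OF E'(1)] in auto)
  also have "\<dots> = E' (y k \<bowtie> l k)"
  proof (rule T.finsum_eq_single[OF k(1)])
    fix i assume i: "i < N"
    then show "E' (y i \<bowtie> l i) \<in> carrier T" using y l T.mult_ops_closed[OF E'(1)] by simp
    assume "i \<noteq> k"
    then show "E' (y i \<bowtie> l i) = \<zero>\<^bsub>T\<^esub>"
    proof -
      have "E (y i) = \<zero>\<^bsub>A\<^esub>" using i \<open>i \<noteq> k\<close> E(2)[OF y[OF i]] g(3) by auto
      then show ?thesis using E'(2)[OF y[OF i] l(1)[OF i]] l(1)[OF i] by simp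
    qed
  qed
  also have "\<dots> = \<one>\<^bsub>A\<^esub> \<bowtie> l k" using k y l E' E(2)[of "y k"] g(2) by simp
  finally have E'x: "E' x = \<one>\<^bsub>A\<^esub> \<bowtie> l k" .
  have "T.is_mop E'" using E'(1) unfolding T.is_mop_def by auto
  then have "T.is_mop (\<lambda>x. (\<one>\<^bsub>A\<^esub> \<bowtie> l') \<otimes>\<^bsub>T\<^esub> E' x)" using l' by (intro T.is_mop_lmult) auto
  then obtain F where F: "F \<in> mult_ops T" "\<forall>x\<in>carrier T. (\<one>\<^bsub>A\<^esub> \<bowtie> l') \<otimes>\<^bsub>T\<^esub> E' x = F x"
    unfolding T.is_mop_def by auto
  have "F x = (\<one>\<^bsub>A\<^esub> \<bowtie> l') \<otimes>\<^bsub>T\<^esub> (\<one>\<^bsub>A\<^esub> \<bowtie> l k)" using F(2) x(1) E'x by auto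
  also have "\<dots> = \<one>\<^bsub>T\<^esub>" using l' l(1)[OF k(1)] by (simp add: pure_mult pure_one)
  finally show "\<exists>E\<in>mult_ops T. E x = \<one>\<^bsub>T\<^esub>" using F(1) by auto
qed

end

subsection \<open>Matrix algebras and capacity\<close>

lemma (in abelian_monoid) finsum_swap_lessThan:
  fixes m n :: nat
  assumes "\<And>i j. i < m \<Longrightarrow> j < n \<Longrightarrow> g i j \<in> carrier G"
  shows "(\<Oplus>i\<in>{..<m}. \<Oplus>j\<in>{..<n}. g i j) = (\<Oplus>j\<in>{..<n}. \<Oplus>i\<in>{..<m}. g i j)"
  using assms
proof (induction m)
  case 0
  have "(\<Oplus>j\<in>{..<n}. \<Oplus>i\<in>{..<0}. g i j) = \<zero>" by (rule finsum_eq_zero) simp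
  then show ?case by simp
next
  case (Suc m)
  have cl: "(\<Oplus>i\<in>{..<m}. g i j) \<in> carrier G" if "j < n" for j
    using Suc.prems that by (intro finsum_closed) auto
  have cl': "(\<Oplus>j\<in>{..<n}. g i j) \<in> carrier G" if "i < Suc m" for i
    using Suc.prems that by (intro finsum_closed) auto
  have "(\<Oplus>i\<in>{..<Suc m}. \<Oplus>j\<in>{..<n}. g i j) = (\<Oplus>i\<in>{..<m}. \<Oplus>j\<in>{..<n}. g i j) \<oplus> (\<Oplus>j\<in>{..<n}. g m j)"
    by (rule finsum_lessThan_Suc) (use cl' in auto)
  also have "(\<Oplus>i\<in>{..<m}. \<Oplus>j\<in>{..<n}. g i j) = (\<Oplus>j\<in>{..<n}. \<Oplus>i\<in>{..<m}. g i j)"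
    using Suc by simp
  also have "\<dots> \<oplus> (\<Oplus>j\<in>{..<n}. g m j) = (\<Oplus>j\<in>{..<n}. (\<Oplus>i\<in>{..<m}. g i j) \<oplus> g m j)"
    by (rule finsum_addf[symmetric]) (use cl Suc.prems in auto)
  also have "\<dots> = (\<Oplus>j\<in>{..<n}. \<Oplus>i\<in>{..<Suc m}. g i j)"
  proof (rule finsum_cong')
    fix j assume "j \<in> {..<n}"
    then show "(\<Oplus>i\<in>{..<m}. g i j) \<oplus> g m j = (\<Oplus>i\<in>{..<Suc m}. g i j)"
      using Suc.prems by (subst finsum_lessThan_Suc) auto
  qed (use Suc.prems in \<open>auto intro!: finsum_closed\<close>)
  finally show ?case .
qed

lemma mat_algebra_simps:
  "monoid.mult (mat_algebra n A) = (\<lambda>M N. mat n n (\<lambda>(i, j). \<Oplus>\<^bsub>A\<^esub>k\<in>{..<n}. M $$ (i, k) \<otimes>\<^bsub>A\<^esub> N $$ (k, j)))"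
  "one (mat_algebra n A) = mat n n (\<lambda>(i, j). if i = j then \<one>\<^bsub>A\<^esub> else \<zero>\<^bsub>A\<^esub>)"
  "ring.zero (mat_algebra n A) = mat n n (\<lambda>_. \<zero>\<^bsub>A\<^esub>)"
  "add (mat_algebra n A) = (\<lambda>M N. mat n n (\<lambda>ij. M $$ ij \<oplus>\<^bsub>A\<^esub> N $$ ij))"
  "module.smult (mat_algebra n A) = (\<lambda>k M. mat n n (\<lambda>ij. k \<odot>\<^bsub>A\<^esub> M $$ ij))"
  by (auto simp: mat_algebra_def)

lemma mat_algebra_carrier:
  "M \<in> carrier (mat_algebra n A) \<longleftrightarrow> M \<in> carrier_mat n n \<and> (\<forall>i<n. \<forall>j<n. M $$ (i, j) \<in> carrier A)"
  by (auto simp: mat_algebra_def)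

lemma mat_algebra_carrierD:
  assumes "M \<in> carrier (mat_algebra n A)"
  shows "dim_row M = n" "dim_col M = n" "i < n \<Longrightarrow> j < n \<Longrightarrow> M $$ (i, j) \<in> carrier A"
  using assms by (auto simp: mat_algebra_carrier)

lemma mat_algebra_ring:
  fixes D :: "('k, 'b) module"
  assumes "ring D"
  shows "ring (mat_algebra n D)"
proof -
  interpret D: ring D by fact
  let ?A = "mat_algebra n D"
  note [simp] = mat_algebra_carrierD
  have cl: "(\<Oplus>\<^bsub>D\<^esub>k\<in>{..<n}. M $$ (i, k) \<otimes>\<^bsub>D\<^esub> N $$ (k, j)) \<in> carrier D"
    if "M \<in> carrier ?A" "N \<in> carrier ?A" "i < n" "j < n" for M N i j
    using that by (intro D.finsum_closed) auto
  show ?thesis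
  proof (rule ringI)
    show "abelian_group ?A"
    proof (rule abelian_groupI)
      fix M assume M: "M \<in> carrier ?A"
      show "\<exists>N\<in>carrier ?A. N \<oplus>\<^bsub>?A\<^esub> M = \<zero>\<^bsub>?A\<^esub>"
        by (rule bexI[of _ "mat n n (\<lambda>ij. \<ominus>\<^bsub>D\<^esub> M $$ ij)"])
          (use M in \<open>auto simp: mat_algebra_simps mat_algebra_carrier D.l_neg intro!: eq_matI\<close>)
    qed (auto simp: mat_algebra_simps mat_algebra_carrier D.a_ac intro!: eq_matI)
    show "Group.monoid ?A"
    proof (rule monoidI)
      fix M N Q assume MNQ: "M \<in> carrier ?A" "N \<in> carrier ?A" "Q \<in> carrier ?A"
      show "M \<otimes>\<^bsub>?A\<^esub> N \<otimes>\<^bsub>?A\<^esub> Q = M \<otimes>\<^bsub>?A\<^esub> (N \<otimes>\<^bsub>?A\<^esub> Q)"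
      proof (rule eq_matI)
        fix i j assume "i < dim_row (M \<otimes>\<^bsub>?A\<^esub> (N \<otimes>\<^bsub>?A\<^esub> Q))" "j < dim_col (M \<otimes>\<^bsub>?A\<^esub> (N \<otimes>\<^bsub>?A\<^esub> Q))"
        then have ij: "i < n" "j < n" by (auto simp: mat_algebra_simps)
        have "(M \<otimes>\<^bsub>?A\<^esub> N \<otimes>\<^bsub>?A\<^esub> Q) $$ (i, j) = (\<Oplus>\<^bsub>D\<^esub>k\<in>{..<n}. (\<Oplus>\<^bsub>D\<^esub>l\<in>{..<n}. M $$ (i, l) \<otimes>\<^bsub>D\<^esub> N $$ (l, k)) \<otimes>\<^bsub>D\<^esub> Q $$ (k, j))"
          using ij MNQ cl by (auto simp: mat_algebra_simps intro!: D.finsum_cong')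
        also have "\<dots> = (\<Oplus>\<^bsub>D\<^esub>k\<in>{..<n}. \<Oplus>\<^bsub>D\<^esub>l\<in>{..<n}. M $$ (i, l) \<otimes>\<^bsub>D\<^esub> N $$ (l, k) \<otimes>\<^bsub>D\<^esub> Q $$ (k, j))"
          using ij MNQ by (intro D.finsum_cong') (auto intro!: D.finsum_ldistr D.finsum_closed)
        also have "\<dots> = (\<Oplus>\<^bsub>D\<^esub>l\<in>{..<n}. \<Oplus>\<^bsub>D\<^esub>k\<in>{..<n}. M $$ (i, l) \<otimes>\<^bsub>D\<^esub> N $$ (l, k) \<otimes>\<^bsub>D\<^esub> Q $$ (k, j))"
          using ij MNQ by (intro D.finsum_swap_lessThan) auto
        also have "\<dots> = (\<Oplus>\<^bsub>D\<^esub>l\<in>{..<n}. M $$ (i, l) \<otimes>\<^bsub>D\<^esub> (\<Oplus>\<^bsub>D\<^esub>k\<in>{..<n}. N $$ (l, k) \<otimes>\<^bsub>D\<^esub> Q $$ (k, j)))"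
        proof (rule D.finsum_cong')
          fix l assume "l \<in> {..<n}"
          then have l: "l < n" by simp
          have "M $$ (i, l) \<otimes>\<^bsub>D\<^esub> (\<Oplus>\<^bsub>D\<^esub>k\<in>{..<n}. N $$ (l, k) \<otimes>\<^bsub>D\<^esub> Q $$ (k, j)) =
            (\<Oplus>\<^bsub>D\<^esub>k\<in>{..<n}. M $$ (i, l) \<otimes>\<^bsub>D\<^esub> (N $$ (l, k) \<otimes>\<^bsub>D\<^esub> Q $$ (k, j)))"
            using ij MNQ l by (intro D.finsum_rdistr) auto
          also have "\<dots> = (\<Oplus>\<^bsub>D\<^esub>k\<in>{..<n}. M $$ (i, l) \<otimes>\<^bsub>D\<^esub> N $$ (l, k) \<otimes>\<^bsub>D\<^esub> Q $$ (k, j))"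
            using ij MNQ l by (intro D.finsum_cong') (auto simp: D.m_assoc)
          finally show "(\<Oplus>\<^bsub>D\<^esub>k\<in>{..<n}. M $$ (i, l) \<otimes>\<^bsub>D\<^esub> N $$ (l, k) \<otimes>\<^bsub>D\<^esub> Q $$ (k, j)) =
            M $$ (i, l) \<otimes>\<^bsub>D\<^esub> (\<Oplus>\<^bsub>D\<^esub>k\<in>{..<n}. N $$ (l, k) \<otimes>\<^bsub>D\<^esub> Q $$ (k, j))" by simp
        qed (use ij MNQ cl in auto)
        also have "\<dots> = (M \<otimes>\<^bsub>?A\<^esub> (N \<otimes>\<^bsub>?A\<^esub> Q)) $$ (i, j)"
          using ij MNQ cl by (auto simp: mat_algebra_simps intro!: D.finsum_cong')
        finally show "(M \<otimes>\<^bsub>?A\<^esub> N \<otimes>\<^bsub>?A\<^esub> Q) $$ (i, j) = (M \<otimes>\<^bsub>?A\<^esub> (N \<otimes>\<^bsub>?A\<^esub> Q)) $$ (i, j)" .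
      qed (auto simp: mat_algebra_simps)
    next
      fix M assume M: "M \<in> carrier ?A"
      show "\<one>\<^bsub>?A\<^esub> \<otimes>\<^bsub>?A\<^esub> M = M"
      proof (rule eq_matI)
        fix i j assume "i < dim_row M" "j < dim_col M"
        then have ij: "i < n" "j < n" using M by auto
        have "(\<one>\<^bsub>?A\<^esub> \<otimes>\<^bsub>?A\<^esub> M) $$ (i, j) = (\<Oplus>\<^bsub>D\<^esub>k\<in>{..<n}. (if i = k then \<one>\<^bsub>D\<^esub> else \<zero>\<^bsub>D\<^esub>) \<otimes>\<^bsub>D\<^esub> M $$ (k, j))"
          using ij M by (auto simp: mat_algebra_simps intro!: D.finsum_cong')
        also have "\<dots> = (if i = i then \<one>\<^bsub>D\<^esub> else \<zero>\<^bsub>D\<^esub>) \<otimes>\<^bsub>D\<^esub> M $$ (i, j)"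
          by (rule D.finsum_eq_single) (use ij M in auto)
        finally show "(\<one>\<^bsub>?A\<^esub> \<otimes>\<^bsub>?A\<^esub> M) $$ (i, j) = M $$ (i, j)" using ij M by simp
      qed (use M in \<open>auto simp: mat_algebra_simps\<close>)
      show "M \<otimes>\<^bsub>?A\<^esub> \<one>\<^bsub>?A\<^esub> = M"
      proof (rule eq_matI)
        fix i j assume "i < dim_row M" "j < dim_col M"
        then have ij: "i < n" "j < n" using M by auto
        have "(M \<otimes>\<^bsub>?A\<^esub> \<one>\<^bsub>?A\<^esub>) $$ (i, j) = (\<Oplus>\<^bsub>D\<^esub>k\<in>{..<n}. M $$ (i, k) \<otimes>\<^bsub>D\<^esub> (if k = j then \<one>\<^bsub>D\<^esub> else \<zero>\<^bsub>D\<^esub>))"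
          using ij M by (auto simp: mat_algebra_simps intro!: D.finsum_cong')
        also have "\<dots> = M $$ (i, j) \<otimes>\<^bsub>D\<^esub> (if j = j then \<one>\<^bsub>D\<^esub> else \<zero>\<^bsub>D\<^esub>)"
          by (rule D.finsum_eq_single) (use ij M in auto)
        finally show "(M \<otimes>\<^bsub>?A\<^esub> \<one>\<^bsub>?A\<^esub>) $$ (i, j) = M $$ (i, j)" using ij M by simp
      qed (use M in \<open>auto simp: mat_algebra_simps\<close>)
    qed (use cl in \<open>auto simp: mat_algebra_simps mat_algebra_carrier\<close>)
  next
    fix M N Q assume MNQ: "M \<in> carrier ?A" "N \<in> carrier ?A" "Q \<in> carrier ?A"
    show "(M \<oplus>\<^bsub>?A\<^esub> N) \<otimes>\<^bsub>?A\<^esub> Q = M \<otimes>\<^bsub>?A\<^esub> Q \<oplus>\<^bsub>?A\<^esub> N \<otimes>\<^bsub>?A\<^esub> Q"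
    proof (rule eq_matI)
      fix i j assume "i < dim_row (M \<otimes>\<^bsub>?A\<^esub> Q \<oplus>\<^bsub>?A\<^esub> N \<otimes>\<^bsub>?A\<^esub> Q)" "j < dim_col (M \<otimes>\<^bsub>?A\<^esub> Q \<oplus>\<^bsub>?A\<^esub> N \<otimes>\<^bsub>?A\<^esub> Q)"
      then have ij: "i < n" "j < n" by (auto simp: mat_algebra_simps)
      have "(\<Oplus>\<^bsub>D\<^esub>k\<in>{..<n}. (M $$ (i, k) \<oplus>\<^bsub>D\<^esub> N $$ (i, k)) \<otimes>\<^bsub>D\<^esub> Q $$ (k, j)) =
        (\<Oplus>\<^bsub>D\<^esub>k\<in>{..<n}. M $$ (i, k) \<otimes>\<^bsub>D\<^esub> Q $$ (k, j) \<oplus>\<^bsub>D\<^esub> N $$ (i, k) \<otimes>\<^bsub>D\<^esub> Q $$ (k, j))"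
        using ij MNQ by (intro D.finsum_cong') (auto simp: D.l_distr)
      also have "\<dots> = (\<Oplus>\<^bsub>D\<^esub>k\<in>{..<n}. M $$ (i, k) \<otimes>\<^bsub>D\<^esub> Q $$ (k, j)) \<oplus>\<^bsub>D\<^esub> (\<Oplus>\<^bsub>D\<^esub>k\<in>{..<n}. N $$ (i, k) \<otimes>\<^bsub>D\<^esub> Q $$ (k, j))"
        using ij MNQ by (intro D.finsum_addf) auto
      finally show "((M \<oplus>\<^bsub>?A\<^esub> N) \<otimes>\<^bsub>?A\<^esub> Q) $$ (i, j) = (M \<otimes>\<^bsub>?A\<^esub> Q \<oplus>\<^bsub>?A\<^esub> N \<otimes>\<^bsub>?A\<^esub> Q) $$ (i, j)"
        using ij MNQ D.finsum_cong'[of "{..<n}" "{..<n}" "\<lambda>k. (M $$ (i, k) \<oplus>\<^bsub>D\<^esub> N $$ (i, k)) \<otimes>\<^bsub>D\<^esub> Q $$ (k, j)"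
          "\<lambda>k. (M \<oplus>\<^bsub>?A\<^esub> N) $$ (i, k) \<otimes>\<^bsub>D\<^esub> Q $$ (k, j)"]
        by (auto simp: mat_algebra_simps)
    qed (auto simp: mat_algebra_simps)
    show "Q \<otimes>\<^bsub>?A\<^esub> (M \<oplus>\<^bsub>?A\<^esub> N) = Q \<otimes>\<^bsub>?A\<^esub> M \<oplus>\<^bsub>?A\<^esub> Q \<otimes>\<^bsub>?A\<^esub> N"
    proof (rule eq_matI)
      fix i j assume "i < dim_row (Q \<otimes>\<^bsub>?A\<^esub> M \<oplus>\<^bsub>?A\<^esub> Q \<otimes>\<^bsub>?A\<^esub> N)" "j < dim_col (Q \<otimes>\<^bsub>?A\<^esub> M \<oplus>\<^bsub>?A\<^esub> Q \<otimes>\<^bsub>?A\<^esub> N)"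
      then have ij: "i < n" "j < n" by (auto simp: mat_algebra_simps)
      have "(\<Oplus>\<^bsub>D\<^esub>k\<in>{..<n}. Q $$ (i, k) \<otimes>\<^bsub>D\<^esub> (M $$ (k, j) \<oplus>\<^bsub>D\<^esub> N $$ (k, j))) =
        (\<Oplus>\<^bsub>D\<^esub>k\<in>{..<n}. Q $$ (i, k) \<otimes>\<^bsub>D\<^esub> M $$ (k, j) \<oplus>\<^bsub>D\<^esub> Q $$ (i, k) \<otimes>\<^bsub>D\<^esub> N $$ (k, j))"
        using ij MNQ by (intro D.finsum_cong') (auto simp: D.r_distr)
      also have "\<dots> = (\<Oplus>\<^bsub>D\<^esub>k\<in>{..<n}. Q $$ (i, k) \<otimes>\<^bsub>D\<^esub> M $$ (k, j)) \<oplus>\<^bsub>D\<^esub> (\<Oplus>\<^bsub>D\<^esub>k\<in>{..<n}. Q $$ (i, k) \<otimes>\<^bsub>D\<^esub> N $$ (k, j))"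
        using ij MNQ by (intro D.finsum_addf) auto
      finally show "(Q \<otimes>\<^bsub>?A\<^esub> (M \<oplus>\<^bsub>?A\<^esub> N)) $$ (i, j) = (Q \<otimes>\<^bsub>?A\<^esub> M \<oplus>\<^bsub>?A\<^esub> Q \<otimes>\<^bsub>?A\<^esub> N) $$ (i, j)"
        using ij MNQ D.finsum_cong'[of "{..<n}" "{..<n}" "\<lambda>k. Q $$ (i, k) \<otimes>\<^bsub>D\<^esub> (M $$ (k, j) \<oplus>\<^bsub>D\<^esub> N $$ (k, j))"
          "\<lambda>k. Q $$ (i, k) \<otimes>\<^bsub>D\<^esub> (M \<oplus>\<^bsub>?A\<^esub> N) $$ (k, j)"]
        by (auto simp: mat_algebra_simps)
    qed (auto simp: mat_algebra_simps)
  qed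
qed


lemma assoc_algebraI:
  assumes "field K" "ring A"
    and "\<And>k x. k \<in> carrier K \<Longrightarrow> x \<in> carrier A \<Longrightarrow> k \<odot>\<^bsub>A\<^esub> x \<in> carrier A"
    and "\<And>k l x. k \<in> carrier K \<Longrightarrow> l \<in> carrier K \<Longrightarrow> x \<in> carrier A \<Longrightarrow> (k \<oplus>\<^bsub>K\<^esub> l) \<odot>\<^bsub>A\<^esub> x = k \<odot>\<^bsub>A\<^esub> x \<oplus>\<^bsub>A\<^esub> l \<odot>\<^bsub>A\<^esub> x"
    and "\<And>k x y. k \<in> carrier K \<Longrightarrow> x \<in> carrier A \<Longrightarrow> y \<in> carrier A \<Longrightarrow> k \<odot>\<^bsub>A\<^esub> (x \<oplus>\<^bsub>A\<^esub> y) = k \<odot>\<^bsub>A\<^esub> x \<oplus>\<^bsub>A\<^esub> k \<odot>\<^bsub>A\<^esub> y"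
    and "\<And>k l x. k \<in> carrier K \<Longrightarrow> l \<in> carrier K \<Longrightarrow> x \<in> carrier A \<Longrightarrow> (k \<otimes>\<^bsub>K\<^esub> l) \<odot>\<^bsub>A\<^esub> x = k \<odot>\<^bsub>A\<^esub> (l \<odot>\<^bsub>A\<^esub> x)"
    and "\<And>x. x \<in> carrier A \<Longrightarrow> \<one>\<^bsub>K\<^esub> \<odot>\<^bsub>A\<^esub> x = x"
    and "\<And>k x y. k \<in> carrier K \<Longrightarrow> x \<in> carrier A \<Longrightarrow> y \<in> carrier A \<Longrightarrow> (k \<odot>\<^bsub>A\<^esub> x) \<otimes>\<^bsub>A\<^esub> y = k \<odot>\<^bsub>A\<^esub> (x \<otimes>\<^bsub>A\<^esub> y)"
    and "\<And>k x y. k \<in> carrier K \<Longrightarrow> x \<in> carrier A \<Longrightarrow> y \<in> carrier A \<Longrightarrow> x \<otimes>\<^bsub>A\<^esub> (k \<odot>\<^bsub>A\<^esub> y) = k \<odot>\<^bsub>A\<^esub> (x \<otimes>\<^bsub>A\<^esub> y)"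
  shows "assoc_algebra K A"
proof -
  interpret K: field K by fact
  interpret A: ring A by fact
  have "module K A" by (rule moduleI) (use assms in \<open>auto intro: K.is_cring A.is_abelian_group\<close>)
  then show ?thesis
    by (intro assoc_algebra.intro vectorspace.intro assoc_algebra_axioms.intro) (use assms in auto)
qed

lemma assoc_algebraD:
  assumes "assoc_algebra K A"
  shows "field K" "ring A" "module K A"
proof -
  interpret assoc_algebra K A by fact
  show "field K" "ring A" "module K A" by unfold_locales
qed

lemma mat_algebra_assoc_algebra:
  assumes "assoc_algebra K D"
  shows "assoc_algebra K (mat_algebra n D)"
proof -
  interpret D: assoc_algebra K D by fact
  note [simp] = mat_algebra_carrierD
  show ?thesis
  proof (rule assoc_algebraI[OF assoc_algebraD(1)[OF assms] mat_algebra_ring[OF assoc_algebraD(2)[OF assms]]])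
    fix k M N assume *: "k \<in> carrier K" "M \<in> carrier (mat_algebra n D)" "N \<in> carrier (mat_algebra n D)"
    have sm: "k \<odot>\<^bsub>D\<^esub> (\<Oplus>\<^bsub>D\<^esub>l\<in>{..<n}. M $$ (i, l) \<otimes>\<^bsub>D\<^esub> N $$ (l, j)) =
      (\<Oplus>\<^bsub>D\<^esub>l\<in>{..<n}. k \<odot>\<^bsub>D\<^esub> (M $$ (i, l) \<otimes>\<^bsub>D\<^esub> N $$ (l, j)))" if "i < n" "j < n" for i j
      by (rule finsum_hom[OF D.M.abelian_monoid_axioms D.M.abelian_monoid_axioms])
        (use * that in \<open>auto simp: D.smult_r_distr\<close>)
    show "(k \<odot>\<^bsub>mat_algebra n D\<^esub> M) \<otimes>\<^bsub>mat_algebra n D\<^esub> N = k \<odot>\<^bsub>mat_algebra n D\<^esub> (M \<otimes>\<^bsub>mat_algebra n D\<^esub> N)"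
      using * by (intro eq_matI) (auto simp: mat_algebra_simps sm D.smult_mult_left intro!: D.M.finsum_cong')
    show "M \<otimes>\<^bsub>mat_algebra n D\<^esub> (k \<odot>\<^bsub>mat_algebra n D\<^esub> N) = k \<odot>\<^bsub>mat_algebra n D\<^esub> (M \<otimes>\<^bsub>mat_algebra n D\<^esub> N)"
      using * by (intro eq_matI) (auto simp: mat_algebra_simps sm D.smult_mult_right intro!: D.M.finsum_cong')
  qed (auto simp: mat_algebra_simps mat_algebra_carrier D.smult_l_distr D.smult_r_distr D.smult_assoc1 intro!: eq_matI)
qed

definition mat_unit :: "nat \<Rightarrow> ('k, 'b) module \<Rightarrow> nat \<Rightarrow> nat \<Rightarrow> 'b \<Rightarrow> 'b mat" where
  "mat_unit n D i j a = mat n n (\<lambda>(r, s). if r = i \<and> s = j then a else \<zero>\<^bsub>D\<^esub>)"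

lemma mat_unit_index [simp]:
  "r < n \<Longrightarrow> s < n \<Longrightarrow> mat_unit n D i j a $$ (r, s) = (if r = i \<and> s = j then a else \<zero>\<^bsub>D\<^esub>)"
  "dim_row (mat_unit n D i j a) = n" "dim_col (mat_unit n D i j a) = n"
  by (auto simp: mat_unit_def)

section \<open>Matrix units of a matrix algebra\<close>

locale mat_alg = D: ring D for D :: "('k, 'b) module" + fixes n :: nat
begin

abbreviation "A \<equiv> mat_algebra n D"

sublocale A: ring A by (rule mat_algebra_ring) unfold_locales

lemma unit_closed [simp]: "a \<in> carrier D \<Longrightarrow> mat_unit n D i j a \<in> carrier A"
  by (auto simp: mat_algebra_carrier)

lemma zero_one_index [simp]:
  "r < n \<Longrightarrow> s < n \<Longrightarrow> \<zero>\<^bsub>A\<^esub> $$ (r, s) = \<zero>\<^bsub>D\<^esub>" "dim_row \<zero>\<^bsub>A\<^esub> = n" "dim_col \<zero>\<^bsub>A\<^esub> = n"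
  "r < n \<Longrightarrow> s < n \<Longrightarrow> \<one>\<^bsub>A\<^esub> $$ (r, s) = (if r = s then \<one>\<^bsub>D\<^esub> else \<zero>\<^bsub>D\<^esub>)" "dim_row \<one>\<^bsub>A\<^esub> = n" "dim_col \<one>\<^bsub>A\<^esub> = n"
  by (auto simp: mat_algebra_simps)

lemma unit_mult_left:
  assumes "a \<in> carrier D" "N \<in> carrier A" "j < n" "r < n" "s < n"
  shows "(mat_unit n D i j a \<otimes>\<^bsub>A\<^esub> N) $$ (r, s) = (if r = i then a \<otimes>\<^bsub>D\<^esub> N $$ (j, s) else \<zero>\<^bsub>D\<^esub>)"
proof -
  note [simp] = mat_algebra_carrierD[OF assms(2)]
  have "(mat_unit n D i j a \<otimes>\<^bsub>A\<^esub> N) $$ (r, s) = (\<Oplus>\<^bsub>D\<^esub>k\<in>{..<n}. mat_unit n D i j a $$ (r, k) \<otimes>\<^bsub>D\<^esub> N $$ (k, s))"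
    using assms by (simp add: mat_algebra_simps)
  also have "\<dots> = mat_unit n D i j a $$ (r, j) \<otimes>\<^bsub>D\<^esub> N $$ (j, s)"
    by (rule D.finsum_eq_single) (use assms in auto)
  finally show ?thesis using assms by auto
qed

lemma unit_mult_right:
  assumes "a \<in> carrier D" "N \<in> carrier A" "i < n" "r < n" "s < n"
  shows "(N \<otimes>\<^bsub>A\<^esub> mat_unit n D i j a) $$ (r, s) = (if s = j then N $$ (r, i) \<otimes>\<^bsub>D\<^esub> a else \<zero>\<^bsub>D\<^esub>)"
proof -
  note [simp] = mat_algebra_carrierD[OF assms(2)]
  have "(N \<otimes>\<^bsub>A\<^esub> mat_unit n D i j a) $$ (r, s) = (\<Oplus>\<^bsub>D\<^esub>k\<in>{..<n}. N $$ (r, k) \<otimes>\<^bsub>D\<^esub> mat_unit n D i j a $$ (k, s))"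
    using assms by (simp add: mat_algebra_simps)
  also have "\<dots> = N $$ (r, i) \<otimes>\<^bsub>D\<^esub> mat_unit n D i j a $$ (i, s)"
    by (rule D.finsum_eq_single) (use assms in auto)
  finally show ?thesis using assms by auto
qed

lemma mult_dims [simp]: "dim_row (M \<otimes>\<^bsub>A\<^esub> N) = n" "dim_col (M \<otimes>\<^bsub>A\<^esub> N) = n"
  by (auto simp: mat_algebra_simps)

lemma unit_mult_unit:
  assumes "a \<in> carrier D" "b \<in> carrier D" "j < n" "k < n"
  shows "mat_unit n D i j a \<otimes>\<^bsub>A\<^esub> mat_unit n D k l b = (if j = k then mat_unit n D i l (a \<otimes>\<^bsub>D\<^esub> b) else \<zero>\<^bsub>A\<^esub>)"
  by (rule eq_matI) (use assms in \<open>auto simp: unit_mult_left\<close>)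

lemma finsum_index:
  assumes "\<And>k. k < t \<Longrightarrow> g k \<in> carrier A" "r < n" "s < n"
  shows "(\<Oplus>\<^bsub>A\<^esub>k\<in>{..<t :: nat}. g k) $$ (r, s) = (\<Oplus>\<^bsub>D\<^esub>k\<in>{..<t}. g k $$ (r, s))"
  by (rule finsum_hom[OF A.abelian_monoid_axioms D.abelian_monoid_axioms])
    (use assms in \<open>auto simp: mat_algebra_simps mat_algebra_carrier\<close>)

lemma corner_unit:
  assumes "N \<in> carrier A" "0 < n"
  shows "mat_unit n D 0 0 \<one>\<^bsub>D\<^esub> \<otimes>\<^bsub>A\<^esub> N \<otimes>\<^bsub>A\<^esub> mat_unit n D 0 0 \<one>\<^bsub>D\<^esub> = mat_unit n D 0 0 (N $$ (0, 0))"
  by (rule eq_matI) (use assms mat_algebra_carrierD[OF assms(1)] in \<open>auto simp: unit_mult_left unit_mult_right\<close>)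

text \<open>The corner at E_00 consists of the matrices supported in position (0, 0), and is a copy
  of \<open>D\<close>; inverses in it come from \<open>D\<close>. The index 0 exists because
  \<open>n\<close> is positive.\<close>

lemma mat_mu_system:
  assumes "0 < n" "\<one>\<^bsub>D\<^esub> \<noteq> \<zero>\<^bsub>D\<^esub>" "carrier D - {\<zero>\<^bsub>D\<^esub>} \<subseteq> Units D"
  shows "mu_system A n (mat_unit n D 0 0 \<one>\<^bsub>D\<^esub>) (\<lambda>i. mat_unit n D i 0 \<one>\<^bsub>D\<^esub>) (\<lambda>j. mat_unit n D 0 j \<one>\<^bsub>D\<^esub>)"
proof
  let ?e = "mat_unit n D 0 0 \<one>\<^bsub>D\<^esub>"
  show "?e \<noteq> \<zero>\<^bsub>A\<^esub>"
  proof
    assume "?e = \<zero>\<^bsub>A\<^esub>"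
    then have "?e $$ (0, 0) = \<zero>\<^bsub>A\<^esub> $$ (0, 0)" by simp
    then show False using assms by (simp add: mat_algebra_simps)
  qed
  show "(\<Oplus>\<^bsub>A\<^esub>i\<in>{..<n}. mat_unit n D i 0 \<one>\<^bsub>D\<^esub> \<otimes>\<^bsub>A\<^esub> mat_unit n D 0 i \<one>\<^bsub>D\<^esub>) = \<one>\<^bsub>A\<^esub>"
  proof (rule eq_matI)
    fix r s assume "r < dim_row \<one>\<^bsub>A\<^esub>" "s < dim_col \<one>\<^bsub>A\<^esub>"
    then have rs: "r < n" "s < n" by (auto simp: mat_algebra_simps)
    have "(\<Oplus>\<^bsub>A\<^esub>i\<in>{..<n}. mat_unit n D i 0 \<one>\<^bsub>D\<^esub> \<otimes>\<^bsub>A\<^esub> mat_unit n D 0 i \<one>\<^bsub>D\<^esub>) $$ (r, s) =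
      (\<Oplus>\<^bsub>D\<^esub>i\<in>{..<n}. (mat_unit n D i 0 \<one>\<^bsub>D\<^esub> \<otimes>\<^bsub>A\<^esub> mat_unit n D 0 i \<one>\<^bsub>D\<^esub>) $$ (r, s))"
      by (rule finsum_index) (use rs in auto)
    also have "\<dots> = (mat_unit n D r 0 \<one>\<^bsub>D\<^esub> \<otimes>\<^bsub>A\<^esub> mat_unit n D 0 r \<one>\<^bsub>D\<^esub>) $$ (r, s)"
      by (rule D.finsum_eq_single) (use rs assms in \<open>auto simp: unit_mult_unit\<close>)
    finally show "(\<Oplus>\<^bsub>A\<^esub>i\<in>{..<n}. mat_unit n D i 0 \<one>\<^bsub>D\<^esub> \<otimes>\<^bsub>A\<^esub> mat_unit n D 0 i \<one>\<^bsub>D\<^esub>) $$ (r, s) = \<one>\<^bsub>A\<^esub> $$ (r, s)"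
      using rs assms by (simp add: unit_mult_unit)
  next
    have *: "(\<Oplus>\<^bsub>A\<^esub>i\<in>{..<n}. mat_unit n D i 0 \<one>\<^bsub>D\<^esub> \<otimes>\<^bsub>A\<^esub> mat_unit n D 0 i \<one>\<^bsub>D\<^esub>) \<in> carrier A"
      by (rule A.finsum_closed) auto
    show "dim_row (\<Oplus>\<^bsub>A\<^esub>i\<in>{..<n}. mat_unit n D i 0 \<one>\<^bsub>D\<^esub> \<otimes>\<^bsub>A\<^esub> mat_unit n D 0 i \<one>\<^bsub>D\<^esub>) = dim_row \<one>\<^bsub>A\<^esub>"
      "dim_col (\<Oplus>\<^bsub>A\<^esub>i\<in>{..<n}. mat_unit n D i 0 \<one>\<^bsub>D\<^esub> \<otimes>\<^bsub>A\<^esub> mat_unit n D 0 i \<one>\<^bsub>D\<^esub>) = dim_col \<one>\<^bsub>A\<^esub>"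
      using mat_algebra_carrierD(1,2)[OF *] by simp_all
  qed
  fix N assume N: "N \<in> carrier A" "?e \<otimes>\<^bsub>A\<^esub> N \<otimes>\<^bsub>A\<^esub> ?e = N" "N \<noteq> \<zero>\<^bsub>A\<^esub>"
  define a where "a = N $$ (0, 0)"
  have a: "a \<in> carrier D" using mat_algebra_carrierD[OF N(1)] assms by (simp add: a_def)
  have Na: "N = mat_unit n D 0 0 a" using corner_unit[OF N(1) assms(1)] N(2) by (simp add: a_def)
  have "a \<noteq> \<zero>\<^bsub>D\<^esub>"
  proof
    assume "a = \<zero>\<^bsub>D\<^esub>"
    then have "N = \<zero>\<^bsub>A\<^esub>" unfolding Na by (auto simp: mat_unit_def mat_algebra_simps intro!: eq_matI)
    with N(3) show False by simp
  qed
  then have "a \<in> Units D" using a assms(3) by auto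
  then obtain b where b: "b \<in> carrier D" "a \<otimes>\<^bsub>D\<^esub> b = \<one>\<^bsub>D\<^esub>" "b \<otimes>\<^bsub>D\<^esub> a = \<one>\<^bsub>D\<^esub>" by (auto simp: Units_def)
  show "\<exists>y\<in>carrier A. ?e \<otimes>\<^bsub>A\<^esub> y \<otimes>\<^bsub>A\<^esub> ?e = y \<and> N \<otimes>\<^bsub>A\<^esub> y = ?e \<and> y \<otimes>\<^bsub>A\<^esub> N = ?e"
    by (rule bexI[of _ "mat_unit n D 0 0 b"]) (use a b assms Na in \<open>auto simp: unit_mult_unit\<close>)
qed (use assms in \<open>auto simp: unit_mult_unit\<close>)

end

lemma mu_system_iso:
  assumes "mu_system R m e f c" "g \<in> ring_iso R S" "ring S"
  shows "mu_system S m (g e) (\<lambda>i. g (f i)) (\<lambda>i. g (c i))"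
proof -
  interpret R: mu_system R m e f c by fact
  interpret S: ring S by fact
  have hom: "g \<in> Ring.ring_hom R S" and bij: "bij_betw g (carrier R) (carrier S)"
    using assms(2) by (auto simp: ring_iso_def)
  note [simp] = ring_hom_closed[OF hom] ring_hom_mult[OF hom, symmetric]
  have g0: "g \<zero>\<^bsub>R\<^esub> = \<zero>\<^bsub>S\<^esub>" using ring_hom_zero[OF hom R.ring_axioms assms(3)] .
  have inj: "g x = g y \<Longrightarrow> x \<in> carrier R \<Longrightarrow> y \<in> carrier R \<Longrightarrow> x = y" for x y
    using bij by (auto simp: bij_betw_def inj_on_def)
  have sum: "g (\<Oplus>\<^bsub>R\<^esub>i\<in>{..<m}. f i \<otimes>\<^bsub>R\<^esub> c i) = (\<Oplus>\<^bsub>S\<^esub>i\<in>{..<m}. g (f i \<otimes>\<^bsub>R\<^esub> c i))"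
    by (rule finsum_hom[OF R.abelian_monoid_axioms S.abelian_monoid_axioms])
      (use g0 ring_hom_add[OF hom] in auto)
  have sum': "(\<Oplus>\<^bsub>S\<^esub>i\<in>{..<m}. g (f i) \<otimes>\<^bsub>S\<^esub> g (c i)) = (\<Oplus>\<^bsub>S\<^esub>i\<in>{..<m}. g (f i \<otimes>\<^bsub>R\<^esub> c i))"
    by (rule S.finsum_cong') auto
  show ?thesis
  proof
    show "g e \<noteq> \<zero>\<^bsub>S\<^esub>" using inj[of e "\<zero>\<^bsub>R\<^esub>"] g0 R.e_nonzero by auto
    show "(\<Oplus>\<^bsub>S\<^esub>i\<in>{..<m}. g (f i) \<otimes>\<^bsub>S\<^esub> g (c i)) = \<one>\<^bsub>S\<^esub>"
      using sum sum' R.sum_f_c ring_hom_one[OF hom] by simp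
    fix x assume x: "x \<in> carrier S" "g e \<otimes>\<^bsub>S\<^esub> x \<otimes>\<^bsub>S\<^esub> g e = x" "x \<noteq> \<zero>\<^bsub>S\<^esub>"
    then obtain z where z: "z \<in> carrier R" "x = g z" using bij by (auto simp: bij_betw_def)
    have "e \<otimes>\<^bsub>R\<^esub> z \<otimes>\<^bsub>R\<^esub> e = z" using inj[of "e \<otimes>\<^bsub>R\<^esub> z \<otimes>\<^bsub>R\<^esub> e" z] x(2) z by simp
    moreover have "z \<noteq> \<zero>\<^bsub>R\<^esub>" using x z g0 by auto
    ultimately obtain y where y: "y \<in> carrier R" "e \<otimes>\<^bsub>R\<^esub> y \<otimes>\<^bsub>R\<^esub> e = y" "z \<otimes>\<^bsub>R\<^esub> y = e" "y \<otimes>\<^bsub>R\<^esub> z = e"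
      using R.corner_inverse[OF z(1)] by auto
    show "\<exists>y\<in>carrier S. g e \<otimes>\<^bsub>S\<^esub> y \<otimes>\<^bsub>S\<^esub> g e = y \<and> x \<otimes>\<^bsub>S\<^esub> y = g e \<and> y \<otimes>\<^bsub>S\<^esub> x = g e"
      by (rule bexI[of _ "g y"]) (use y z in auto)
  qed (use R.c_f g0 in auto)
qed

context mu_system
begin

lemma expand:
  assumes "x \<in> carrier B"
  shows "(\<Oplus>i\<in>{..<m}. \<Oplus>j\<in>{..<m}. f i \<otimes> (c i \<otimes> x \<otimes> f j) \<otimes> c j) = x"
proof -
  have "(\<Oplus>i\<in>{..<m}. \<Oplus>j\<in>{..<m}. f i \<otimes> (c i \<otimes> x \<otimes> f j) \<otimes> c j) = (\<Oplus>i\<in>{..<m}. (f i \<otimes> c i) \<otimes> x)"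
  proof (rule finsum_cong')
    fix i assume "i \<in> {..<m}"
    then have i: "i < m" by simp
    have "(\<Oplus>j\<in>{..<m}. f i \<otimes> (c i \<otimes> x \<otimes> f j) \<otimes> c j) = (\<Oplus>j\<in>{..<m}. (f i \<otimes> c i \<otimes> x) \<otimes> (f j \<otimes> c j))"
      by (rule finsum_cong') (use assms i in \<open>auto simp: m_assoc\<close>)
    also have "\<dots> = (f i \<otimes> c i \<otimes> x) \<otimes> (\<Oplus>j\<in>{..<m}. f j \<otimes> c j)"
      by (rule finsum_rdistr[symmetric]) (use assms i in auto)
    finally show "(\<Oplus>j\<in>{..<m}. f i \<otimes> (c i \<otimes> x \<otimes> f j) \<otimes> c j) = (f i \<otimes> c i) \<otimes> x"
      using assms i sum_f_c by simp
  qed (use assms in auto)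
  also have "\<dots> = (\<Oplus>j\<in>{..<m}. f j \<otimes> c j) \<otimes> x"
    by (rule finsum_ldistr[symmetric]) (use assms in auto)
  finally show ?thesis using assms sum_f_c by simp
qed

text \<open>The counterpart of \<open>expand\<close>: the components c_h x f_k can be prescribed
  arbitrarily in the corner. Together they make x \<mapsto> (c_i x f_j) a bijection onto the
  matrices over the corner.\<close>

lemma compress:
  assumes d: "\<And>i j. i < m \<Longrightarrow> j < m \<Longrightarrow> d i j \<in> carrier B"
    "\<And>i j. i < m \<Longrightarrow> j < m \<Longrightarrow> e \<otimes> d i j \<otimes> e = d i j" and hk: "h < m" "k < m"
  shows "c h \<otimes> (\<Oplus>i\<in>{..<m}. \<Oplus>j\<in>{..<m}. f i \<otimes> d i j \<otimes> c j) \<otimes> f k = d h k"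
proof -
  let ?s = "\<lambda>i. \<Oplus>j\<in>{..<m}. f i \<otimes> d i j \<otimes> c j"
  have s: "?s i \<in> carrier B" if "i < m" for i
    by (rule finsum_closed) (use that d in auto)
  have cs: "c h \<otimes> ?s i = (\<Oplus>j\<in>{..<m}. (c h \<otimes> f i) \<otimes> (d i j \<otimes> c j))" if "i < m" for i
    using that d hk by (subst finsum_rdistr) (auto intro!: finsum_cong' simp: m_assoc)
  have "c h \<otimes> (\<Oplus>i\<in>{..<m}. ?s i) = (\<Oplus>i\<in>{..<m}. c h \<otimes> ?s i)"
    by (rule finsum_rdistr) (use s hk in auto)
  also have "\<dots> = c h \<otimes> ?s h"
  proof (rule finsum_eq_single)
    fix i assume i: "i < m" "i \<noteq> h"
    show "c h \<otimes> ?s i = \<zero>" unfolding cs[OF i(1)]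
      by (rule finsum_eq_zero) (use i hk c_f d in auto)
  qed (use s hk in auto)
  also have "\<dots> = (\<Oplus>j\<in>{..<m}. d h j \<otimes> c j)"
    unfolding cs[OF hk(1)]
  proof (rule finsum_cong')
    fix j assume "j \<in> {..<m}"
    then have j: "j < m" by simp
    have "e \<otimes> (d h j \<otimes> c j) = (e \<otimes> d h j) \<otimes> c j" using d(1)[OF hk(1) j] j by (simp add: m_assoc)
    then show "(c h \<otimes> f h) \<otimes> (d h j \<otimes> c j) = d h j \<otimes> c j"
      using corner_e(1)[of "d h j"] d[OF hk(1) j] hk c_f by simp
  qed (use hk d in auto)
  finally have eq: "c h \<otimes> (\<Oplus>i\<in>{..<m}. ?s i) = (\<Oplus>j\<in>{..<m}. d h j \<otimes> c j)" .
  have "c h \<otimes> (\<Oplus>i\<in>{..<m}. ?s i) \<otimes> f k = (\<Oplus>j\<in>{..<m}. d h j \<otimes> c j \<otimes> f k)"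
    unfolding eq by (rule finsum_ldistr) (use d hk in auto)
  also have "\<dots> = d h k \<otimes> c k \<otimes> f k"
    by (rule finsum_eq_single[OF hk(2)]) (use d hk c_f in \<open>auto simp: m_assoc\<close>)
  also have "\<dots> = d h k"
    using d[OF hk] hk c_f corner_e(2)[of "d h k"] by (simp add: m_assoc)
  finally show ?thesis .
qed

end

lemma corner_division_algebra:
  assumes "assoc_algebra K B" "mu_system B m e f c"
  shows "division_algebra K (corner B e)"
proof -
  interpret B: assoc_algebra K B by fact
  interpret mu: mu_system B m e f c by fact
  have e: "e \<otimes>\<^bsub>B\<^esub> (x \<oplus>\<^bsub>B\<^esub> y) \<otimes>\<^bsub>B\<^esub> e = x \<oplus>\<^bsub>B\<^esub> y"
    if "x \<in> carrier (corner B e)" "y \<in> carrier (corner B e)" for x y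
    using that by (simp add: B.A.r_distr B.A.l_distr)
  have R: "ring (corner B e)"
  proof (rule ringI)
    show "abelian_group (corner B e)"
    proof (rule abelian_groupI)
      fix x assume x: "x \<in> carrier (corner B e)"
      show "\<exists>y\<in>carrier (corner B e). y \<oplus>\<^bsub>corner B e\<^esub> x = \<zero>\<^bsub>corner B e\<^esub>"
        by (rule bexI[of _ "\<ominus>\<^bsub>B\<^esub> x"]) (use x in \<open>auto simp: B.A.l_minus B.A.r_minus B.M.l_neg\<close>)
    qed (auto simp: B.A.r_distr B.A.l_distr B.M.a_ac)
    show "Group.monoid (corner B e)"
    proof (rule monoidI)
      fix x assume "x \<in> carrier (corner B e)"
      then show "\<one>\<^bsub>corner B e\<^esub> \<otimes>\<^bsub>corner B e\<^esub> x = x" "x \<otimes>\<^bsub>corner B e\<^esub> \<one>\<^bsub>corner B e\<^esub> = x"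
        using mu.corner_e[of x] by auto
    next
      fix x y assume "x \<in> carrier (corner B e)" "y \<in> carrier (corner B e)"
      then show "x \<otimes>\<^bsub>corner B e\<^esub> y \<in> carrier (corner B e)" using mu.corner_mult[of x y] by simp
    next
      fix x y z assume "x \<in> carrier (corner B e)" "y \<in> carrier (corner B e)" "z \<in> carrier (corner B e)"
      then have "x \<in> carrier B" "y \<in> carrier B" "z \<in> carrier B" by auto
      then show "x \<otimes>\<^bsub>corner B e\<^esub> y \<otimes>\<^bsub>corner B e\<^esub> z = x \<otimes>\<^bsub>corner B e\<^esub> (y \<otimes>\<^bsub>corner B e\<^esub> z)"
        by (simp add: B.A.m_assoc)
    qed simp
  qed (auto simp: B.A.r_distr B.A.l_distr)
  have "assoc_algebra K (corner B e)"
    by (rule assoc_algebraI[OF assoc_algebraD(1)[OF assms(1)] R])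
      (auto simp: B.smult_mult_left B.smult_mult_right B.smult_l_distr B.smult_r_distr B.smult_assoc1)
  moreover have "x \<in> Units (corner B e)" if x: "x \<in> carrier (corner B e)" "x \<noteq> \<zero>\<^bsub>B\<^esub>" for x
  proof -
    obtain y where "y \<in> carrier B" "e \<otimes>\<^bsub>B\<^esub> y \<otimes>\<^bsub>B\<^esub> e = y" "x \<otimes>\<^bsub>B\<^esub> y = e" "y \<otimes>\<^bsub>B\<^esub> x = e"
      using mu.corner_inverse[of x] x by auto
    then show ?thesis using x by (auto simp: Units_def intro!: bexI[of _ y])
  qed
  ultimately show ?thesis
    by (intro division_algebra.intro division_algebra_axioms.intro) (use mu.e_nonzero in auto)
qed

text \<open>Inserting 1 = \<Sum> f_k c_k between x and y in c_i x y f_j produces exactly the matrix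
  product. Bijectivity is \<open>expand\<close> and \<open>compress\<close>.\<close>

lemma mu_system_algebra_iso:
  assumes "assoc_algebra K B" "mu_system B m e f c"
  shows "(\<lambda>x. mat m m (\<lambda>(i, j). c i \<otimes>\<^bsub>B\<^esub> x \<otimes>\<^bsub>B\<^esub> f j)) \<in> algebra_iso K B (mat_algebra m (corner B e))"
    (is "?\<phi> \<in> _")
proof -
  interpret B: assoc_algebra K B by fact
  interpret mu: mu_system B m e f c by fact
  interpret D: division_algebra K "corner B e" by (rule corner_division_algebra[OF assms])
  let ?A = "mat_algebra m (corner B e)"
  have cl: "?\<phi> x \<in> carrier ?A" if "x \<in> carrier B" for x
    using that mu.corner_cxf by (auto simp: mat_algebra_carrier)
  have "?\<phi> \<in> ring_iso B ?A"
  proof (rule ring_iso_memI)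
    fix x y assume x: "x \<in> carrier B" and y: "y \<in> carrier B"
    show "?\<phi> (x \<otimes>\<^bsub>B\<^esub> y) = ?\<phi> x \<otimes>\<^bsub>?A\<^esub> ?\<phi> y"
    proof (rule eq_matI)
      fix i j assume "i < dim_row (?\<phi> x \<otimes>\<^bsub>?A\<^esub> ?\<phi> y)" "j < dim_col (?\<phi> x \<otimes>\<^bsub>?A\<^esub> ?\<phi> y)"
      then have ij: "i < m" "j < m" by (auto simp: mat_algebra_simps)
      let ?g = "\<lambda>k. (c i \<otimes>\<^bsub>B\<^esub> x \<otimes>\<^bsub>B\<^esub> f k) \<otimes>\<^bsub>B\<^esub> (c k \<otimes>\<^bsub>B\<^esub> y \<otimes>\<^bsub>B\<^esub> f j)"
      have g: "?g k \<in> carrier (corner B e)" if "k < m" for k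
        using that ij x y mu.corner_cxf mu.corner_mult by auto
      have "(?\<phi> x \<otimes>\<^bsub>?A\<^esub> ?\<phi> y) $$ (i, j) = (\<Oplus>\<^bsub>corner B e\<^esub>k\<in>{..<m}. ?g k)"
        using ij g by (auto simp: mat_algebra_simps intro!: D.M.finsum_cong')
      also have "\<dots> = (\<Oplus>\<^bsub>B\<^esub>k\<in>{..<m}. ?g k)"
        by (rule finsum_hom[OF D.M.abelian_monoid_axioms B.M.abelian_monoid_axioms g]) auto
      also have "\<dots> = (\<Oplus>\<^bsub>B\<^esub>k\<in>{..<m}. (c i \<otimes>\<^bsub>B\<^esub> x) \<otimes>\<^bsub>B\<^esub> ((f k \<otimes>\<^bsub>B\<^esub> c k) \<otimes>\<^bsub>B\<^esub> (y \<otimes>\<^bsub>B\<^esub> f j)))"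
        by (rule B.M.finsum_cong') (use ij x y in \<open>auto simp: B.A.m_assoc\<close>)
      also have "\<dots> = (c i \<otimes>\<^bsub>B\<^esub> x) \<otimes>\<^bsub>B\<^esub> (\<Oplus>\<^bsub>B\<^esub>k\<in>{..<m}. (f k \<otimes>\<^bsub>B\<^esub> c k) \<otimes>\<^bsub>B\<^esub> (y \<otimes>\<^bsub>B\<^esub> f j))"
        by (rule B.A.finsum_rdistr[symmetric]) (use ij x y in auto)
      also have "(\<Oplus>\<^bsub>B\<^esub>k\<in>{..<m}. (f k \<otimes>\<^bsub>B\<^esub> c k) \<otimes>\<^bsub>B\<^esub> (y \<otimes>\<^bsub>B\<^esub> f j)) = (\<Oplus>\<^bsub>B\<^esub>k\<in>{..<m}. f k \<otimes>\<^bsub>B\<^esub> c k) \<otimes>\<^bsub>B\<^esub> (y \<otimes>\<^bsub>B\<^esub> f j)"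
        by (rule B.A.finsum_ldistr[symmetric]) (use ij x y in auto)
      finally show "?\<phi> (x \<otimes>\<^bsub>B\<^esub> y) $$ (i, j) = (?\<phi> x \<otimes>\<^bsub>?A\<^esub> ?\<phi> y) $$ (i, j)"
        using ij x y mu.sum_f_c by (simp add: B.A.m_assoc)
    qed (auto simp: mat_algebra_simps)
    show "?\<phi> (x \<oplus>\<^bsub>B\<^esub> y) = ?\<phi> x \<oplus>\<^bsub>?A\<^esub> ?\<phi> y"
      using x y by (auto simp: mat_algebra_simps B.A.l_distr B.A.r_distr intro!: eq_matI)
  next
    show "?\<phi> \<one>\<^bsub>B\<^esub> = \<one>\<^bsub>?A\<^esub>" by (auto simp: mat_algebra_simps mu.c_f intro!: eq_matI)
    show "bij_betw ?\<phi> (carrier B) (carrier ?A)"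
      unfolding bij_betw_def
    proof
      show "inj_on ?\<phi> (carrier B)"
      proof (rule inj_onI)
        fix x y assume x: "x \<in> carrier B" and y: "y \<in> carrier B" and eq: "?\<phi> x = ?\<phi> y"
        have "c i \<otimes>\<^bsub>B\<^esub> x \<otimes>\<^bsub>B\<^esub> f j = c i \<otimes>\<^bsub>B\<^esub> y \<otimes>\<^bsub>B\<^esub> f j" if "i < m" "j < m" for i j
        proof -
          have "?\<phi> x $$ (i, j) = ?\<phi> y $$ (i, j)" using eq by simp
          then show ?thesis using that by simp
        qed
        then have "(\<Oplus>\<^bsub>B\<^esub>i\<in>{..<m}. \<Oplus>\<^bsub>B\<^esub>j\<in>{..<m}. f i \<otimes>\<^bsub>B\<^esub> (c i \<otimes>\<^bsub>B\<^esub> x \<otimes>\<^bsub>B\<^esub> f j) \<otimes>\<^bsub>B\<^esub> c j) =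
          (\<Oplus>\<^bsub>B\<^esub>i\<in>{..<m}. \<Oplus>\<^bsub>B\<^esub>j\<in>{..<m}. f i \<otimes>\<^bsub>B\<^esub> (c i \<otimes>\<^bsub>B\<^esub> y \<otimes>\<^bsub>B\<^esub> f j) \<otimes>\<^bsub>B\<^esub> c j)"
          using y by (intro B.M.finsum_cong') (auto intro!: B.M.finsum_closed)
        then show "x = y" using mu.expand[OF x] mu.expand[OF y] by simp
      qed
      show "?\<phi> ` carrier B = carrier ?A"
      proof
        show "?\<phi> ` carrier B \<subseteq> carrier ?A" using cl by auto
        show "carrier ?A \<subseteq> ?\<phi> ` carrier B"
        proof
          fix M assume M: "M \<in> carrier ?A"
          note Md = mat_algebra_carrierD[OF M]
          let ?x = "\<Oplus>\<^bsub>B\<^esub>i\<in>{..<m}. \<Oplus>\<^bsub>B\<^esub>j\<in>{..<m}. f i \<otimes>\<^bsub>B\<^esub> M $$ (i, j) \<otimes>\<^bsub>B\<^esub> c j"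
          have "c h \<otimes>\<^bsub>B\<^esub> ?x \<otimes>\<^bsub>B\<^esub> f k = M $$ (h, k)" if "h < m" "k < m" for h k
            by (rule mu.compress) (use Md(3) that in auto)
          then have "?\<phi> ?x = M" using Md by (intro eq_matI) auto
          moreover have "?x \<in> carrier B" using Md(3) by (intro B.M.finsum_closed) (auto intro!: B.M.finsum_closed)
          ultimately show "M \<in> ?\<phi> ` carrier B" by (intro image_eqI[of M ?\<phi> ?x]) simp_all
        qed
      qed
    qed
  qed (use cl in auto)
  moreover have "?\<phi> (k \<odot>\<^bsub>B\<^esub> x) = k \<odot>\<^bsub>?A\<^esub> ?\<phi> x" if "k \<in> carrier K" "x \<in> carrier B" for k x
    using that by (auto simp: mat_algebra_simps B.smult_mult_left B.smult_mult_right intro!: eq_matI)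
  ultimately show ?thesis by (simp add: algebra_iso_def)
qed

text \<open>An isomorphism onto the matrices of size k over a division algebra carries the standard
  matrix units back to a \<open>mu_system\<close> of size k. Uniqueness of the size is a hypothesis
  because it is proved over the base field, while \<open>K\<close> may be an extension field given
  only as a record.\<close>

theorem capacity_eq:
  fixes K :: "('a, 'k) ring_scheme" and B :: "('a, 'c) module"
  assumes "assoc_algebra K B" "mu_system B m e f c"
    and unique: "\<And>m' e' f' c'. mu_system B m' e' f' c' \<Longrightarrow> m' = m"
  shows "capacity K B = m"
  unfolding capacity_def
proof (rule the_equality)
  interpret B: assoc_algebra K B by fact
  interpret mu: mu_system B m e f c by fact
  have "algebra_iso K B (mat_algebra m (corner B e)) \<noteq> {}"
    using mu_system_algebra_iso[OF assms(1,2)] by blast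
  then show "m \<ge> 1 \<and> (\<exists>D :: ('a, 'c) module. division_algebra K D \<and> algebra_iso K B (mat_algebra m D) \<noteq> {})"
    using mu.m_pos corner_division_algebra[OF assms(1,2)] by (intro conjI exI[of _ "corner B e"]) auto
  fix k assume k: "k \<ge> 1 \<and> (\<exists>D :: ('a, 'c) module. division_algebra K D \<and> algebra_iso K B (mat_algebra k D) \<noteq> {})"
  then obtain D :: "('a, 'c) module" and h where D: "division_algebra K D" and h: "h \<in> algebra_iso K B (mat_algebra k D)"
    by auto
  interpret D: division_algebra K D by fact
  interpret M: mat_alg D k by unfold_locales
  have "h \<in> ring_iso B (mat_algebra k D)" using h by (simp add: algebra_iso_def)
  then have "inv_into (carrier B) h \<in> ring_iso (mat_algebra k D) B"
    by (rule ring_iso_set_sym[OF B.A.ring_axioms])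
  from mu_system_iso[OF M.mat_mu_system this B.A.ring_axioms] k D.one_neq_zero D.nonzero_Units
  show "k = m" using unique by auto
qed

subsection \<open>Polynomials of matrices\<close>

definition poly_mat :: "'a :: comm_ring_1 poly \<Rightarrow> 'a mat \<Rightarrow> 'a mat" where
  "poly_mat p T = foldr (\<lambda>a M. a \<cdot>\<^sub>m 1\<^sub>m (dim_row T) + T * M) (coeffs p) (0\<^sub>m (dim_row T) (dim_row T))"

lemma poly_mat_0 [simp]: "T \<in> carrier_mat n n \<Longrightarrow> poly_mat 0 T = 0\<^sub>m n n"
  by (auto simp: poly_mat_def)

lemma poly_mat_pCons:
  assumes "T \<in> carrier_mat n n"
  shows "poly_mat (pCons a p) T = a \<cdot>\<^sub>m 1\<^sub>m n + T * poly_mat p T"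
proof (cases "a = 0 \<and> p = 0")
  case True
  have "0 \<cdot>\<^sub>m 1\<^sub>m n + T * 0\<^sub>m n n = (0\<^sub>m n n :: 'a mat)" using assms by (intro eq_matI) auto
  then show ?thesis using True assms by simp
next
  case False
  then have "coeffs (pCons a p) = a # coeffs p" by (auto simp: cCons_def)
  then show ?thesis using assms by (auto simp: poly_mat_def)
qed

lemma poly_mat_dims [simp]: "dim_row (poly_mat p T) = dim_row T" "dim_col (poly_mat p T) = dim_row T"
proof -
  have "dim_row (foldr (\<lambda>a M. a \<cdot>\<^sub>m 1\<^sub>m (dim_row T) + T * M) cs (0\<^sub>m (dim_row T) (dim_row T))) = dim_row T \<and>
    dim_col (foldr (\<lambda>a M. a \<cdot>\<^sub>m 1\<^sub>m (dim_row T) + T * M) cs (0\<^sub>m (dim_row T) (dim_row T))) = dim_row T" for cs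
    by (induction cs) auto
  then show "dim_row (poly_mat p T) = dim_row T" "dim_col (poly_mat p T) = dim_row T"
    by (auto simp: poly_mat_def)
qed

lemma poly_mat_closed [simp]: "T \<in> carrier_mat n n \<Longrightarrow> poly_mat p T \<in> carrier_mat n n"
  by (induction p) (auto simp: poly_mat_pCons)

lemma poly_mat_add:
  assumes T: "T \<in> carrier_mat n n"
  shows "poly_mat (p + q) T = poly_mat p T + poly_mat q T"
proof (induction p q rule: poly_induct2)
  case 0
  then show ?case using T by (intro eq_matI) auto
next
  case (pCons a p b q)
  have "poly_mat (pCons a p + pCons b q) T = (a + b) \<cdot>\<^sub>m 1\<^sub>m n + (T * poly_mat p T + T * poly_mat q T)"
    using T pCons by (simp add: poly_mat_pCons mult_add_distrib_mat[of _ n n _ n])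
  also have "\<dots> = (a \<cdot>\<^sub>m 1\<^sub>m n + T * poly_mat p T) + (b \<cdot>\<^sub>m 1\<^sub>m n + T * poly_mat q T)"
    using T by (intro eq_matI) (auto simp: algebra_simps)
  finally show ?case using T by (simp add: poly_mat_pCons)
qed

lemma poly_mat_smult:
  assumes T: "T \<in> carrier_mat n n"
  shows "poly_mat (Polynomial.smult c p) T = c \<cdot>\<^sub>m poly_mat p T"
proof (induction p)
  case 0
  then show ?case using T by (intro eq_matI) auto
next
  case (pCons a p)
  have "poly_mat (Polynomial.smult c (pCons a p)) T = (c * a) \<cdot>\<^sub>m 1\<^sub>m n + c \<cdot>\<^sub>m (T * poly_mat p T)"
    using T pCons by (simp add: poly_mat_pCons mult_smult_distrib[of _ n n _ n])
  also have "\<dots> = c \<cdot>\<^sub>m (a \<cdot>\<^sub>m 1\<^sub>m n + T * poly_mat p T)"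
    using T by (intro eq_matI) (auto simp: algebra_simps)
  finally show ?case using T by (simp add: poly_mat_pCons)
qed

lemma poly_mat_mult:
  assumes T: "T \<in> carrier_mat n n"
  shows "poly_mat (p * q) T = poly_mat p T * poly_mat q T"
proof (induction p)
  case 0
  then show ?case using T by (simp add: left_mult_zero_mat[OF poly_mat_closed[OF T]])
next
  case (pCons a p)
  have z: "(0 \<cdot>\<^sub>m 1\<^sub>m n :: 'a mat) = 0\<^sub>m n n" by (intro eq_matI) auto
  have c: "T * (poly_mat p T * poly_mat q T) \<in> carrier_mat n n"
    by (rule mult_carrier_mat[OF T mult_carrier_mat[OF poly_mat_closed[OF T] poly_mat_closed[OF T]]])
  have "poly_mat (pCons a p * q) T = a \<cdot>\<^sub>m poly_mat q T + T * (poly_mat p T * poly_mat q T)"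
    using T pCons by (simp add: poly_mat_add poly_mat_smult poly_mat_pCons z left_add_zero_mat[OF c])
  also have "\<dots> = (a \<cdot>\<^sub>m 1\<^sub>m n) * poly_mat q T + (T * poly_mat p T) * poly_mat q T"
    using T by (simp add: assoc_mult_mat[of _ n n _ n _ n] mult_smult_assoc_mat[of _ n n _ n])
  also have "\<dots> = (a \<cdot>\<^sub>m 1\<^sub>m n + T * poly_mat p T) * poly_mat q T"
    using T by (intro add_mult_distrib_mat[symmetric]) auto
  finally show ?case using T by (simp add: poly_mat_pCons)
qed

lemma poly_mat_1 [simp]: "T \<in> carrier_mat n n \<Longrightarrow> poly_mat 1 T = 1\<^sub>m n"
  unfolding one_pCons by (auto simp: poly_mat_pCons intro!: eq_matI)

lemma poly_mat_commute:
  assumes T: "T \<in> carrier_mat n n" and M: "M \<in> carrier_mat n n" "M * T = T * M"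
  shows "M * poly_mat p T = poly_mat p T * M"
proof (induction p)
  case 0
  then show ?case using T M by simp
next
  case (pCons a p)
  have "M * (a \<cdot>\<^sub>m 1\<^sub>m n + T * poly_mat p T) = a \<cdot>\<^sub>m M + (M * T) * poly_mat p T"
    using T M(1) by (simp add: mult_add_distrib_mat[of _ n n _ n] mult_smult_distrib[of _ n n _ n] assoc_mult_mat[of _ n n _ n _ n])
  also have "\<dots> = a \<cdot>\<^sub>m M + T * (M * poly_mat p T)"
    using T M(1) by (simp add: M(2) assoc_mult_mat[of _ n n _ n _ n])
  also have "\<dots> = (a \<cdot>\<^sub>m 1\<^sub>m n + T * poly_mat p T) * M"
    using T M(1) by (simp add: pCons add_mult_distrib_mat[of _ n n _ _ n] mult_smult_assoc_mat[of _ n n _ n] assoc_mult_mat[of _ n n _ n _ n])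
  finally show ?case using T by (simp add: poly_mat_pCons)
qed

lemma poly_mat_eigenvector:
  assumes T: "T \<in> carrier_mat n n" and v: "v \<in> carrier_vec n" "T *\<^sub>v v = l \<cdot>\<^sub>v v"
  shows "poly_mat p T *\<^sub>v v = poly p l \<cdot>\<^sub>v v"
proof (induction p)
  case 0
  then show ?case using T v by (intro eq_vecI) auto
next
  case (pCons a p)
  have "(a \<cdot>\<^sub>m 1\<^sub>m n + T * poly_mat p T) *\<^sub>v v = (a \<cdot>\<^sub>m 1\<^sub>m n) *\<^sub>v v + T *\<^sub>v (poly_mat p T *\<^sub>v v)"
    using T v by (simp add: add_mult_distrib_mat_vec[of _ n n] assoc_mult_mat_vec[of _ n n _ n])
  also have "(a \<cdot>\<^sub>m 1\<^sub>m n) *\<^sub>v v = a \<cdot>\<^sub>v v" using v by (intro eq_vecI) (auto simp: scalar_prod_smult_left)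
  also have "T *\<^sub>v (poly_mat p T *\<^sub>v v) = poly p l \<cdot>\<^sub>v (l \<cdot>\<^sub>v v)"
  proof -
    have "T *\<^sub>v (poly p l \<cdot>\<^sub>v v) = poly p l \<cdot>\<^sub>v (T *\<^sub>v v)"
      using T v(1) by (intro eq_vecI) (auto simp: scalar_prod_def sum_distrib_left ac_simps)
    then show ?thesis using pCons v(2) by simp
  qed
  finally show ?case using T v
    by (simp add: poly_mat_pCons smult_smult_assoc add_smult_distrib_vec[symmetric] mult.commute)
qed

lemma poly_mat_hom:
  assumes "comm_ring_hom h" "T \<in> carrier_mat n n"
  shows "map_mat h (poly_mat p T) = poly_mat (map_poly h p) (map_mat h T)"
proof -
  interpret comm_ring_hom h by fact
  show ?thesis
  proof (induction p)
    case 0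
    then show ?case using assms(2) by (auto intro!: eq_matI)
  next
    case (pCons a p)
    have "map_mat h (a \<cdot>\<^sub>m 1\<^sub>m n + T * poly_mat p T) = h a \<cdot>\<^sub>m 1\<^sub>m n + map_mat h T * map_mat h (poly_mat p T)"
      using assms(2) carrier_matD[OF poly_mat_closed[OF assms(2), of p]]
      by (intro eq_matI) (auto simp: scalar_prod_def hom_distribs)
    then show ?case
      using assms(2) pCons by (simp add: poly_mat_pCons map_poly_pCons)
  qed
qed

lemma mult_four_block_upper:
  assumes "A1 \<in> carrier_mat k1 k1" "B1 \<in> carrier_mat k1 k2" "D1 \<in> carrier_mat k2 k2"
    "A2 \<in> carrier_mat k1 k1" "B2 \<in> carrier_mat k1 k2" "D2 \<in> carrier_mat k2 k2"
  shows "four_block_mat A1 B1 (0\<^sub>m k2 k1) D1 * four_block_mat A2 B2 (0\<^sub>m k2 k1) D2 =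
    four_block_mat (A1 * A2) (A1 * B2 + B1 * D2) (0\<^sub>m k2 k1) (D1 * D2)"
  using assms by (subst mult_four_block_mat[of _ k1 k1 _ k2 _ k2 _ _ k1 _ k2]) auto

lemma poly_mat_four_block:
  assumes "A \<in> carrier_mat k1 k1" "B \<in> carrier_mat k1 k2" "D \<in> carrier_mat k2 k2"
  shows "\<exists>C\<in>carrier_mat k1 k2. poly_mat p (four_block_mat A B (0\<^sub>m k2 k1) D) =
    four_block_mat (poly_mat p A) C (0\<^sub>m k2 k1) (poly_mat p D)"
proof (induction p)
  case 0
  show ?case using assms by (intro bexI[of _ "0\<^sub>m k1 k2"]) (auto simp: four_block_carrier_mat)
next
  case (pCons a p)
  let ?T = "four_block_mat A B (0\<^sub>m k2 k1) D"
  have T: "?T \<in> carrier_mat (k1 + k2) (k1 + k2)" using assms by auto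
  obtain C where C: "C \<in> carrier_mat k1 k2" "poly_mat p ?T = four_block_mat (poly_mat p A) C (0\<^sub>m k2 k1) (poly_mat p D)"
    using pCons by blast
  have "poly_mat (pCons a p) ?T = a \<cdot>\<^sub>m 1\<^sub>m (k1 + k2) +
    four_block_mat (A * poly_mat p A) (A * C + B * poly_mat p D) (0\<^sub>m k2 k1) (D * poly_mat p D)"
    unfolding poly_mat_pCons[OF T] C(2) using assms C(1) by (subst mult_four_block_upper) auto
  also have "\<dots> = four_block_mat (a \<cdot>\<^sub>m 1\<^sub>m k1 + A * poly_mat p A) (A * C + B * poly_mat p D) (0\<^sub>m k2 k1) (a \<cdot>\<^sub>m 1\<^sub>m k2 + D * poly_mat p D)"
    using assms C by (intro eq_matI) auto
  finally show ?case using assms C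
    by (intro bexI[of _ "A * C + B * poly_mat p D"]) (auto simp: poly_mat_pCons)
qed

text \<open>Here \<open>G q\<close> stands for q(g) and is known only through the Horner recursion.
  This fits operators that are given in closed form, such as right multiplication by the class of
  q.\<close>

lemma (in fvs) poly_mat_mat_of:
  assumes "fbasis V k b" "linmap V V g" "\<And>q. linmap V V (G q)" "\<And>v. v \<in> carrier V \<Longrightarrow> G 0 v = \<zero>\<^bsub>V\<^esub>"
    "\<And>a q v. v \<in> carrier V \<Longrightarrow> G (pCons a q) v = a \<odot>\<^bsub>V\<^esub> v \<oplus>\<^bsub>V\<^esub> g (G q v)"
  shows "poly_mat q (mat_of V k b g) = mat_of V k b (G q)"
proof (induction q)
  case 0
  have "mat_of V k b (G 0) = 0\<^sub>m k k" by (rule mat_of_zero) (use assms in auto)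
  then show ?case by (simp add: poly_mat_0[of _ k])
next
  case (pCons a q)
  have 1: "mat_of V k b (\<lambda>v. a \<odot>\<^bsub>V\<^esub> v) = a \<cdot>\<^sub>m 1\<^sub>m k"
    using mat_of_smult[OF assms(1), of "\<lambda>v. v" "\<lambda>v. a \<odot>\<^bsub>V\<^esub> v" a] mat_of_id[OF assms(1), of "\<lambda>v. v"] by simp
  have "mat_of V k b (G (pCons a q)) = mat_of V k b (\<lambda>v. a \<odot>\<^bsub>V\<^esub> v) + mat_of V k b (\<lambda>v. g (G q v))"
    by (rule mat_of_add) (use assms linmapD(1)[OF assms(2)] linmapD(1)[OF assms(3)] in auto)
  also have "\<dots> = a \<cdot>\<^sub>m 1\<^sub>m k + mat_of V k b g * mat_of V k b (G q)"
    using 1 mat_of_comp[OF assms(1,2,3)] by simp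
  finally show ?case using pCons by (simp add: poly_mat_pCons[of _ k])
qed

subsection \<open>Multiplicities of irreducible factors\<close>

text \<open>The p-adic valuation as a relation. It spares a default value at the zero polynomial,
  and multiplicities can be produced before they are shown to be unique.\<close>

definition pmult :: "'a :: field poly \<Rightarrow> 'a poly \<Rightarrow> nat \<Rightarrow> bool" where
  "pmult p g j \<longleftrightarrow> (\<exists>h. g = p ^ j * h \<and> \<not> p dvd h)"

lemma pmult_mult:
  assumes "Factorial_Ring.irreducible p" "pmult p g j" "pmult p g' j'"
  shows "pmult p (g * g') (j + j')"
proof -
  obtain h h' where "g = p ^ j * h" "\<not> p dvd h" "g' = p ^ j' * h'" "\<not> p dvd h'"
    using assms(2,3) by (auto simp: pmult_def)
  moreover from this have "\<not> p dvd h * h'"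
    using field_poly_irreducible_imp_prime[OF assms(1)] by (simp add: prime_elem_dvd_mult_iff)
  ultimately show ?thesis unfolding pmult_def by (intro exI[of _ "h * h'"]) (simp add: power_add ac_simps)
qed

lemma pmult_unique:
  assumes "Factorial_Ring.irreducible p" "pmult p g j" "pmult p g j'"
  shows "j = j'"
proof -
  have le: "j' \<le> j" if jj: "pmult p g j" "pmult p g j'" for j j'
  proof (rule ccontr)
    assume "\<not> j' \<le> j"
    then obtain i where i: "j' = j + Suc i" by (metis less_imp_Suc_add not_le add_Suc_right)
    obtain h h' where h: "g = p ^ j * h" "\<not> p dvd h" "g = p ^ j' * h'"
      using jj unfolding pmult_def by blast
    have "p \<noteq> 0" using assms(1) by auto
    then have "h = p * (p ^ i * h')" using h(1,3) i by (simp add: power_add ac_simps)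
    then show False using h(2) by simp
  qed
  show ?thesis using le[OF assms(2,3)] le[OF assms(3,2)] by simp
qed

lemma irreducible_degree_pos: "Factorial_Ring.irreducible (p :: 'a :: field poly) \<Longrightarrow> Polynomial.degree p > 0"
  using is_unit_iff_degree[of p] by (auto simp: Factorial_Ring.irreducible_def)

lemma pmult_one: "Factorial_Ring.irreducible p \<Longrightarrow> pmult p 1 0"
  unfolding pmult_def by (intro exI[of _ 1]) (auto simp: Factorial_Ring.irreducible_def)

lemma pmult_self_power: "Factorial_Ring.irreducible p \<Longrightarrow> pmult p (p ^ j) j"
  unfolding pmult_def by (intro exI[of _ 1]) (auto simp: Factorial_Ring.irreducible_def)

lemma pmult_power:
  assumes "Factorial_Ring.irreducible p" "pmult p g j"
  shows "pmult p (g ^ n) (n * j)"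
proof (induction n)
  case 0
  then show ?case using pmult_one[OF assms(1)] by simp
next
  case (Suc n)
  then show ?case using pmult_mult[OF assms(1,2) Suc] by simp
qed

lemma monic_irreducible_dvd_eq:
  fixes p q :: "'a :: field poly"
  assumes "Factorial_Ring.irreducible p" "Factorial_Ring.irreducible q"
    "lead_coeff p = 1" "lead_coeff q = 1" "p dvd q"
  shows "p = q"
proof -
  have "q dvd p" using assms(1,2,5) by (meson Factorial_Ring.irreducible_def irreducibleD')
  have "p dvd q" "q dvd p" by fact+
  then show ?thesis using poly_dvd_antisym[of p q] assms(3,4) by simp
qed

lemma pmult_other:
  assumes "Factorial_Ring.irreducible p" "Factorial_Ring.irreducible q" "lead_coeff p = 1" "lead_coeff q = 1" "p \<noteq> q"
  shows "pmult p (q ^ j) 0"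
proof -
  have "\<not> p dvd q" using monic_irreducible_dvd_eq assms by blast
  then have "\<not> p dvd q ^ j"
    using prime_elem_dvd_power[OF field_poly_irreducible_imp_prime[OF assms(1)]] by blast
  then show ?thesis unfolding pmult_def by simp
qed

text \<open>By induction on the degree: a monic irreducible factor of g divides h^N, hence h, and
  cancels on both sides. The argument holds in every characteristic. It recovers f from f^d and
  removes the exponents that come from counting columns.\<close>

lemma monic_power_inj:
  fixes g h :: "'a :: field poly"
  assumes "lead_coeff g = 1" "lead_coeff h = 1" "g ^ N = h ^ N" "0 < N"
  shows "g = h"
  using assms(1-3)
proof (induction "Polynomial.degree g" arbitrary: g h rule: less_induct)
  case less
  have g0: "g \<noteq> 0" and h0: "h \<noteq> 0" using less.prems by auto
  have deg: "Polynomial.degree g = Polynomial.degree h"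
    using arg_cong[OF less.prems(3), of Polynomial.degree] assms(4) g0 h0 by (simp add: degree_power_eq)
  show ?case
  proof (cases "Polynomial.degree g = 0")
    case True
    then show ?thesis using less.prems deg by (metis degree_0_id)
  next
    case False
    then obtain q r where qr: "Factorial_Ring.irreducible q" "g = q * r" "lead_coeff q = 1"
      using irreducible_monic_factor[of g] by auto
    have "q dvd h ^ N" using qr(2) less.prems(3) assms(4)
      by (metis dvd_mult2 dvd_power dvd_refl dvd_trans dvd_triv_left)
    then have "q dvd h" using prime_elem_dvd_power[OF field_poly_irreducible_imp_prime[OF qr(1)]] by blast
    then obtain s where s: "h = q * s" unfolding dvd_def by blast
    have q0: "q \<noteq> 0" using qr by auto
    have "r ^ N = s ^ N" using less.prems(3) q0 by (simp add: qr(2) s power_mult_distrib)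
    moreover have "lead_coeff r = 1" "lead_coeff s = 1"
      using less.prems(1,2) qr(3) by (auto simp: qr(2) s lead_coeff_mult)
    moreover have "Polynomial.degree r < Polynomial.degree g"
      using irreducible_degree_pos[OF qr(1)] g0 by (simp add: qr(2) degree_mult_eq)
    ultimately show ?thesis using less.hyps[of r s] qr(2) s by simp
  qed
qed

subsection \<open>Characteristic polynomials\<close>

lemma to_ac_field_hom: "field_hom to_ac"
  by unfold_locales auto

interpretation to_ac: field_hom to_ac by (rule to_ac_field_hom)

interpretation to_ac_poly: map_poly_inj_idom_hom to_ac ..

lemma char_poly_four_block:
  fixes A :: "'a :: idom mat"
  assumes "A \<in> carrier_mat k1 k1" "B \<in> carrier_mat k1 k2" "D \<in> carrier_mat k2 k2"
  shows "char_poly (four_block_mat A B (0\<^sub>m k2 k1) D) = char_poly A * char_poly D"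
proof -
  have "char_poly_matrix (four_block_mat A B (0\<^sub>m k2 k1) D) =
    four_block_mat (char_poly_matrix A) (map_mat (\<lambda>a. [:- a:]) B) (0\<^sub>m k2 k1) (char_poly_matrix D)"
    using assms by (intro eq_matI) (auto simp: char_poly_matrix_def)
  then show ?thesis unfolding char_poly_def
    using assms by (simp add: det_four_block_mat_lower_left_zero[of _ k1 _ k2])
qed

text \<open>A nonzero polynomial g over F of least degree that vanishes at x divides every
  polynomial over F that vanishes there, in particular p and q. It is not a unit, so by
  irreducibility p divides g.\<close>

lemma common_root_dvd:
  fixes p q :: "'a :: field poly"
  assumes "Factorial_Ring.irreducible p" "p \<noteq> 0" "poly (map_poly to_ac p) x = 0" "poly (map_poly to_ac q) x = 0"
  shows "p dvd q"
proof -
  let ?P = "\<lambda>g. g \<noteq> 0 \<and> poly (map_poly to_ac g) x = 0"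
  obtain g where g: "?P g" "\<And>h. ?P h \<Longrightarrow> Polynomial.degree g \<le> Polynomial.degree h"
    using ex_has_least_nat[of ?P p Polynomial.degree] assms(2,3) by blast
  have dvd: "g dvd h" if "poly (map_poly to_ac h) x = 0" for h
  proof -
    have "map_poly to_ac h = map_poly to_ac (h div g) * map_poly to_ac g + map_poly to_ac (h mod g)"
      by (metis div_mult_mod_eq to_ac_poly.hom_add to_ac_poly.hom_mult)
    then have "poly (map_poly to_ac (h mod g)) x = 0" using that g(1) by simp
    moreover have "h mod g = 0 \<or> Polynomial.degree (h mod g) < Polynomial.degree g"
      using degree_mod_less[of g h] g(1) by auto
    ultimately have "h mod g = 0" using g(2)[of "h mod g"] by force
    then show ?thesis by (rule mod_0_imp_dvd)
  qed
  have "\<not> is_unit g"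
  proof
    assume "is_unit g"
    then obtain a where "g = [:a:]" "a \<noteq> 0" using is_unit_poly_iff by (metis is_unit_pCons_iff is_unit_polyE)
    then show False using g(1) by (simp add: map_poly_pCons)
  qed
  moreover have "g dvd p" by (rule dvd[OF assms(3)])
  ultimately have "p dvd g" using irreducibleD'[OF assms(1)] by blast
  then show ?thesis using dvd[OF assms(4)] dvd_trans by blast
qed

lemma irreducible_has_root:
  fixes p :: "'a :: field poly"
  assumes "Factorial_Ring.irreducible p"
  obtains x where "poly (map_poly to_ac p) x = 0"
proof -
  have "Polynomial.degree (map_poly to_ac p) > 0" using irreducible_degree_pos[OF assms] by simp
  then show ?thesis using that alg_closed_imp_poly_has_root by blast
qed

lemma char_poly_root_eigenvector:
  assumes "T \<in> carrier_mat k k" "poly (map_poly to_ac (char_poly T)) x = 0"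
  obtains v where "v \<in> carrier_vec k" "v \<noteq> 0\<^sub>v k" "map_mat to_ac T *\<^sub>v v = x \<cdot>\<^sub>v v"
proof -
  have T: "map_mat to_ac T \<in> carrier_mat k k" using assms by simp
  have "eigenvalue (map_mat to_ac T) x"
    unfolding eigenvalue_root_char_poly[OF T] using to_ac.char_poly_hom[OF assms(1)] assms(2) by simp
  then show ?thesis using that assms(1) unfolding eigenvalue_def eigenvector_def by auto
qed

text \<open>A root x of a monic irreducible factor q of the characteristic polynomial is an
  eigenvalue over the closure. As p(T) = 0, an eigenvector gives p(x) = 0; so q and p have a common
  root and are equal.\<close>

lemma char_poly_annihilated:
  fixes T :: "'a :: field mat"
  assumes "T \<in> carrier_mat k k" "Factorial_Ring.irreducible p" "lead_coeff p = 1" "poly_mat p T = 0\<^sub>m k k"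
  obtains j where "char_poly T = p ^ j"
proof -
  have factor: "q = p" if q: "Factorial_Ring.irreducible q" "lead_coeff q = 1" "q dvd char_poly T" for q
  proof -
    obtain x where x: "poly (map_poly to_ac q) x = 0" using irreducible_has_root[OF q(1)] .
    obtain r where "char_poly T = q * r" using q(3) unfolding dvd_def by blast
    then have "poly (map_poly to_ac (char_poly T)) x = 0" using x by (simp add: to_ac_poly.hom_mult)
    then obtain v where v: "v \<in> carrier_vec k" "v \<noteq> 0\<^sub>v k" "map_mat to_ac T *\<^sub>v v = x \<cdot>\<^sub>v v"
      using char_poly_root_eigenvector[OF assms(1)] by blast
    have "poly_mat (map_poly to_ac p) (map_mat to_ac T) = map_mat to_ac (poly_mat p T)"
      by (rule poly_mat_hom[OF to_ac.comm_ring_hom_axioms assms(1), symmetric])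
    also have "\<dots> = 0\<^sub>m k k" unfolding assms(4) by (intro eq_matI) auto
    finally have "0\<^sub>m k k *\<^sub>v v = poly (map_poly to_ac p) x \<cdot>\<^sub>v v"
      using poly_mat_eigenvector[of "map_mat to_ac T" k v x "map_poly to_ac p"] v assms(1) by simp
    moreover have "0\<^sub>m k k *\<^sub>v v = 0\<^sub>v k" using v(1) by (intro eq_vecI) auto
    ultimately have "poly (map_poly to_ac p) x \<cdot>\<^sub>v v = 0\<^sub>v k" by simp
    moreover obtain i where "i < k" "v $ i \<noteq> 0" using v(1,2) by (metis eq_vecI carrier_vecD index_zero_vec)
    ultimately have "poly (map_poly to_ac p) x = 0"
      using v(1) by (metis carrier_vecD index_smult_vec(1) index_zero_vec(1) mult_eq_0_iff)
    then have "q dvd p" using common_root_dvd[OF q(1) _ x] q(1) by auto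
    then show ?thesis using monic_irreducible_dvd_eq[OF q(1) assms(2) q(2) assms(3)] by simp
  qed
  have pow: "\<exists>j. g = p ^ j" if "lead_coeff g = 1" "g dvd char_poly T" for g
    using that
  proof (induction "Polynomial.degree g" arbitrary: g rule: less_induct)
    case less
    show ?case
    proof (cases "Polynomial.degree g = 0")
      case True
      then have "g = 1" using less.prems(1) by (metis degree_0_id one_pCons)
      then show ?thesis by (intro exI[of _ 0]) simp
    next
      case False
      then obtain q r where qr: "Factorial_Ring.irreducible q" "g = q * r" "lead_coeff q = 1"
        using irreducible_monic_factor[of g] by auto
      have "q = p" using factor[OF qr(1,3)] less.prems(2) qr(2) dvd_trans dvd_triv_left by blast
      have "g \<noteq> 0" using less.prems by auto
      then have "Polynomial.degree r < Polynomial.degree g"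
        using irreducible_degree_pos[OF qr(1)] by (simp add: qr(2) degree_mult_eq)
      moreover have "lead_coeff r = 1" using less.prems(1) qr(3) by (simp add: qr(2) lead_coeff_mult)
      moreover have "r dvd char_poly T" using less.prems(2) qr(2) by (metis dvd_mult_right)
      ultimately obtain j where "r = p ^ j" using less.hyps by blast
      then show ?thesis using qr(2) \<open>q = p\<close> by (intro exI[of _ "Suc j"]) simp
    qed
  qed
  have "lead_coeff (char_poly T) = 1" using degree_monic_char_poly[OF assms(1)] by auto
  from pow[OF this dvd_refl] obtain j where "char_poly T = p ^ j" ..
  then show ?thesis by (rule that)
qed

text \<open>An eigenvector over the closure shows that p(T) becomes singular there. The determinant
  commutes with the embedding of fields, so p(T) is singular already over F and has a kernel vector
  there.\<close>

lemma irreducible_factor_singular: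
  fixes T :: "'a :: field mat"
  assumes "T \<in> carrier_mat k k" "Factorial_Ring.irreducible p" "p dvd char_poly T"
  obtains w where "w \<in> carrier_vec k" "w \<noteq> 0\<^sub>v k" "poly_mat p T *\<^sub>v w = 0\<^sub>v k"
proof -
  obtain x where x: "poly (map_poly to_ac p) x = 0" using irreducible_has_root[OF assms(2)] .
  obtain r where "char_poly T = p * r" using assms(3) unfolding dvd_def by blast
  then have "poly (map_poly to_ac (char_poly T)) x = 0" using x by (simp add: to_ac_poly.hom_mult)
  then obtain v where v: "v \<in> carrier_vec k" "v \<noteq> 0\<^sub>v k" "map_mat to_ac T *\<^sub>v v = x \<cdot>\<^sub>v v"
    using char_poly_root_eigenvector[OF assms(1)] by blast
  have eq: "poly_mat (map_poly to_ac p) (map_mat to_ac T) = map_mat to_ac (poly_mat p T)"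
    by (rule poly_mat_hom[OF to_ac.comm_ring_hom_axioms assms(1), symmetric])
  have "map_mat to_ac (poly_mat p T) *\<^sub>v v = 0 \<cdot>\<^sub>v v"
    using poly_mat_eigenvector[of "map_mat to_ac T" k v x "map_poly to_ac p"] v assms(1) x eq by simp
  also have "\<dots> = 0\<^sub>v k" using v(1) by auto
  finally have "det (map_mat to_ac (poly_mat p T)) = 0"
    using det_0_iff_vec_prod_zero[of "map_mat to_ac (poly_mat p T)" k] v assms(1) by auto
  then have "det (poly_mat p T) = 0" by (simp add: to_ac.hom_det)
  then show ?thesis using that det_0_iff_vec_prod_zero[of "poly_mat p T" k] assms(1) by auto
qed

subsection \<open>Capacity of the scalar extension\<close>

lemma finsum_ring_cong:
  assumes "ring R" "ring S" "carrier S = carrier R" "ring.zero S = ring.zero R" "add S = add R"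
    "\<And>i. i < n \<Longrightarrow> g i \<in> carrier R"
  shows "finsum S g {..<n :: nat} = finsum R g {..<n}"
proof -
  interpret R: ring R by fact
  interpret S: ring S by fact
  show ?thesis
    using finsum_hom[OF S.abelian_monoid_axioms R.abelian_monoid_axioms, of n g "\<lambda>x. x"] assms(3-) by simp
qed

lemma mu_system_cong:
  assumes "mu_system R m e f c" "carrier S = carrier R" "monoid.mult S = monoid.mult R" "one S = one R"
    "ring.zero S = ring.zero R" "add S = add R"
  shows "mu_system S m e f c"
proof -
  interpret R: mu_system R m e f c by fact
  have S: "ring S" by (rule ring_cong[OF R.ring_axioms]) (use assms in auto)
  moreover have "(\<Oplus>\<^bsub>S\<^esub>i\<in>{..<m}. f i \<otimes>\<^bsub>R\<^esub> c i) = (\<Oplus>\<^bsub>R\<^esub>i\<in>{..<m}. f i \<otimes>\<^bsub>R\<^esub> c i)"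
    by (rule finsum_ring_cong[OF R.ring_axioms S]) (use assms in auto)
  ultimately show ?thesis
    unfolding mu_system_def mu_system_axioms_def assms(2-)
    using R.mu_system_axioms unfolding mu_system_def mu_system_axioms_def by simp
qed

lemma simple_ring_cong:
  assumes "simple_ring R" "carrier S = carrier R" "monoid.mult S = monoid.mult R" "one S = one R"
    "ring.zero S = ring.zero R" "add S = add R"
  shows "simple_ring S"
proof -
  have "E \<in> mult_ops S" if "E \<in> mult_ops R" for E using that
  proof induction
    case (mult p q)
    then show ?case using mult_ops.mult[of p S q] by (simp add: assms)
  next
    case (add E E')
    then show ?case using mult_ops.add[of E S E'] by (simp add: assms)
  qed
  then show ?thesis using assms(1) unfolding simple_ring_def assms(2-) by blast
qed

context tensor
begin

text \<open>The scalar extension as an algebra over the base field.\<close>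

definition TF :: "('f, ('b \<times> 'c \<Rightarrow>\<^sub>0 int) set) module" where
  "TF = \<lparr>carrier = carrier T, monoid.mult = monoid.mult T, one = one T, ring.zero = ring.zero T,
    add = add T, module.smult = (\<lambda>k x. ((k \<odot>\<^bsub>A\<^esub> \<one>\<^bsub>A\<^esub>) \<bowtie> \<one>\<^bsub>L\<^esub>) \<otimes>\<^bsub>T\<^esub> x)\<rparr>"

lemma TF_simps [simp]: "carrier TF = carrier T" "monoid.mult TF = monoid.mult T" "one TF = one T"
  "ring.zero TF = ring.zero T" "add TF = add T"
  "k \<odot>\<^bsub>TF\<^esub> x = ((k \<odot>\<^bsub>A\<^esub> \<one>\<^bsub>A\<^esub>) \<bowtie> \<one>\<^bsub>L\<^esub>) \<otimes>\<^bsub>T\<^esub> x"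
  by (auto simp: TF_def)

lemma scalar_central:
  assumes "x \<in> carrier T" "l \<in> carrier L"
  shows "((k \<odot>\<^bsub>A\<^esub> \<one>\<^bsub>A\<^esub>) \<bowtie> l) \<otimes>\<^bsub>T\<^esub> x = x \<otimes>\<^bsub>T\<^esub> ((k \<odot>\<^bsub>A\<^esub> \<one>\<^bsub>A\<^esub>) \<bowtie> l)"
  using assms(1)
proof (induction rule: T_induct)
  case (pure a l')
  then show ?case using assms(2) by (simp add: pure_mult A.sc_l A.sc_r L.m_comm)
next
  case zero
  then show ?case using assms(2) by simp
next
  case (diff x y)
  then show ?case using assms(2) by (simp add: T.minus_eq T.r_distr T.l_distr T.l_minus T.r_minus)
qed

lemma one_central:
  assumes "x \<in> carrier T" "l \<in> carrier L"
  shows "(\<one>\<^bsub>A\<^esub> \<bowtie> l) \<otimes>\<^bsub>T\<^esub> x = x \<otimes>\<^bsub>T\<^esub> (\<one>\<^bsub>A\<^esub> \<bowtie> l)"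
  using scalar_central[OF assms, of 1] by simp

lemma TF_falg: "falg TF"
  unfolding falg_def
proof (rule assoc_algebraI[OF class_field])
  show "ring TF" by (rule ring_cong[OF T_ring]) auto
next
  fix k l :: 'f and x assume "x \<in> carrier TF"
  then have x: "x \<in> carrier T" by simp
  show "(k \<oplus>\<^bsub>class_ring\<^esub> l) \<odot>\<^bsub>TF\<^esub> x = k \<odot>\<^bsub>TF\<^esub> x \<oplus>\<^bsub>TF\<^esub> l \<odot>\<^bsub>TF\<^esub> x"
    using x by (simp add: A.sc_add pure_add_left T.l_distr)
  show "(k \<otimes>\<^bsub>class_ring\<^esub> l) \<odot>\<^bsub>TF\<^esub> x = k \<odot>\<^bsub>TF\<^esub> (l \<odot>\<^bsub>TF\<^esub> x)"
    using x by (simp add: T.m_assoc[symmetric] pure_mult A.sc_l A.sc_r A.sc_mult[symmetric] mult.commute)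
next
  fix k :: 'f and x y assume "x \<in> carrier TF" "y \<in> carrier TF"
  then have xy: "x \<in> carrier T" "y \<in> carrier T" by simp_all
  show "x \<otimes>\<^bsub>TF\<^esub> (k \<odot>\<^bsub>TF\<^esub> y) = k \<odot>\<^bsub>TF\<^esub> (x \<otimes>\<^bsub>TF\<^esub> y)"
    using xy scalar_central[OF xy(1), of "\<one>\<^bsub>L\<^esub>" k] by (simp add: T.m_assoc[symmetric])
qed (auto simp: T.r_distr T.m_assoc pure_one)

lemma TF_smult_pure: "a \<in> carrier A \<Longrightarrow> l \<in> carrier L \<Longrightarrow> k \<odot>\<^bsub>TF\<^esub> (a \<bowtie> l) = a \<bowtie> (k \<odot>\<^bsub>L\<^esub> l)"
  by (simp add: pure_mult A.sc_l L.sc_l pure_sc)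

lemma TF_fbasis:
  assumes "fbasis A N y" "fbasis L r z"
  shows "fbasis TF (N * r) (\<lambda>x. y (x div r) \<bowtie> z (x mod r))"
proof (rule fbasis_prod[OF _ _ assms(2)])
  interpret TF: falg TF by (rule TF_falg)
  have y: "\<And>i. i < N \<Longrightarrow> y i \<in> carrier A" using A.fbasisD(2)[OF assms(1)] .
  have fs: "(\<Oplus>\<^bsub>TF\<^esub>i\<in>{..<N}. y i \<bowtie> u i) = (\<Oplus>\<^bsub>T\<^esub>i\<in>{..<N}. y i \<bowtie> u i)" if "\<And>i. i < N \<Longrightarrow> u i \<in> carrier L" for u
    by (rule finsum_ring_cong[OF T_ring TF.A.ring_axioms]) (use y that in auto)
  show "fvs TF" "fvs L" by (rule TF.fvs_axioms, rule L.fvs_axioms)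
  show "linmap L TF (\<lambda>l. y i \<bowtie> l)" if "i < N" for i
    unfolding linmap_def using y[OF that] TF_smult_pure by (simp add: pure_add_right del: TF_simps(6))
  show "\<exists>u. (\<forall>i<N. u i \<in> carrier L) \<and> v = (\<Oplus>\<^bsub>TF\<^esub>i\<in>{..<N}. y i \<bowtie> u i)" if v: "v \<in> carrier TF" for v
  proof -
    obtain u where "\<forall>i<N. u i \<in> carrier L" "v = (\<Oplus>\<^bsub>T\<^esub>i\<in>{..<N}. y i \<bowtie> u i)"
      using T_expand[OF assms(1), of v] v by auto
    then show ?thesis using fs[of u] by (intro exI[of _ u]) simp
  qed
  show "u i = \<zero>\<^bsub>L\<^esub>" if "\<And>i. i < N \<Longrightarrow> u i \<in> carrier L" "(\<Oplus>\<^bsub>TF\<^esub>i\<in>{..<N}. y i \<bowtie> u i) = \<zero>\<^bsub>TF\<^esub>" "i < N" for u i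
    using T_independent[OF assms(1) that(1) _ that(3)] fs[OF that(1)] that(2) by simp
qed

lemma T_assoc_algebra:
  assumes "field L"
  shows "assoc_algebra L T"
proof (rule assoc_algebraI[OF assms T_ring])
  fix k x y assume "k \<in> carrier L" "x \<in> carrier T" "y \<in> carrier T"
  then show "x \<otimes>\<^bsub>T\<^esub> (k \<odot>\<^bsub>T\<^esub> y) = k \<odot>\<^bsub>T\<^esub> (x \<otimes>\<^bsub>T\<^esub> y)"
    using one_central[of x k] by (simp add: T_smult T.m_assoc[symmetric])
next
  fix k l x assume "k \<in> carrier L" "l \<in> carrier L" "x \<in> carrier T"
  then show "(k \<otimes>\<^bsub>L\<^esub> l) \<odot>\<^bsub>T\<^esub> x = k \<odot>\<^bsub>T\<^esub> (l \<odot>\<^bsub>T\<^esub> x)"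
    by (simp add: T_smult T.m_assoc[symmetric] pure_mult)
qed (auto simp: T_smult T.r_distr T.l_distr T.m_assoc pure_one pure_add_right)

text \<open>A system of matrix units and simplicity involve the ring alone, which \<open>T\<close>
  and \<open>TF\<close> share. Existence and uniqueness of the size are obtained over F, where
  \<open>TF\<close> has finite dimension; \<open>capacity_eq\<close> turns the size into the
  capacity over \<open>L\<close>.\<close>

theorem T_mu_system:
  assumes "simple_ring A" "central_algebra A" "fbasis A N y" "field L" "fbasis L r z"
  obtains e f c where "mu_system TF (capacity L T) e f c"
proof -
  interpret TF: falg TF by (rule TF_falg)
  interpret Lf: field L by fact
  have "simple_ring T"
  proof (rule T_simple[OF assms(1-3)])
    show "\<one>\<^bsub>L\<^esub> \<noteq> \<zero>\<^bsub>L\<^esub>" by simp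
    fix l assume "l \<in> carrier L" "l \<noteq> \<zero>\<^bsub>L\<^esub>"
    then show "\<exists>l'\<in>carrier L. l' \<otimes>\<^bsub>L\<^esub> l = \<one>\<^bsub>L\<^esub>"
      using Lf.field_Units by (intro bexI[of _ "inv\<^bsub>L\<^esub> l"]) auto
  qed
  then have "simple_ring TF" by (rule simple_ring_cong) auto
  note bas = TF_fbasis[OF assms(3,5)]
  obtain m e f c where mu: "mu_system TF m e f c" using TF.ex_mu_system[OF bas \<open>simple_ring TF\<close>] .
  have "mu_system T m e f c" by (rule mu_system_cong[OF mu]) auto
  moreover have "m' = m" if "mu_system T m' e' f' c'" for m' e' f' c'
  proof -
    have "mu_system TF m' e' f' c'" by (rule mu_system_cong[OF that]) auto
    then show ?thesis using TF.mu_system_size_unique[OF bas _ mu] by blast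
  qed
  ultimately have "capacity L T = m" by (rule capacity_eq[OF T_assoc_algebra[OF assms(4)]])
  with mu that show ?thesis by blast
qed

end

subsection \<open>The field obtained by adjoining a root\<close>

lemma poly_algebra_simps [simp]: "carrier poly_algebra = UNIV" "monoid.mult poly_algebra = (*)"
  "one poly_algebra = 1" "ring.zero poly_algebra = 0" "add poly_algebra = (+)"
  "module.smult poly_algebra = Polynomial.smult"
  by (auto simp: poly_algebra_def)

lemma poly_algebra_cring: "cring (poly_algebra :: ('f :: field, 'f poly) module)"
proof (rule cringI)
  show "abelian_group (poly_algebra :: ('f, 'f poly) module)"
  proof (rule abelian_groupI)
    fix x :: "'f poly"
    assume "x \<in> carrier poly_algebra"
    show "\<exists>y\<in>carrier poly_algebra. y \<oplus>\<^bsub>poly_algebra\<^esub> x = \<zero>\<^bsub>poly_algebra\<^esub>"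
      by (intro bexI[of _ "- x"]) auto
  qed (auto simp: add_ac)
  show "Group.comm_monoid (poly_algebra :: ('f, 'f poly) module)" by (rule comm_monoidI) (auto simp: mult_ac)
qed (auto simp: algebra_simps)

locale adjoin =
  fixes p :: "'f :: field poly"
  assumes irr: "Factorial_Ring.irreducible p" and monic: "lead_coeff p = 1"
begin

interpretation R: cring "poly_algebra :: ('f, 'f poly) module" by (rule poly_algebra_cring)

abbreviation "L \<equiv> adjoin_root p"
abbreviation "J \<equiv> PIdl\<^bsub>poly_algebra\<^esub> p"

definition cls :: "'f poly \<Rightarrow> 'f poly set" where "cls g = J +>\<^bsub>poly_algebra\<^esub> g"

interpretation J: ideal J "poly_algebra :: ('f, 'f poly) module" by (rule R.cgenideal_ideal) simp

lemma mem_J: "g \<in> J \<longleftrightarrow> p dvd g"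
  by (auto simp: cgenideal_def dvd_def mult.commute)

lemma L_simps: "carrier L = a_rcosets\<^bsub>poly_algebra\<^esub> J" "monoid.mult L = rcoset_mult poly_algebra J"
  "one L = J +>\<^bsub>poly_algebra\<^esub> 1" "ring.zero L = J" "add L = set_add poly_algebra"
  "k \<odot>\<^bsub>L\<^esub> C = (\<Union>x\<in>C. J +>\<^bsub>poly_algebra\<^esub> (Polynomial.smult k x))"
  by (auto simp: adjoin_root_def quot_algebra_def FactRing_def)

lemma L_carrier: "carrier L = range cls"
  by (auto simp: L_simps cls_def A_RCOSETS_def RCOSETS_def a_r_coset_def)

lemma cls_closed [simp]: "cls g \<in> carrier L" by (simp add: L_carrier)

lemma cls_add: "cls g \<oplus>\<^bsub>L\<^esub> cls h = cls (g + h)"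
  unfolding L_simps cls_def using J.a_rcos_sum[of g h] by simp

lemma cls_mult: "cls g \<otimes>\<^bsub>L\<^esub> cls h = cls (g * h)"
  unfolding L_simps cls_def using J.rcoset_mult_add[of g h] by simp

lemma cls_one: "\<one>\<^bsub>L\<^esub> = cls 1" by (simp add: L_simps cls_def)

lemma cls_zero: "\<zero>\<^bsub>L\<^esub> = cls 0"
  unfolding L_simps cls_def using J.a_rcos_const[of 0] by (simp add: mem_J)

lemma cls_eq_iff: "cls g = cls h \<longleftrightarrow> p dvd g - h"
proof -
  have "\<ominus>\<^bsub>poly_algebra\<^esub> h = - h" by (rule R.minus_equality) auto
  then have "g \<ominus>\<^bsub>poly_algebra\<^esub> h = g - h" by (simp add: R.minus_eq)
  then show ?thesis
    using R.quotient_eq_iff_same_a_r_cos[OF J.ideal_axioms, of g h] by (simp add: cls_def mem_J)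
qed

lemma cls_smult: "k \<odot>\<^bsub>L\<^esub> cls g = cls (Polynomial.smult k g)"
proof -
  have 1: "cls (Polynomial.smult k x) = cls (Polynomial.smult k g)" if "x \<in> cls g" for x
  proof -
    have "cls x = cls g" using J.a_repr_independence'[of x g] that by (simp add: cls_def)
    then have "p dvd x - g" by (simp add: cls_eq_iff)
    then have "p dvd Polynomial.smult k (x - g)" by (rule dvd_smult)
    then show ?thesis by (simp add: cls_eq_iff smult_diff_right)
  qed
  have 2: "g \<in> cls g" using J.a_rcos_self[of g] by (simp add: cls_def)
  have 3: "k \<odot>\<^bsub>L\<^esub> cls g = (\<Union>x\<in>cls g. cls (Polynomial.smult k x))" unfolding L_simps(6) cls_def ..
  show ?thesis unfolding 3 by (rule UN_constant_eq[OF 2]) (rule ballI, rule 1)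
qed

lemma L_ring: "ring L"
  by (rule ring_cong[OF J.quotient_is_ring]) (auto simp: adjoin_root_def quot_algebra_def)

lemma L_cring: "cring L"
proof -
  interpret L: ring L by (rule L_ring)
  have "x \<otimes>\<^bsub>L\<^esub> y = y \<otimes>\<^bsub>L\<^esub> x" if xy: "x \<in> carrier L" "y \<in> carrier L" for x y
  proof -
    obtain g h where "x = cls g" "y = cls h" using xy unfolding L_carrier by blast
    then show ?thesis by (simp add: cls_mult mult.commute)
  qed
  then show ?thesis
    by (intro cring.intro L_ring comm_monoid.intro L.monoid_axioms comm_monoid_axioms.intro)
qed

lemma L_falg: "falg L"
  unfolding falg_def
proof (rule assoc_algebraI[OF class_field L_ring])
  fix k l :: 'f and x assume "x \<in> carrier L"
  then obtain g where g: "x = cls g" unfolding L_carrier by blast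
  show "k \<odot>\<^bsub>L\<^esub> x \<in> carrier L" "(k \<oplus>\<^bsub>class_ring\<^esub> l) \<odot>\<^bsub>L\<^esub> x = k \<odot>\<^bsub>L\<^esub> x \<oplus>\<^bsub>L\<^esub> l \<odot>\<^bsub>L\<^esub> x"
    "(k \<otimes>\<^bsub>class_ring\<^esub> l) \<odot>\<^bsub>L\<^esub> x = k \<odot>\<^bsub>L\<^esub> (l \<odot>\<^bsub>L\<^esub> x)" "\<one>\<^bsub>class_ring\<^esub> \<odot>\<^bsub>L\<^esub> x = x"
    by (simp_all add: g cls_smult cls_add smult_add_left)
next
  fix k :: 'f and x y assume "x \<in> carrier L" "y \<in> carrier L"
  then obtain g h where g: "x = cls g" "y = cls h" unfolding L_carrier by blast
  show "k \<odot>\<^bsub>L\<^esub> (x \<oplus>\<^bsub>L\<^esub> y) = k \<odot>\<^bsub>L\<^esub> x \<oplus>\<^bsub>L\<^esub> k \<odot>\<^bsub>L\<^esub> y"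
    "(k \<odot>\<^bsub>L\<^esub> x) \<otimes>\<^bsub>L\<^esub> y = k \<odot>\<^bsub>L\<^esub> (x \<otimes>\<^bsub>L\<^esub> y)" "x \<otimes>\<^bsub>L\<^esub> (k \<odot>\<^bsub>L\<^esub> y) = k \<odot>\<^bsub>L\<^esub> (x \<otimes>\<^bsub>L\<^esub> y)"
    by (simp_all add: g cls_smult cls_add cls_mult smult_add_right)
qed

sublocale L: falg L by (rule L_falg)

definition root_basis :: "nat \<Rightarrow> 'f poly set" where "root_basis i = cls (Polynomial.monom 1 i)"

lemma lc_root_basis: "lc L n root_basis c = cls (\<Sum>i<n. Polynomial.monom (c i) i)"
  by (induction n) (simp_all add: cls_zero L.lc_Suc root_basis_def cls_smult cls_add smult_monom)

lemma coeff_sum_monom: "Polynomial.coeff (\<Sum>i<n. Polynomial.monom (c i) i) j = (if j < n then c j else 0)"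
  by (simp add: coeff_sum)

text \<open>Division with remainder: each class has a representative of degree below deg p, and a
  nonzero polynomial of such degree is not divisible by p.\<close>

lemma L_fbasis: "fbasis L (Polynomial.degree p) root_basis"
proof -
  let ?n = "Polynomial.degree p"
  have pos: "0 < ?n" by (rule irreducible_degree_pos[OF irr])
  have deg: "Polynomial.degree (\<Sum>i<?n. Polynomial.monom (c i) i) < ?n" for c :: "nat \<Rightarrow> 'f"
    using pos by (intro degree_lessI) (auto simp: coeff_sum_monom)
  have "c i = 0" if 0: "lc L ?n root_basis c = \<zero>\<^bsub>L\<^esub>" and i: "i < ?n" for c i
  proof -
    have "p dvd (\<Sum>i<?n. Polynomial.monom (c i) i)" using 0 by (simp add: lc_root_basis cls_zero cls_eq_iff)
    then have "(\<Sum>i<?n. Polynomial.monom (c i) i) = 0" using deg[of c] dvd_imp_degree_le not_le by blast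
    then have "Polynomial.coeff (\<Sum>i<?n. Polynomial.monom (c i) i) i = 0" by simp
    then show ?thesis using i by (simp add: coeff_sum_monom)
  qed
  moreover have "\<exists>c. v = lc L ?n root_basis c" if v: "v \<in> carrier L" for v
  proof -
    obtain g where g: "v = cls g" using v unfolding L_carrier by blast
    have "(\<Sum>i<?n. Polynomial.monom (Polynomial.coeff (g mod p) i) i) = g mod p"
    proof (rule poly_eqI)
      fix j
      have "p \<noteq> 0" using pos by auto
      then have "Polynomial.coeff (g mod p) j = 0" if "\<not> j < ?n"
        using degree_mod_less'[of p g] that by (cases "g mod p = 0") (auto intro!: coeff_eq_0)
      then show "Polynomial.coeff (\<Sum>i<?n. Polynomial.monom (Polynomial.coeff (g mod p) i) i) j = Polynomial.coeff (g mod p) j"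
        by (auto simp: coeff_sum_monom)
    qed
    then have "lc L ?n root_basis (Polynomial.coeff (g mod p)) = cls (g mod p)" by (simp add: lc_root_basis)
    also have "\<dots> = v" unfolding g cls_eq_iff by (simp add: mod_eq_dvd_iff[symmetric])
    finally show ?thesis by metis
  qed
  ultimately show ?thesis by (auto simp: fbasis_def indep_def root_basis_def)
qed

lemma L_dim: "vectorspace.dim class_ring L = Polynomial.degree p"
  using L.fbasis_dim(2)[OF L_fbasis] .

lemma cls_eq_zero_iff: "cls g = \<zero>\<^bsub>L\<^esub> \<longleftrightarrow> p dvd g"
  by (simp add: cls_zero cls_eq_iff)

text \<open>As p is prime, multiplication by a nonzero class is injective. It therefore maps a basis
  to an independent family of full length, again a basis, and 1 lies in the image.\<close>

lemma L_field: "field L"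
proof -
  interpret L': cring L by (rule L_cring)
  have inv: "\<exists>y\<in>carrier L. x \<otimes>\<^bsub>L\<^esub> y = \<one>\<^bsub>L\<^esub>" if x: "x \<in> carrier L" "x \<noteq> \<zero>\<^bsub>L\<^esub>" for x
  proof -
    obtain g where g: "x = cls g" using x(1) unfolding L_carrier by blast
    have g2: "\<not> p dvd g" using x(2) unfolding g cls_eq_zero_iff .
    have lin: "linmap L L (\<lambda>z. x \<otimes>\<^bsub>L\<^esub> z)" unfolding linmap_def using x by (simp add: L.A.r_distr L.sc_r)
    let ?n = "Polynomial.degree p"
    have b: "\<And>i. i < ?n \<Longrightarrow> root_basis i \<in> carrier L" by (simp add: root_basis_def)
    have lcx: "lc L ?n (\<lambda>i. x \<otimes>\<^bsub>L\<^esub> root_basis i) c = x \<otimes>\<^bsub>L\<^esub> lc L ?n root_basis c" for c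
      by (rule linmap_lc[OF L.fvs_axioms L.fvs_axioms lin b, symmetric])
    have "indep L ?n (\<lambda>i. x \<otimes>\<^bsub>L\<^esub> root_basis i)"
      unfolding indep_def
    proof (intro conjI allI impI)
      fix c i assume 0: "lc L ?n (\<lambda>i. x \<otimes>\<^bsub>L\<^esub> root_basis i) c = \<zero>\<^bsub>L\<^esub>" and i: "i < ?n"
      obtain h where h: "lc L ?n root_basis c = cls h" by (simp add: lc_root_basis)
      have "x \<otimes>\<^bsub>L\<^esub> lc L ?n root_basis c = \<zero>\<^bsub>L\<^esub>" using 0 unfolding lcx .
      then have "p dvd g * h" unfolding h g cls_mult cls_eq_zero_iff .
      then have "p dvd h" using g2 field_poly_irreducible_imp_prime[OF irr] by (simp add: prime_elem_dvd_mult_iff)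
      then have "lc L ?n root_basis c = \<zero>\<^bsub>L\<^esub>" by (simp add: h cls_eq_zero_iff)
      then show "c i = 0" using L.indepD(2)[OF L.fbasisD(1)[OF L_fbasis]] i by blast
    qed (use x b in auto)
    then have "fbasis L ?n (\<lambda>i. x \<otimes>\<^bsub>L\<^esub> root_basis i)" by (rule L.indep_full_fbasis[OF L_fbasis])
    then obtain c where "\<one>\<^bsub>L\<^esub> = lc L ?n (\<lambda>i. x \<otimes>\<^bsub>L\<^esub> root_basis i) c" unfolding fbasis_def by auto
    then show ?thesis using lcx b by (metis L.lc_closed)
  qed
  show ?thesis
  proof (rule L'.cring_fieldI)
    have ne: "\<one>\<^bsub>L\<^esub> \<noteq> \<zero>\<^bsub>L\<^esub>" using irr by (auto simp: cls_one cls_eq_zero_iff Factorial_Ring.irreducible_def)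
    show "Units L = carrier L - {\<zero>\<^bsub>L\<^esub>}"
    proof
      show "Units L \<subseteq> carrier L - {\<zero>\<^bsub>L\<^esub>}" using ne
        by (auto simp: Units_def)
      show "carrier L - {\<zero>\<^bsub>L\<^esub>} \<subseteq> Units L"
        using inv L'.m_comm unfolding Units_def by fastforce
    qed
  qed
qed

end

subsection \<open>Coordinate spaces and kernels\<close>

lemma fvs_vec: "fvs (module_vec TYPE('k :: field) n)"
proof -
  interpret vec_space "TYPE('k)" n .
  show ?thesis unfolding fvs_def using vec_vs .
qed

lemma lc_vec:
  fixes c :: "nat \<Rightarrow> 'k :: field"
  assumes "\<And>j. j < m \<Longrightarrow> b j \<in> carrier_vec n"
  shows "lc (module_vec TYPE('k) n) m b c = vec n (\<lambda>i. \<Sum>j<m. c j * b j $ i)"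
proof -
  interpret V: fvs "module_vec TYPE('k) n" by (rule fvs_vec)
  show ?thesis using assms
  proof (induction m)
    case 0
    then show ?case by (auto simp: module_vec_simps)
  next
    case (Suc m)
    then have "lc (module_vec TYPE('k) n) (Suc m) b c = lc (module_vec TYPE('k) n) m b c + c m \<cdot>\<^sub>v b m"
      using V.lc_Suc[of m b c] by (simp add: module_vec_simps)
    also have "\<dots> = vec n (\<lambda>i. \<Sum>j<Suc m. c j * b j $ i)"
    proof (rule eq_vecI)
      have dim: "dim_vec (b m) = n" using Suc.prems[of m] by simp
      show "(lc (module_vec TYPE('k) n) m b c + c m \<cdot>\<^sub>v b m) $ i = vec n (\<lambda>i. \<Sum>j<Suc m. c j * b j $ i) $ i"
        if "i < dim_vec (vec n (\<lambda>i. \<Sum>j<Suc m. c j * b j $ i))" for i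
      proof -
        have i: "i < n" using that by simp
        have "(lc (module_vec TYPE('k) n) m b c + c m \<cdot>\<^sub>v b m) $ i = lc (module_vec TYPE('k) n) m b c $ i + (c m \<cdot>\<^sub>v b m) $ i"
          by (rule index_add_vec(1)) (simp add: dim i)
        moreover have "(c m \<cdot>\<^sub>v b m) $ i = c m * b m $ i" by (rule index_smult_vec(1)) (simp add: dim i)
        moreover have "lc (module_vec TYPE('k) n) m b c = vec n (\<lambda>i. \<Sum>j<m. c j * b j $ i)"
          by (rule Suc.IH) (use Suc.prems in simp)
        ultimately show ?thesis using i by simp
      qed
      show "dim_vec (lc (module_vec TYPE('k) n) m b c + c m \<cdot>\<^sub>v b m) = dim_vec (vec n (\<lambda>i. \<Sum>j<Suc m. c j * b j $ i))"
        by (simp add: dim)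
    qed
    finally show ?case .
  qed
qed

lemma lc_unit_vec: "lc (module_vec TYPE('k :: field) n) n (unit_vec n) c = vec n c"
proof -
  have "(\<Sum>j<n. c j * unit_vec n j $ i) = c i" if "i < n" for i
  proof -
    have "(\<Sum>j<n. c j * unit_vec n j $ i) = (\<Sum>j<n. if j = i then c j else 0)"
      by (rule sum.cong) (use that in auto)
    then show ?thesis using that by simp
  qed
  then show ?thesis by (subst lc_vec) (auto intro!: eq_vecI)
qed

lemma fbasis_unit_vec: "fbasis (module_vec TYPE('k :: field) n) n (unit_vec n)"
proof -
  have "c i = 0" if "vec n c = 0\<^sub>v n" "i < n" for c :: "nat \<Rightarrow> 'k" and i
    using arg_cong[OF that(1), of "\<lambda>v :: 'k vec. v $ i"] that(2) by simp
  moreover have "\<exists>c. v = vec n c" if "v \<in> carrier_vec n" for v :: "'k vec"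
    using that by (intro exI[of _ "\<lambda>i. v $ i"]) auto
  ultimately show ?thesis
    unfolding fbasis_def indep_def lc_unit_vec by (auto simp: module_vec_simps)
qed

lemma linmap_mat:
  "M \<in> carrier_mat n n \<Longrightarrow> linmap (module_vec TYPE('k :: field) n) (module_vec TYPE('k) n) (\<lambda>v. M *\<^sub>v v)"
  unfolding linmap_def module_vec_simps
  by (auto simp: mult_add_distrib_mat_vec mult_mat_vec)

lemma mat_of_unit_vec:
  assumes "M \<in> carrier_mat n n"
  shows "mat_of (module_vec TYPE('k :: field) n) n (unit_vec n) (\<lambda>v. M *\<^sub>v v) = M"
proof -
  interpret V: fvs "module_vec TYPE('k) n" by (rule fvs_vec)
  show ?thesis
  proof (rule V.mat_ofI[OF fbasis_unit_vec assms])
    fix j assume "j < n"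
    then show "M *\<^sub>v unit_vec n j = lc (module_vec TYPE('k) n) n (unit_vec n) (\<lambda>i. M $$ (i, j))"
      using assms unfolding lc_unit_vec by (intro eq_vecI) auto
  qed
qed

lemma (in fvs) lc_truncate:
  assumes "k \<le> n" "\<And>i. i < n \<Longrightarrow> b i \<in> carrier V"
  shows "lc V n b (\<lambda>i. if i < k then c i else 0) = lc V k b c"
  using assms
proof (induction n)
  case (Suc n)
  show ?case
  proof (cases "k = Suc n")
    case True
    show ?thesis unfolding True by (rule lc_cong) (use Suc.prems in auto)
  next
    case False
    then have "lc V n b (\<lambda>i. if i < k then c i else 0) = lc V k b c" using Suc by simp
    then show ?thesis using False Suc.prems by (simp add: lc_Suc)
  qed
qed simp

text \<open>\<open>\<Phi>\<close> is a change of basis that makes \<open>ker C\<close> the span of the first \<open>k1\<close> basis vectors.\<close>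

lemma kernel_block:
  fixes C :: "'k :: field mat"
  assumes C: "C \<in> carrier_mat k k" and w: "w \<in> carrier_vec k" "w \<noteq> 0\<^sub>v k" "C *\<^sub>v w = 0\<^sub>v k"
  obtains k1 k2 \<Phi> where "k = k1 + k2" "0 < k1"
    "\<And>M. M \<in> carrier_mat k k \<Longrightarrow> \<Phi> M \<in> carrier_mat k k"
    "\<And>M. M \<in> carrier_mat k k \<Longrightarrow> similar_mat M (\<Phi> M)"
    "\<And>M N. M \<in> carrier_mat k k \<Longrightarrow> N \<in> carrier_mat k k \<Longrightarrow> \<Phi> (M * N) = \<Phi> M * \<Phi> N"
    "\<And>M N. M \<in> carrier_mat k k \<Longrightarrow> N \<in> carrier_mat k k \<Longrightarrow> \<Phi> (M + N) = \<Phi> M + \<Phi> N"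
    "\<And>c M. M \<in> carrier_mat k k \<Longrightarrow> \<Phi> (c \<cdot>\<^sub>m M) = c \<cdot>\<^sub>m \<Phi> M" "\<Phi> (1\<^sub>m k) = 1\<^sub>m k"
    "\<And>M i j. M \<in> carrier_mat k k \<Longrightarrow> M * C = C * M \<Longrightarrow> k1 \<le> i \<Longrightarrow> i < k \<Longrightarrow> j < k1 \<Longrightarrow> \<Phi> M $$ (i, j) = 0"
    "\<And>i j. i < k \<Longrightarrow> j < k1 \<Longrightarrow> \<Phi> C $$ (i, j) = 0"
proof -
  let ?V = "module_vec TYPE('k) k"
  interpret V: fvs ?V by (rule fvs_vec)
  note vs = module_vec_simps
  define S where "S = {v \<in> carrier_vec k. C *\<^sub>v v = 0\<^sub>v k}"
  have S: "V.subsp S"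
    unfolding V.subsp_def S_def vs using C by (auto simp: mult_add_distrib_mat_vec mult_mat_vec)
  obtain k1 u where u: "fbasis (?V\<lparr>carrier := S\<rparr>) k1 u"
    using V.subsp_ex_fbasis[OF fbasis_unit_vec S] by metis
  have ui: "indep ?V k1 u" "\<And>i. i < k1 \<Longrightarrow> u i \<in> S"
    using u V.subsp_indep[OF S] by (auto simp: fbasis_def)
  obtain n b where b0: "fbasis ?V n b" "k1 \<le> n" "\<And>i. i < k1 \<Longrightarrow> b i = u i"
    using V.indep_extend_fbasis[OF ui(1), of k] V.indep_le_fbasis[OF fbasis_unit_vec] by metis
  have n: "n = k" using V.fbasis_unique[OF b0(1) fbasis_unit_vec] .
  note b = b0(1)[unfolded n]
  have bc: "\<And>i. i < k \<Longrightarrow> b i \<in> carrier_vec k" using V.fbasisD(2)[OF b] by (simp add: vs)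
  have bS: "b i \<in> S" if "i < k1" for i using b0(3) ui(2) that by simp
  define \<Phi> where "\<Phi> M = mat_of ?V k b (\<lambda>v. M *\<^sub>v v)" for M
  \<comment> \<open>The nonzero kernel vector \<open>w\<close> forces a positive kernel dimension,
    so the lower right block is strictly smaller than the whole matrix; inductions on size rely on
    this.\<close>
  have k1: "0 < k1"
  proof (rule ccontr)
    assume "\<not> 0 < k1"
    then have "k1 = 0" by simp
    moreover have "w \<in> S" using w by (simp add: S_def)
    ultimately have "\<exists>c. w = lc (?V\<lparr>carrier := S\<rparr>) 0 u c" using u by (auto simp: fbasis_def)
    then show False using w(2) fvs.lc_0[OF V.subsp_fvs[OF S]] by (auto simp: vs)
  qed
  show ?thesis
  proof (rule that[of k1 "k - k1" \<Phi>])
    show "k = k1 + (k - k1)" using b0(2) n by simp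
    show "0 < k1" by (rule k1)
    show "\<Phi> M \<in> carrier_mat k k" for M by (simp add: \<Phi>_def)
    show "similar_mat M (\<Phi> M)" if "M \<in> carrier_mat k k" for M
      using V.mat_of_similar[OF fbasis_unit_vec b linmap_mat[OF that]] mat_of_unit_vec[OF that]
      by (simp add: \<Phi>_def)
    show "\<Phi> (M * N) = \<Phi> M * \<Phi> N" if MN: "M \<in> carrier_mat k k" "N \<in> carrier_mat k k" for M N
    proof -
      have "\<Phi> M * \<Phi> N = mat_of ?V k b (\<lambda>v. M *\<^sub>v (N *\<^sub>v v))"
        using V.mat_of_comp[OF b linmap_mat[OF MN(1)] linmap_mat[OF MN(2)]] by (simp add: \<Phi>_def)
      also have "\<dots> = \<Phi> (M * N)" unfolding \<Phi>_def mat_of_def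
        using MN bc by (intro cong_mat) (auto simp: assoc_mult_mat_vec)
      finally show ?thesis by simp
    qed
    show "\<Phi> (M + N) = \<Phi> M + \<Phi> N" if MN: "M \<in> carrier_mat k k" "N \<in> carrier_mat k k" for M N
      unfolding \<Phi>_def using MN
      by (intro V.mat_of_add[OF b]) (auto simp: vs add_mult_distrib_mat_vec)
    show "\<Phi> (c \<cdot>\<^sub>m M) = c \<cdot>\<^sub>m \<Phi> M" if M: "M \<in> carrier_mat k k" for c M
      unfolding \<Phi>_def using M
      by (intro V.mat_of_smult[OF b]) (auto simp: vs intro!: eq_vecI scalar_prod_smult_left)
    show "\<Phi> (1\<^sub>m k) = 1\<^sub>m k" unfolding \<Phi>_def by (rule V.mat_of_id[OF b]) (auto simp: vs)
    \<comment> \<open>A matrix that commutes with \<open>C\<close> maps ker C into itself, so the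
      images of the first k1 basis vectors have no coordinates beyond k1.\<close>
    show "\<Phi> M $$ (i, j) = 0"
      if M: "M \<in> carrier_mat k k" "M * C = C * M" and ij: "k1 \<le> i" "i < k" "j < k1" for M i j
    proof -
      have jk: "j < k" using ij by simp
      have "C *\<^sub>v (M *\<^sub>v b j) = (C * M) *\<^sub>v b j" by (rule assoc_mult_mat_vec[OF C M(1) bc[OF jk], symmetric])
      also have "\<dots> = M *\<^sub>v (C *\<^sub>v b j)" unfolding M(2)[symmetric] by (rule assoc_mult_mat_vec[OF M(1) C bc[OF jk]])
      also have "\<dots> = 0\<^sub>v k" using bS[OF ij(3)] M(1) by (simp add: S_def) (auto intro!: eq_vecI)
      finally have "M *\<^sub>v b j \<in> S" using M(1) bc[OF jk] by (auto simp: S_def)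
      then obtain c where "M *\<^sub>v b j = lc (?V\<lparr>carrier := S\<rparr>) k1 u c" using u by (auto simp: fbasis_def)
      also have "\<dots> = lc ?V k1 u c" by (rule V.subsp_lc[OF S ui(2)])
      also have "\<dots> = lc ?V k1 b c" by (rule V.lc_cong) (use ui b0(3) V.indepD(1)[OF ui(1)] in auto)
      also have "\<dots> = lc ?V k b (\<lambda>i. if i < k1 then c i else 0)"
        by (rule V.lc_truncate[symmetric]) (use b0(2) n bc in \<open>auto simp: vs\<close>)
      finally show ?thesis using V.coord_eqI[OF b _ ij(2)] ij jk by (simp add: \<Phi>_def mat_of_def)
    qed
    show "\<Phi> C $$ (i, j) = 0" if ij: "i < k" "j < k1" for i j
    proof -
      have jk: "j < k" using ij b0(2) n by simp
      have "C *\<^sub>v b j = \<zero>\<^bsub>?V\<^esub>" using bS[OF ij(2)] by (simp add: S_def vs)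
      also have "\<dots> = lc ?V k b (\<lambda>_. 0)" using bc by (simp add: vs)
      finally show ?thesis using V.coord_eqI[OF b _ ij(1)] ij jk by (simp add: \<Phi>_def mat_of_def)
    qed
  qed
qed

lemma poly_mat_matrix_hom:
  fixes T :: "'a :: field mat"
  assumes T: "T \<in> carrier_mat k k"
    and "\<And>M. M \<in> carrier_mat k k \<Longrightarrow> \<Phi> M \<in> carrier_mat k k"
    and "\<And>M N. M \<in> carrier_mat k k \<Longrightarrow> N \<in> carrier_mat k k \<Longrightarrow> \<Phi> (M * N) = \<Phi> M * \<Phi> N"
    and "\<And>M N. M \<in> carrier_mat k k \<Longrightarrow> N \<in> carrier_mat k k \<Longrightarrow> \<Phi> (M + N) = \<Phi> M + \<Phi> N"
    and "\<And>c M. M \<in> carrier_mat k k \<Longrightarrow> \<Phi> (c \<cdot>\<^sub>m M) = c \<cdot>\<^sub>m \<Phi> M" "\<Phi> (1\<^sub>m k) = 1\<^sub>m k"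
  shows "\<Phi> (poly_mat q T) = poly_mat q (\<Phi> T)"
proof (induction q)
  case 0
  have "\<Phi> (0 \<cdot>\<^sub>m 1\<^sub>m k) = 0 \<cdot>\<^sub>m \<Phi> (1\<^sub>m k)" using assms(5)[of "1\<^sub>m k" 0] by simp
  moreover have "0 \<cdot>\<^sub>m 1\<^sub>m k = (0\<^sub>m k k :: 'a mat)" "0 \<cdot>\<^sub>m (1\<^sub>m k) = (0\<^sub>m k k :: 'a mat)" by (auto intro!: eq_matI)
  ultimately have "\<Phi> (0\<^sub>m k k) = 0\<^sub>m k k" using assms(6) by simp
  then show ?case using T assms(2)[OF T] by simp
next
  case (pCons a q)
  have "\<Phi> (a \<cdot>\<^sub>m 1\<^sub>m k + T * poly_mat q T) = a \<cdot>\<^sub>m 1\<^sub>m k + \<Phi> T * \<Phi> (poly_mat q T)"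
    using T assms(3)[OF T poly_mat_closed[OF T]] assms(4)[of "a \<cdot>\<^sub>m 1\<^sub>m k" "T * poly_mat q T"] assms(5)[of "1\<^sub>m k" a] assms(6)
    by simp
  then show ?case using pCons T assms(2)[OF T] by (simp add: poly_mat_pCons)
qed

subsection \<open>Representations\<close>

text \<open>An antirepresentation turns \<open>F\<^sup>k\<close> into a right \<open>B\<close>-module by \<open>v \<cdot> a = \<sigma> a v\<close>; \<open>bimod\<close> adds an endomorphism
  \<open>T\<close> of this module.\<close>

definition antirep :: "('k :: field, 'b) module \<Rightarrow> nat \<Rightarrow> ('b \<Rightarrow> 'k mat) \<Rightarrow> bool" where
  "antirep B k \<sigma> \<longleftrightarrow> (\<forall>a\<in>carrier B. \<sigma> a \<in> carrier_mat k k) \<and>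
    (\<forall>a\<in>carrier B. \<forall>b\<in>carrier B. \<sigma> (a \<oplus>\<^bsub>B\<^esub> b) = \<sigma> a + \<sigma> b \<and> \<sigma> (a \<otimes>\<^bsub>B\<^esub> b) = \<sigma> b * \<sigma> a) \<and>
    (\<forall>c. \<forall>a\<in>carrier B. \<sigma> (c \<odot>\<^bsub>B\<^esub> a) = c \<cdot>\<^sub>m \<sigma> a) \<and> \<sigma> \<one>\<^bsub>B\<^esub> = 1\<^sub>m k"

definition bimod :: "('k :: field, 'b) module \<Rightarrow> nat \<Rightarrow> 'k mat \<Rightarrow> ('b \<Rightarrow> 'k mat) \<Rightarrow> bool" where
  "bimod B k T \<sigma> \<longleftrightarrow> antirep B k \<sigma> \<and> T \<in> carrier_mat k k \<and> (\<forall>a\<in>carrier B. \<sigma> a * T = T * \<sigma> a)"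

lemma antirepD:
  assumes "antirep B k \<sigma>"
  shows "a \<in> carrier B \<Longrightarrow> \<sigma> a \<in> carrier_mat k k"
    "a \<in> carrier B \<Longrightarrow> b \<in> carrier B \<Longrightarrow> \<sigma> (a \<oplus>\<^bsub>B\<^esub> b) = \<sigma> a + \<sigma> b"
    "a \<in> carrier B \<Longrightarrow> b \<in> carrier B \<Longrightarrow> \<sigma> (a \<otimes>\<^bsub>B\<^esub> b) = \<sigma> b * \<sigma> a"
    "a \<in> carrier B \<Longrightarrow> \<sigma> (c \<odot>\<^bsub>B\<^esub> a) = c \<cdot>\<^sub>m \<sigma> a"
    "\<sigma> \<one>\<^bsub>B\<^esub> = 1\<^sub>m k"
  using assms by (auto simp: antirep_def)

lemma antirep_rmod:
  assumes "falg B" "antirep B k \<sigma>"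
  shows "rmod B (module_vec TYPE('k :: field) k) (\<lambda>v a. \<sigma> a *\<^sub>v v)"
proof -
  interpret B: falg B by fact
  interpret V: fvs "module_vec TYPE('k) k" by (rule fvs_vec)
  note s = antirepD[OF assms(2)]
  show ?thesis
  proof
    fix v x y assume "v \<in> carrier (module_vec TYPE('k) k)" "x \<in> carrier B" "y \<in> carrier B"
    then show "\<sigma> (x \<otimes>\<^bsub>B\<^esub> y) *\<^sub>v v = \<sigma> y *\<^sub>v (\<sigma> x *\<^sub>v v)"
      using s(1)[of x] s(1)[of y] by (simp add: s(3) module_vec_simps assoc_mult_mat_vec[of _ k k _ k])
    show "\<sigma> (x \<oplus>\<^bsub>B\<^esub> y) *\<^sub>v v = \<sigma> x *\<^sub>v v \<oplus>\<^bsub>module_vec TYPE('k) k\<^esub> \<sigma> y *\<^sub>v v" 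
      if "v \<in> carrier (module_vec TYPE('k) k)" "x \<in> carrier B" "y \<in> carrier B" for v x y
      using that s(1)[of x] s(1)[of y] by (simp add: s(2) module_vec_simps add_mult_distrib_mat_vec[of _ k k])
  next
    fix v x k' assume v: "v \<in> carrier (module_vec TYPE('k) k)" and x: "x \<in> carrier B"
    show "\<sigma> x *\<^sub>v v \<in> carrier (module_vec TYPE('k) k)" using s(1)[OF x] v by (auto simp: module_vec_simps)
    show "\<sigma> x *\<^sub>v (k' \<odot>\<^bsub>module_vec TYPE('k) k\<^esub> v) = k' \<odot>\<^bsub>module_vec TYPE('k) k\<^esub> (\<sigma> x *\<^sub>v v)"
      using s(1)[OF x] v by (simp add: module_vec_simps mult_mat_vec[of _ k k])
    show "\<sigma> (k' \<odot>\<^bsub>B\<^esub> x) *\<^sub>v v = k' \<odot>\<^bsub>module_vec TYPE('k) k\<^esub> (\<sigma> x *\<^sub>v v)"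
      using s(1)[OF x] v x by (auto simp: s(4) module_vec_simps scalar_prod_smult_left intro!: eq_vecI)
  next
    fix v assume "v \<in> carrier (module_vec TYPE('k) k)"
    then show "\<sigma> \<one>\<^bsub>B\<^esub> *\<^sub>v v = v" by (simp add: s(5) module_vec_simps)
  next
    fix v w x assume "v \<in> carrier (module_vec TYPE('k) k)" "w \<in> carrier (module_vec TYPE('k) k)" "x \<in> carrier B"
    then show "\<sigma> x *\<^sub>v (v \<oplus>\<^bsub>module_vec TYPE('k) k\<^esub> w) = \<sigma> x *\<^sub>v v \<oplus>\<^bsub>module_vec TYPE('k) k\<^esub> \<sigma> x *\<^sub>v w"
      using s(1)[of x] by (simp add: module_vec_simps mult_add_distrib_mat_vec[of _ k k])
  qed
qed

text \<open>A module has dimension k = m r \<delta>, while N = m^2 \<delta>. Thus k is a multiple of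
  N / m, which is written without division.\<close>

lemma antirep_dim:
  fixes B :: "('k :: field, 'b) module"
  assumes "falg B" "antirep B k \<sigma>" "mu_system B m e f c" "fbasis B N b"
  shows "N dvd m * k"
proof -
  interpret B: falg B by fact
  interpret mu: mu_system B m e f c by fact
  interpret R: rmod B "module_vec TYPE('k) k" "\<lambda>v a. \<sigma> a *\<^sub>v v" by (rule antirep_rmod[OF assms(1,2)])
  obtain \<delta> y where y: "fbasis (corner B e) \<delta> y" using B.corner_ex_fbasis[OF assms(4) mu.e_closed] .
  have N: "N = m * m * \<delta>" using B.fbasis_unique[OF assms(4) B.mu_system_basis[OF assms(3) y]] .
  obtain r where "k = m * r * \<delta>"
    by (rule R.rmod_basis[OF assms(3) fbasis_unit_vec y]) (use R.V.fbasis_unique[OF fbasis_unit_vec] in blast)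
  then have "m * k = N * r" using N by (simp add: ac_simps)
  then show ?thesis by simp
qed

lemma antirep_mat_of:
  assumes "falg B" "fvs V" "fbasis V k b"
    and lin: "\<And>a. a \<in> carrier B \<Longrightarrow> linmap V V (\<lambda>v. act v a)"
    and add: "\<And>v x y. v \<in> carrier V \<Longrightarrow> x \<in> carrier B \<Longrightarrow> y \<in> carrier B \<Longrightarrow> act v (x \<oplus>\<^bsub>B\<^esub> y) = act v x \<oplus>\<^bsub>V\<^esub> act v y"
    and sc: "\<And>v x l. v \<in> carrier V \<Longrightarrow> x \<in> carrier B \<Longrightarrow> act v (l \<odot>\<^bsub>B\<^esub> x) = l \<odot>\<^bsub>V\<^esub> act v x"
    and mult: "\<And>v x y. v \<in> carrier V \<Longrightarrow> x \<in> carrier B \<Longrightarrow> y \<in> carrier B \<Longrightarrow> act v (x \<otimes>\<^bsub>B\<^esub> y) = act (act v x) y"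
    and one: "\<And>v. v \<in> carrier V \<Longrightarrow> act v \<one>\<^bsub>B\<^esub> = v"
  shows "antirep B k (\<lambda>a. mat_of V k b (\<lambda>v. act v a))"
proof -
  interpret B: falg B by fact
  interpret V: fvs V by fact
  have bc: "\<And>i. i < k \<Longrightarrow> b i \<in> carrier V" using V.fbasisD(2)[OF assms(3)] .
  show ?thesis unfolding antirep_def
  proof (intro conjI ballI allI)
    fix x y assume xy: "x \<in> carrier B" "y \<in> carrier B"
    show "mat_of V k b (\<lambda>v. act v (x \<oplus>\<^bsub>B\<^esub> y)) = mat_of V k b (\<lambda>v. act v x) + mat_of V k b (\<lambda>v. act v y)"
      by (rule V.mat_of_add[OF assms(3)]) (use xy add linmapD(1)[OF lin] in auto)
    have "mat_of V k b (\<lambda>v. act v (x \<otimes>\<^bsub>B\<^esub> y)) = mat_of V k b (\<lambda>v. act (act v x) y)"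
      unfolding mat_of_def by (rule cong_mat) (use xy mult bc in auto)
    also have "\<dots> = mat_of V k b (\<lambda>v. act v y) * mat_of V k b (\<lambda>v. act v x)"
      by (rule V.mat_of_comp[OF assms(3) lin lin]) (use xy in auto)
    finally show "mat_of V k b (\<lambda>v. act v (x \<otimes>\<^bsub>B\<^esub> y)) = mat_of V k b (\<lambda>v. act v y) * mat_of V k b (\<lambda>v. act v x)" .
  next
    fix l x assume x: "x \<in> carrier B"
    show "mat_of V k b (\<lambda>v. act v (l \<odot>\<^bsub>B\<^esub> x)) = l \<cdot>\<^sub>m mat_of V k b (\<lambda>v. act v x)"
      by (rule V.mat_of_smult[OF assms(3)]) (use x sc linmapD(1)[OF lin] in auto)
  next
    show "mat_of V k b (\<lambda>v. act v \<one>\<^bsub>B\<^esub>) = 1\<^sub>m k" by (rule V.mat_of_id[OF assms(3) one])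
  qed simp
qed

text \<open>The block form says that the first k1 coordinates span a subspace stable under
  everything. The upper left blocks describe this submodule and the lower right blocks the quotient;
  the laws follow by comparing diagonal blocks.\<close>

lemma bimod_four_block:
  fixes B :: "('k :: field, 'b) module"
  assumes "\<And>a. a \<in> carrier B \<Longrightarrow> \<sigma> a = four_block_mat (\<sigma>1 a) (\<tau> a) (0\<^sub>m k2 k1) (\<sigma>2 a)"
    and "T = four_block_mat T1 U (0\<^sub>m k2 k1) T2"
    and c: "\<And>a. a \<in> carrier B \<Longrightarrow> \<sigma>1 a \<in> carrier_mat k1 k1" "\<And>a. a \<in> carrier B \<Longrightarrow> \<tau> a \<in> carrier_mat k1 k2"
      "\<And>a. a \<in> carrier B \<Longrightarrow> \<sigma>2 a \<in> carrier_mat k2 k2"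
      "T1 \<in> carrier_mat k1 k1" "U \<in> carrier_mat k1 k2" "T2 \<in> carrier_mat k2 k2"
    and "falg B" "bimod B (k1 + k2) T \<sigma>"
  shows "bimod B k1 T1 \<sigma>1" "bimod B k2 T2 \<sigma>2"
proof -
  interpret B: falg B by fact
  have s: "antirep B (k1 + k2) \<sigma>" and T: "\<And>a. a \<in> carrier B \<Longrightarrow> \<sigma> a * T = T * \<sigma> a"
    using assms(10) by (auto simp: bimod_def)
  note s = antirepD[OF s]
  have inj: "A = A' \<and> D = D'" if "four_block_mat A E (0\<^sub>m k2 k1) D = four_block_mat A' E' (0\<^sub>m k2 k1) D'"
    "A \<in> carrier_mat k1 k1" "A' \<in> carrier_mat k1 k1" "D \<in> carrier_mat k2 k2" "D' \<in> carrier_mat k2 k2"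
    for A A' E E' D D' :: "'k mat"
  proof
    show "A = A'"
    proof (rule eq_matI)
      fix i j assume "i < dim_row A'" "j < dim_col A'"
      then show "A $$ (i, j) = A' $$ (i, j)"
        using arg_cong[OF that(1), of "\<lambda>M. M $$ (i, j)"] that(2-) by simp
    qed (use that in auto)
    show "D = D'"
    proof (rule eq_matI)
      fix i j assume "i < dim_row D'" "j < dim_col D'"
      then show "D $$ (i, j) = D' $$ (i, j)"
        using arg_cong[OF that(1), of "\<lambda>M. M $$ (i + k1, j + k1)"] that(2-) by simp
    qed (use that in auto)
  qed
  have add: "\<sigma>1 (a \<oplus>\<^bsub>B\<^esub> b) = \<sigma>1 a + \<sigma>1 b \<and> \<sigma>2 (a \<oplus>\<^bsub>B\<^esub> b) = \<sigma>2 a + \<sigma>2 b" if ab: "a \<in> carrier B" "b \<in> carrier B" for a b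
  proof (rule inj)
    have "four_block_mat (\<sigma>1 (a \<oplus>\<^bsub>B\<^esub> b)) (\<tau> (a \<oplus>\<^bsub>B\<^esub> b)) (0\<^sub>m k2 k1) (\<sigma>2 (a \<oplus>\<^bsub>B\<^esub> b)) = \<sigma> a + \<sigma> b"
      using s(2)[OF ab] assms(1)[of "a \<oplus>\<^bsub>B\<^esub> b"] ab by simp
    also have "\<dots> = four_block_mat (\<sigma>1 a + \<sigma>1 b) (\<tau> a + \<tau> b) (0\<^sub>m k2 k1) (\<sigma>2 a + \<sigma>2 b)"
      using ab c(1-3) by (subst (1 2) assms(1)) (auto simp: add_four_block_mat[of _ k1 k1 _ k2 _ k2])
    finally show "four_block_mat (\<sigma>1 (a \<oplus>\<^bsub>B\<^esub> b)) (\<tau> (a \<oplus>\<^bsub>B\<^esub> b)) (0\<^sub>m k2 k1) (\<sigma>2 (a \<oplus>\<^bsub>B\<^esub> b)) =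
      four_block_mat (\<sigma>1 a + \<sigma>1 b) (\<tau> a + \<tau> b) (0\<^sub>m k2 k1) (\<sigma>2 a + \<sigma>2 b)" .
  qed (use ab c(1-3) in auto)
  have mult: "\<sigma>1 (a \<otimes>\<^bsub>B\<^esub> b) = \<sigma>1 b * \<sigma>1 a \<and> \<sigma>2 (a \<otimes>\<^bsub>B\<^esub> b) = \<sigma>2 b * \<sigma>2 a" if ab: "a \<in> carrier B" "b \<in> carrier B" for a b
  proof (rule inj)
    have "four_block_mat (\<sigma>1 (a \<otimes>\<^bsub>B\<^esub> b)) (\<tau> (a \<otimes>\<^bsub>B\<^esub> b)) (0\<^sub>m k2 k1) (\<sigma>2 (a \<otimes>\<^bsub>B\<^esub> b)) = \<sigma> b * \<sigma> a"
      using s(3)[OF ab] assms(1)[of "a \<otimes>\<^bsub>B\<^esub> b"] ab by simp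
    also have "\<dots> = four_block_mat (\<sigma>1 b * \<sigma>1 a) (\<sigma>1 b * \<tau> a + \<tau> b * \<sigma>2 a) (0\<^sub>m k2 k1) (\<sigma>2 b * \<sigma>2 a)"
      using ab c(1-3) by (subst (1 2) assms(1)) (auto simp: mult_four_block_upper)
    finally show "four_block_mat (\<sigma>1 (a \<otimes>\<^bsub>B\<^esub> b)) (\<tau> (a \<otimes>\<^bsub>B\<^esub> b)) (0\<^sub>m k2 k1) (\<sigma>2 (a \<otimes>\<^bsub>B\<^esub> b)) =
      four_block_mat (\<sigma>1 b * \<sigma>1 a) (\<sigma>1 b * \<tau> a + \<tau> b * \<sigma>2 a) (0\<^sub>m k2 k1) (\<sigma>2 b * \<sigma>2 a)" .
  qed (use ab c(1-3) in \<open>auto intro: mult_carrier_mat\<close>)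
  have smult: "\<sigma>1 (l \<odot>\<^bsub>B\<^esub> a) = l \<cdot>\<^sub>m \<sigma>1 a \<and> \<sigma>2 (l \<odot>\<^bsub>B\<^esub> a) = l \<cdot>\<^sub>m \<sigma>2 a" if a: "a \<in> carrier B" for l a
  proof (rule inj)
    have "four_block_mat (\<sigma>1 (l \<odot>\<^bsub>B\<^esub> a)) (\<tau> (l \<odot>\<^bsub>B\<^esub> a)) (0\<^sub>m k2 k1) (\<sigma>2 (l \<odot>\<^bsub>B\<^esub> a)) = l \<cdot>\<^sub>m \<sigma> a"
      using s(4)[OF a] assms(1)[of "l \<odot>\<^bsub>B\<^esub> a"] a by simp
    also have "\<dots> = four_block_mat (l \<cdot>\<^sub>m \<sigma>1 a) (l \<cdot>\<^sub>m \<tau> a) (0\<^sub>m k2 k1) (l \<cdot>\<^sub>m \<sigma>2 a)"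
      using a c(1)[OF a] c(2)[OF a] c(3)[OF a] by (subst assms(1)) (auto intro!: eq_matI)
    finally show "four_block_mat (\<sigma>1 (l \<odot>\<^bsub>B\<^esub> a)) (\<tau> (l \<odot>\<^bsub>B\<^esub> a)) (0\<^sub>m k2 k1) (\<sigma>2 (l \<odot>\<^bsub>B\<^esub> a)) =
      four_block_mat (l \<cdot>\<^sub>m \<sigma>1 a) (l \<cdot>\<^sub>m \<tau> a) (0\<^sub>m k2 k1) (l \<cdot>\<^sub>m \<sigma>2 a)" .
  qed (use a c(1-3) in auto)
  have one: "\<sigma>1 \<one>\<^bsub>B\<^esub> = 1\<^sub>m k1 \<and> \<sigma>2 \<one>\<^bsub>B\<^esub> = 1\<^sub>m k2"
  proof (rule inj)
    show "four_block_mat (\<sigma>1 \<one>\<^bsub>B\<^esub>) (\<tau> \<one>\<^bsub>B\<^esub>) (0\<^sub>m k2 k1) (\<sigma>2 \<one>\<^bsub>B\<^esub>) = four_block_mat (1\<^sub>m k1) (0\<^sub>m k1 k2) (0\<^sub>m k2 k1) (1\<^sub>m k2)"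
      using s(5) assms(1)[of "\<one>\<^bsub>B\<^esub>"] by simp
  qed (use c(1-3) in auto)
  have com: "\<sigma>1 a * T1 = T1 * \<sigma>1 a \<and> \<sigma>2 a * T2 = T2 * \<sigma>2 a" if a: "a \<in> carrier B" for a
  proof (rule inj)
    show "four_block_mat (\<sigma>1 a * T1) (\<sigma>1 a * U + \<tau> a * T2) (0\<^sub>m k2 k1) (\<sigma>2 a * T2) =
      four_block_mat (T1 * \<sigma>1 a) (T1 * \<tau> a + U * \<sigma>2 a) (0\<^sub>m k2 k1) (T2 * \<sigma>2 a)"
      using T[OF a] unfolding assms(2) assms(1)[OF a]
      using a c(1)[OF a] c(2)[OF a] c(3)[OF a] c(4-6) by (simp add: mult_four_block_upper)
  qed (use a c in \<open>auto intro: mult_carrier_mat\<close>)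
  show "bimod B k1 T1 \<sigma>1" "bimod B k2 T2 \<sigma>2"
    unfolding bimod_def antirep_def using c add mult smult one com by auto
qed

lemma bimod_direct_sum:
  fixes B :: "('k :: field, 'b) module"
  assumes "falg B" "bimod B k1 T1 \<sigma>1" "bimod B k2 T2 \<sigma>2"
  shows "bimod B (k1 + k2) (four_block_mat T1 (0\<^sub>m k1 k2) (0\<^sub>m k2 k1) T2)
    (\<lambda>a. four_block_mat (\<sigma>1 a) (0\<^sub>m k1 k2) (0\<^sub>m k2 k1) (\<sigma>2 a))"
proof -
  interpret B: falg B by fact
  have 1: "antirep B k1 \<sigma>1" "T1 \<in> carrier_mat k1 k1" "\<And>a. a \<in> carrier B \<Longrightarrow> \<sigma>1 a * T1 = T1 * \<sigma>1 a"
    and 2: "antirep B k2 \<sigma>2" "T2 \<in> carrier_mat k2 k2" "\<And>a. a \<in> carrier B \<Longrightarrow> \<sigma>2 a * T2 = T2 * \<sigma>2 a"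
    using assms by (auto simp: bimod_def)
  note s1 = antirepD[OF 1(1)] and s2 = antirepD[OF 2(1)]
  have mult: "four_block_mat M1 (0\<^sub>m k1 k2) (0\<^sub>m k2 k1) M2 * four_block_mat N1 (0\<^sub>m k1 k2) (0\<^sub>m k2 k1) N2 =
    four_block_mat (M1 * N1) (0\<^sub>m k1 k2) (0\<^sub>m k2 k1) (M2 * N2)"
    if "M1 \<in> carrier_mat k1 k1" "N1 \<in> carrier_mat k1 k1" "M2 \<in> carrier_mat k2 k2" "N2 \<in> carrier_mat k2 k2"
    for M1 M2 N1 N2 :: "'k mat"
    using that by (subst mult_four_block_upper) auto
  have sm: "l \<cdot>\<^sub>m four_block_mat M1 (0\<^sub>m k1 k2) (0\<^sub>m k2 k1) M2 = four_block_mat (l \<cdot>\<^sub>m M1) (0\<^sub>m k1 k2) (0\<^sub>m k2 k1) (l \<cdot>\<^sub>m M2)"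
    if "M1 \<in> carrier_mat k1 k1" "M2 \<in> carrier_mat k2 k2" for M1 M2 :: "'k mat" and l
    using that by (intro eq_matI) auto
  show ?thesis
    unfolding bimod_def antirep_def
    using 1 2 s1(1) s2(1)
    by (auto simp: mult sm s1(2-) s2(2-) add_four_block_mat[of _ k1 k1 _ k2 _ k2] intro!: cong_four_block_mat)
qed

subsection \<open>Bimodules over a central division algebra\<close>

locale cda = D: falg D for D :: "('f :: field, 'b) module" +
  fixes d :: nat and y :: "nat \<Rightarrow> 'b"
  assumes division: "x \<in> carrier D \<Longrightarrow> x \<noteq> \<zero>\<^bsub>D\<^esub> \<Longrightarrow> \<exists>z\<in>carrier D. x \<otimes>\<^bsub>D\<^esub> z = \<one>\<^bsub>D\<^esub> \<and> z \<otimes>\<^bsub>D\<^esub> x = \<one>\<^bsub>D\<^esub>"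
    and nontrivial: "\<one>\<^bsub>D\<^esub> \<noteq> \<zero>\<^bsub>D\<^esub>"
    and central: "central_algebra D"
    and basis: "fbasis D (d * d) y"
begin

lemma simple: "simple_ring D"
  unfolding simple_ring_def
proof (intro conjI ballI impI)
  show "\<one>\<^bsub>D\<^esub> \<noteq> \<zero>\<^bsub>D\<^esub>" by (rule nontrivial)
  fix x assume "x \<in> carrier D" "x \<noteq> \<zero>\<^bsub>D\<^esub>"
  then obtain z where "z \<in> carrier D" "z \<otimes>\<^bsub>D\<^esub> x = \<one>\<^bsub>D\<^esub>" using division by blast
  then show "\<exists>E\<in>mult_ops D. E x = \<one>\<^bsub>D\<^esub>"
    by (intro bexI[of _ "\<lambda>x. z \<otimes>\<^bsub>D\<^esub> x \<otimes>\<^bsub>D\<^esub> \<one>\<^bsub>D\<^esub>"] mult_ops.mult) auto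
qed

text \<open>The trivial system with e = 1. Together with \<open>antirep_dim\<close> it shows that
  the F-dimension of every \<Delta>-module is divisible by d^2.\<close>

lemma mu_one: "mu_system D 1 \<one>\<^bsub>D\<^esub> (\<lambda>_. \<one>\<^bsub>D\<^esub>) (\<lambda>_. \<one>\<^bsub>D\<^esub>)"
proof
  show "(\<Oplus>\<^bsub>D\<^esub>i\<in>{..<1::nat}. \<one>\<^bsub>D\<^esub> \<otimes>\<^bsub>D\<^esub> \<one>\<^bsub>D\<^esub>) = \<one>\<^bsub>D\<^esub>"
    by (subst D.M.finsum_eq_single[of 0]) auto
  fix x assume "x \<in> carrier D" "x \<noteq> \<zero>\<^bsub>D\<^esub>"
  then show "\<exists>y\<in>carrier D. \<one>\<^bsub>D\<^esub> \<otimes>\<^bsub>D\<^esub> y \<otimes>\<^bsub>D\<^esub> \<one>\<^bsub>D\<^esub> = y \<and> x \<otimes>\<^bsub>D\<^esub> y = \<one>\<^bsub>D\<^esub> \<and> y \<otimes>\<^bsub>D\<^esub> x = \<one>\<^bsub>D\<^esub>"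
    using division[of x] by auto
qed (use nontrivial in auto)

lemma d_pos: "0 < d"
proof (rule ccontr)
  assume "\<not> 0 < d"
  then have "\<one>\<^bsub>D\<^esub> = \<zero>\<^bsub>D\<^esub>" using basis unfolding fbasis_def by (metis D.A.one_closed D.lc_0 gr0I mult_0)
  then show False using nontrivial by simp
qed

abbreviation "cap p \<equiv> capacity (adjoin_root p) (base_change class_ring D (adjoin_root p))"

lemma tensor_adjoin:
  assumes "adjoin p"
  shows "tensor D (adjoin_root p)"
proof -
  interpret adjoin p by fact
  show ?thesis by (intro tensor.intro D.falg_axioms L_falg L_cring)
qed

text \<open>When p(S) = 0, the space becomes a right module over \<Delta> \<otimes> F[t]/(p), with t
  acting as S. This algebra has dimension d^2 deg p over F and capacity \<open>cap p\<close>, so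
  \<open>antirep_dim\<close> gives the claim.\<close>

lemma bimod_annihilated:
  assumes "Factorial_Ring.irreducible p" "lead_coeff p = 1" "bimod D k S \<sigma>" "poly_mat p S = 0\<^sub>m k k"
  shows "d * d * Polynomial.degree p dvd cap p * k"
proof -
  interpret p: adjoin p by unfold_locales fact+
  interpret t: tensor D "adjoin_root p" by (rule tensor_adjoin[OF p.adjoin_axioms])
  have s: "antirep D k \<sigma>" and S: "S \<in> carrier_mat k k" and com: "\<And>a. a \<in> carrier D \<Longrightarrow> \<sigma> a * S = S * \<sigma> a"
    using assms(3) by (auto simp: bimod_def)
  note s = antirepD[OF s]
  \<comment> \<open>Evaluation at \<open>S\<close> of some representative of the class l. Any other
    representative differs by a multiple of p and gives the same matrix, because p(S) = 0.\<close>
  define \<tau> where "\<tau> l = poly_mat (SOME g. p.cls g = l) S" for l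
  have \<tau>: "\<tau> (p.cls g) = poly_mat g S" for g
  proof -
    let ?h = "SOME h. p.cls h = p.cls g"
    have "p.cls ?h = p.cls g" by (rule someI[of _ g]) simp
    then have "p dvd ?h - g" by (simp only: p.cls_eq_iff)
    then obtain r where "?h - g = p * r" unfolding dvd_def by blast
    then have "?h = g + p * r" by (metis add.commute diff_add_cancel)
    then have "poly_mat ?h S = poly_mat g S + poly_mat p S * poly_mat r S"
      using S by (simp only: poly_mat_add poly_mat_mult)
    also have "\<dots> = poly_mat g S"
      using S unfolding assms(4) by (simp add: left_mult_zero_mat[OF poly_mat_closed[OF S]] right_add_zero_mat[OF poly_mat_closed[OF S]])
    finally show ?thesis unfolding \<tau>_def .
  qed
  have cases: "\<exists>g. l = p.cls g" if "l \<in> carrier p.L" for l using that unfolding p.L_carrier by blast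
  have \<tau>c: "\<tau> l \<in> carrier_mat k k" if "l \<in> carrier p.L" for l using cases[OF that] \<tau> S by auto
  have \<tau>add: "\<tau> (l \<oplus>\<^bsub>p.L\<^esub> l') = \<tau> l + \<tau> l'" and \<tau>mult: "\<tau> (l \<otimes>\<^bsub>p.L\<^esub> l') = \<tau> l * \<tau> l'"
    if ll: "l \<in> carrier p.L" "l' \<in> carrier p.L" for l l'
  proof -
    obtain g h where "l = p.cls g" "l' = p.cls h" using cases ll by blast
    then show "\<tau> (l \<oplus>\<^bsub>p.L\<^esub> l') = \<tau> l + \<tau> l'" "\<tau> (l \<otimes>\<^bsub>p.L\<^esub> l') = \<tau> l * \<tau> l'"
      using S by (simp_all add: p.cls_add p.cls_mult \<tau> poly_mat_add poly_mat_mult)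
  qed
  have \<tau>sc: "\<tau> (c \<odot>\<^bsub>p.L\<^esub> l) = c \<cdot>\<^sub>m \<tau> l" if l: "l \<in> carrier p.L" for c l
  proof -
    obtain g where "l = p.cls g" using cases l by blast
    then show ?thesis using S by (simp add: p.cls_smult \<tau> poly_mat_smult)
  qed
  have \<tau>com: "\<sigma> a * \<tau> l = \<tau> l * \<sigma> a" if al: "a \<in> carrier D" "l \<in> carrier p.L" for a l
  proof -
    obtain g where "l = p.cls g" using cases al by blast
    then show ?thesis using poly_mat_commute[OF S s(1)[OF al(1)] com[OF al(1)]] by (simp add: \<tau>)
  qed
  have \<tau>com': "\<tau> l * \<tau> l' = \<tau> l' * \<tau> l" if "l \<in> carrier p.L" "l' \<in> carrier p.L" for l l'
    using that \<tau>mult[of l l'] \<tau>mult[of l' l] t.L.m_comm by simp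
  let ?G = "module_mat TYPE('f) k k"
  note ms = module_mat_simps
  obtain h where h: "\<And>x. x \<in> carrier t.T \<Longrightarrow> h x \<in> carrier ?G"
    "\<And>x y. x \<in> carrier t.T \<Longrightarrow> y \<in> carrier t.T \<Longrightarrow> h (x \<oplus>\<^bsub>t.T\<^esub> y) = h x \<oplus>\<^bsub>?G\<^esub> h y"
    "\<And>a l. a \<in> carrier D \<Longrightarrow> l \<in> carrier p.L \<Longrightarrow> h (pure_tensor class_ring D p.L a l) = \<sigma> a * \<tau> l"
  proof (rule t.T_universal[of ?G "\<lambda>a l. \<sigma> a * \<tau> l"])
    show "abelian_group ?G" by (rule abelian_group_mat)
    fix a l assume al: "a \<in> carrier D" "l \<in> carrier p.L"
    note c = s(1)[OF al(1)] \<tau>c[OF al(2)]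
    show "\<sigma> a * \<tau> l \<in> carrier ?G" using c by (simp add: ms)
    show "\<sigma> (k' \<odot>\<^bsub>D\<^esub> a) * \<tau> l = \<sigma> a * \<tau> (k' \<odot>\<^bsub>p.L\<^esub> l)" for k'
      using c al by (simp add: s(4) \<tau>sc mult_smult_assoc_mat[of _ k k _ k] mult_smult_distrib[of _ k k _ k])
    show "\<sigma> (a \<oplus>\<^bsub>D\<^esub> a') * \<tau> l = \<sigma> a * \<tau> l \<oplus>\<^bsub>?G\<^esub> \<sigma> a' * \<tau> l" if "a' \<in> carrier D" for a'
      using c al s(1)[OF that] that by (simp add: s(2) ms add_mult_distrib_mat[of _ k k _ _ k])
    show "\<sigma> a * \<tau> (l \<oplus>\<^bsub>p.L\<^esub> l') = \<sigma> a * \<tau> l \<oplus>\<^bsub>?G\<^esub> \<sigma> a * \<tau> l'" if "l' \<in> carrier p.L" for l'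
      using c al \<tau>c[OF that] that by (simp add: \<tau>add ms mult_add_distrib_mat[of _ k k _ k])
  qed blast
  have hc: "h x \<in> carrier_mat k k" if "x \<in> carrier t.T" for x using h(1)[OF that] by (simp add: ms)
  have hadd: "h (x \<oplus>\<^bsub>t.T\<^esub> z) = h x + h z" if "x \<in> carrier t.T" "z \<in> carrier t.T" for x z
    using h(2)[OF that] by (simp add: ms)
  have hdiff: "h (x \<ominus>\<^bsub>t.T\<^esub> z) = h x - h z" if xz: "x \<in> carrier t.T" "z \<in> carrier t.T" for x z
  proof -
    have "x = (x \<ominus>\<^bsub>t.T\<^esub> z) \<oplus>\<^bsub>t.T\<^esub> z" using xz by (simp add: t.T.minus_eq t.T.a_assoc t.T.l_neg)
    then have eq: "h x = h (x \<ominus>\<^bsub>t.T\<^esub> z) + h z" using hadd[of "x \<ominus>\<^bsub>t.T\<^esub> z" z] xz by simp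
    show ?thesis unfolding eq using hc[OF xz(2)] hc[of "x \<ominus>\<^bsub>t.T\<^esub> z"] xz by (intro eq_matI) auto
  qed
  have hzero: "h \<zero>\<^bsub>t.T\<^esub> = 0\<^sub>m k k"
  proof -
    have "h (\<zero>\<^bsub>t.T\<^esub> \<ominus>\<^bsub>t.T\<^esub> \<zero>\<^bsub>t.T\<^esub>) = h \<zero>\<^bsub>t.T\<^esub> - h \<zero>\<^bsub>t.T\<^esub>" by (rule hdiff) auto
    moreover have "h \<zero>\<^bsub>t.T\<^esub> - h \<zero>\<^bsub>t.T\<^esub> = 0\<^sub>m k k" using hc[of "\<zero>\<^bsub>t.T\<^esub>"] by (intro eq_matI) auto
    ultimately show ?thesis by (simp add: t.T.minus_eq)
  qed
  \<comment> \<open>The universal property only made \<open>h\<close> additive. That it reverses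
    products is checked first for a pure tensor as second factor, where \<sigma> a and \<tau> l
    commute, and then extended to arbitrary second factors in \<open>hmult\<close>.\<close>
  have hmult1: "h (x \<otimes>\<^bsub>t.T\<^esub> pure_tensor class_ring D p.L a l) = (\<sigma> a * \<tau> l) * h x"
    if x: "x \<in> carrier t.T" and al: "a \<in> carrier D" "l \<in> carrier p.L" for x a l
    using x
  proof (induction rule: t.T_induct)
    case (pure a' l')
    note c = s(1)[OF al(1)] \<tau>c[OF al(2)] s(1)[OF pure(1)] \<tau>c[OF pure(2)]
    have "h (pure_tensor class_ring D p.L a' l' \<otimes>\<^bsub>t.T\<^esub> pure_tensor class_ring D p.L a l) = (\<sigma> a * \<sigma> a') * (\<tau> l' * \<tau> l)"
      using pure al by (simp add: t.pure_mult h(3) s(3) \<tau>mult)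
    also have "\<dots> = \<sigma> a * ((\<sigma> a' * \<tau> l) * \<tau> l')"
      using c pure al \<tau>com'[of l l'] by (simp add: assoc_mult_mat[of _ k k _ k _ k])
    also have "\<dots> = (\<sigma> a * \<tau> l) * (\<sigma> a' * \<tau> l')"
      unfolding \<tau>com[OF pure(1) al(2)] using c by (simp add: assoc_mult_mat[of _ k k _ k _ k])
    finally show ?case using pure by (simp add: h(3))
  next
    case zero
    have "(\<sigma> a * \<tau> l) * 0\<^sub>m k k = 0\<^sub>m k k" using s(1)[OF al(1)] \<tau>c[OF al(2)] by (intro right_mult_zero_mat) auto
    then show ?case using al by (simp add: hzero)
  next
    case (diff x x')
    have c: "\<sigma> a * \<tau> l \<in> carrier_mat k k" using s(1)[OF al(1)] \<tau>c[OF al(2)] by auto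
    have "h ((x \<ominus>\<^bsub>t.T\<^esub> x') \<otimes>\<^bsub>t.T\<^esub> pure_tensor class_ring D p.L a l) =
      h (x \<otimes>\<^bsub>t.T\<^esub> pure_tensor class_ring D p.L a l \<ominus>\<^bsub>t.T\<^esub> x' \<otimes>\<^bsub>t.T\<^esub> pure_tensor class_ring D p.L a l)"
      using diff al by (simp add: t.T.minus_eq t.T.l_distr t.T.l_minus)
    also have "\<dots> = (\<sigma> a * \<tau> l) * h x - (\<sigma> a * \<tau> l) * h x'"
      using diff al by (simp add: hdiff)
    also have "\<dots> = (\<sigma> a * \<tau> l) * (h x - h x')"
      by (rule mult_minus_distrib_mat[symmetric]) (use c hc diff in auto)
    finally show ?case using diff by (simp add: hdiff)
  qed
  have hmult: "h (x \<otimes>\<^bsub>t.T\<^esub> z) = h z * h x" if x: "x \<in> carrier t.T" and z: "z \<in> carrier t.T" for x z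
    using z
  proof (induction rule: t.T_induct)
    case (pure a l)
    then show ?case using hmult1[OF x pure] by (simp add: h(3))
  next
    case zero
    have "0\<^sub>m k k * h x = 0\<^sub>m k k" by (rule left_mult_zero_mat[OF hc[OF x]])
    then show ?case using x by (simp add: hzero)
  next
    case (diff z z')
    have "h (x \<otimes>\<^bsub>t.T\<^esub> (z \<ominus>\<^bsub>t.T\<^esub> z')) = h (x \<otimes>\<^bsub>t.T\<^esub> z \<ominus>\<^bsub>t.T\<^esub> x \<otimes>\<^bsub>t.T\<^esub> z')"
      using diff x by (simp add: t.T.minus_eq t.T.r_distr t.T.r_minus)
    also have "\<dots> = h z * h x - h z' * h x" using diff x by (simp add: hdiff)
    also have "\<dots> = (h z - h z') * h x"
      by (rule minus_mult_distrib_mat[OF hc[OF diff(1)] hc[OF diff(2)] hc[OF x], symmetric])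
    finally show ?case using diff by (simp add: hdiff)
  qed
  have hone: "h \<one>\<^bsub>t.T\<^esub> = 1\<^sub>m k"
  proof -
    have "h \<one>\<^bsub>t.T\<^esub> = \<sigma> \<one>\<^bsub>D\<^esub> * \<tau> \<one>\<^bsub>p.L\<^esub>" using h(3)[of "\<one>\<^bsub>D\<^esub>" "\<one>\<^bsub>p.L\<^esub>"] t.pure_one by simp
    also have "\<tau> \<one>\<^bsub>p.L\<^esub> = 1\<^sub>m k" using S by (simp add: p.cls_one \<tau>)
    finally show ?thesis by (simp add: s(5))
  qed
  have "antirep t.TF k h"
    unfolding antirep_def
  proof (intro conjI ballI allI)
    fix c x assume "x \<in> carrier t.TF"
    then have x: "x \<in> carrier t.T" by simp
    have kc: "c \<odot>\<^bsub>D\<^esub> \<one>\<^bsub>D\<^esub> \<in> carrier D" by simp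
    \<comment> \<open>Over F, scaling in \<open>TF\<close> is multiplication by c \<otimes> 1, and
      \<open>h\<close> sends this element to the scalar matrix c.\<close>
    have "h (c \<odot>\<^bsub>t.TF\<^esub> x) = h x * (\<sigma> (c \<odot>\<^bsub>D\<^esub> \<one>\<^bsub>D\<^esub>) * \<tau> \<one>\<^bsub>p.L\<^esub>)"
      using x kc hmult[of "pure_tensor class_ring D p.L (c \<odot>\<^bsub>D\<^esub> \<one>\<^bsub>D\<^esub>) \<one>\<^bsub>p.L\<^esub>" x] by (simp add: h(3))
    also have "\<sigma> (c \<odot>\<^bsub>D\<^esub> \<one>\<^bsub>D\<^esub>) * \<tau> \<one>\<^bsub>p.L\<^esub> = c \<cdot>\<^sub>m 1\<^sub>m k"
      using S by (simp add: p.cls_one \<tau> s(4,5))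
    also have "h x * (c \<cdot>\<^sub>m 1\<^sub>m k) = c \<cdot>\<^sub>m h x"
      using hc[OF x] by (simp add: mult_smult_distrib[of _ k k _ k])
    finally show "h (c \<odot>\<^bsub>t.TF\<^esub> x) = c \<cdot>\<^sub>m h x" .
  qed (use hc hadd hmult hone in auto)
  moreover obtain e f c where "mu_system t.TF (cap p) e f c"
    using t.T_mu_system[OF simple central basis p.L_field p.L_fbasis] .
  ultimately show ?thesis
    using antirep_dim[OF t.TF_falg] t.TF_fbasis[OF basis p.L_fbasis] by blast
qed

text \<open>Induction on the dimension. For a monic irreducible factor q of the characteristic
  polynomial, the kernel of q(S) is a nonzero submodule on which the characteristic polynomial is a
  power of q; the quotient is covered by the induction hypothesis. The kernel contributes to the
  multiplicity of p only if q = p, and then its multiplicity satisfies both divisibilities.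
  Multiplicities of kernel and quotient add up, and so do the divisibilities.\<close>

theorem bimod_multiplicity:
  assumes p: "Factorial_Ring.irreducible p" "lead_coeff p = 1" and "bimod D k S \<sigma>"
  shows "\<exists>j. pmult p (char_poly S) j \<and> d * d dvd Polynomial.degree p * j \<and> d * d dvd cap p * j"
  using assms(3)
proof (induction k arbitrary: S \<sigma> rule: less_induct)
  case (less k)
  have s: "antirep D k \<sigma>" and S: "S \<in> carrier_mat k k" and com: "\<And>a. a \<in> carrier D \<Longrightarrow> \<sigma> a * S = S * \<sigma> a"
    using less.prems by (auto simp: bimod_def)
  have deg: "Polynomial.degree (char_poly S) = k" "lead_coeff (char_poly S) = 1"
    using degree_monic_char_poly[OF S] by auto
  show ?case
  proof (cases "k = 0")
    case True
    then have "char_poly S = 1" using deg by (metis degree_0_id one_pCons)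
    then show ?thesis using pmult_one[OF p(1)] by (intro exI[of _ 0]) simp
  next
    case False
    then obtain q r where q: "Factorial_Ring.irreducible q" "char_poly S = q * r" "lead_coeff q = 1"
      using irreducible_monic_factor[of "char_poly S"] deg by auto
    let ?C = "poly_mat q S"
    have C: "?C \<in> carrier_mat k k" using S by simp
    \<comment> \<open>A kernel vector over F itself; it makes the kernel of q(S) nonzero and so the
      quotient smaller.\<close>
    obtain w where w: "w \<in> carrier_vec k" "w \<noteq> 0\<^sub>v k" "?C *\<^sub>v w = 0\<^sub>v k"
      using irreducible_factor_singular[OF S q(1)] q(2) by auto
    obtain k1 k2 \<Phi> where k: "k = k1 + k2" "0 < k1"
      and \<Phi>c: "\<And>M. M \<in> carrier_mat k k \<Longrightarrow> \<Phi> M \<in> carrier_mat k k"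
      and sim: "\<And>M. M \<in> carrier_mat k k \<Longrightarrow> similar_mat M (\<Phi> M)"
      and \<Phi>m: "\<And>M N. M \<in> carrier_mat k k \<Longrightarrow> N \<in> carrier_mat k k \<Longrightarrow> \<Phi> (M * N) = \<Phi> M * \<Phi> N"
      and \<Phi>a: "\<And>M N. M \<in> carrier_mat k k \<Longrightarrow> N \<in> carrier_mat k k \<Longrightarrow> \<Phi> (M + N) = \<Phi> M + \<Phi> N"
      and \<Phi>s: "\<And>c M. M \<in> carrier_mat k k \<Longrightarrow> \<Phi> (c \<cdot>\<^sub>m M) = c \<cdot>\<^sub>m \<Phi> M" and \<Phi>1: "\<Phi> (1\<^sub>m k) = 1\<^sub>m k"
      and block: "\<And>M i j. M \<in> carrier_mat k k \<Longrightarrow> M * ?C = ?C * M \<Longrightarrow> k1 \<le> i \<Longrightarrow> i < k \<Longrightarrow> j < k1 \<Longrightarrow> \<Phi> M $$ (i, j) = 0"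
      and ker: "\<And>i j. i < k \<Longrightarrow> j < k1 \<Longrightarrow> \<Phi> ?C $$ (i, j) = 0"
      using kernel_block[OF C w] by blast
    \<comment> \<open>Diagonal blocks in the adapted basis: \<open>ul\<close> gives the action on
      the kernel of q(S), \<open>lr\<close> the action on the quotient.\<close>
    define ul where "ul M = mat k1 k1 (\<lambda>(i, j). M $$ (i, j))" for M :: "'f mat"
    define ur where "ur M = mat k1 k2 (\<lambda>(i, j). M $$ (i, j + k1))" for M :: "'f mat"
    define lr where "lr M = mat k2 k2 (\<lambda>(i, j). M $$ (i + k1, j + k1))" for M :: "'f mat"
    have fb: "\<Phi> M = four_block_mat (ul (\<Phi> M)) (ur (\<Phi> M)) (0\<^sub>m k2 k1) (lr (\<Phi> M))"
      if M: "M \<in> carrier_mat k k" "M * ?C = ?C * M" for M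
      using \<Phi>c[OF M(1)] block[OF M] k(1) by (intro eq_matI) (auto simp: ul_def ur_def lr_def)
    have comC: "\<sigma> a * ?C = ?C * \<sigma> a" if "a \<in> carrier D" for a
      by (rule poly_mat_commute[OF S antirepD(1)[OF s that] com[OF that]])
    have SC: "S * ?C = ?C * S" by (rule poly_mat_commute[OF S S refl])
    have bi: "bimod D (k1 + k2) (\<Phi> S) (\<lambda>a. \<Phi> (\<sigma> a))"
      unfolding bimod_def antirep_def k(1)[symmetric]
      using antirepD[OF s] S com \<Phi>c \<Phi>m \<Phi>a \<Phi>s \<Phi>1 by (metis (no_types, lifting))
    have b12: "bimod D k1 (ul (\<Phi> S)) (\<lambda>a. ul (\<Phi> (\<sigma> a)))" "bimod D k2 (lr (\<Phi> S)) (\<lambda>a. lr (\<Phi> (\<sigma> a)))"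
      by (rule bimod_four_block[where \<sigma> = "\<lambda>a. \<Phi> (\<sigma> a)" and T = "\<Phi> S" and \<tau> = "\<lambda>a. ur (\<Phi> (\<sigma> a))" and U = "ur (\<Phi> S)",
            OF fb[OF antirepD(1)[OF s] comC] fb[OF S SC] _ _ _ _ _ _ D.falg_axioms bi];
          simp add: ul_def ur_def lr_def)+
    have chi: "char_poly S = char_poly (ul (\<Phi> S)) * char_poly (lr (\<Phi> S))"
    proof -
      have "char_poly S = char_poly (\<Phi> S)" by (rule char_poly_similar[OF sim[OF S]])
      also have "\<dots> = char_poly (four_block_mat (ul (\<Phi> S)) (ur (\<Phi> S)) (0\<^sub>m k2 k1) (lr (\<Phi> S)))"
        using fb[OF S SC] by simp
      also have "\<dots> = char_poly (ul (\<Phi> S)) * char_poly (lr (\<Phi> S))"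
        by (rule char_poly_four_block) (auto simp: ul_def ur_def lr_def)
      finally show ?thesis .
    qed
    have ulc: "ul (\<Phi> S) \<in> carrier_mat k1 k1" by (simp add: ul_def)
    \<comment> \<open>The upper left block of q(S) is q of the upper left block of S. It vanishes
      because q(S) kills the first k1 basis vectors.\<close>
    have zero: "poly_mat q (ul (\<Phi> S)) = 0\<^sub>m k1 k1"
    proof -
      have "\<Phi> ?C = poly_mat q (\<Phi> S)" by (rule poly_mat_matrix_hom[OF S \<Phi>c \<Phi>m \<Phi>a \<Phi>s \<Phi>1])
      also have "\<dots> = poly_mat q (four_block_mat (ul (\<Phi> S)) (ur (\<Phi> S)) (0\<^sub>m k2 k1) (lr (\<Phi> S)))"
        using fb[OF S SC] by simp
      finally obtain E where E: "E \<in> carrier_mat k1 k2"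
        "\<Phi> ?C = four_block_mat (poly_mat q (ul (\<Phi> S))) E (0\<^sub>m k2 k1) (poly_mat q (lr (\<Phi> S)))"
        using poly_mat_four_block[of "ul (\<Phi> S)" k1 "ur (\<Phi> S)" k2 "lr (\<Phi> S)" q]
        by (auto simp: ul_def ur_def lr_def)
      show ?thesis
      proof (rule eq_matI)
        fix i j assume "i < dim_row (0\<^sub>m k1 k1 :: 'f mat)" "j < dim_col (0\<^sub>m k1 k1 :: 'f mat)"
        then have ij: "i < k1" "j < k1" by auto
        have "\<Phi> ?C $$ (i, j) = poly_mat q (ul (\<Phi> S)) $$ (i, j)"
          unfolding E(2) using ij by (subst index_mat_four_block) (auto simp: ul_def lr_def)
        then show "poly_mat q (ul (\<Phi> S)) $$ (i, j) = 0\<^sub>m k1 k1 $$ (i, j)" using ker[of i j] ij k by simp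
      qed (auto simp: ul_def)
    qed
    obtain i where i: "char_poly (ul (\<Phi> S)) = q ^ i" using char_poly_annihilated[OF ulc q(1,3) zero] .
    have deg1: "i * Polynomial.degree q = k1"
      using degree_monic_char_poly[OF ulc] q(1) unfolding i by (auto simp: degree_power_eq)
    have "k2 < k" using k by simp
    from less.IH[OF this b12(2)] obtain j2 where j2: "pmult p (char_poly (lr (\<Phi> S))) j2"
      "d * d dvd Polynomial.degree p * j2" "d * d dvd cap p * j2" by blast
    \<comment> \<open>For q = p the kernel has dimension k1 = i deg p. It is a \<Delta>-module, so
      d^2 divides deg p * i; it is annihilated by p(S), so d^2 deg p divides cap p * i * deg p, and
      deg p cancels. For q \<noteq> p the multiplicity is 0.\<close>
    have "\<exists>j1. pmult p (q ^ i) j1 \<and> d * d dvd Polynomial.degree p * j1 \<and> d * d dvd cap p * j1"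
    proof (cases "q = p")
      case True
      have "antirep D k1 (\<lambda>a. ul (\<Phi> (\<sigma> a)))" using b12(1) by (simp add: bimod_def)
      then have "d * d dvd 1 * k1" using antirep_dim[OF D.falg_axioms _ mu_one basis] by blast
      then have 1: "d * d dvd Polynomial.degree p * i" using deg1 True by (simp add: mult.commute)
      have "d * d * Polynomial.degree p dvd cap p * (i * Polynomial.degree p)"
        using bimod_annihilated[OF p b12(1)] zero deg1 True by simp
      then have "Polynomial.degree p * (d * d) dvd Polynomial.degree p * (cap p * i)" by (simp only: ac_simps)
      then have "d * d dvd cap p * i" using irreducible_degree_pos[OF p(1)] by simp
      then show ?thesis using 1 pmult_self_power[OF p(1)] True by blast
    next
      case False
      then show ?thesis using pmult_other[OF p(1) q(1) p(2) q(3)] by (intro exI[of _ 0]) simp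
    qed
    then obtain j1 where j1: "pmult p (q ^ i) j1" "d * d dvd Polynomial.degree p * j1" "d * d dvd cap p * j1" by blast
    have "pmult p (char_poly S) (j1 + j2)" unfolding chi i by (rule pmult_mult[OF p(1) j1(1) j2(1)])
    then show ?thesis using j1 j2 by (intro exI[of _ "j1 + j2"]) (simp add: distrib_left)
  qed
qed

text \<open>The module is the right ideal e (\<Delta> \<otimes> F[t]/(p)), on which S is
  multiplication by the class of t and \<Delta> acts through the first factor. Its dimension is N /
  cap p with N = d^2 deg p. Since p(S) = 0, the characteristic polynomial is p^i with i deg p equal
  to this dimension, that is, cap p * i = d^2.\<close>

theorem bimod_exists_irreducible:
  assumes "Factorial_Ring.irreducible p" "lead_coeff p = 1"
  obtains k S \<sigma> i where "bimod D k S \<sigma>" "char_poly S = p ^ i" "cap p * i = d * d"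
proof -
  interpret p: adjoin p by unfold_locales fact+
  interpret t: tensor D "adjoin_root p" by (rule tensor_adjoin[OF p.adjoin_axioms])
  interpret TF: falg t.TF by (rule t.TF_falg)
  obtain e f c where mu: "mu_system t.TF (cap p) e f c"
    using t.T_mu_system[OF simple central basis p.L_field p.L_fbasis] .
  interpret mu: mu_system t.TF "cap p" e f c by fact
  note bas = t.TF_fbasis[OF basis p.L_fbasis]
  obtain \<delta> z where z: "fbasis (corner t.TF e) \<delta> z" using TF.corner_ex_fbasis[OF bas mu.e_closed] .
  have N: "d * d * Polynomial.degree p = cap p * cap p * \<delta>"
    by (rule TF.fbasis_unique[OF bas TF.mu_system_basis[OF mu z]])
  let ?V = "right_ideal t.TF e"
  define k where "k = cap p * \<delta>"
  obtain b where b: "fbasis ?V k b" using TF.mu_system_right_ideal_basis[OF mu z] by (auto simp: k_def)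
  interpret R: rmod t.TF ?V "\<lambda>v x. v \<otimes>\<^bsub>t.TF\<^esub> x" by (rule TF.rmod_right_ideal[OF mu.e_closed])
  let ?pt = "pure_tensor class_ring D p.L"
  let ?X = "p.cls [:0, 1:]"
  define S where "S = mat_of ?V k b (\<lambda>v. v \<otimes>\<^bsub>t.TF\<^esub> ?pt \<one>\<^bsub>D\<^esub> ?X)"
  define \<sigma> where "\<sigma> a = mat_of ?V k b (\<lambda>v. v \<otimes>\<^bsub>t.TF\<^esub> ?pt a \<one>\<^bsub>p.L\<^esub>)" for a
  have ptc: "?pt a l \<in> carrier t.TF" if "a \<in> carrier D" "l \<in> carrier p.L" for a l using that by simp
  have lin: "linmap ?V ?V (\<lambda>v. v \<otimes>\<^bsub>t.TF\<^esub> x)" if "x \<in> carrier t.TF" for x by (rule R.act_linmap[OF that])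
  have vT: "v \<in> carrier t.T" if "v \<in> carrier ?V" for v using that by simp
  have s: "antirep D k \<sigma>"
    unfolding \<sigma>_def
  proof (rule antirep_mat_of[OF D.falg_axioms R.V.fvs_axioms b])
    fix a assume a: "a \<in> carrier D"
    show "linmap ?V ?V (\<lambda>v. v \<otimes>\<^bsub>t.TF\<^esub> ?pt a \<one>\<^bsub>p.L\<^esub>)" by (rule lin[OF ptc]) (use a in auto)
  next
    fix v x x' assume v: "v \<in> carrier ?V" and x: "x \<in> carrier D" and x': "x' \<in> carrier D"
    show "v \<otimes>\<^bsub>t.TF\<^esub> ?pt (x \<oplus>\<^bsub>D\<^esub> x') \<one>\<^bsub>p.L\<^esub> = v \<otimes>\<^bsub>t.TF\<^esub> ?pt x \<one>\<^bsub>p.L\<^esub> \<oplus>\<^bsub>?V\<^esub> v \<otimes>\<^bsub>t.TF\<^esub> ?pt x' \<one>\<^bsub>p.L\<^esub>"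
      using vT[OF v] x x' by (simp add: t.pure_add_left t.T.r_distr)
    show "v \<otimes>\<^bsub>t.TF\<^esub> ?pt (x \<otimes>\<^bsub>D\<^esub> x') \<one>\<^bsub>p.L\<^esub> = (v \<otimes>\<^bsub>t.TF\<^esub> ?pt x \<one>\<^bsub>p.L\<^esub>) \<otimes>\<^bsub>t.TF\<^esub> ?pt x' \<one>\<^bsub>p.L\<^esub>"
      using vT[OF v] x x' by (simp add: t.pure_mult t.T.m_assoc)
  next
    fix v x l assume v: "v \<in> carrier ?V" and x: "x \<in> carrier D"
    have "?pt (l \<odot>\<^bsub>D\<^esub> x) \<one>\<^bsub>p.L\<^esub> = l \<odot>\<^bsub>t.TF\<^esub> ?pt x \<one>\<^bsub>p.L\<^esub>"
      using x t.TF_smult_pure[OF x, of "\<one>\<^bsub>p.L\<^esub>" l] t.pure_sc[OF x, of "\<one>\<^bsub>p.L\<^esub>" l] by simp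
    then show "v \<otimes>\<^bsub>t.TF\<^esub> ?pt (l \<odot>\<^bsub>D\<^esub> x) \<one>\<^bsub>p.L\<^esub> = l \<odot>\<^bsub>?V\<^esub> (v \<otimes>\<^bsub>t.TF\<^esub> ?pt x \<one>\<^bsub>p.L\<^esub>)"
      using R.act_sc_right[OF v ptc[OF x p.L.A.one_closed], of l] by simp
  next
    fix v assume v: "v \<in> carrier ?V"
    show "v \<otimes>\<^bsub>t.TF\<^esub> ?pt \<one>\<^bsub>D\<^esub> \<one>\<^bsub>p.L\<^esub> = v" using vT[OF v] t.pure_one by simp
  qed
  have bim: "bimod D k S \<sigma>"
    unfolding bimod_def
  proof (intro conjI ballI s)
    show "S \<in> carrier_mat k k" by (simp add: S_def)
    fix a assume a: "a \<in> carrier D"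
    have bc: "\<And>i. i < k \<Longrightarrow> b i \<in> carrier ?V" using R.V.fbasisD(2)[OF b] .
    have 1: "\<sigma> a * S = mat_of ?V k b (\<lambda>v. (v \<otimes>\<^bsub>t.TF\<^esub> ?pt \<one>\<^bsub>D\<^esub> ?X) \<otimes>\<^bsub>t.TF\<^esub> ?pt a \<one>\<^bsub>p.L\<^esub>)"
      unfolding \<sigma>_def S_def by (rule R.V.mat_of_comp[OF b lin lin, symmetric]) (use a in auto)
    have 2: "S * \<sigma> a = mat_of ?V k b (\<lambda>v. (v \<otimes>\<^bsub>t.TF\<^esub> ?pt a \<one>\<^bsub>p.L\<^esub>) \<otimes>\<^bsub>t.TF\<^esub> ?pt \<one>\<^bsub>D\<^esub> ?X)"
      unfolding \<sigma>_def S_def by (rule R.V.mat_of_comp[OF b lin lin, symmetric]) (use a in auto)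
    show "\<sigma> a * S = S * \<sigma> a" unfolding 1 2 mat_of_def
      by (rule cong_mat) (use a vT[OF bc] in \<open>auto simp: t.T.m_assoc t.pure_mult\<close>)
  qed
  \<comment> \<open>For each polynomial q, the matrix q(S) describes right multiplication by 1
    \<otimes> q, because the class of q satisfies the Horner recursion. For q = p this class is
    zero.\<close>
  have "poly_mat p S = mat_of ?V k b (\<lambda>v. v \<otimes>\<^bsub>t.TF\<^esub> ?pt \<one>\<^bsub>D\<^esub> (p.cls p))"
    unfolding S_def
  proof (rule R.V.poly_mat_mat_of[OF b, where G = "\<lambda>q v. v \<otimes>\<^bsub>t.TF\<^esub> ?pt \<one>\<^bsub>D\<^esub> (p.cls q)"])
    show "linmap ?V ?V (\<lambda>v. v \<otimes>\<^bsub>t.TF\<^esub> ?pt \<one>\<^bsub>D\<^esub> ?X)" "\<And>q. linmap ?V ?V (\<lambda>v. v \<otimes>\<^bsub>t.TF\<^esub> ?pt \<one>\<^bsub>D\<^esub> (p.cls q))"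
      by (rule lin[OF ptc]; simp)+
    fix v assume v: "v \<in> carrier ?V"
    show "v \<otimes>\<^bsub>t.TF\<^esub> ?pt \<one>\<^bsub>D\<^esub> (p.cls 0) = \<zero>\<^bsub>?V\<^esub>" using vT[OF v] by (simp add: p.cls_zero[symmetric])
    fix a q
    have "p.cls (pCons a q) = a \<odot>\<^bsub>p.L\<^esub> p.cls 1 \<oplus>\<^bsub>p.L\<^esub> p.cls q \<otimes>\<^bsub>p.L\<^esub> ?X"
      by (simp add: p.cls_smult p.cls_mult p.cls_add)
    then have "?pt \<one>\<^bsub>D\<^esub> (p.cls (pCons a q)) = a \<odot>\<^bsub>t.TF\<^esub> \<one>\<^bsub>t.TF\<^esub> \<oplus>\<^bsub>t.TF\<^esub> ?pt \<one>\<^bsub>D\<^esub> (p.cls q) \<otimes>\<^bsub>t.TF\<^esub> ?pt \<one>\<^bsub>D\<^esub> ?X"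
      using t.TF_smult_pure[of "\<one>\<^bsub>D\<^esub>" "p.cls 1" a] t.pure_one
      by (simp add: t.pure_add_right t.pure_mult p.cls_one[symmetric])
    then have "v \<otimes>\<^bsub>t.TF\<^esub> ?pt \<one>\<^bsub>D\<^esub> (p.cls (pCons a q)) =
      v \<otimes>\<^bsub>t.TF\<^esub> (a \<odot>\<^bsub>t.TF\<^esub> \<one>\<^bsub>t.TF\<^esub>) \<oplus>\<^bsub>t.TF\<^esub> v \<otimes>\<^bsub>t.TF\<^esub> (?pt \<one>\<^bsub>D\<^esub> (p.cls q) \<otimes>\<^bsub>t.TF\<^esub> ?pt \<one>\<^bsub>D\<^esub> ?X)"
      using vT[OF v] by (simp add: t.T.r_distr)
    also have "v \<otimes>\<^bsub>t.TF\<^esub> (a \<odot>\<^bsub>t.TF\<^esub> \<one>\<^bsub>t.TF\<^esub>) = a \<odot>\<^bsub>t.TF\<^esub> v"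
      using TF.sc_r[of v "\<one>\<^bsub>t.TF\<^esub>" a] vT[OF v] by simp
    finally show "v \<otimes>\<^bsub>t.TF\<^esub> ?pt \<one>\<^bsub>D\<^esub> (p.cls (pCons a q)) =
      a \<odot>\<^bsub>?V\<^esub> v \<oplus>\<^bsub>?V\<^esub> (v \<otimes>\<^bsub>t.TF\<^esub> ?pt \<one>\<^bsub>D\<^esub> (p.cls q)) \<otimes>\<^bsub>t.TF\<^esub> ?pt \<one>\<^bsub>D\<^esub> ?X"
      using vT[OF v] by (simp add: t.T.m_assoc)
  qed
  also have "\<dots> = 0\<^sub>m k k"
  proof (rule R.V.mat_of_zero[OF b])
    fix v assume v: "v \<in> carrier ?V"
    have "p.cls p = \<zero>\<^bsub>p.L\<^esub>" by (simp add: p.cls_eq_zero_iff)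
    then show "v \<otimes>\<^bsub>t.TF\<^esub> ?pt \<one>\<^bsub>D\<^esub> (p.cls p) = \<zero>\<^bsub>?V\<^esub>" using vT[OF v] by simp
  qed
  finally have zero: "poly_mat p S = 0\<^sub>m k k" .
  have Sc: "S \<in> carrier_mat k k" by (simp add: S_def)
  obtain i where i: "char_poly S = p ^ i" using char_poly_annihilated[OF Sc assms zero] .
  have "i * Polynomial.degree p = k"
    using degree_monic_char_poly[OF Sc] assms(1) unfolding i by (auto simp: degree_power_eq)
  \<comment> \<open>Combines k = cap p * \<delta> with the two values d^2 deg p and (cap p)^2
    \<delta> of the dimension of the algebra.\<close>
  then have "Polynomial.degree p * (cap p * i) = Polynomial.degree p * (d * d)"
    using N by (simp add: k_def ac_simps)
  then have "cap p * i = d * d" using irreducible_degree_pos[OF assms(1)] by simp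
  with bim i that show ?thesis by blast
qed

lemma bimod_zero: "bimod D 0 (1\<^sub>m 0) (\<lambda>_. 1\<^sub>m 0)"
  unfolding bimod_def antirep_def by (auto intro!: eq_matI)

lemma bimod_mult:
  assumes "bimod D k1 S1 \<sigma>1" "bimod D k2 S2 \<sigma>2"
  shows "\<exists>k S \<sigma>. bimod D k S \<sigma> \<and> char_poly S = char_poly S1 * char_poly S2"
proof -
  have "S1 \<in> carrier_mat k1 k1" "S2 \<in> carrier_mat k2 k2" using assms by (auto simp: bimod_def)
  from char_poly_four_block[OF this(1) zero_carrier_mat this(2)] show ?thesis
    using bimod_direct_sum[OF D.falg_axioms assms] by blast
qed

lemma char_poly_one_mat_0: "char_poly (1\<^sub>m 0 :: 'f mat) = 1"
  using degree_monic_char_poly[of "1\<^sub>m 0 :: 'f mat" 0] by (metis degree_0_id one_carrier_mat one_pCons)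

lemma bimod_power:
  assumes "bimod D k S \<sigma>"
  shows "\<exists>k S' \<sigma>. bimod D k S' \<sigma> \<and> char_poly S' = char_poly S ^ t"
proof (induction t)
  case 0
  then show ?case using bimod_zero char_poly_one_mat_0 by auto
next
  case (Suc t)
  then show ?case using bimod_mult[OF assms] by (metis power_Suc)
qed

text \<open>The module for one irreducible p contributes the exponent j with cap p * j = d^2. The
  divisibility hypothesis makes the required exponent a multiple j t, so t copies are added up, and
  then the sums for all p_i. In the application the exponents \<open>a i\<close> are those of
  f^d.\<close>

theorem bimod_exists:
  assumes "\<And>i. i \<in> I \<Longrightarrow> Factorial_Ring.irreducible (p i)" "\<And>i. i \<in> I \<Longrightarrow> lead_coeff (p i) = 1"
    "\<And>i. i \<in> I \<Longrightarrow> d * d dvd cap (p i) * a i" "finite I"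
  shows "\<exists>k S \<sigma>. bimod D k S \<sigma> \<and> char_poly S = (\<Prod>i\<in>I. p i ^ a i)"
  using assms(4,1-3)
proof (induction I)
  case empty
  then show ?case using bimod_zero char_poly_one_mat_0 by auto
next
  case (insert i I)
  have "\<exists>k S \<sigma>. bimod D k S \<sigma> \<and> char_poly S = (\<Prod>i\<in>I. p i ^ a i)"
    by (rule insert.IH) (use insert.prems in auto)
  then obtain k S \<sigma> where 1: "bimod D k S \<sigma>" "char_poly S = (\<Prod>i\<in>I. p i ^ a i)" by blast
  obtain k0 S0 \<sigma>0 j where 2: "bimod D k0 S0 \<sigma>0" "char_poly S0 = p i ^ j" "cap (p i) * j = d * d"
    using bimod_exists_irreducible[OF insert.prems(1)[OF insertI1] insert.prems(2)[OF insertI1]] .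
  obtain t where "cap (p i) * a i = d * d * t" using insert.prems(3)[of i] by auto
  then have "cap (p i) * a i = cap (p i) * (j * t)" using 2(3) by (simp add: ac_simps)
  \<comment> \<open>Allows cap to be cancelled; it is nonzero as a divisor of d^2 > 0.\<close>
  moreover have "cap (p i) \<noteq> 0" using 2(3) d_pos by (metis mult_0 nat_0_less_mult_iff less_irrefl)
  ultimately have "a i = j * t" by simp
  moreover obtain k1 S1 \<sigma>1 where 3: "bimod D k1 S1 \<sigma>1" "char_poly S1 = char_poly S0 ^ t"
    using bimod_power[OF 2(1)] by blast
  ultimately have "char_poly S1 = p i ^ a i" using 2(2) by (simp add: power_mult)
  then show ?case using bimod_mult[OF 3(1) 1(1)] 1(2) insert.hyps by simp
qed

end

subsection \<open>Block matrices\<close>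

definition block_diag :: "nat \<Rightarrow> nat \<Rightarrow> 'a :: zero mat \<Rightarrow> 'a mat" where
  "block_diag q k M = mat (q * k) (q * k) (\<lambda>(i, j). if i div k = j div k then M $$ (i mod k, j mod k) else 0)"

lemma char_poly_block_diag:
  fixes M :: "'a :: field mat"
  assumes M: "M \<in> carrier_mat k k"
  shows "char_poly (block_diag q k M) = char_poly M ^ q"
proof (induction q)
  case 0
  have "block_diag 0 k M \<in> carrier_mat 0 0" by (simp add: block_diag_def)
  from degree_monic_char_poly[OF this] have "char_poly (block_diag 0 k M) = 1" by (metis degree_0_id one_pCons)
  then show ?case by simp
next
  case (Suc q)
  have hi: "h div k = q" "h mod k = h - q * k" if h: "\<not> h < q * k" "h < q * k + k" for h
  proof -
    obtain t where "h = q * k + t" using h(1) le_Suc_ex[of "q * k" h] by (auto simp: not_less)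
    moreover from this have "t < k" using h(2) by simp
    ultimately show "h div k = q" "h mod k = h - q * k" by simp_all
  qed
  have lo: "h div k < q" if "h < q * k" for h using that by (simp add: less_mult_imp_div_less)
  have "block_diag (Suc q) k M = four_block_mat (block_diag q k M) (0\<^sub>m (q * k) k) (0\<^sub>m k (q * k)) M"
    (is "_ = ?R")
  proof (rule eq_matI)
    fix i j assume "i < dim_row ?R" "j < dim_col ?R"
    then have ij: "i < q * k + k" "j < q * k + k" using M by (auto simp: block_diag_def)
    have L: "block_diag (Suc q) k M $$ (i, j) = (if i div k = j div k then M $$ (i mod k, j mod k) else 0)"
      using ij by (simp add: block_diag_def add.commute)
    have R: "?R $$ (i, j) = (if i < q * k then if j < q * k then block_diag q k M $$ (i, j) else 0
      else if j < q * k then 0 else M $$ (i - q * k, j - q * k))"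
      using ij M by (subst index_mat_four_block) (auto simp: block_diag_def)
    show "block_diag (Suc q) k M $$ (i, j) = ?R $$ (i, j)"
    proof (cases "i < q * k")
      case i: True
      show ?thesis
      proof (cases "j < q * k")
        case True
        then show ?thesis unfolding L R using i by (simp add: block_diag_def)
      next
        case False
        then show ?thesis unfolding L R using i lo[OF i] hi(1)[OF False ij(2)] by simp
      qed
    next
      case i: False
      show ?thesis
      proof (cases "j < q * k")
        case True
        then show ?thesis unfolding L R using i lo[OF True] hi(1)[OF i ij(1)] by simp
      next
        case False
        then show ?thesis unfolding L R using i hi[OF False ij(2)] hi[OF i ij(1)] by simp
      qed
    qed
  qed (use M in \<open>auto simp: block_diag_def\<close>)
  also have "char_poly \<dots> = char_poly (block_diag q k M) * char_poly M"
    by (rule char_poly_four_block) (use M in \<open>auto simp: block_diag_def\<close>)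
  finally show ?case using Suc.IH by (simp add: mult.commute)
qed

lemma index_mult_add_less: "i < q \<Longrightarrow> h < k \<Longrightarrow> i * k + h < q * (k :: nat)"
proof -
  assume "i < q" "h < k"
  then have "i * k + h < Suc i * k" by simp
  also have "\<dots> \<le> q * k" using \<open>i < q\<close> by (intro mult_right_mono) auto
  finally show ?thesis .
qed

text \<open>In this basis the map has \<open>M\<close> repeated \<open>q\<close> times along the
  diagonal. It is applied twice to left multiplication, which treats all columns alike: once with
  the standard matrix units and once with the image of the basis \<open>mb\<close>.\<close>

lemma (in fvs) char_poly_mat_of_repeat:
  assumes b: "fbasis V (q * k) b" and M: "M \<in> carrier_mat k k"
    and g: "\<And>s j. s < q \<Longrightarrow> j < k \<Longrightarrow> g (b (s * k + j)) = lc V k (\<lambda>i. b (s * k + i)) (\<lambda>i. M $$ (i, j))"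
  shows "char_poly (mat_of V (q * k) b g) = char_poly M ^ q"
proof -
  note bc = fbasisD(2)[OF b]
  have "mat_of V (q * k) b g = block_diag q k M"
  proof (rule mat_ofI[OF b])
    show "block_diag q k M \<in> carrier_mat (q * k) (q * k)" by (simp add: block_diag_def)
    fix x assume x: "x < q * k"
    define s j where "s = x div k" and "j = x mod k"
    have k: "0 < k" using x by (cases k) auto
    have sj: "s < q" "j < k" "x = s * k + j"
      using x k by (auto simp: s_def j_def less_mult_imp_div_less)
    let ?c = "\<lambda>i. block_diag q k M $$ (i, x)"
    have c: "?c (i * k + h) = (if i = s then M $$ (h, j) else 0)" if "i < q" "h < k" for i h
      using index_mult_add_less[OF that] that x by (simp add: block_diag_def s_def j_def)
    have bc': "b (i * k + h) \<in> carrier V" if "i < q" "h < k" for i h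
      using bc[OF index_mult_add_less[OF that]] .
    have "lc V (q * k) b ?c = (\<Oplus>\<^bsub>V\<^esub>i\<in>{..<q}. \<Oplus>\<^bsub>V\<^esub>h\<in>{..<k}. ?c (i * k + h) \<odot>\<^bsub>V\<^esub> b (i * k + h))"
      unfolding lc_def by (rule M.finsum_lessThan_mult) (use bc in auto)
    also have "\<dots> = (\<Oplus>\<^bsub>V\<^esub>h\<in>{..<k}. ?c (s * k + h) \<odot>\<^bsub>V\<^esub> b (s * k + h))"
    proof (rule M.finsum_eq_single[OF sj(1)])
      show "(\<Oplus>\<^bsub>V\<^esub>h\<in>{..<k}. ?c (i * k + h) \<odot>\<^bsub>V\<^esub> b (i * k + h)) \<in> carrier V" if "i < q" for i
        using bc'[OF that] by (intro M.finsum_closed) auto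
      show "(\<Oplus>\<^bsub>V\<^esub>h\<in>{..<k}. ?c (i * k + h) \<odot>\<^bsub>V\<^esub> b (i * k + h)) = \<zero>\<^bsub>V\<^esub>" if "i < q" "i \<noteq> s" for i
        using bc'[OF that(1)] c[OF that(1)] that(2) by (intro M.finsum_eq_zero) simp
    qed
    also have "\<dots> = lc V k (\<lambda>i. b (s * k + i)) (\<lambda>i. M $$ (i, j))"
      unfolding lc_def by (rule M.finsum_cong') (use bc'[OF sj(1)] c[OF sj(1)] in auto)
    finally show "g (b x) = lc V (q * k) b ?c" using g[OF sj(1,2)] sj(3) by simp
  qed
  then show ?thesis using char_poly_block_diag[OF M] by simp
qed

section \<open>Left multiplication on square matrices\<close>

lemma fvs_mat: "fvs (module_mat TYPE('k :: field) n m)"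
  unfolding fvs_def by (rule matrix_vs)

lemma lc_mat:
  fixes c :: "nat \<Rightarrow> 'k :: field"
  assumes "\<And>j. j < t \<Longrightarrow> b j \<in> carrier_mat n m"
  shows "lc (module_mat TYPE('k) n m) t b c = mat n m (\<lambda>rs. \<Sum>j<t. c j * b j $$ rs)"
proof -
  interpret V: fvs "module_mat TYPE('k) n m" by (rule fvs_mat)
  show ?thesis using assms
  proof (induction t)
    case 0
    then show ?case by (auto simp: module_mat_simps intro!: eq_matI)
  next
    case (Suc t)
    have bt: "b t \<in> carrier_mat n m" using Suc.prems by simp
    have "lc (module_mat TYPE('k) n m) (Suc t) b c = lc (module_mat TYPE('k) n m) t b c + c t \<cdot>\<^sub>m b t"
      using V.lc_Suc[of t b c] Suc.prems by (simp add: module_mat_simps)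
    also have "\<dots> = mat n m (\<lambda>rs. \<Sum>j<t. c j * b j $$ rs) + c t \<cdot>\<^sub>m b t"
      using Suc.IH Suc.prems by simp
    also have "\<dots> = mat n m (\<lambda>rs. \<Sum>j<Suc t. c j * b j $$ rs)"
      by (rule eq_matI) (use bt in auto)
    finally show ?case .
  qed
qed

text \<open>The matrix units numbered column by column: t * N + r is the number of E_rt. Left
  multiplication then acts in the same way on each block of N consecutive units.\<close>

definition std_mat :: "nat \<Rightarrow> nat \<Rightarrow> 'k :: zero_neq_one mat" where
  "std_mat N x = mat N N (\<lambda>(r, t). if r = x mod N \<and> t = x div N then 1 else 0)"

lemma std_mat_carrier [simp]: "std_mat N x \<in> carrier_mat N N"
  "dim_row (std_mat N x) = N" "dim_col (std_mat N x) = N"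
  by (simp_all add: std_mat_def)

lemma lc_std_mat:
  fixes c :: "nat \<Rightarrow> 'k :: field"
  shows "lc (module_mat TYPE('k) N N) (N * N) (std_mat N) c = mat N N (\<lambda>(r, t). c (t * N + r))"
proof -
  have "(\<Sum>x<N * N. c x * std_mat N x $$ (r, t)) = c (t * N + r)" if rt: "r < N" "t < N" for r t
  proof -
    have "r = x mod N \<and> t = x div N \<longleftrightarrow> x = t * N + r" for x using rt by auto
    then have "(\<Sum>x<N * N. c x * std_mat N x $$ (r, t)) = (\<Sum>x<N * N. if x = t * N + r then c x else 0)"
      using rt by (intro sum.cong) (auto simp: std_mat_def)
    then show ?thesis using index_mult_add_less[OF rt(2,1)] by simp
  qed
  then show ?thesis by (subst lc_mat) (auto intro!: eq_matI)
qed

lemma fbasis_std_mat: "fbasis (module_mat TYPE('k :: field) N N) (N * N) (std_mat N)"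
proof -
  have "c i = 0" if z: "mat N N (\<lambda>(r, t). c (t * N + r)) = 0\<^sub>m N N" and i: "i < N * N" for c :: "nat \<Rightarrow> 'k" and i
  proof -
    have N: "0 < N" using i by (cases N) auto
    have "mat N N (\<lambda>(r, t). c (t * N + r)) $$ (i mod N, i div N) = c i"
      using i N by (simp add: less_mult_imp_div_less)
    then show ?thesis using i N unfolding z by (simp add: less_mult_imp_div_less)
  qed
  moreover have "\<exists>c. M = mat N N (\<lambda>(r, t). c (t * N + r))" if M: "M \<in> carrier_mat N N" for M :: "'k mat"
    by (rule exI[of _ "\<lambda>x. M $$ (x mod N, x div N)"], rule eq_matI) (use M in auto)
  ultimately show ?thesis
    unfolding fbasis_def indep_def lc_std_mat by (auto simp: module_mat_simps)
qed

lemma char_poly_left_mult: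
  fixes M :: "'k :: field mat"
  assumes M: "M \<in> carrier_mat N N"
  shows "char_poly (mat_of (module_mat TYPE('k) N N) (N * N) (std_mat N) (\<lambda>v. M * v)) = char_poly M ^ N"
proof -
  interpret V: fvs "module_mat TYPE('k) N N" by (rule fvs_mat)
  show ?thesis
  proof (rule V.char_poly_mat_of_repeat[OF fbasis_std_mat M])
    fix s j assume sj: "s < N" "j < N"
    have *: "lc (module_mat TYPE('k) N N) N (\<lambda>i. std_mat N (s * N + i)) (\<lambda>i. M $$ (i, j)) =
      mat N N (\<lambda>rs. \<Sum>i<N. M $$ (i, j) * std_mat N (s * N + i) $$ rs)"
      by (rule lc_mat) simp
    show "M * std_mat N (s * N + j) = lc (module_mat TYPE('k) N N) N (\<lambda>i. std_mat N (s * N + i)) (\<lambda>i. M $$ (i, j))"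
      unfolding *
    proof (rule eq_matI)
      fix r t assume "r < dim_row (mat N N (\<lambda>rs. \<Sum>i<N. M $$ (i, j) * std_mat N (s * N + i) $$ rs))"
        "t < dim_col (mat N N (\<lambda>rs. \<Sum>i<N. M $$ (i, j) * std_mat N (s * N + i) $$ rs))"
      then have rt: "r < N" "t < N" by auto
      have "(M * std_mat N (s * N + j)) $$ (r, t) = (\<Sum>h<N. M $$ (r, h) * std_mat N (s * N + j) $$ (h, t))"
        using rt M by (auto simp: scalar_prod_def lessThan_atLeast0 intro!: sum.cong)
      also have "\<dots> = (\<Sum>h<N. if h = j then if t = s then M $$ (r, h) else 0 else 0)"
        by (rule sum.cong) (use rt sj in \<open>auto simp: std_mat_def\<close>)
      also have "\<dots> = (if t = s then M $$ (r, j) else 0)" using sj by simp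
      also have "\<dots> = (\<Sum>i<N. if i = r then if t = s then M $$ (i, j) else 0 else 0)" using rt by simp
      also have "\<dots> = (\<Sum>i<N. M $$ (i, j) * std_mat N (s * N + i) $$ (r, t))"
        by (rule sum.cong) (use rt sj in \<open>auto simp: std_mat_def\<close>)
      finally show "(M * std_mat N (s * N + j)) $$ (r, t) =
        mat N N (\<lambda>rs. \<Sum>i<N. M $$ (i, j) * std_mat N (s * N + i) $$ rs) $$ (r, t)" using rt by simp
    qed (use M in \<open>auto simp: std_mat_def\<close>)
  qed
qed

lemma fbasis_image:
  assumes "fvs V" "fvs W" "linmap V W g" "bij_betw g (carrier V) (carrier W)" "fbasis V n b"
  shows "fbasis W n (\<lambda>i. g (b i))"
proof -
  interpret V: fvs V by fact
  interpret W: fvs W by fact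
  have bc: "\<And>i. i < n \<Longrightarrow> b i \<in> carrier V" using V.fbasisD(2)[OF assms(5)] .
  note lc = linmap_lc[OF assms(1-3) bc, symmetric]
  have "c i = 0" if 0: "lc W n (\<lambda>i. g (b i)) c = \<zero>\<^bsub>W\<^esub>" and i: "i < n" for c i
  proof -
    have "g (lc V n b c) = g \<zero>\<^bsub>V\<^esub>" using 0 lc linmap_zero[OF assms(1-3)] by simp
    then have "lc V n b c = \<zero>\<^bsub>V\<^esub>"
      using inj_onD[OF bij_betw_imp_inj_on[OF assms(4)]] V.lc_closed[OF bc] V.M.zero_closed by simp
    then show ?thesis by (rule V.indepD(2)[OF V.fbasisD(1)[OF assms(5)] _ i])
  qed
  moreover have "\<exists>c. w = lc W n (\<lambda>i. g (b i)) c" if w: "w \<in> carrier W" for w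
  proof -
    obtain v where v: "v \<in> carrier V" "w = g v" using assms(4) w unfolding bij_betw_def by blast
    then obtain c where "v = lc V n b c" using assms(5) unfolding fbasis_def by blast
    then have "w = lc W n (\<lambda>i. g (b i)) c" using v(2) lc by simp
    then show ?thesis by blast
  qed
  ultimately show ?thesis using bc linmapD(1)[OF assms(3)] by (simp add: fbasis_def indep_def)
qed

subsection \<open>Splitting over an algebraically closed field\<close>

text \<open>Left multiplication by an element x of the corner has an eigenvalue l, so x u = l u for
  some nonzero u in the corner. As u is invertible there, x = l e.\<close>

lemma alg_closed_corner:
  fixes B :: "('k :: alg_closed_field, 'b) module"
  assumes "falg B" "mu_system B m e f c" "fbasis B N b"
  shows "fbasis (corner B e) 1 (\<lambda>_. e)"
proof -
  interpret B: falg B by fact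
  interpret mu: mu_system B m e f c by fact
  interpret C: fvs "corner B e" by (rule B.corner_fvs[OF mu.e_closed])
  obtain \<delta> w where w: "fbasis (corner B e) \<delta> w" using B.corner_ex_fbasis[OF assms(3) mu.e_closed] .
  have eC: "e \<in> carrier (corner B e)" by simp
  have \<delta>: "0 < \<delta>"
  proof (rule ccontr)
    assume "\<not> 0 < \<delta>"
    then have "\<exists>c. e = lc (corner B e) 0 w c" using w eC unfolding fbasis_def by simp
    then show False using mu.e_nonzero by simp
  qed
  have scal: "\<exists>l. x = l \<odot>\<^bsub>B\<^esub> e" if x: "x \<in> carrier (corner B e)" for x
  proof -
    have xB: "x \<in> carrier B" "e \<otimes>\<^bsub>B\<^esub> x \<otimes>\<^bsub>B\<^esub> e = x" using x by auto
    have lin: "linmap (corner B e) (corner B e) (\<lambda>v. x \<otimes>\<^bsub>B\<^esub> v)"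
      unfolding linmap_def using xB mu.corner_mult[OF xB] by (simp add: B.A.r_distr B.sc_r)
    define M where "M = mat_of (corner B e) \<delta> w (\<lambda>v. x \<otimes>\<^bsub>B\<^esub> v)"
    have M: "M \<in> carrier_mat \<delta> \<delta>" by (simp add: M_def)
    obtain l where "poly (char_poly M) l = 0"
      using alg_closed_imp_poly_has_root[of "char_poly M"] degree_monic_char_poly[OF M] \<delta> by auto
    then have "eigenvalue M l" using eigenvalue_root_char_poly[OF M] by simp
    then obtain v where v: "v \<in> carrier_vec \<delta>" "v \<noteq> 0\<^sub>v \<delta>" "M *\<^sub>v v = l \<cdot>\<^sub>v v"
      using M unfolding eigenvalue_def eigenvector_def by auto
    note wc = C.fbasisD(2)[OF w]
    define u where "u = lc (corner B e) \<delta> w (\<lambda>i. vec_index v i)"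
    have uC: "u \<in> carrier (corner B e)" unfolding u_def by (rule C.lc_closed[OF wc])
    have u0: "u \<noteq> \<zero>\<^bsub>B\<^esub>"
    proof
      assume "u = \<zero>\<^bsub>B\<^esub>"
      then have "lc (corner B e) \<delta> w (\<lambda>i. vec_index v i) = \<zero>\<^bsub>corner B e\<^esub>" by (simp add: u_def)
      then have "vec_index v i = 0" if "i < \<delta>" for i using C.indepD(2)[OF C.fbasisD(1)[OF w]] that by blast
      then have "v = 0\<^sub>v \<delta>" using v(1) by (intro eq_vecI) auto
      then show False using v(2) by simp
    qed
    have "x \<otimes>\<^bsub>B\<^esub> u = lc (corner B e) \<delta> w (\<lambda>i. \<Sum>j<\<delta>. M $$ (i, j) * vec_index v j)"
      unfolding u_def M_def by (rule C.mat_of_apply[OF w lin])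
    also have "\<dots> = lc (corner B e) \<delta> w (\<lambda>i. l * vec_index v i)"
    proof (rule C.lc_cong[OF wc])
      fix i assume i: "i < \<delta>"
      have "(\<Sum>j<\<delta>. M $$ (i, j) * vec_index v j) = vec_index (M *\<^sub>v v) i"
        using i M v(1) by (auto simp: scalar_prod_def lessThan_atLeast0 intro!: sum.cong)
      then show "(\<Sum>j<\<delta>. M $$ (i, j) * vec_index v j) = l * vec_index v i" using v(1,3) i by simp
    qed auto
    also have "\<dots> = l \<odot>\<^bsub>B\<^esub> u" unfolding u_def using C.lc_smult[OF wc] by simp
    finally have xu: "x \<otimes>\<^bsub>B\<^esub> u = l \<odot>\<^bsub>B\<^esub> u" .
    have uB: "u \<in> carrier B" "e \<otimes>\<^bsub>B\<^esub> u \<otimes>\<^bsub>B\<^esub> e = u" using uC by auto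
    \<comment> \<open>Multiplying x u = l u by the inverse of u in the corner gives x = l e.\<close>
    obtain u' where u': "u' \<in> carrier B" "u \<otimes>\<^bsub>B\<^esub> u' = e" using mu.corner_inverse[OF uB u0] by blast
    have "x = x \<otimes>\<^bsub>B\<^esub> (u \<otimes>\<^bsub>B\<^esub> u')" using mu.corner_e(2)[OF xB] u'(2) by simp
    also have "\<dots> = (x \<otimes>\<^bsub>B\<^esub> u) \<otimes>\<^bsub>B\<^esub> u'" using xB uB u' by (simp add: B.A.m_assoc)
    also have "\<dots> = l \<odot>\<^bsub>B\<^esub> e" unfolding xu using B.sc_l[OF uB(1) u'(1)] u'(2) by simp
    finally show ?thesis by blast
  qed
  have lc1: "lc (corner B e) 1 (\<lambda>_. e) c = c 0 \<odot>\<^bsub>B\<^esub> e" for c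
    using C.lc_Suc[of 0 "\<lambda>_. e" c] by simp
  show ?thesis
    unfolding fbasis_def indep_def lc1
  proof (intro conjI allI impI ballI eC)
    fix c :: "nat \<Rightarrow> 'k" and i :: nat assume "c 0 \<odot>\<^bsub>B\<^esub> e = \<zero>\<^bsub>corner B e\<^esub>" "i < 1"
    then show "c i = 0" using B.sc_eq_zero[OF mu.e_closed, of "c 0"] mu.e_nonzero by auto
  next
    fix v assume "v \<in> carrier (corner B e)"
    then obtain l where "v = l \<odot>\<^bsub>B\<^esub> e" using scal by blast
    then show "\<exists>c. v = c 0 \<odot>\<^bsub>B\<^esub> e" by (intro exI[of _ "\<lambda>_. l"])
  qed
qed

text \<open>The corner consists of the multiples of e, so B is isomorphic to the matrices of size m
  over a copy of the field, and comparison of the dimensions N^2 = m^2 identifies m.\<close>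

theorem alg_closed_split:
  fixes B :: "('k :: alg_closed_field, 'b) module"
  assumes "falg B" "fbasis B (N * N) b" "simple_ring B"
  shows "\<exists>\<phi>. \<phi> \<in> algebra_iso class_ring B (module_mat TYPE('k) N N)"
proof -
  interpret B: falg B by fact
  obtain m e f c where mu: "mu_system B m e f c" using B.ex_mu_system[OF assms(2,3)] .
  interpret mu: mu_system B m e f c by fact
  let ?C = "corner B e"
  interpret C: fvs ?C by (rule B.corner_fvs[OF mu.e_closed])
  have bas: "fbasis ?C 1 (\<lambda>_. e)" by (rule alg_closed_corner[OF assms(1) mu assms(2)])
  have "N * N = m * m * 1" by (rule B.fbasis_unique[OF assms(2) B.mu_system_basis[OF mu bas]])
  then have mN: "m = N" by (metis mult_1_right power2_eq_square power2_eq_iff_nonneg zero_le)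
  have eC: "e \<in> carrier ?C" by simp
  \<comment> \<open>The scalar l with z = l e; an isomorphism from the corner to the field, applied
    entrywise to matrices below.\<close>
  define \<kappa> where "\<kappa> z = coord ?C 1 (\<lambda>_. e) z 0" for z
  have lc1: "lc ?C 1 (\<lambda>_. e) h = h 0 \<odot>\<^bsub>B\<^esub> e" for h using C.lc_Suc[of 0 "\<lambda>_. e" h] by simp
  have \<kappa>: "z = \<kappa> z \<odot>\<^bsub>B\<^esub> e" if "z \<in> carrier ?C" for z
    using C.lc_coord[OF bas that] unfolding lc1 \<kappa>_def by simp
  have \<kappa>I: "\<kappa> (l \<odot>\<^bsub>B\<^esub> e) = l" for l
    unfolding \<kappa>_def using C.coord_eqI[OF bas lc1[of "\<lambda>_. l", symmetric], of 0] by simp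
  have \<kappa>add: "\<kappa> (z \<oplus>\<^bsub>B\<^esub> z') = \<kappa> z + \<kappa> z'" if "z \<in> carrier ?C" "z' \<in> carrier ?C" for z z'
    unfolding \<kappa>_def using C.coord_add[OF bas that, of 0] by simp
  have \<kappa>sc: "\<kappa> (l \<odot>\<^bsub>B\<^esub> z) = l * \<kappa> z" if "z \<in> carrier ?C" for z l
    unfolding \<kappa>_def using C.coord_smult[OF bas that, of 0] by simp
  have \<kappa>mult: "\<kappa> (z \<otimes>\<^bsub>B\<^esub> z') = \<kappa> z * \<kappa> z'" if z: "z \<in> carrier ?C" "z' \<in> carrier ?C" for z z'
  proof -
    have "z \<otimes>\<^bsub>B\<^esub> z' = (\<kappa> z \<odot>\<^bsub>B\<^esub> e) \<otimes>\<^bsub>B\<^esub> (\<kappa> z' \<odot>\<^bsub>B\<^esub> e)" using \<kappa>[OF z(1)] \<kappa>[OF z(2)] by simp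
    also have "\<dots> = (\<kappa> z * \<kappa> z') \<odot>\<^bsub>B\<^esub> e" by (simp add: B.sc_l B.sc_r B.sc_mult[symmetric] mult.commute)
    finally show ?thesis by (simp add: \<kappa>I)
  qed
  have \<kappa>e: "\<kappa> e = 1" using \<kappa>I[of 1] by simp
  have \<kappa>0: "\<kappa> \<zero>\<^bsub>B\<^esub> = 0" using \<kappa>I[of 0] by simp
  have \<kappa>sum: "\<kappa> (\<Oplus>\<^bsub>?C\<^esub>k\<in>{..<t}. g k) = (\<Sum>k<t. \<kappa> (g k))" if "\<And>k. k < t \<Longrightarrow> g k \<in> carrier ?C" for g and t :: nat
    using that
  proof (induction t)
    case 0
    then show ?case using \<kappa>0 by simp
  next
    case (Suc t)
    have s: "(\<Oplus>\<^bsub>?C\<^esub>k\<in>{..<t}. g k) \<in> carrier ?C" using Suc.prems by (intro C.M.finsum_closed) auto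
    have "(\<Oplus>\<^bsub>?C\<^esub>k\<in>{..<Suc t}. g k) = (\<Oplus>\<^bsub>?C\<^esub>k\<in>{..<t}. g k) \<oplus>\<^bsub>?C\<^esub> g t"
      by (rule C.M.finsum_lessThan_Suc) (use Suc.prems in auto)
    then have "\<kappa> (\<Oplus>\<^bsub>?C\<^esub>k\<in>{..<Suc t}. g k) = \<kappa> (\<Oplus>\<^bsub>?C\<^esub>k\<in>{..<t}. g k) + \<kappa> (g t)"
      using \<kappa>add[OF s, of "g t"] Suc.prems[of t] by (simp del: corner_simps(1))
    moreover have "\<kappa> (\<Oplus>\<^bsub>?C\<^esub>k\<in>{..<t}. g k) = (\<Sum>k<t. \<kappa> (g k))" by (rule Suc.IH) (use Suc.prems in simp)
    ultimately show ?case by simp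
  qed
  have Cmult: "z \<otimes>\<^bsub>B\<^esub> z' \<in> carrier ?C" if "z \<in> carrier ?C" "z' \<in> carrier ?C" for z z'
    using that mu.corner_mult[of z z'] by simp
  let ?A = "mat_algebra m ?C" and ?M = "module_mat TYPE('k) m m"
  define \<psi> where "\<psi> P = mat m m (\<lambda>ij. \<kappa> (P $$ ij))" for P
  have \<psi>: "\<psi> \<in> ring_iso ?A ?M"
  proof (rule ring_iso_memI)
    fix P Q assume P: "P \<in> carrier ?A" and Q: "Q \<in> carrier ?A"
    note Pc = mat_algebra_carrierD[OF P] and Qc = mat_algebra_carrierD[OF Q]
    show "\<psi> P \<in> carrier ?M" by (simp add: \<psi>_def module_mat_simps)
    show "\<psi> (P \<otimes>\<^bsub>?A\<^esub> Q) = \<psi> P \<otimes>\<^bsub>?M\<^esub> \<psi> Q"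
      unfolding module_mat_simps
    proof (rule eq_matI)
      fix i j assume "i < dim_row (\<psi> P * \<psi> Q)" "j < dim_col (\<psi> P * \<psi> Q)"
      then have ij: "i < m" "j < m" by (auto simp: \<psi>_def)
      have "\<psi> (P \<otimes>\<^bsub>?A\<^esub> Q) $$ (i, j) = \<kappa> (\<Oplus>\<^bsub>?C\<^esub>k\<in>{..<m}. P $$ (i, k) \<otimes>\<^bsub>B\<^esub> Q $$ (k, j))"
        using ij by (simp add: \<psi>_def mat_algebra_simps)
      also have "\<dots> = (\<Sum>k<m. \<kappa> (P $$ (i, k) \<otimes>\<^bsub>B\<^esub> Q $$ (k, j)))"
      proof (rule \<kappa>sum)
        fix k assume k: "k < m"
        show "P $$ (i, k) \<otimes>\<^bsub>B\<^esub> Q $$ (k, j) \<in> carrier ?C" by (rule Cmult[OF Pc(3)[OF ij(1) k] Qc(3)[OF k ij(2)]])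
      qed
      also have "\<dots> = (\<Sum>k<m. \<kappa> (P $$ (i, k)) * \<kappa> (Q $$ (k, j)))"
        by (rule sum.cong) (use \<kappa>mult Pc(3) Qc(3) ij in \<open>auto simp del: corner_simps(1)\<close>)
      also have "\<dots> = (\<psi> P * \<psi> Q) $$ (i, j)"
        using ij by (simp add: \<psi>_def scalar_prod_def lessThan_atLeast0)
      finally show "\<psi> (P \<otimes>\<^bsub>?A\<^esub> Q) $$ (i, j) = (\<psi> P * \<psi> Q) $$ (i, j)" .
    qed (auto simp: \<psi>_def)
    show "\<psi> (P \<oplus>\<^bsub>?A\<^esub> Q) = \<psi> P \<oplus>\<^bsub>?M\<^esub> \<psi> Q"
      unfolding module_mat_simps \<psi>_def
      by (rule eq_matI) (use \<kappa>add Pc(3) Qc(3) in \<open>auto simp: mat_algebra_simps simp del: corner_simps(1)\<close>)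
  next
    show "\<psi> \<one>\<^bsub>?A\<^esub> = \<one>\<^bsub>?M\<^esub>"
      unfolding module_mat_simps \<psi>_def by (rule eq_matI) (auto simp: mat_algebra_simps \<kappa>e \<kappa>0)
    show "bij_betw \<psi> (carrier ?A) (carrier ?M)"
    proof (rule bij_betwI[where g = "\<lambda>P. mat m m (\<lambda>ij. P $$ ij \<odot>\<^bsub>B\<^esub> e)"])
      show "\<psi> \<in> carrier ?A \<rightarrow> carrier ?M" by (auto simp: \<psi>_def module_mat_simps)
      have "l \<odot>\<^bsub>B\<^esub> e \<in> carrier ?C" for l using C.sc[OF eC, of l] by simp
      then show "(\<lambda>P. mat m m (\<lambda>ij. P $$ ij \<odot>\<^bsub>B\<^esub> e)) \<in> carrier ?M \<rightarrow> carrier ?A"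
        by (simp add: mat_algebra_carrier del: corner_simps(1))
      show "mat m m (\<lambda>ij. \<psi> P $$ ij \<odot>\<^bsub>B\<^esub> e) = P" if P: "P \<in> carrier ?A" for P
        by (rule eq_matI) (use mat_algebra_carrierD[OF P] \<kappa> in \<open>auto simp: \<psi>_def simp del: corner_simps(1)\<close>)
      show "\<psi> (mat m m (\<lambda>ij. P $$ ij \<odot>\<^bsub>B\<^esub> e)) = P" if "P \<in> carrier ?M" for P
        by (rule eq_matI) (use that in \<open>auto simp: \<psi>_def module_mat_simps \<kappa>I\<close>)
    qed
  qed
  have \<psi>sc: "\<psi> (l \<odot>\<^bsub>?A\<^esub> P) = l \<odot>\<^bsub>?M\<^esub> \<psi> P" if P: "P \<in> carrier ?A" for l P
    unfolding module_mat_simps \<psi>_def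
    by (rule eq_matI) (use \<kappa>sc mat_algebra_carrierD(3)[OF P] in \<open>auto simp: mat_algebra_simps simp del: corner_simps(1)\<close>)
  obtain \<phi> where \<phi>: "\<phi> \<in> algebra_iso class_ring B ?A"
    using mu_system_algebra_iso[OF B.assoc_algebra_axioms mu] by blast
  then have \<phi>r: "\<phi> \<in> ring_iso B ?A" and \<phi>sc: "\<And>k x. x \<in> carrier B \<Longrightarrow> \<phi> (k \<odot>\<^bsub>B\<^esub> x) = k \<odot>\<^bsub>?A\<^esub> \<phi> x"
    by (auto simp: algebra_iso_def)
  have "\<phi> x \<in> carrier ?A" if "x \<in> carrier B" for x
    using \<phi>r that by (auto simp: ring_iso_def dest: ring_hom_closed)
  then have "\<psi> \<circ> \<phi> \<in> algebra_iso class_ring B ?M"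
    using ring_iso_set_trans[OF \<phi>r \<psi>] \<phi>sc \<psi>sc unfolding algebra_iso_def by simp
  then show ?thesis unfolding mN by blast
qed

section \<open>Scalar extension to the algebraic closure\<close>

lemma closure_algebra_simps [simp]: "carrier closure_algebra = UNIV" "monoid.mult closure_algebra = (*)"
  "one closure_algebra = 1" "ring.zero closure_algebra = 0" "add closure_algebra = (+)"
  "c \<odot>\<^bsub>closure_algebra\<^esub> x = to_ac c * x"
  by (auto simp: closure_algebra_def)

lemma closure_algebra_cring: "cring (closure_algebra :: ('f :: field, 'f alg_closure) module)"
proof (rule cringI)
  show "abelian_group (closure_algebra :: ('f, 'f alg_closure) module)"
  proof (rule abelian_groupI)
    fix x :: "'f alg_closure"
    assume "x \<in> carrier closure_algebra"
    show "\<exists>y\<in>carrier closure_algebra. y \<oplus>\<^bsub>closure_algebra\<^esub> x = \<zero>\<^bsub>closure_algebra\<^esub>"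
      by (intro bexI[of _ "- x"]) auto
  qed (auto simp: add_ac)
  show "Group.comm_monoid (closure_algebra :: ('f, 'f alg_closure) module)" by (rule comm_monoidI) (auto simp: mult_ac)
qed (auto simp: algebra_simps)

lemma closure_algebra_falg: "falg (closure_algebra :: ('f :: field, 'f alg_closure) module)"
  unfolding falg_def
  by (rule assoc_algebraI[OF class_field cring.axioms(1)[OF closure_algebra_cring]]) (auto simp: algebra_simps)

locale closure_tensor = A: falg A for A :: "('f :: field, 'b) module"

sublocale closure_tensor \<subseteq> tensor A closure_algebra
  by (intro tensor.intro A.falg_axioms closure_algebra_falg closure_algebra_cring)

context closure_tensor
begin

abbreviation closure_pure (infixl "\<bowtie>" 71) where "a \<bowtie> l \<equiv> pure_tensor class_ring A closure_algebra a l"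

lemma T_smult_pure: "a \<in> carrier A \<Longrightarrow> l \<odot>\<^bsub>T\<^esub> (a \<bowtie> l') = a \<bowtie> (l * l')"
  by (simp add: T_smult pure_mult)

text \<open>The algebraic closure is a type of fields, so here the extended algebra fits
  \<open>falg\<close> over the larger field, and the splitting theorem applies directly. For
  F[t]/(p), a record, the ground field of \<open>falg\<close> stays F.\<close>

lemma T_falg: "falg T"
  unfolding falg_def
proof (rule assoc_algebraI[OF class_field T_ring])
  fix k x y assume "x \<in> carrier T" "y \<in> carrier T"
  then show "x \<otimes>\<^bsub>T\<^esub> (k \<odot>\<^bsub>T\<^esub> y) = k \<odot>\<^bsub>T\<^esub> (x \<otimes>\<^bsub>T\<^esub> y)"
    using one_central[of x k] by (simp add: T_smult T.m_assoc[symmetric])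
next
  fix k l x assume "x \<in> carrier T"
  then show "(k \<otimes>\<^bsub>class_ring\<^esub> l) \<odot>\<^bsub>T\<^esub> x = k \<odot>\<^bsub>T\<^esub> (l \<odot>\<^bsub>T\<^esub> x)"
    using pure_mult[of "\<one>\<^bsub>A\<^esub>" k "\<one>\<^bsub>A\<^esub>" l] by (simp add: T_smult T.m_assoc[symmetric])
next
  fix k l x assume "x \<in> carrier T"
  then show "(k \<oplus>\<^bsub>class_ring\<^esub> l) \<odot>\<^bsub>T\<^esub> x = k \<odot>\<^bsub>T\<^esub> x \<oplus>\<^bsub>T\<^esub> l \<odot>\<^bsub>T\<^esub> x"
    using pure_add_right[of "\<one>\<^bsub>A\<^esub>" k l] by (simp add: T_smult T.l_distr)
next
  fix x assume "x \<in> carrier T"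
  then show "\<one>\<^bsub>class_ring\<^esub> \<odot>\<^bsub>T\<^esub> x = x" using pure_one by (simp add: T_smult)
qed (auto simp: T_smult T.r_distr T.m_assoc)

sublocale TA: falg T by (rule T_falg)

lemma T_fbasis:
  assumes "fbasis A N y"
  shows "fbasis T N (\<lambda>i. y i \<bowtie> 1)"
proof -
  have y: "\<And>i. i < N \<Longrightarrow> y i \<in> carrier A" using A.fbasisD(2)[OF assms] .
  have lc: "lc T N (\<lambda>i. y i \<bowtie> 1) c = (\<Oplus>\<^bsub>T\<^esub>i\<in>{..<N}. y i \<bowtie> c i)" for c
    unfolding lc_def by (rule T.finsum_cong') (use y in \<open>auto simp: T_smult_pure\<close>)
  have "\<exists>c. x = lc T N (\<lambda>i. y i \<bowtie> 1) c" if "x \<in> carrier T" for x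
    using T_expand[OF assms that] unfolding lc by blast
  moreover have "c i = 0" if "lc T N (\<lambda>i. y i \<bowtie> 1) c = \<zero>\<^bsub>T\<^esub>" "i < N" for c i
    using T_independent[OF assms _ that(1)[unfolded lc] that(2)] by simp
  ultimately show ?thesis using y by (simp add: fbasis_def indep_def)
qed

text \<open>Coefficients in F pass through the tensor sign unchanged. Hence a matrix of left
  multiplication over F keeps its entries, embedded by \<open>to_ac\<close>, after scalar
  extension.\<close>

lemma lc_pure:
  assumes "\<And>i. i < k \<Longrightarrow> b i \<in> carrier A"
  shows "lc A k b c \<bowtie> 1 = lc T k (\<lambda>i. b i \<bowtie> 1) (\<lambda>i. to_ac (c i))"
  using assms
proof (induction k)
  case 0
  then show ?case using pure_zero_left[of 1] by simp
next
  case (Suc k)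
  have bk: "b k \<in> carrier A" using Suc.prems by simp
  have l: "lc A k b c \<in> carrier A" by (rule A.lc_closed) (use Suc.prems in simp)
  have "(c k \<odot>\<^bsub>A\<^esub> b k) \<bowtie> 1 = to_ac (c k) \<odot>\<^bsub>T\<^esub> (b k \<bowtie> 1)"
    using pure_sc[OF bk, of 1 "c k"] T_smult_pure[OF bk, of "to_ac (c k)" 1] by simp
  moreover have "lc A (Suc k) b c = lc A k b c \<oplus>\<^bsub>A\<^esub> c k \<odot>\<^bsub>A\<^esub> b k"
    by (rule A.lc_Suc) (use Suc.prems in simp)
  moreover have "lc T (Suc k) (\<lambda>i. b i \<bowtie> 1) (\<lambda>i. to_ac (c i)) =
    lc T k (\<lambda>i. b i \<bowtie> 1) (\<lambda>i. to_ac (c i)) \<oplus>\<^bsub>T\<^esub> to_ac (c k) \<odot>\<^bsub>T\<^esub> (b k \<bowtie> 1)"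
    by (rule TA.lc_Suc) (use Suc.prems in simp)
  moreover have "lc A k b c \<bowtie> 1 = lc T k (\<lambda>i. b i \<bowtie> 1) (\<lambda>i. to_ac (c i))"
    by (rule Suc.IH) (use Suc.prems in simp)
  ultimately show ?case using pure_add_left[OF l A.sc[OF bk], of 1 "c k"] by simp
qed

theorem T_split:
  assumes "simple_ring A" "central_algebra A" "fbasis A (N * N) y"
  shows "\<exists>\<phi>. \<phi> \<in> algebra_iso class_ring T (module_mat TYPE('f alg_closure) N N)"
proof (rule alg_closed_split[OF T_falg T_fbasis[OF assms(3)]])
  show "simple_ring T"
  proof (rule T_simple[OF assms])
    fix l :: "'f alg_closure" assume "l \<noteq> \<zero>\<^bsub>closure_algebra\<^esub>"
    then show "\<exists>l'\<in>carrier closure_algebra. l' \<otimes>\<^bsub>closure_algebra\<^esub> l = \<one>\<^bsub>closure_algebra\<^esub>"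
      by (intro bexI[of _ "inverse l"]) auto
  qed simp
qed

end

subsection \<open>Matrices over a central division algebra\<close>

locale cda_mat = cda D d y for D :: "('f :: field, 'b) module" and d :: nat and y :: "nat \<Rightarrow> 'b" +
  fixes n :: nat
  assumes n_pos: "0 < n"

sublocale cda_mat \<subseteq> W: mat_alg D n
  by unfold_locales

sublocale cda_mat \<subseteq> F: falg "mat_algebra n D"
  unfolding falg_def by (rule mat_algebra_assoc_algebra[OF D.assoc_algebra_axioms])

sublocale cda_mat \<subseteq> C: closure_tensor "mat_algebra n D"
  by (rule closure_tensor.intro[OF F.falg_axioms])

context cda_mat
begin

abbreviation "A \<equiv> mat_algebra n D"
abbreviation "E \<equiv> mat_unit n D"

section \<open>A basis of the matrix algebra arranged by columns\<close>

lemma unit_linmap: "linmap D A (E r s)"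
  unfolding linmap_def
proof (intro conjI ballI allI)
  fix a b c assume a: "a \<in> carrier D" and b: "b \<in> carrier D"
  show "E r s a \<in> carrier A" using a by simp
  show "E r s (a \<oplus>\<^bsub>D\<^esub> b) = E r s a \<oplus>\<^bsub>A\<^esub> E r s b"
    by (rule eq_matI) (use a b in \<open>auto simp: mat_algebra_simps\<close>)
  show "E r s (c \<odot>\<^bsub>D\<^esub> a) = c \<odot>\<^bsub>A\<^esub> E r s a"
    by (rule eq_matI) (use a in \<open>auto simp: mat_algebra_simps\<close>)
qed

lemma unit_sum_index:
  assumes u: "\<And>t. t < n * n \<Longrightarrow> u t \<in> carrier D" and rs: "r < n" "s < n"
  shows "(\<Oplus>\<^bsub>A\<^esub>t\<in>{..<n * n}. E (t mod n) (t div n) (u t)) $$ (r, s) = u (s * n + r)"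
proof -
  have k: "s * n + r < n * n" by (rule index_mult_add_less[OF rs(2,1)])
  have "(\<Oplus>\<^bsub>A\<^esub>t\<in>{..<n * n}. E (t mod n) (t div n) (u t)) $$ (r, s) =
    (\<Oplus>\<^bsub>D\<^esub>t\<in>{..<n * n}. E (t mod n) (t div n) (u t) $$ (r, s))"
    by (rule W.finsum_index) (use u rs in auto)
  also have "\<dots> = E ((s * n + r) mod n) ((s * n + r) div n) (u (s * n + r)) $$ (r, s)"
  proof (rule D.M.finsum_eq_single[OF k])
    show "E (t mod n) (t div n) (u t) $$ (r, s) \<in> carrier D" if "t < n * n" for t using u[OF that] rs by simp
    show "E (t mod n) (t div n) (u t) $$ (r, s) = \<zero>\<^bsub>D\<^esub>" if "t < n * n" "t \<noteq> s * n + r" for t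
    proof -
      have "\<not> (r = t mod n \<and> s = t div n)" using that(2) div_mult_mod_eq[of t n] by auto
      then show ?thesis using rs by auto
    qed
  qed
  also have "\<dots> = u (s * n + r)" using rs by simp
  finally show ?thesis .
qed

text \<open>The index (s * n + r) * (d * d) + l stands for the matrix with y_l in position (r, s).
  All of column s forms one block of length n d^2, and block 0 is a basis of the column space used
  below.\<close>

definition mb :: "nat \<Rightarrow> 'b mat" where
  "mb x = E (x div (d * d) mod n) (x div (d * d) div n) (y (x mod (d * d)))"

lemma mat_basis: "fbasis A (n * (n * (d * d))) mb"
proof -
  have "fbasis A (n * n * (d * d)) (\<lambda>x. (\<lambda>t. E (t mod n) (t div n)) (x div (d * d)) (y (x mod (d * d))))"
  proof (rule fbasis_prod[OF F.fvs_axioms D.fvs_axioms basis])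
    show "linmap D A (E (i mod n) (i div n))" for i by (rule unit_linmap)
    show "\<exists>u. (\<forall>i<n * n. u i \<in> carrier D) \<and> v = (\<Oplus>\<^bsub>A\<^esub>i\<in>{..<n * n}. E (i mod n) (i div n) (u i))"
      if v: "v \<in> carrier A" for v
    proof (intro exI conjI allI impI)
      let ?u = "\<lambda>t. v $$ (t mod n, t div n)"
      show u: "?u t \<in> carrier D" if "t < n * n" for t
        using mat_algebra_carrierD(3)[OF v] that n_pos by (simp add: less_mult_imp_div_less)
      have c: "(\<Oplus>\<^bsub>A\<^esub>i\<in>{..<n * n}. E (i mod n) (i div n) (?u i)) \<in> carrier A"
        by (rule W.A.finsum_closed) (use u in auto)
      show "v = (\<Oplus>\<^bsub>A\<^esub>i\<in>{..<n * n}. E (i mod n) (i div n) (?u i))"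
      proof (rule eq_matI)
        fix r s assume "r < dim_row (\<Oplus>\<^bsub>A\<^esub>i\<in>{..<n * n}. E (i mod n) (i div n) (?u i))"
          "s < dim_col (\<Oplus>\<^bsub>A\<^esub>i\<in>{..<n * n}. E (i mod n) (i div n) (?u i))"
        then have rs: "r < n" "s < n" using mat_algebra_carrierD(1,2)[OF c] by auto
        show "v $$ (r, s) = (\<Oplus>\<^bsub>A\<^esub>i\<in>{..<n * n}. E (i mod n) (i div n) (?u i)) $$ (r, s)"
          using unit_sum_index[OF u rs] rs by simp
      qed (use mat_algebra_carrierD(1,2)[OF c] mat_algebra_carrierD(1,2)[OF v] in auto)
    qed
    show "u i = \<zero>\<^bsub>D\<^esub>" if u: "\<And>i. i < n * n \<Longrightarrow> u i \<in> carrier D"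
      and z: "(\<Oplus>\<^bsub>A\<^esub>i\<in>{..<n * n}. E (i mod n) (i div n) (u i)) = \<zero>\<^bsub>A\<^esub>" and i: "i < n * n" for u i
    proof -
      have rs: "i mod n < n" "i div n < n" using n_pos i by (auto simp: less_mult_imp_div_less)
      show ?thesis using unit_sum_index[of u, OF u rs] rs unfolding z by simp
    qed
  qed
  then show ?thesis unfolding mb_def[abs_def] by (simp add: mult.assoc)
qed

lemma mb_closed [simp]: "x < n * (n * (d * d)) \<Longrightarrow> mb x \<in> carrier A"
  by (rule F.fbasisD(2)[OF mat_basis])

lemma dd_pos: "0 < d * d" using d_pos by simp

lemma mb_block:
  assumes "s < n" "j < n * (d * d)"
  shows "mb (s * (n * (d * d)) + j) = E (j div (d * d)) s (y (j mod (d * d)))"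
proof -
  have q: "j div (d * d) < n" using assms(2) by (simp add: less_mult_imp_div_less)
  have e: "s * (n * (d * d)) + j = (s * n) * (d * d) + j" by (simp add: mult.assoc)
  have "((s * n) * (d * d) + j) div (d * d) = s * n + j div (d * d)" using dd_pos by simp
  moreover have "((s * n) * (d * d) + j) mod (d * d) = j mod (d * d)" by simp
  ultimately show ?thesis using q n_pos unfolding mb_def e by simp
qed

lemma y_closed [simp]: "y (j mod (d * d)) \<in> carrier D"
  by (rule D.fbasisD(2)[OF basis]) (use dd_pos in simp)

lemma mb_column: "j < n * (d * d) \<Longrightarrow> mb j = E (j div (d * d)) 0 (y (j mod (d * d)))"
  using mb_block[OF n_pos] by simp

lemma mb_column_mult:
  assumes "s < n" "j < n * (d * d)"
  shows "mb j \<otimes>\<^bsub>A\<^esub> E 0 s \<one>\<^bsub>D\<^esub> = mb (s * (n * (d * d)) + j)"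
  using assms n_pos by (simp add: mb_column mb_block W.unit_mult_unit)

abbreviation "column_set \<equiv> {v \<in> carrier A. v \<otimes>\<^bsub>A\<^esub> E 0 0 \<one>\<^bsub>D\<^esub> = v}"

text \<open>The column space \<open>\<Delta>\<^sup>n\<close>, realised as the left ideal \<open>A E\<^sub>0\<^sub>0\<close>.\<close>

definition Col :: "('f, 'b mat) module" where "Col = A\<lparr>carrier := column_set\<rparr>"

lemma Col_simps [simp]: "carrier Col = column_set" "add Col = add A" "module.smult Col = module.smult A"
  "ring.zero Col = ring.zero A"
  by (simp_all add: Col_def)

lemma Col_subsp: "F.subsp column_set"
  unfolding F.subsp_def by (simp add: W.A.l_distr F.sc_l subset_eq)

sublocale Col: fvs Col
  unfolding Col_def by (rule F.subsp_fvs[OF Col_subsp])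

lemma Col_lc: "(\<And>i. i < k \<Longrightarrow> b i \<in> column_set) \<Longrightarrow> lc Col k b c = lc A k b c"
  unfolding Col_def by (rule F.subsp_lc[OF Col_subsp])

lemma mb_Col: "j < n * (d * d) \<Longrightarrow> mb j \<in> column_set"
  using n_pos by (simp add: mb_column W.unit_mult_unit)

lemma column_le: "n * (d * d) \<le> n * (n * (d * d))"
  using n_pos by simp

text \<open>Right multiplication by E_00 fixes the basis matrices of column 0 and kills all others;
  so a vector fixed by it is a combination of the first n d^2 basis vectors.\<close>

lemma Col_basis: "fbasis Col (n * (d * d)) mb"
proof -
  let ?k = "n * (d * d)" and ?K = "n * (n * (d * d))"
  have "c i = 0" if 0: "lc Col ?k mb c = \<zero>\<^bsub>Col\<^esub>" and i: "i < ?k" for c i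
  proof -
    have "lc A ?K mb (\<lambda>i. if i < ?k then c i else 0) = lc A ?k mb c"
      by (rule F.lc_truncate[OF column_le]) simp
    also have "\<dots> = lc Col ?k mb c" by (rule Col_lc[OF mb_Col, symmetric])
    finally have "lc A ?K mb (\<lambda>i. if i < ?k then c i else 0) = \<zero>\<^bsub>A\<^esub>" using 0 by simp
    from F.indepD(2)[OF F.fbasisD(1)[OF mat_basis] this, of i] show ?thesis using i column_le by simp
  qed
  moreover have "\<exists>c. v = lc Col ?k mb c" if v: "v \<in> carrier Col" for v
  proof -
    have vA: "v \<in> carrier A" "v \<otimes>\<^bsub>A\<^esub> E 0 0 \<one>\<^bsub>D\<^esub> = v" using v by auto
    obtain c where c: "v = lc A ?K mb c" using mat_basis vA(1) unfolding fbasis_def by blast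
    have lin: "linmap A A (\<lambda>v. v \<otimes>\<^bsub>A\<^esub> E 0 0 \<one>\<^bsub>D\<^esub>)"
      unfolding linmap_def by (simp add: W.A.l_distr F.sc_l)
    have mbE: "mb x \<otimes>\<^bsub>A\<^esub> E 0 0 \<one>\<^bsub>D\<^esub> = (if x < ?k then mb x else \<zero>\<^bsub>A\<^esub>)" if x: "x < ?K" for x
    proof -
      define s j where "s = x div ?k" and "j = x mod ?k"
      have sj: "s < n" "j < ?k" "x = s * ?k + j"
        using x n_pos dd_pos unfolding s_def j_def by (simp_all add: less_mult_imp_div_less div_mult_mod_eq)
      have "x < ?k \<longleftrightarrow> s = 0" unfolding s_def using n_pos dd_pos by (simp add: div_eq_0_iff)
      moreover have "mb x = E (j div (d * d)) s (y (j mod (d * d)))" unfolding sj(3) by (rule mb_block[OF sj(1,2)])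
      ultimately show ?thesis using sj(1) n_pos by (simp add: W.unit_mult_unit)
    qed
    have "v = lc A ?K mb c \<otimes>\<^bsub>A\<^esub> E 0 0 \<one>\<^bsub>D\<^esub>" using vA(2) c by simp
    also have "\<dots> = lc A ?K (\<lambda>x. mb x \<otimes>\<^bsub>A\<^esub> E 0 0 \<one>\<^bsub>D\<^esub>) c"
      by (rule linmap_lc[OF F.fvs_axioms F.fvs_axioms lin]) simp
    also have "\<dots> = lc A ?K mb (\<lambda>i. if i < ?k then c i else 0)"
      unfolding lc_def by (rule W.A.finsum_cong') (auto simp: mbE)
    also have "\<dots> = lc A ?k mb c" by (rule F.lc_truncate[OF column_le]) simp
    also have "\<dots> = lc Col ?k mb c" by (rule Col_lc[OF mb_Col, symmetric])
    finally show ?thesis by blast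
  qed
  ultimately show ?thesis using mb_Col by (simp add: fbasis_def indep_def)
qed

definition lrep :: "'b mat \<Rightarrow> 'f mat" where
  "lrep x = mat_of Col (n * (d * d)) mb (\<lambda>v. x \<otimes>\<^bsub>A\<^esub> v)"

lemma lrep_carrier [simp]: "lrep x \<in> carrier_mat (n * (d * d)) (n * (d * d))"
  by (simp add: lrep_def)

lemma left_linmap: "x \<in> carrier A \<Longrightarrow> linmap Col Col (\<lambda>v. x \<otimes>\<^bsub>A\<^esub> v)"
  unfolding linmap_def by (simp add: W.A.r_distr F.sc_r W.A.m_assoc)

lemma lrep_column:
  assumes x: "x \<in> carrier A" and j: "j < n * (d * d)"
  shows "x \<otimes>\<^bsub>A\<^esub> mb j = lc A (n * (d * d)) mb (\<lambda>i. lrep x $$ (i, j))"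
proof -
  have mj: "mb j \<in> carrier Col" using mb_Col[OF j] by simp
  have "x \<otimes>\<^bsub>A\<^esub> mb j = lc Col (n * (d * d)) mb (coord Col (n * (d * d)) mb (x \<otimes>\<^bsub>A\<^esub> mb j))"
    by (rule Col.lc_coord[OF Col_basis linmapD(1)[OF left_linmap[OF x] mj], symmetric])
  also have "\<dots> = lc Col (n * (d * d)) mb (\<lambda>i. lrep x $$ (i, j))"
    by (rule Col.lc_cong) (use mb_Col j in \<open>auto simp: lrep_def mat_of_def\<close>)
  also have "\<dots> = lc A (n * (d * d)) mb (\<lambda>i. lrep x $$ (i, j))" by (rule Col_lc[OF mb_Col])
  finally show ?thesis .
qed

text \<open>Right multiplication by E_0s moves column 0 to column s and commutes with left
  multiplication by x. So x acts on every column by the same matrix.\<close>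

lemma lrep_block:
  assumes x: "x \<in> carrier A" and j: "j < n * (d * d)" and s: "s < n"
  shows "x \<otimes>\<^bsub>A\<^esub> mb (s * (n * (d * d)) + j) =
    lc A (n * (d * d)) (\<lambda>i. mb (s * (n * (d * d)) + i)) (\<lambda>i. lrep x $$ (i, j))"
proof -
  have mA: "\<And>i. i < n * (d * d) \<Longrightarrow> mb i \<in> carrier A" using mb_Col by simp
  have EA: "E 0 s \<one>\<^bsub>D\<^esub> \<in> carrier A" by simp
  have lin: "linmap A A (\<lambda>v. v \<otimes>\<^bsub>A\<^esub> E 0 s \<one>\<^bsub>D\<^esub>)"
    unfolding linmap_def by (simp add: W.A.l_distr F.sc_l)
  have "x \<otimes>\<^bsub>A\<^esub> mb (s * (n * (d * d)) + j) = (x \<otimes>\<^bsub>A\<^esub> mb j) \<otimes>\<^bsub>A\<^esub> E 0 s \<one>\<^bsub>D\<^esub>"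
    unfolding mb_column_mult[OF s j, symmetric] by (rule W.A.m_assoc[OF x mA[OF j] EA, symmetric])
  also have "\<dots> = lc A (n * (d * d)) (\<lambda>i. mb i \<otimes>\<^bsub>A\<^esub> E 0 s \<one>\<^bsub>D\<^esub>) (\<lambda>i. lrep x $$ (i, j))"
    unfolding lrep_column[OF x j] by (rule linmap_lc[OF F.fvs_axioms F.fvs_axioms lin mA])
  also have "\<dots> = lc A (n * (d * d)) (\<lambda>i. mb (s * (n * (d * d)) + i)) (\<lambda>i. lrep x $$ (i, j))"
    by (rule F.lc_cong) (use mA EA mb_column_mult[OF s] mb_closed[OF index_mult_add_less[OF s]] in auto)
  finally show ?thesis .
qed

text \<open>Left multiplication by \<phi>(x \<otimes> 1) on the matrices of size nd is computed in
  two bases. The standard units give the characteristic polynomial of \<phi>(x \<otimes> 1) to the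
  power nd. The images of the basis \<open>mb\<close> give that of \<open>lrep x\<close> to the
  power n, one factor for each column of \<open>A\<close>.\<close>

theorem char_poly_lrep:
  assumes \<phi>: "\<phi> \<in> algebra_iso class_ring (base_change class_ring A closure_algebra)
      (module_mat TYPE('f alg_closure) (n * d) (n * d))"
    and x: "x \<in> carrier A"
  shows "char_poly (\<phi> (pure_tensor class_ring A closure_algebra x 1)) ^ (n * d) =
    map_poly to_ac (char_poly (lrep x)) ^ n"
proof -
  let ?k = "n * (d * d)" and ?N = "n * d" and ?T = "base_change class_ring A closure_algebra"
  let ?V = "module_mat TYPE('f alg_closure) ?N ?N"
  let ?p = "\<lambda>a. pure_tensor class_ring A closure_algebra a 1"
  interpret V: fvs ?V by (rule fvs_mat)
  have hom: "\<phi> \<in> Ring.ring_hom ?T ?V" and bij: "bij_betw \<phi> (carrier ?T) (carrier ?V)"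
    and sc: "\<And>l v. v \<in> carrier ?T \<Longrightarrow> \<phi> (l \<odot>\<^bsub>?T\<^esub> v) = l \<odot>\<^bsub>?V\<^esub> \<phi> v"
    using \<phi> by (auto simp: algebra_iso_def ring_iso_def)
  have lin: "linmap ?T ?V \<phi>"
    unfolding linmap_def using ring_hom_closed[OF hom] ring_hom_add[OF hom] sc by blast
  have pc: "?p a \<in> carrier ?T" if "a \<in> carrier A" for a using that by simp
  let ?M = "\<phi> (?p x)" and ?g = "\<lambda>v. \<phi> (?p x) * v"
  have M: "?M \<in> carrier_mat ?N ?N" using ring_hom_closed[OF hom pc[OF x]] by (simp add: module_mat_simps)
  have glin: "linmap ?V ?V ?g"
    unfolding linmap_def module_mat_simps using M
    by (auto simp: mult_add_distrib_mat[of _ ?N ?N _ ?N] mult_smult_distrib[of _ ?N ?N _ ?N])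
  have b: "fbasis ?V (n * ?k) (\<lambda>i. \<phi> (?p (mb i)))"
    by (rule fbasis_image[OF C.TA.fvs_axioms V.fvs_axioms lin bij C.T_fbasis[OF mat_basis]])
  have L: "map_mat to_ac (lrep x) \<in> carrier_mat ?k ?k" by simp
  have rep: "char_poly (mat_of ?V (n * ?k) (\<lambda>i. \<phi> (?p (mb i))) ?g) = char_poly (map_mat to_ac (lrep x)) ^ n"
  proof (rule V.char_poly_mat_of_repeat[OF b L])
    fix s j assume s: "s < n" and j: "j < ?k"
    have sj: "s * ?k + j < n * ?k" by (rule index_mult_add_less[OF s j])
    have mA: "mb (s * ?k + i) \<in> carrier A" if "i < ?k" for i
      by (rule mb_closed[OF index_mult_add_less[OF s that]])
    have "\<phi> (?p x) * \<phi> (?p (mb (s * ?k + j))) = \<phi> (?p x \<otimes>\<^bsub>?T\<^esub> ?p (mb (s * ?k + j)))"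
      using ring_hom_mult[OF hom pc[OF x] pc[OF mA[OF j]]] by (simp add: module_mat_simps)
    also have "?p x \<otimes>\<^bsub>?T\<^esub> ?p (mb (s * ?k + j)) = ?p (x \<otimes>\<^bsub>A\<^esub> mb (s * ?k + j))"
      using C.pure_mult[OF x, of 1 "mb (s * ?k + j)" 1] mA[OF j] by simp
    also have "\<dots> = ?p (lc A ?k (\<lambda>i. mb (s * ?k + i)) (\<lambda>i. lrep x $$ (i, j)))"
      unfolding lrep_block[OF x j s] ..
    also have "\<dots> = lc ?T ?k (\<lambda>i. ?p (mb (s * ?k + i))) (\<lambda>i. to_ac (lrep x $$ (i, j)))"
      by (rule C.lc_pure[OF mA])
    also have "\<phi> \<dots> = lc ?V ?k (\<lambda>i. \<phi> (?p (mb (s * ?k + i)))) (\<lambda>i. to_ac (lrep x $$ (i, j)))"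
      by (rule linmap_lc[OF C.TA.fvs_axioms V.fvs_axioms lin]) (rule pc[OF mA])
    also have "\<dots> = lc ?V ?k (\<lambda>i. \<phi> (?p (mb (s * ?k + i)))) (\<lambda>i. map_mat to_ac (lrep x) $$ (i, j))"
      by (rule V.lc_cong) (use linmapD(1)[OF lin pc[OF mA]] j in \<open>auto simp: lrep_def\<close>)
    finally show "?M * \<phi> (?p (mb (s * ?k + j))) =
      lc ?V ?k (\<lambda>i. \<phi> (?p (mb (s * ?k + i)))) (\<lambda>i. map_mat to_ac (lrep x) $$ (i, j))" .
  qed
  have NN: "n * ?k = ?N * ?N" by (simp add: ac_simps)
  have "char_poly ?M ^ ?N = char_poly (mat_of ?V (?N * ?N) (std_mat ?N) ?g)"
    by (rule char_poly_left_mult[OF M, symmetric])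
  also have "\<dots> = char_poly (mat_of ?V (?N * ?N) (\<lambda>i. \<phi> (?p (mb i))) ?g)"
    by (rule char_poly_similar[OF V.mat_of_similar[OF fbasis_std_mat b[unfolded NN] glin]])
  also have "\<dots> = char_poly (map_mat to_ac (lrep x)) ^ n" using rep unfolding NN .
  also have "char_poly (map_mat to_ac (lrep x)) = map_poly to_ac (char_poly (lrep x))"
    by (rule to_ac.char_poly_hom[OF lrep_carrier])
  finally show ?thesis .
qed

text \<open>From a nonzero entry x_rs with left inverse z, the sum of E_hr(z) x E_sh(1) over all h
  is the identity, since its h-th term has the single entry 1 in position (h, h).\<close>

lemma mat_simple: "simple_ring A"
  unfolding simple_ring_def
proof (intro conjI ballI impI)
  show "\<one>\<^bsub>A\<^esub> \<noteq> \<zero>\<^bsub>A\<^esub>"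
  proof
    assume "\<one>\<^bsub>A\<^esub> = \<zero>\<^bsub>A\<^esub>"
    then have "\<one>\<^bsub>A\<^esub> $$ (0, 0) = \<zero>\<^bsub>A\<^esub> $$ (0, 0)" by simp
    then show False using n_pos nontrivial by simp
  qed
  fix x assume x: "x \<in> carrier A" "x \<noteq> \<zero>\<^bsub>A\<^esub>"
  note xc = mat_algebra_carrierD[OF x(1)]
  have "\<exists>r s. r < n \<and> s < n \<and> x $$ (r, s) \<noteq> \<zero>\<^bsub>D\<^esub>"
  proof (rule ccontr)
    assume *: "\<not> ?thesis"
    have "x = \<zero>\<^bsub>A\<^esub>" by (rule eq_matI) (use * xc in auto)
    then show False using x(2) by simp
  qed
  then obtain r s where rs: "r < n" "s < n" "x $$ (r, s) \<noteq> \<zero>\<^bsub>D\<^esub>" by blast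
  obtain z where z: "z \<in> carrier D" "z \<otimes>\<^bsub>D\<^esub> x $$ (r, s) = \<one>\<^bsub>D\<^esub>" using division[OF xc(3)[OF rs(1,2)] rs(3)] by blast
  define g where "g v = (\<Oplus>\<^bsub>A\<^esub>h\<in>{..<n}. E h r z \<otimes>\<^bsub>A\<^esub> v \<otimes>\<^bsub>A\<^esub> E s h \<one>\<^bsub>D\<^esub>)" for v
  have "W.A.is_mop g" unfolding g_def by (rule W.A.is_mop_sum) (use z in \<open>auto intro: W.A.is_mop_mult\<close>)
  then obtain G where G: "G \<in> mult_ops A" "\<forall>x\<in>carrier A. g x = G x" unfolding W.A.is_mop_def by blast
  have gc: "g x \<in> carrier A" unfolding g_def by (rule W.A.finsum_closed) (use z x in auto)
  have "g x = \<one>\<^bsub>A\<^esub>"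
  proof (rule eq_matI)
    fix i j assume "i < dim_row \<one>\<^bsub>A\<^esub>" "j < dim_col \<one>\<^bsub>A\<^esub>"
    then have ij: "i < n" "j < n" by auto
    have t: "(E h r z \<otimes>\<^bsub>A\<^esub> x \<otimes>\<^bsub>A\<^esub> E s h \<one>\<^bsub>D\<^esub>) $$ (i, j) = (if i = h \<and> j = h then \<one>\<^bsub>D\<^esub> else \<zero>\<^bsub>D\<^esub>)" if "h < n" for h
      using ij rs z x xc(3) by (simp add: W.unit_mult_right W.unit_mult_left)
    have "g x $$ (i, j) = (\<Oplus>\<^bsub>D\<^esub>h\<in>{..<n}. (E h r z \<otimes>\<^bsub>A\<^esub> x \<otimes>\<^bsub>A\<^esub> E s h \<one>\<^bsub>D\<^esub>) $$ (i, j))"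
      unfolding g_def by (rule W.finsum_index) (use ij x z in auto)
    also have "\<dots> = (E i r z \<otimes>\<^bsub>A\<^esub> x \<otimes>\<^bsub>A\<^esub> E s i \<one>\<^bsub>D\<^esub>) $$ (i, j)"
      by (rule D.M.finsum_eq_single[OF ij(1)]) (simp_all add: t)
    finally show "g x $$ (i, j) = \<one>\<^bsub>A\<^esub> $$ (i, j)" using t[OF ij(1)] ij by simp
  qed (use mat_algebra_carrierD[OF gc] in auto)
  then show "\<exists>E\<in>mult_ops A. E x = \<one>\<^bsub>A\<^esub>" using G x(1) by (intro bexI[of _ G]) auto
qed

text \<open>Comparing entries of z E_ij(a) and E_ij(a) z shows that z is diagonal with equal
  entries, and that the common entry commutes with every a in \<open>D\<close>.\<close>

lemma mat_central: "central_algebra A"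
  unfolding central_algebra_def
proof (intro ballI impI)
  fix z assume z: "z \<in> carrier A" and com: "\<forall>x\<in>carrier A. z \<otimes>\<^bsub>A\<^esub> x = x \<otimes>\<^bsub>A\<^esub> z"
  note zc = mat_algebra_carrierD[OF z]
  have eq: "(if s = j then z $$ (r, i) \<otimes>\<^bsub>D\<^esub> a else \<zero>\<^bsub>D\<^esub>) = (if r = i then a \<otimes>\<^bsub>D\<^esub> z $$ (j, s) else \<zero>\<^bsub>D\<^esub>)"
    if "a \<in> carrier D" "i < n" "j < n" "r < n" "s < n" for a i j r s
  proof -
    have "(z \<otimes>\<^bsub>A\<^esub> E i j a) $$ (r, s) = (E i j a \<otimes>\<^bsub>A\<^esub> z) $$ (r, s)" using com that by simp
    then show ?thesis using W.unit_mult_right[OF that(1) z that(2,4,5)] W.unit_mult_left[OF that(1) z that(3-5)] by simp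
  qed
  have "\<forall>a\<in>carrier D. z $$ (0, 0) \<otimes>\<^bsub>D\<^esub> a = a \<otimes>\<^bsub>D\<^esub> z $$ (0, 0)"
    using eq[of _ 0 0 0 0] n_pos by simp
  then obtain l where l: "z $$ (0, 0) = l \<odot>\<^bsub>D\<^esub> \<one>\<^bsub>D\<^esub>"
    using central zc(3)[OF n_pos n_pos] unfolding central_algebra_def by blast
  have "z = l \<odot>\<^bsub>A\<^esub> \<one>\<^bsub>A\<^esub>"
  proof (rule eq_matI)
    fix i j assume "i < dim_row (l \<odot>\<^bsub>A\<^esub> \<one>\<^bsub>A\<^esub>)" "j < dim_col (l \<odot>\<^bsub>A\<^esub> \<one>\<^bsub>A\<^esub>)"
    then have ij: "i < n" "j < n" by (auto simp: mat_algebra_simps)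
    have "z $$ (i, j) = (if i = j then l \<odot>\<^bsub>D\<^esub> \<one>\<^bsub>D\<^esub> else \<zero>\<^bsub>D\<^esub>)"
    proof (cases "i = j")
      case True
      then show ?thesis using eq[of "\<one>\<^bsub>D\<^esub>" i 0 i 0] ij n_pos zc(3) l by simp
    next
      case False
      then show ?thesis using eq[of "\<one>\<^bsub>D\<^esub>" j j i j] ij zc(3) by simp
    qed
    then show "z $$ (i, j) = (l \<odot>\<^bsub>A\<^esub> \<one>\<^bsub>A\<^esub>) $$ (i, j)" using ij by (simp add: mat_algebra_simps)
  qed (use zc in \<open>auto simp: mat_algebra_simps\<close>)
  then show "\<exists>k. z = k \<odot>\<^bsub>A\<^esub> \<one>\<^bsub>A\<^esub>" by blast
qed

lemma ex_split: "\<exists>\<phi>. \<phi> \<in> algebra_iso class_ring (base_change class_ring A closure_algebra)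
    (module_mat TYPE('f alg_closure) (n * d) (n * d))"
proof (rule C.T_split[OF mat_simple mat_central])
  have e: "n * (n * (d * d)) = n * d * (n * d)" by (simp add: ac_simps)
  show "fbasis A (n * d * (n * d)) mb" using mat_basis unfolding e .
qed

text \<open>An element a of \<Delta> acts on a column by right multiplication with E_00(a). This
  preserves A E_00, and by associativity it commutes with left multiplication by x.\<close>

lemma lrep_bimod:
  assumes x: "x \<in> carrier A"
  shows "\<exists>\<sigma>. bimod D (n * (d * d)) (lrep x) \<sigma>"
proof -
  let ?k = "n * (d * d)"
  define \<sigma> where "\<sigma> a = mat_of Col ?k mb (\<lambda>v. v \<otimes>\<^bsub>A\<^esub> E 0 0 a)" for a
  have E1: "E 0 0 a \<otimes>\<^bsub>A\<^esub> E 0 0 \<one>\<^bsub>D\<^esub> = E 0 0 a" if "a \<in> carrier D" for a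
    using that n_pos by (simp add: W.unit_mult_unit)
  have lin: "linmap Col Col (\<lambda>v. v \<otimes>\<^bsub>A\<^esub> E 0 0 a)" if a: "a \<in> carrier D" for a
    unfolding linmap_def using a E1[OF a] by (simp add: W.A.l_distr F.sc_l W.A.m_assoc)
  have "antirep D ?k \<sigma>"
    unfolding \<sigma>_def
  proof (rule antirep_mat_of[OF D.falg_axioms Col.fvs_axioms Col_basis lin])
    fix v a b assume v: "v \<in> carrier Col" and a: "a \<in> carrier D" and b: "b \<in> carrier D"
    have vA: "v \<in> carrier A" using v by simp
    show "v \<otimes>\<^bsub>A\<^esub> E 0 0 (a \<oplus>\<^bsub>D\<^esub> b) = v \<otimes>\<^bsub>A\<^esub> E 0 0 a \<oplus>\<^bsub>Col\<^esub> v \<otimes>\<^bsub>A\<^esub> E 0 0 b"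
      using vA a b linmapD(2)[OF unit_linmap a b] by (simp add: W.A.r_distr)
    have "E 0 0 (a \<otimes>\<^bsub>D\<^esub> b) = E 0 0 a \<otimes>\<^bsub>A\<^esub> E 0 0 b" using a b n_pos by (simp add: W.unit_mult_unit)
    then show "v \<otimes>\<^bsub>A\<^esub> E 0 0 (a \<otimes>\<^bsub>D\<^esub> b) = v \<otimes>\<^bsub>A\<^esub> E 0 0 a \<otimes>\<^bsub>A\<^esub> E 0 0 b"
      using vA a b by (simp add: W.A.m_assoc)
  next
    fix v a l assume v: "v \<in> carrier Col" and a: "a \<in> carrier D"
    then show "v \<otimes>\<^bsub>A\<^esub> E 0 0 (l \<odot>\<^bsub>D\<^esub> a) = l \<odot>\<^bsub>Col\<^esub> (v \<otimes>\<^bsub>A\<^esub> E 0 0 a)"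
      using linmapD(3)[OF unit_linmap a] by (simp add: F.sc_r)
  qed auto
  moreover have "\<sigma> a * lrep x = lrep x * \<sigma> a" if a: "a \<in> carrier D" for a
  proof -
    have 1: "\<sigma> a * lrep x = mat_of Col ?k mb (\<lambda>v. (x \<otimes>\<^bsub>A\<^esub> v) \<otimes>\<^bsub>A\<^esub> E 0 0 a)"
      unfolding \<sigma>_def lrep_def by (rule Col.mat_of_comp[OF Col_basis lin[OF a] left_linmap[OF x], symmetric])
    have 2: "lrep x * \<sigma> a = mat_of Col ?k mb (\<lambda>v. x \<otimes>\<^bsub>A\<^esub> (v \<otimes>\<^bsub>A\<^esub> E 0 0 a))"
      unfolding \<sigma>_def lrep_def by (rule Col.mat_of_comp[OF Col_basis left_linmap[OF x] lin[OF a], symmetric])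
    show ?thesis unfolding 1 2 mat_of_def
      by (rule cong_mat) (use mb_Col x a in \<open>auto simp: W.A.m_assoc\<close>)
  qed
  ultimately show ?thesis unfolding bimod_def by auto
qed

text \<open>A right \<Delta>-module of F-dimension n d^2 is free of rank n. Writing the images S w_j
  of a \<Delta>-basis as \<Sum> w_i a_ji, the entries a_ji form a matrix x over \<Delta>.
  Identifying columns with coordinate vectors turns left multiplication by x into S.\<close>

lemma bimod_lrep:
  assumes bi: "bimod D (n * (d * d)) S \<sigma>"
  obtains x where "x \<in> carrier A" "char_poly (lrep x) = char_poly S"
proof -
  let ?k = "n * (d * d)"
  have s: "antirep D ?k \<sigma>" and S: "S \<in> carrier_mat ?k ?k" and com: "\<And>a. a \<in> carrier D \<Longrightarrow> \<sigma> a * S = S * \<sigma> a"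
    using bi by (auto simp: bimod_def)
  let ?V = "module_vec TYPE('f) ?k" and ?act = "\<lambda>v a. \<sigma> a *\<^sub>v v"
  interpret R: rmod D ?V ?act by (rule antirep_rmod[OF D.falg_axioms s])
  have corner: "fbasis (corner D \<one>\<^bsub>D\<^esub>) (d * d) y"
  proof -
    have "corner D \<one>\<^bsub>D\<^esub> = D" by (rule module.equality) auto
    then show ?thesis using basis by simp
  qed
  let ?b = "\<lambda>r w x. ?act (?act (w (x div (d * d) mod r)) (y (x mod (d * d)))) \<one>\<^bsub>D\<^esub>"
  have "\<exists>r w. (\<forall>i<r. w i \<in> carrier ?V) \<and> fbasis ?V (1 * r * (d * d)) (?b r w) \<and>
    (\<forall>v\<in>carrier ?V. ?act v \<one>\<^bsub>D\<^esub> = v \<longrightarrow>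
      (\<exists>a. (\<forall>i<r. a i \<in> carrier (corner D \<one>\<^bsub>D\<^esub>)) \<and> v = (\<Oplus>\<^bsub>?V\<^esub>i\<in>{..<r}. ?act (w i) (a i))))"
  proof (rule R.rmod_basis[OF mu_one fbasis_unit_vec corner])
    fix r w
    assume "\<And>i. i < r \<Longrightarrow> w i \<in> carrier ?V" "fbasis ?V (1 * r * (d * d)) (?b r w)"
      "\<And>v. v \<in> carrier ?V \<Longrightarrow> ?act v \<one>\<^bsub>D\<^esub> = v \<Longrightarrow>
        \<exists>a. (\<forall>i<r. a i \<in> carrier (corner D \<one>\<^bsub>D\<^esub>)) \<and> v = (\<Oplus>\<^bsub>?V\<^esub>i\<in>{..<r}. ?act (w i) (a i))"
    then show ?thesis by (intro exI[of _ r] exI[of _ w] conjI allI impI ballI)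
  qed
  then obtain r w where w: "\<forall>i<r. w i \<in> carrier ?V"
    and wb: "fbasis ?V (1 * r * (d * d)) (?b r w)"
    and sp: "\<forall>v\<in>carrier ?V. ?act v \<one>\<^bsub>D\<^esub> = v \<longrightarrow>
      (\<exists>a. (\<forall>i<r. a i \<in> carrier (corner D \<one>\<^bsub>D\<^esub>)) \<and> v = (\<Oplus>\<^bsub>?V\<^esub>i\<in>{..<r}. ?act (w i) (a i)))"
    by (elim exE conjE)
  \<comment> \<open>Both are the F-dimension of the module; cancelling d^2 shows that the rank is
    n.\<close>
  have "1 * r * (d * d) = ?k" by (rule R.V.fbasis_unique[OF wb fbasis_unit_vec])
  then have r: "r = n" using dd_pos by simp
  note w = w[unfolded r, rule_format] and wb = wb[unfolded r] and sp = sp[unfolded r, rule_format]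
  have Sw: "S *\<^sub>v w j \<in> carrier ?V" if "j < n" for j using w[OF that] S by (auto simp: module_vec_simps)
  have "\<forall>j. \<exists>a. j < n \<longrightarrow> (\<forall>i<n. a i \<in> carrier D) \<and> S *\<^sub>v w j = (\<Oplus>\<^bsub>?V\<^esub>i\<in>{..<n}. ?act (w i) (a i))"
  proof
    fix j
    show "\<exists>a. j < n \<longrightarrow> (\<forall>i<n. a i \<in> carrier D) \<and> S *\<^sub>v w j = (\<Oplus>\<^bsub>?V\<^esub>i\<in>{..<n}. ?act (w i) (a i))"
    proof (cases "j < n")
      case True
      obtain a where "\<forall>i<n. a i \<in> carrier (corner D \<one>\<^bsub>D\<^esub>)" "S *\<^sub>v w j = (\<Oplus>\<^bsub>?V\<^esub>i\<in>{..<n}. ?act (w i) (a i))"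
        using sp[OF Sw[OF True] R.act_one[OF Sw[OF True]]] by (elim exE conjE)
      then show ?thesis by (intro exI[of _ a]) simp
    qed simp
  qed
  then obtain a where a: "\<And>i j. i < n \<Longrightarrow> j < n \<Longrightarrow> a j i \<in> carrier D"
    "\<And>j. j < n \<Longrightarrow> S *\<^sub>v w j = (\<Oplus>\<^bsub>?V\<^esub>i\<in>{..<n}. ?act (w i) (a j i))" by metis
  \<comment> \<open>Column j of x holds the coordinates of S w_j, hence the exchange of the indices.
    Coordinates stand to the right of the basis vectors, which is why x acts on columns from the
    left.\<close>
  define x where "x = mat n n (\<lambda>(i, j). a j i)"
  have x: "x \<in> carrier A" using a(1) by (auto simp: x_def mat_algebra_carrier)
  \<comment> \<open>Defined on all of \<open>A\<close> but depending only on column 0, so that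
    linearity can be proved without restriction to \<open>Col\<close>.\<close>
  define \<Psi> where "\<Psi> v = (\<Oplus>\<^bsub>?V\<^esub>i\<in>{..<n}. ?act (w i) (v $$ (i, 0)))" for v :: "'b mat"
  have vc: "v $$ (i, 0) \<in> carrier D" if "v \<in> carrier A" "i < n" for v i
    by (rule mat_algebra_carrierD(3)[OF that n_pos])
  have \<Psi>c: "?act (w i) (v $$ (i, 0)) \<in> carrier ?V" if "v \<in> carrier A" "i < n" for v i
    by (rule R.act_closed[OF w[OF that(2)] vc[OF that]])
  have lin: "linmap A ?V \<Psi>"
    unfolding linmap_def
  proof (intro conjI ballI allI)
    fix v v' l assume v: "v \<in> carrier A" and v': "v' \<in> carrier A"
    show "\<Psi> v \<in> carrier ?V" unfolding \<Psi>_def by (rule R.V.M.finsum_closed) (use \<Psi>c[OF v] in auto)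
    have "\<Psi> (v \<oplus>\<^bsub>A\<^esub> v') = (\<Oplus>\<^bsub>?V\<^esub>i\<in>{..<n}. ?act (w i) (v $$ (i, 0)) \<oplus>\<^bsub>?V\<^esub> ?act (w i) (v' $$ (i, 0)))"
      unfolding \<Psi>_def
    proof (rule R.V.M.finsum_cong')
      show "(\<lambda>i. ?act (w i) (v $$ (i, 0)) \<oplus>\<^bsub>?V\<^esub> ?act (w i) (v' $$ (i, 0))) \<in> {..<n} \<rightarrow> carrier ?V"
        using \<Psi>c[OF v] \<Psi>c[OF v'] by (intro Pi_I R.V.M.a_closed) auto
      fix i assume "i \<in> {..<n}"
      then have i: "i < n" by simp
      have "(v \<oplus>\<^bsub>A\<^esub> v') $$ (i, 0) = v $$ (i, 0) \<oplus>\<^bsub>D\<^esub> v' $$ (i, 0)" using i n_pos by (simp add: mat_algebra_simps)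
      then show "?act (w i) ((v \<oplus>\<^bsub>A\<^esub> v') $$ (i, 0)) = ?act (w i) (v $$ (i, 0)) \<oplus>\<^bsub>?V\<^esub> ?act (w i) (v' $$ (i, 0))"
        using R.act_add_right[OF w[OF i] vc[OF v i] vc[OF v' i]] by simp
    qed simp
    also have "\<dots> = \<Psi> v \<oplus>\<^bsub>?V\<^esub> \<Psi> v'"
      unfolding \<Psi>_def by (rule R.V.M.finsum_addf) (use \<Psi>c[OF v] \<Psi>c[OF v'] in auto)
    finally show "\<Psi> (v \<oplus>\<^bsub>A\<^esub> v') = \<Psi> v \<oplus>\<^bsub>?V\<^esub> \<Psi> v'" .
    have "l \<odot>\<^bsub>?V\<^esub> \<Psi> v = (\<Oplus>\<^bsub>?V\<^esub>i\<in>{..<n}. l \<odot>\<^bsub>?V\<^esub> ?act (w i) (v $$ (i, 0)))"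
      unfolding \<Psi>_def by (rule finsum_hom[OF R.V.M.abelian_monoid_axioms R.V.M.abelian_monoid_axioms])
        (use \<Psi>c[OF v] R.V.sc R.V.sc_distr R.V.sc_zero in auto)
    also have "\<dots> = \<Psi> (l \<odot>\<^bsub>A\<^esub> v)"
      unfolding \<Psi>_def
    proof (rule R.V.M.finsum_cong')
      show "(\<lambda>i. ?act (w i) ((l \<odot>\<^bsub>A\<^esub> v) $$ (i, 0))) \<in> {..<n} \<rightarrow> carrier ?V"
        using \<Psi>c[OF F.sc[OF v]] by auto
      fix i assume "i \<in> {..<n}"
      then have i: "i < n" by simp
      have "(l \<odot>\<^bsub>A\<^esub> v) $$ (i, 0) = l \<odot>\<^bsub>D\<^esub> v $$ (i, 0)" using i n_pos by (simp add: mat_algebra_simps)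
      then show "l \<odot>\<^bsub>?V\<^esub> ?act (w i) (v $$ (i, 0)) = ?act (w i) ((l \<odot>\<^bsub>A\<^esub> v) $$ (i, 0))"
        using R.act_sc_right[OF w[OF i] vc[OF v i], of l] by simp
    qed simp
    finally show "\<Psi> (l \<odot>\<^bsub>A\<^esub> v) = l \<odot>\<^bsub>?V\<^esub> \<Psi> v" by simp
  qed
  have \<Psi>unit: "\<Psi> (E i 0 b) = ?act (w i) b" if i: "i < n" and b: "b \<in> carrier D" for i b
  proof -
    have "\<Psi> (E i 0 b) = ?act (w i) (E i 0 b $$ (i, 0))"
      unfolding \<Psi>_def
    proof (rule R.V.M.finsum_eq_single[OF i])
      show "?act (w h) (E i 0 b $$ (h, 0)) \<in> carrier ?V" if "h < n" for h by (rule \<Psi>c[OF _ that]) (use b in simp)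
      show "?act (w h) (E i 0 b $$ (h, 0)) = \<zero>\<^bsub>?V\<^esub>" if h: "h < n" "h \<noteq> i" for h
        using R.act_zero_right[OF w[OF h(1)]] h n_pos by simp
    qed
    then show ?thesis using i n_pos by simp
  qed
  have Slin: "linmap ?V ?V (\<lambda>v. S *\<^sub>v v)" by (rule linmap_mat[OF S])
  have Sact: "S *\<^sub>v ?act v b = ?act (S *\<^sub>v v) b" if v: "v \<in> carrier ?V" and b: "b \<in> carrier D" for v b
  proof -
    have vv: "v \<in> carrier_vec ?k" using v by (simp add: module_vec_simps)
    note sb = antirepD(1)[OF s b]
    show ?thesis using assoc_mult_mat_vec[OF S sb vv] assoc_mult_mat_vec[OF sb S vv] com[OF b] by simp
  qed
  \<comment> \<open>Expanding both sides over the \<Delta>-basis, the two double sums differ only in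
    the order of summation; \<open>S\<close> commutes with the action of \<Delta> by
    \<open>Sact\<close>.\<close>
  have \<Psi>S: "\<Psi> (x \<otimes>\<^bsub>A\<^esub> v) = S *\<^sub>v \<Psi> v" if v: "v \<in> carrier A" for v
  proof -
    have xv: "(x \<otimes>\<^bsub>A\<^esub> v) $$ (i, 0) = (\<Oplus>\<^bsub>D\<^esub>j\<in>{..<n}. a j i \<otimes>\<^bsub>D\<^esub> v $$ (j, 0))" if i: "i < n" for i
    proof -
      have "(x \<otimes>\<^bsub>A\<^esub> v) $$ (i, 0) = (\<Oplus>\<^bsub>D\<^esub>j\<in>{..<n}. x $$ (i, j) \<otimes>\<^bsub>D\<^esub> v $$ (j, 0))"
        using i n_pos by (simp add: mat_algebra_simps)
      also have "\<dots> = (\<Oplus>\<^bsub>D\<^esub>j\<in>{..<n}. a j i \<otimes>\<^bsub>D\<^esub> v $$ (j, 0))"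
        by (rule D.M.finsum_cong') (use i a(1) vc[OF v] in \<open>auto simp: x_def\<close>)
      finally show ?thesis .
    qed
    have c1: "?act (w i) (a j i \<otimes>\<^bsub>D\<^esub> v $$ (j, 0)) \<in> carrier ?V" if "i < n" "j < n" for i j
      by (rule R.act_closed[OF w[OF that(1)]]) (use a(1)[OF that] vc[OF v that(2)] in simp)
    have "\<Psi> (x \<otimes>\<^bsub>A\<^esub> v) = (\<Oplus>\<^bsub>?V\<^esub>i\<in>{..<n}. \<Oplus>\<^bsub>?V\<^esub>j\<in>{..<n}. ?act (w i) (a j i \<otimes>\<^bsub>D\<^esub> v $$ (j, 0)))"
      unfolding \<Psi>_def
    proof (rule R.V.M.finsum_cong')
      show "(\<lambda>i. \<Oplus>\<^bsub>?V\<^esub>j\<in>{..<n}. ?act (w i) (a j i \<otimes>\<^bsub>D\<^esub> v $$ (j, 0))) \<in> {..<n} \<rightarrow> carrier ?V"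
        by (intro Pi_I R.V.M.finsum_closed) (use c1 in auto)
      fix i assume "i \<in> {..<n}"
      then have i: "i < n" by simp
      show "?act (w i) ((x \<otimes>\<^bsub>A\<^esub> v) $$ (i, 0)) = (\<Oplus>\<^bsub>?V\<^esub>j\<in>{..<n}. ?act (w i) (a j i \<otimes>\<^bsub>D\<^esub> v $$ (j, 0)))"
        unfolding xv[OF i] by (rule R.act_finsum_right[OF _ w[OF i]]) (use a(1)[OF i] vc[OF v] in simp)
    qed simp
    also have "\<dots> = (\<Oplus>\<^bsub>?V\<^esub>j\<in>{..<n}. \<Oplus>\<^bsub>?V\<^esub>i\<in>{..<n}. ?act (w i) (a j i \<otimes>\<^bsub>D\<^esub> v $$ (j, 0)))"
      by (rule R.V.M.finsum_swap_lessThan[OF c1])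
    also have "\<dots> = (\<Oplus>\<^bsub>?V\<^esub>j\<in>{..<n}. S *\<^sub>v ?act (w j) (v $$ (j, 0)))"
    proof (rule R.V.M.finsum_cong')
      show "(\<lambda>j. S *\<^sub>v ?act (w j) (v $$ (j, 0))) \<in> {..<n} \<rightarrow> carrier ?V"
        using linmapD(1)[OF Slin \<Psi>c[OF v]] by auto
      fix j assume "j \<in> {..<n}"
      then have j: "j < n" by simp
      have wa: "?act (w i) (a j i) \<in> carrier ?V" if "i < n" for i
        by (rule R.act_closed[OF w[OF that] a(1)[OF that j]])
      have "(\<Oplus>\<^bsub>?V\<^esub>i\<in>{..<n}. ?act (w i) (a j i \<otimes>\<^bsub>D\<^esub> v $$ (j, 0))) =
        (\<Oplus>\<^bsub>?V\<^esub>i\<in>{..<n}. ?act (?act (w i) (a j i)) (v $$ (j, 0)))"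
      proof (rule R.V.M.finsum_cong')
        show "(\<lambda>i. ?act (?act (w i) (a j i)) (v $$ (j, 0))) \<in> {..<n} \<rightarrow> carrier ?V"
          using R.act_closed[OF wa vc[OF v j]] by auto
        fix i assume "i \<in> {..<n}"
        then have i: "i < n" by simp
        show "?act (w i) (a j i \<otimes>\<^bsub>D\<^esub> v $$ (j, 0)) = ?act (?act (w i) (a j i)) (v $$ (j, 0))"
          by (rule R.act_mult[OF w[OF i] a(1)[OF i j] vc[OF v j]])
      qed simp
      also have "\<dots> = ?act (\<Oplus>\<^bsub>?V\<^esub>i\<in>{..<n}. ?act (w i) (a j i)) (v $$ (j, 0))"
        by (rule R.act_finsum_left[OF wa vc[OF v j], symmetric])
      also have "\<dots> = S *\<^sub>v ?act (w j) (v $$ (j, 0))"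
        unfolding a(2)[OF j, symmetric] by (rule Sact[OF w[OF j] vc[OF v j], symmetric])
      finally show "(\<Oplus>\<^bsub>?V\<^esub>i\<in>{..<n}. ?act (w i) (a j i \<otimes>\<^bsub>D\<^esub> v $$ (j, 0))) = S *\<^sub>v ?act (w j) (v $$ (j, 0))" .
    qed simp
    also have "\<dots> = S *\<^sub>v \<Psi> v"
      unfolding \<Psi>_def
      by (rule finsum_hom[OF R.V.M.abelian_monoid_axioms R.V.M.abelian_monoid_axioms \<Psi>c[OF v], symmetric])
        (use linmapD[OF Slin] linmap_zero[OF R.V.fvs_axioms R.V.fvs_axioms Slin] in auto)
    finally show ?thesis .
  qed
  define bw where "bw t = \<Psi> (mb t)" for t
  have bw: "bw t = ?act (?act (w (t div (d * d) mod n)) (y (t mod (d * d)))) \<one>\<^bsub>D\<^esub>" if t: "t < ?k" for t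
  proof -
    have q: "t div (d * d) < n" using t by (simp add: less_mult_imp_div_less)
    have "bw t = ?act (w (t div (d * d))) (y (t mod (d * d)))"
      unfolding bw_def mb_column[OF t] by (rule \<Psi>unit[OF q y_closed])
    then show ?thesis using R.act_one[OF R.act_closed[OF w[OF q] y_closed]] q by (simp del: R.act_one)
  qed
  \<comment> \<open>On indices below n d^2 the images of the column basis agree with the F-basis
    supplied by \<open>rmod_basis\<close>, so they are independent; having full length, they form a
    basis.\<close>
  have bwb: "fbasis ?V ?k bw"
  proof (rule R.V.indep_full_fbasis[OF fbasis_unit_vec])
    have i: "indep ?V ?k (\<lambda>x. ?act (?act (w (x div (d * d) mod n)) (y (x mod (d * d)))) \<one>\<^bsub>D\<^esub>)"
      using R.V.fbasisD(1)[OF wb] by simp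
    have eq: "lc ?V ?k bw c = lc ?V ?k (\<lambda>x. ?act (?act (w (x div (d * d) mod n)) (y (x mod (d * d)))) \<one>\<^bsub>D\<^esub>) c" for c
      by (rule R.V.lc_cong) (use R.V.indepD(1)[OF i] bw in auto)
    show "indep ?V ?k bw"
      unfolding indep_def eq using i bw unfolding indep_def by simp
  qed
  have "mat_of ?V ?k bw (\<lambda>v. S *\<^sub>v v) = lrep x"
  proof (rule R.V.mat_ofI[OF bwb lrep_carrier])
    fix j assume j: "j < ?k"
    have mA: "mb i \<in> carrier A" if "i < ?k" for i using mb_Col[OF that] by simp
    have "S *\<^sub>v bw j = \<Psi> (x \<otimes>\<^bsub>A\<^esub> mb j)" unfolding bw_def by (rule \<Psi>S[OF mA[OF j], symmetric])
    also have "\<dots> = \<Psi> (lc A ?k mb (\<lambda>i. lrep x $$ (i, j)))" unfolding lrep_column[OF x j] ..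
    also have "\<dots> = lc ?V ?k (\<lambda>i. \<Psi> (mb i)) (\<lambda>i. lrep x $$ (i, j))"
      by (rule linmap_lc[OF F.fvs_axioms R.V.fvs_axioms lin mA])
    finally show "S *\<^sub>v bw j = lc ?V ?k bw (\<lambda>i. lrep x $$ (i, j))" unfolding bw_def .
  qed
  then have "similar_mat S (lrep x)"
    using R.V.mat_of_similar[OF fbasis_unit_vec bwb Slin] mat_of_unit_vec[OF S] by simp
  then have "char_poly (lrep x) = char_poly S" using char_poly_similar by fastforce
  with x that show ?thesis by blast
qed

text \<open>By \<open>char_poly_lrep\<close> the power nd of the reduced characteristic polynomial
  equals the power n of that of \<open>lrep x\<close>, and common exponents of monic polynomials can
  be removed. The equivalence holds for each splitting isomorphism \<phi>, so the result is
  independent of \<phi>; \<open>ex_split\<close> supplies one for the direction from right to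
  left.\<close>

lemma is_char_poly_iff:
  assumes x: "x \<in> carrier A" and f: "lead_coeff f = 1"
  shows "is_char_poly A (n * d) x f \<longleftrightarrow> char_poly (lrep x) = f ^ d"
proof -
  let ?c = "\<lambda>\<phi>. char_poly (\<phi> (pure_tensor class_ring A closure_algebra x 1))"
  let ?I = "algebra_iso class_ring (base_change class_ring A closure_algebra) (module_mat TYPE('f alg_closure) (n * d) (n * d))"
  have L: "lead_coeff (char_poly (lrep x)) = 1" using degree_monic_char_poly[OF lrep_carrier] by simp
  have lf: "lead_coeff (map_poly to_ac f) = 1" using f by simp
  have iff: "map_poly to_ac f = ?c \<phi> \<longleftrightarrow> char_poly (lrep x) = f ^ d" if \<phi>: "\<phi> \<in> ?I" for \<phi>
  proof
    have rel: "?c \<phi> ^ (n * d) = map_poly to_ac (char_poly (lrep x)) ^ n" by (rule char_poly_lrep[OF \<phi> x])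
    show "char_poly (lrep x) = f ^ d" if "map_poly to_ac f = ?c \<phi>"
    proof -
      have "map_poly to_ac (char_poly (lrep x) ^ n) = map_poly to_ac ((f ^ d) ^ n)"
        using rel that by (simp add: to_ac_poly.hom_power power_mult[symmetric] mult.commute)
      then have "char_poly (lrep x) ^ n = (f ^ d) ^ n" by (rule to_ac_poly.injectivity)
      moreover have "lead_coeff (f ^ d) = 1" using f by (simp add: lead_coeff_power)
      ultimately show ?thesis using monic_power_inj[OF L _ _ n_pos] by blast
    qed
    show "map_poly to_ac f = ?c \<phi>" if e: "char_poly (lrep x) = f ^ d"
    proof -
      have hom: "\<phi> \<in> Ring.ring_hom (base_change class_ring A closure_algebra) (module_mat TYPE('f alg_closure) (n * d) (n * d))"
        using \<phi> by (simp add: algebra_iso_def ring_iso_def)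
      have "pure_tensor class_ring A closure_algebra x 1 \<in> carrier (base_change class_ring A closure_algebra)"
        using x by simp
      from ring_hom_closed[OF hom this]
      have "\<phi> (pure_tensor class_ring A closure_algebra x 1) \<in> carrier (module_mat TYPE('f alg_closure) (n * d) (n * d))" .
      then have "\<phi> (pure_tensor class_ring A closure_algebra x 1) \<in> carrier_mat (n * d) (n * d)"
        by (simp add: module_mat_simps)
      from degree_monic_char_poly[OF this] have lc: "lead_coeff (?c \<phi>) = 1" by simp
      have eq: "map_poly to_ac f ^ (n * d) = ?c \<phi> ^ (n * d)"
        unfolding rel e by (simp add: to_ac_poly.hom_power power_mult[symmetric] mult.commute)
      have pos: "0 < n * d" using n_pos d_pos by simp
      show ?thesis by (rule monic_power_inj[OF lf lc eq pos])
    qed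
  qed
  show ?thesis
  proof
    assume "is_char_poly A (n * d) x f"
    then obtain \<phi> where "\<phi> \<in> ?I" "map_poly to_ac f = ?c \<phi>" unfolding is_char_poly_def by (elim bexE)
    then show "char_poly (lrep x) = f ^ d" by (simp only: iff)
  next
    assume e: "char_poly (lrep x) = f ^ d"
    obtain \<phi> where \<phi>: "\<phi> \<in> ?I" using ex_split by (elim exE)
    from e have eq: "map_poly to_ac f = ?c \<phi>" unfolding iff[OF \<phi>] .
    show "is_char_poly A (n * d) x f" unfolding is_char_poly_def by (rule bexI[OF _ \<phi>], rule eq)
  qed
qed

end

section \<open>Multiplicities in the given factorization and the final equivalence\<close>

lemma pmult_prod:
  fixes p :: "'i \<Rightarrow> 'f :: field poly"
  assumes "finite J" "\<And>j. j \<in> J \<Longrightarrow> Factorial_Ring.irreducible (p j)" "\<And>j. j \<in> J \<Longrightarrow> lead_coeff (p j) = 1"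
    and "inj_on p J" "i \<in> J"
  shows "pmult (p i) (\<Prod>j\<in>J. p j ^ a j) (a i)"
proof -
  have i: "Factorial_Ring.irreducible (p i)" "lead_coeff (p i) = 1" using assms by auto
  have "pmult (p i) (\<Prod>j\<in>K. p j ^ a j) 0" if "K \<subseteq> J - {i}" for K
    using finite_subset[OF that finite_Diff[OF assms(1)]] that
  proof (induction K)
    case empty
    then show ?case using pmult_one[OF i(1)] by simp
  next
    case (insert k K)
    have "p i \<noteq> p k" using insert.prems assms(4,5) by (auto dest: inj_onD)
    then have "pmult (p i) (p k ^ a k) 0" using pmult_other[OF i(1) _ i(2)] assms(2,3) insert.prems by auto
    then show ?case using pmult_mult[OF i(1), of "p k ^ a k" 0] insert by fastforce
  qed
  then have "pmult (p i) (\<Prod>j\<in>J - {i}. p j ^ a j) 0" by blast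
  from pmult_mult[OF i(1) pmult_self_power[OF i(1)] this, of "a i"] show ?thesis
    using assms(1,5) by (simp add: prod.remove)
qed

lemma central_division_algebra_cda:
  fixes \<Delta> :: "('f :: field, 'b) module"
  assumes "central_division_algebra class_ring \<Delta>" "vectorspace.fin_dim class_ring \<Delta>"
    and "real d = algebra_degree class_ring \<Delta>"
  obtains y where "cda \<Delta> d y"
proof -
  interpret central_division_algebra "class_ring :: 'f ring" \<Delta> by fact
  interpret B: falg \<Delta> unfolding falg_def by (rule assoc_algebra_axioms)
  \<comment> \<open>The degree is a real square root; squaring it gives an equation of natural
    numbers, so that the dimension is d * d.\<close>
  have "real (d * d) = real (vectorspace.dim class_ring \<Delta>)"
    using assms(3) unfolding algebra_degree_def by simp
  then have dim: "vectorspace.dim class_ring \<Delta> = d * d" using of_nat_eq_iff by metis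
  obtain y where y: "fbasis \<Delta> (vectorspace.dim class_ring \<Delta>) y" using B.ex_fbasis_dim[OF assms(2)] .
  have "cda \<Delta> d y"
  proof
    fix x assume "x \<in> carrier \<Delta>" "x \<noteq> \<zero>\<^bsub>\<Delta>\<^esub>"
    then have "x \<in> Units \<Delta>" using nonzero_Units by auto
    then show "\<exists>z\<in>carrier \<Delta>. x \<otimes>\<^bsub>\<Delta>\<^esub> z = \<one>\<^bsub>\<Delta>\<^esub> \<and> z \<otimes>\<^bsub>\<Delta>\<^esub> x = \<one>\<^bsub>\<Delta>\<^esub>" unfolding Units_def by blast
  next
    show "\<one>\<^bsub>\<Delta>\<^esub> \<noteq> \<zero>\<^bsub>\<Delta>\<^esub>" by (rule one_neq_zero)
    show "central_algebra \<Delta>"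
      unfolding central_algebra_def
    proof (intro ballI impI)
      fix z assume "z \<in> carrier \<Delta>" "\<forall>x\<in>carrier \<Delta>. z \<otimes>\<^bsub>\<Delta>\<^esub> x = x \<otimes>\<^bsub>\<Delta>\<^esub> z"
      then have "z \<in> algebra_center \<Delta>" by (simp add: algebra_center_def)
      then show "\<exists>k. z = k \<odot>\<^bsub>\<Delta>\<^esub> \<one>\<^bsub>\<Delta>\<^esub>" unfolding center_eq by blast
    qed
    show "fbasis \<Delta> (d * d) y" using y dim by simp
  qed
  with that show ?thesis .
qed

theorem theorem4:
  fixes \<Delta> :: "('f :: field, 'b) module"
    and f :: "'f poly"
    and p :: "nat \<Rightarrow> 'f poly"
    and a :: "nat \<Rightarrow> nat"
    and n d s :: nat
  assumes "central_division_algebra class_ring \<Delta>"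
    and "vectorspace.fin_dim class_ring \<Delta>"
    and "real d = algebra_degree class_ring \<Delta>"
    and "n \<ge> 1"
    and "lead_coeff f = 1"
    and "Polynomial.degree f = n * d"
    and "f = (\<Prod>i = 1..s. p i ^ a i)"
    and "inj_on p {1..s}"
    and "\<And>i. i \<in> {1..s} \<Longrightarrow> lead_coeff (p i) = 1"
    and "\<And>i. i \<in> {1..s} \<Longrightarrow> Factorial_Ring.irreducible (p i)"
    and "\<And>i. i \<in> {1..s} \<Longrightarrow> a i > 0"
  shows "(\<exists>x \<in> carrier (mat_algebra n \<Delta>). is_char_poly (mat_algebra n \<Delta>) (n * d) x f) \<longleftrightarrow>
    (\<forall>i \<in> {1..s}. \<exists>n\<^sub>i > 0.
       a i * Polynomial.degree (p i) = n\<^sub>i * d \<and>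
       vectorspace.dim class_ring (adjoin_root (p i)) dvd
         n\<^sub>i * capacity (adjoin_root (p i))
           (base_change class_ring \<Delta> (adjoin_root (p i))))"
proof -
  obtain y where "cda \<Delta> d y" using central_division_algebra_cda[OF assms(1-3)] .
  then interpret cda \<Delta> d y .
  interpret cda_mat \<Delta> d y n by unfold_locales (use assms(4) in simp)
  have dim: "vectorspace.dim class_ring (adjoin_root (p i)) = Polynomial.degree (p i)" if "i \<in> {1..s}" for i
    by (rule adjoin.L_dim) (use assms(9,10)[OF that] in unfold_locales)
  have epos: "0 < Polynomial.degree (p i)" if "i \<in> {1..s}" for i
    by (rule irreducible_degree_pos[OF assms(10)[OF that]])
  show ?thesis
  proof
    assume "\<exists>x \<in> carrier (mat_algebra n \<Delta>). is_char_poly (mat_algebra n \<Delta>) (n * d) x f"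
    then obtain x where x: "x \<in> carrier (mat_algebra n \<Delta>)" "char_poly (lrep x) = f ^ d"
      using is_char_poly_iff[OF _ assms(5)] by blast
    obtain \<sigma> where bi: "bimod \<Delta> (n * (d * d)) (lrep x) \<sigma>" using lrep_bimod[OF x(1)] by blast
    show "\<forall>i \<in> {1..s}. \<exists>n\<^sub>i > 0. a i * Polynomial.degree (p i) = n\<^sub>i * d \<and>
      vectorspace.dim class_ring (adjoin_root (p i)) dvd n\<^sub>i * cap (p i)"
    proof
      fix i assume i: "i \<in> {1..s}"
      let ?e = "Polynomial.degree (p i)"
      have "pmult (p i) f (a i)"
        unfolding assms(7) by (rule pmult_prod) (use assms(8-10) i in auto)
      then have "pmult (p i) (f ^ d) (d * a i)" by (rule pmult_power[OF assms(10)[OF i]])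
      moreover obtain j where j: "pmult (p i) (f ^ d) j" "d * d dvd ?e * j" "d * d dvd cap (p i) * j"
        using bimod_multiplicity[OF assms(10)[OF i] assms(9)[OF i] bi] unfolding x(2) by blast
      ultimately have ja: "j = d * a i" using pmult_unique[OF assms(10)[OF i]] by blast
      \<comment> \<open>With j = d a_i one factor d cancels. The first divisibility then yields the
        number n_i of condition (a), called m below.\<close>
      have "d * d dvd d * (?e * a i)" "d * d dvd d * (cap (p i) * a i)"
        using j(2,3) unfolding ja by (simp_all only: ac_simps)
      then have dv: "d dvd ?e * a i" "d dvd cap (p i) * a i" using d_pos by auto
      obtain m where m: "?e * a i = d * m" using dv(1) by (rule dvdE)
      obtain q where q: "cap (p i) * a i = d * q" using dv(2) by (rule dvdE)
      have "0 < m" using m epos[OF i] assms(11)[OF i] by (metis mult_0_right nat_0_less_mult_iff neq0_conv)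
      \<comment> \<open>Both sides equal deg p_i * a_i * cap; cancelling d leaves condition
        (b).\<close>
      moreover have "d * (m * cap (p i)) = d * (?e * q)"
      proof -
        have "d * (m * cap (p i)) = (?e * a i) * cap (p i)" unfolding m by (simp only: ac_simps)
        also have "\<dots> = ?e * (cap (p i) * a i)" by (simp only: ac_simps)
        also have "\<dots> = d * (?e * q)" unfolding q by (simp only: ac_simps)
        finally show ?thesis .
      qed
      then have "m * cap (p i) = ?e * q" using d_pos by simp
      then have "vectorspace.dim class_ring (adjoin_root (p i)) dvd m * cap (p i)" unfolding dim[OF i] by (rule dvdI)
      moreover have "a i * ?e = m * d" using m by (simp only: ac_simps)
      ultimately show "\<exists>n\<^sub>i > 0. a i * ?e = n\<^sub>i * d \<and> vectorspace.dim class_ring (adjoin_root (p i)) dvd n\<^sub>i * cap (p i)"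
        by blast
    qed
  next
    assume H: "\<forall>i \<in> {1..s}. \<exists>n\<^sub>i > 0. a i * Polynomial.degree (p i) = n\<^sub>i * d \<and>
      vectorspace.dim class_ring (adjoin_root (p i)) dvd n\<^sub>i * cap (p i)"
    have dv: "d * d dvd cap (p i) * (a i * d)" if i: "i \<in> {1..s}" for i
    proof -
      let ?e = "Polynomial.degree (p i)"
      obtain m where m: "a i * ?e = m * d" "?e dvd m * cap (p i)" using H i dim[OF i] by metis
      obtain q where q: "m * cap (p i) = ?e * q" using m(2) by (rule dvdE)
      \<comment> \<open>The same computation backwards: deg p_i cancels, and d divides cap * a_i.
        Another factor d comes from the exponent a_i d of p_i in f^d.\<close>
      have "?e * (cap (p i) * a i) = (a i * ?e) * cap (p i)" by (simp only: ac_simps)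
      also have "\<dots> = (m * cap (p i)) * d" unfolding m(1) by (simp only: ac_simps)
      also have "\<dots> = ?e * (q * d)" unfolding q by (simp only: ac_simps)
      finally have "cap (p i) * a i = q * d" using epos[OF i] by simp
      then have "cap (p i) * (a i * d) = d * d * q" by (simp add: mult.assoc[symmetric])
      then show ?thesis by (rule dvdI)
    qed
    have fd: "(\<Prod>i = 1..s. p i ^ (a i * d)) = f ^ d"
      unfolding assms(7) by (simp add: prod_power_distrib power_mult)
    have "\<exists>k S \<sigma>. bimod \<Delta> k S \<sigma> \<and> char_poly S = (\<Prod>i = 1..s. p i ^ (a i * d))"
      by (rule bimod_exists) (use assms(9,10) dv in auto)
    then obtain k S \<sigma> where S: "bimod \<Delta> k S \<sigma>" "char_poly S = f ^ d" unfolding fd by blast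
    have Sc: "S \<in> carrier_mat k k" using S(1) by (simp add: bimod_def)
    \<comment> \<open>The dimension of the constructed module is forced by the degree nd of f; the
      value n d^2 is exactly what makes the module free of rank n, so that \<open>S\<close> comes
      from a matrix of size n.\<close>
    have "k = Polynomial.degree (f ^ d)" using degree_monic_char_poly[OF Sc] S(2) by simp
    also have "\<dots> = d * (n * d)" using assms(5,6) by (subst degree_power_eq) auto
    also have "\<dots> = n * (d * d)" by (simp only: ac_simps)
    finally obtain x where "x \<in> carrier (mat_algebra n \<Delta>)" "char_poly (lrep x) = char_poly S"
      using bimod_lrep S(1) by blast
    then show "\<exists>x \<in> carrier (mat_algebra n \<Delta>). is_char_poly (mat_algebra n \<Delta>) (n * d) x f"
      using is_char_poly_iff[OF _ assms(5)] S(2) by auto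
  qed
qed

end
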